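(* Let $k$ be a field, $\mathcal{C}$ an essentially small $k$-linear category and $T$ a Yoneda bifunctor for $\mathcal{C}$. Let $X$ and $Y$ be two complexes of $\mathcal{D}_{\mathrm{perf}}(\mathcal{C}_T\text{-mod})$. There is a natural isomorphism $$R\operatorname{Hom}(X,Y)'\cong R\operatorname{Hom}(Y,RD(X)').$$ In particular, the functor $RD(-)'$ is a Serre duality for $\mathcal{D}_{\mathrm{perf}}(\mathcal{C}_T\text{-mod})$.
   Context: $\mathcal{C}\text{-mod}$ (resp. $\mathcal{C}^{op}\text{-mod}$) is the category of covariant functors from $\mathcal{C}$ (resp. $\mathcal{C}^{op}$) to $k$-modules. A Yoneda bifunctor for $\mathcal{C}$ is a functor $T:\mathcal{C}^{op}\times\mathcal{C}\to k\text{-mod}$ together with a surjective natural transformation $\mu$ from $(x,y)\mapsto k[\operatorname{Hom}_{\mathcal{C}}(x,y)]$ (free $k$-module on the Hom set) to $T$, such that, writing $T_a=T(a,-)$ and $T^a=T(-,a)$, the map $\operatorname{Hom}_{\mathcal{C}\text{-mod}}(T_b,T_a)\to T(a,b)$, $F\mapsto F_b(\mu_{b,b}(\mathbf{1}_b))$, is an isomorphism for all $a,b$. $\mathcal{C}_T\text{-mod}$ is the smallest full subcategory of $\mathcal{C}\text{-mod}$ containing all $T_a$ and stable under limits and colimits; $\mathcal{C}_{T^{op}}\text{-mod}$ is the analogous subcategory of $\mathcal{C}^{op}\text{-mod}$ containing the $T^a$. $\mathcal{C}_T\text{-mod}$ is abelian and the $T_a$ (the $T$-standard projectives) form a system of projective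 generators. An object is of finite type if it is a quotient of a finite sum of $T$-standard projectives. A complex is perfect if it is quasi-isomorphic to a bounded complex of finite type projectives of $\mathcal{C}_T\text{-mod}$, and $\mathcal{D}_{\mathrm{perf}}(\mathcal{C}_T\text{-mod})$ is the full subcategory of $\mathcal{D}(\mathcal{C}_T\text{-mod})$ of perfect complexes. The functor of duality $D:(\mathcal{C}_T\text{-mod})^{op}\to\mathcal{C}_{T^{op}}\text{-mod}$ is $DF(x)=\operatorname{Hom}_{\mathcal{C}\text{-mod}}(F,T_x)$, extended to cochain complexes by $D(X)^n=D(X^{-n})$, $d^n_{D(X)}=(-1)^{n+1}D(d_X^{-(n+1)})$; $RD$ is its derived functor (apply $D$ to a projective resolution in $\mathcal{C}_T\text{-mod}$). $V'=\operatorname{Hom}_k(V,k)$ and $F'$ is the postcomposition of $F$ with $V\mapsto V'$ (also for complexes). $R\operatorname{Hom}$ is taken over $\mathcal{C}_T\text{-mod}$. A Serre duality for a $k$-linear category $\mathcal{A}$ is an endofunctor $S:\mathcal{A}\to\mathcal{A}$ with a natural isomorphism $\operatorname{Hom}_{\mathcal{A}}(b,Sa)\to\operatorname{Hom}_{\mathcal{A}}(a,b)'$ for all objects $a,b$ of $\mathcal{A}$.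
   Formalization: RD(X)' need not be perfect (e.g. C = k[x], T = Hom), so Serre duality on D_perf is stated only when RD(-)' preserves D_perf; the natural isomorphisms Hom(Y,RD(X)') ≅ Hom(X,Y)' hold always, with RD(-)' valued in D(C_T-mod). k-modules range over a universe large relative to k and C. *)

theory Defs
  imports "HOL-Algebra.Module" "HOL-Library.FuncSet"
begin

section \<open>Categories, functors, limits\<close>

text \<open>Hom sets are not required to be disjoint, so composition and functors
  carry the objects explicitly: \<open>cmp A a b c g f\<close> is \<open>g \<circ> f\<close> for \<open>f : a \<rightarrow> b\<close>, \<open>g : b \<rightarrow> c\<close>.\<close>

record ('o, 'm) cat =
  Ob :: "'o set"
  Arr :: "'o \<Rightarrow> 'o \<Rightarrow> 'm set"
  ide :: "'o \<Rightarrow> 'm"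
  cmp :: "'o \<Rightarrow> 'o \<Rightarrow> 'o \<Rightarrow> 'm \<Rightarrow> 'm \<Rightarrow> 'm"

definition category :: "('o, 'm, 'z) cat_scheme \<Rightarrow> bool" where
  "category A \<longleftrightarrow>
     (\<forall>a\<in>Ob A. ide A a \<in> Arr A a a) \<and>
     (\<forall>a\<in>Ob A. \<forall>b\<in>Ob A. \<forall>c\<in>Ob A. \<forall>f\<in>Arr A a b. \<forall>g\<in>Arr A b c. cmp A a b c g f \<in> Arr A a c) \<and>
     (\<forall>a\<in>Ob A. \<forall>b\<in>Ob A. \<forall>f\<in>Arr A a b. cmp A a a b f (ide A a) = f \<and> cmp A a b b (ide A b) f = f) \<and>
     (\<forall>a\<in>Ob A. \<forall>b\<in>Ob A. \<forall>c\<in>Ob A. \<forall>d\<in>Ob A. \<forall>f\<in>Arr A a b. \<forall>g\<in>Arr A b c. \<forall>h\<in>Arr A c d.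
        cmp A a c d h (cmp A a b c g f) = cmp A a b d (cmp A b c d h g) f)"

definition op_cat :: "('o, 'm, 'z) cat_scheme \<Rightarrow> ('o, 'm) cat" where
  "op_cat A = \<lparr>Ob = Ob A, Arr = (\<lambda>a b. Arr A b a), ide = ide A,
     cmp = (\<lambda>a b c g f. cmp A c b a f g)\<rparr>"

definition prod_cat ::
  "('o, 'm, 'z) cat_scheme \<Rightarrow> ('p, 'n, 'y) cat_scheme \<Rightarrow> ('o \<times> 'p, 'm \<times> 'n) cat" where
  "prod_cat A B = \<lparr>Ob = Ob A \<times> Ob B,
     Arr = (\<lambda>(a, b) (a', b'). Arr A a a' \<times> Arr B b b'),
     ide = (\<lambda>(a, b). (ide A a, ide B b)),
     cmp = (\<lambda>(a, b) (a', b') (a'', b'') (g, g') (f, f').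
              (cmp A a a' a'' g f, cmp B b b' b'' g' f'))\<rparr>"

definition full_subcat :: "('o, 'm, 'z) cat_scheme \<Rightarrow> 'o set \<Rightarrow> ('o, 'm, 'z) cat_scheme" where
  "full_subcat A S = A\<lparr>Ob := Ob A \<inter> S\<rparr>"

definition inverse_arrows ::
  "('o, 'm, 'z) cat_scheme \<Rightarrow> 'o \<Rightarrow> 'o \<Rightarrow> 'm \<Rightarrow> 'm \<Rightarrow> bool" where
  "inverse_arrows A a b f g \<longleftrightarrow> f \<in> Arr A a b \<and> g \<in> Arr A b a \<and>
     cmp A a b a g f = ide A a \<and> cmp A b a b f g = ide A b"

definition is_iso :: "('o, 'm, 'z) cat_scheme \<Rightarrow> 'o \<Rightarrow> 'o \<Rightarrow> 'm \<Rightarrow> bool" where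
  "is_iso A a b f \<longleftrightarrow> (\<exists>g. inverse_arrows A a b f g)"

definition is_epi :: "('o, 'm, 'z) cat_scheme \<Rightarrow> 'o \<Rightarrow> 'o \<Rightarrow> 'm \<Rightarrow> bool" where
  "is_epi A a b e \<longleftrightarrow> e \<in> Arr A a b \<and>
     (\<forall>c\<in>Ob A. \<forall>g\<in>Arr A b c. \<forall>h\<in>Arr A b c. cmp A a b c g e = cmp A a b c h e \<longrightarrow> g = h)"

definition projective_ob :: "('o, 'm, 'z) cat_scheme \<Rightarrow> 'o \<Rightarrow> bool" where
  "projective_ob A p \<longleftrightarrow> p \<in> Ob A \<and>
     (\<forall>a\<in>Ob A. \<forall>b\<in>Ob A. \<forall>e. is_epi A a b e \<longrightarrow>
        (\<forall>f\<in>Arr A p b. \<exists>g\<in>Arr A p a. cmp A p a b e g = f))"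

record ('o, 'm, 'p, 'n) fnc =
  om :: "'o \<Rightarrow> 'p"
  mm :: "'o \<Rightarrow> 'o \<Rightarrow> 'm \<Rightarrow> 'n"

definition is_functor ::
  "('o, 'm, 'z) cat_scheme \<Rightarrow> ('p, 'n, 'y) cat_scheme \<Rightarrow> ('o, 'm, 'p, 'n) fnc \<Rightarrow> bool" where
  "is_functor A B F \<longleftrightarrow> category A \<and> category B \<and>
     (\<forall>a\<in>Ob A. om F a \<in> Ob B \<and> mm F a a (ide A a) = ide B (om F a)) \<and>
     (\<forall>a\<in>Ob A. \<forall>b\<in>Ob A. \<forall>f\<in>Arr A a b. mm F a b f \<in> Arr B (om F a) (om F b)) \<and>
     (\<forall>a\<in>Ob A. \<forall>b\<in>Ob A. \<forall>c\<in>Ob A. \<forall>f\<in>Arr A a b. \<forall>g\<in>Arr A b c.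
        mm F a c (cmp A a b c g f) = cmp B (om F a) (om F b) (om F c) (mm F b c g) (mm F a b f))"

definition op_fnc :: "('o, 'm, 'p, 'n) fnc \<Rightarrow> ('o, 'm, 'p, 'n) fnc" where
  "op_fnc F = \<lparr>om = om F, mm = (\<lambda>a b f. mm F b a f)\<rparr>"

definition natural_iso ::
  "('o, 'm, 'z) cat_scheme \<Rightarrow> ('p, 'n, 'y) cat_scheme \<Rightarrow> ('o, 'm, 'p, 'n) fnc \<Rightarrow> ('o, 'm, 'p, 'n) fnc
     \<Rightarrow> ('o \<Rightarrow> 'n) \<Rightarrow> bool" where
  "natural_iso A B F G \<eta> \<longleftrightarrow> is_functor A B F \<and> is_functor A B G \<and>
     (\<forall>a\<in>Ob A. is_iso B (om F a) (om G a) (\<eta> a)) \<and>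
     (\<forall>a\<in>Ob A. \<forall>b\<in>Ob A. \<forall>f\<in>Arr A a b.
        cmp B (om F a) (om F b) (om G b) (\<eta> b) (mm F a b f) =
        cmp B (om F a) (om G a) (om G b) (mm G a b f) (\<eta> a))"

definition is_cone ::
  "('o, 'm, 'z) cat_scheme \<Rightarrow> ('j, 'i, 'y) cat_scheme \<Rightarrow> ('j, 'i, 'o, 'm) fnc \<Rightarrow> 'o \<Rightarrow> ('j \<Rightarrow> 'm) \<Rightarrow> bool" where
  "is_cone A J G L \<pi> \<longleftrightarrow> L \<in> Ob A \<and> (\<forall>j\<in>Ob J. \<pi> j \<in> Arr A L (om G j)) \<and>
     (\<forall>i\<in>Ob J. \<forall>j\<in>Ob J. \<forall>u\<in>Arr J i j. cmp A L (om G i) (om G j) (mm G i j u) (\<pi> i) = \<pi> j)"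

definition is_limit ::
  "('o, 'm, 'z) cat_scheme \<Rightarrow> ('j, 'i, 'y) cat_scheme \<Rightarrow> ('j, 'i, 'o, 'm) fnc \<Rightarrow> 'o \<Rightarrow> ('j \<Rightarrow> 'm) \<Rightarrow> bool" where
  "is_limit A J G L \<pi> \<longleftrightarrow> is_cone A J G L \<pi> \<and>
     (\<forall>M \<rho>. is_cone A J G M \<rho> \<longrightarrow>
        (\<exists>!h. h \<in> Arr A M L \<and> (\<forall>j\<in>Ob J. cmp A M L (om G j) (\<pi> j) h = \<rho> j)))"

definition is_colimit ::
  "('o, 'm, 'z) cat_scheme \<Rightarrow> ('j, 'i, 'y) cat_scheme \<Rightarrow> ('j, 'i, 'o, 'm) fnc \<Rightarrow> 'o \<Rightarrow> ('j \<Rightarrow> 'm) \<Rightarrow> bool" where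
  "is_colimit A J G L \<iota> \<longleftrightarrow> is_limit (op_cat A) (op_cat J) (op_fnc G) L \<iota>"

definition is_finite_sum ::
  "('o, 'm, 'z) cat_scheme \<Rightarrow> 'o list \<Rightarrow> 'o \<Rightarrow> (nat \<Rightarrow> 'm) \<Rightarrow> bool" where
  "is_finite_sum A xs S \<iota> \<longleftrightarrow> S \<in> Ob A \<and> (\<forall>i<length xs. \<iota> i \<in> Arr A (xs ! i) S) \<and>
     (\<forall>z\<in>Ob A. \<forall>g. (\<forall>i<length xs. g i \<in> Arr A (xs ! i) z) \<longrightarrow>
        (\<exists>!h. h \<in> Arr A S z \<and> (\<forall>i<length xs. cmp A (xs ! i) S z h (\<iota> i) = g i)))"

section \<open>Vector spaces and linear categories\<close>

text \<open>Maps between carriers are extensional (\<open>undefined\<close> off the carrier), so that equality of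
  linear maps is equality of HOL functions. The \<open>mult\<close> and \<open>one\<close> fields that a module record
  inherits from rings are irrelevant to \<^const>\<open>module\<close> and left undefined.\<close>

definition lin :: "'k ring \<Rightarrow> ('k, 'v) module \<Rightarrow> ('k, 'w) module \<Rightarrow> ('v \<Rightarrow> 'w) set" where
  "lin K V W = {f \<in> carrier V \<rightarrow>\<^sub>E carrier W.
     (\<forall>x\<in>carrier V. \<forall>y\<in>carrier V. f (x \<oplus>\<^bsub>V\<^esub> y) = f x \<oplus>\<^bsub>W\<^esub> f y) \<and>
     (\<forall>c\<in>carrier K. \<forall>x\<in>carrier V. f (c \<odot>\<^bsub>V\<^esub> x) = c \<odot>\<^bsub>W\<^esub> f x)}"

definition lin_mod :: "'k ring \<Rightarrow> ('k, 'v) module \<Rightarrow> ('k, 'w) module \<Rightarrow> ('k, 'v \<Rightarrow> 'w) module" where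
  "lin_mod K V W = \<lparr>carrier = lin K V W, mult = undefined, one = undefined,
     zero = (\<lambda>x\<in>carrier V. \<zero>\<^bsub>W\<^esub>),
     add = (\<lambda>f g. \<lambda>x\<in>carrier V. f x \<oplus>\<^bsub>W\<^esub> g x),
     smult = (\<lambda>c f. \<lambda>x\<in>carrier V. c \<odot>\<^bsub>W\<^esub> f x)\<rparr>"

definition lin_iso :: "'k ring \<Rightarrow> ('k, 'v) module \<Rightarrow> ('k, 'w) module \<Rightarrow> ('v \<Rightarrow> 'w) \<Rightarrow> bool" where
  "lin_iso K V W f \<longleftrightarrow> f \<in> lin K V W \<and> bij_betw f (carrier V) (carrier W)"

definition ground :: "'k ring \<Rightarrow> ('k, 'k) module" where
  "ground K = \<lparr>carrier = carrier K, mult = undefined, one = undefined,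
     zero = \<zero>\<^bsub>K\<^esub>, add = add K, smult = mult K\<rparr>"

definition dual :: "'k ring \<Rightarrow> ('k, 'v) module \<Rightarrow> ('k, 'v \<Rightarrow> 'k) module" where
  "dual K V = lin_mod K V (ground K)"

text \<open>The transpose \<open>W' \<rightarrow> V'\<close> of \<open>g : V \<rightarrow> W\<close>.\<close>

definition dual_map ::
  "'k ring \<Rightarrow> ('k, 'v) module \<Rightarrow> ('k, 'w) module \<Rightarrow> ('v \<Rightarrow> 'w) \<Rightarrow> ('w \<Rightarrow> 'k) \<Rightarrow> 'v \<Rightarrow> 'k" where
  "dual_map K V W g = (\<lambda>\<alpha>\<in>carrier (dual K W). compose (carrier V) \<alpha> g)"

text \<open>The free module \<open>k[S]\<close>: finitely supported functions on \<open>S\<close>, extended by \<open>0\<close>.\<close>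

definition free_mod :: "'k ring \<Rightarrow> 's set \<Rightarrow> ('k, 's \<Rightarrow> 'k) module" where
  "free_mod K S = \<lparr>carrier = {\<phi>. (\<forall>s\<in>S. \<phi> s \<in> carrier K) \<and> (\<forall>s. s \<notin> S \<longrightarrow> \<phi> s = \<zero>\<^bsub>K\<^esub>) \<and>
                          finite {s. \<phi> s \<noteq> \<zero>\<^bsub>K\<^esub>}},
     mult = undefined, one = undefined,
     zero = (\<lambda>s. \<zero>\<^bsub>K\<^esub>),
     add = (\<lambda>\<phi> \<psi> s. \<phi> s \<oplus>\<^bsub>K\<^esub> \<psi> s),
     smult = (\<lambda>c \<phi> s. c \<otimes>\<^bsub>K\<^esub> \<phi> s)\<rparr>"

definition free_basis :: "'k ring \<Rightarrow> 's \<Rightarrow> 's \<Rightarrow> 'k" where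
  "free_basis K s = (\<lambda>t. if t = s then \<one>\<^bsub>K\<^esub> else \<zero>\<^bsub>K\<^esub>)"

definition free_map :: "'k ring \<Rightarrow> 's set \<Rightarrow> ('s \<Rightarrow> 't) \<Rightarrow> ('s \<Rightarrow> 'k) \<Rightarrow> 't \<Rightarrow> 'k" where
  "free_map K S h = (\<lambda>\<phi>\<in>carrier (free_mod K S). \<lambda>t.
     finsum K \<phi> {s \<in> S. \<phi> s \<noteq> \<zero>\<^bsub>K\<^esub> \<and> h s = t})"

record ('k, 'o, 'm) kcat = "('o, 'm) cat" +
  homm :: "'o \<Rightarrow> 'o \<Rightarrow> ('k, 'm) module"

definition klinear_category :: "'k ring \<Rightarrow> ('k, 'o, 'm, 'z) kcat_scheme \<Rightarrow> bool" where
  "klinear_category K A \<longleftrightarrow> category A \<and>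
     (\<forall>a\<in>Ob A. \<forall>b\<in>Ob A. module K (homm A a b) \<and> carrier (homm A a b) = Arr A a b) \<and>
     (\<forall>a\<in>Ob A. \<forall>b\<in>Ob A. \<forall>c\<in>Ob A.
        (\<forall>g\<in>Arr A b c. (\<lambda>f\<in>Arr A a b. cmp A a b c g f) \<in> lin K (homm A a b) (homm A a c)) \<and>
        (\<forall>f\<in>Arr A a b. (\<lambda>g\<in>Arr A b c. cmp A a b c g f) \<in> lin K (homm A b c) (homm A a c)))"

definition zero_ob :: "('k, 'o, 'm, 'z) kcat_scheme \<Rightarrow> 'o \<Rightarrow> bool" where
  "zero_ob A a \<longleftrightarrow> a \<in> Ob A \<and> ide A a = \<zero>\<^bsub>homm A a a\<^esub>"

definition kmod :: "'k ring \<Rightarrow> ('k, ('k, 'v) module, 'v \<Rightarrow> 'v) kcat" where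
  "kmod K = \<lparr>Ob = {V. module K V}, Arr = lin K,
     ide = (\<lambda>V. \<lambda>x\<in>carrier V. x),
     cmp = (\<lambda>U V W g f. compose (carrier U) g f),
     homm = lin_mod K\<rparr>"

text \<open>A module-valued functor with values on the type \<open>'v\<close>. In HOL a type \<open>'v\<close> plays the role
  of the universe in which the underlying sets of the modules live.\<close>

type_synonym ('k, 'o, 'm, 'v) mfnc = "('o, 'm, ('k, 'v) module, 'v \<Rightarrow> 'v) fnc"

text \<open>Natural transformations; source and target may live on different types.\<close>

definition nat_trans ::
  "'k ring \<Rightarrow> ('o, 'm, 'z) cat_scheme \<Rightarrow> ('k, 'o, 'm, 'v) mfnc \<Rightarrow> ('k, 'o, 'm, 'w) mfnc
     \<Rightarrow> ('o \<Rightarrow> 'v \<Rightarrow> 'w) set" where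
  "nat_trans K C F G = {\<eta> \<in> extensional (Ob C).
     (\<forall>x\<in>Ob C. \<eta> x \<in> lin K (om F x) (om G x)) \<and>
     (\<forall>x\<in>Ob C. \<forall>y\<in>Ob C. \<forall>f\<in>Arr C x y. \<forall>v\<in>carrier (om F x).
        \<eta> y (mm F x y f v) = mm G x y f (\<eta> x v))}"

definition nat_mod ::
  "'k ring \<Rightarrow> ('o, 'm, 'z) cat_scheme \<Rightarrow> ('k, 'o, 'm, 'v) mfnc \<Rightarrow> ('k, 'o, 'm, 'w) mfnc
     \<Rightarrow> ('k, 'o \<Rightarrow> 'v \<Rightarrow> 'w) module" where
  "nat_mod K C F G = \<lparr>carrier = nat_trans K C F G, mult = undefined, one = undefined,
     zero = (\<lambda>x\<in>Ob C. \<zero>\<^bsub>lin_mod K (om F x) (om G x)\<^esub>),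
     add = (\<lambda>\<eta> \<theta>. \<lambda>x\<in>Ob C. \<eta> x \<oplus>\<^bsub>lin_mod K (om F x) (om G x)\<^esub> \<theta> x),
     smult = (\<lambda>c \<eta>. \<lambda>x\<in>Ob C. c \<odot>\<^bsub>lin_mod K (om F x) (om G x)\<^esub> \<eta> x)\<rparr>"

text \<open>\<open>C-mod\<close>: all functors from \<open>C\<close> to \<open>k\<close>-modules, not only the \<open>k\<close>-linear ones.\<close>

definition cmod ::
  "'k ring \<Rightarrow> ('o, 'm, 'z) cat_scheme \<Rightarrow> ('k, ('k, 'o, 'm, 'v) mfnc, 'o \<Rightarrow> 'v \<Rightarrow> 'v) kcat" where
  "cmod K C = \<lparr>Ob = {F. is_functor C (kmod K) F},
     Arr = nat_trans K C,
     ide = (\<lambda>F. \<lambda>x\<in>Ob C. ide (kmod K) (om F x)),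
     cmp = (\<lambda>F G H \<theta> \<eta>. \<lambda>x\<in>Ob C. cmp (kmod K) (om F x) (om G x) (om H x) (\<theta> x) (\<eta> x)),
     homm = nat_mod K C\<rparr>"

section \<open>Yoneda bifunctors\<close>

definition free_hom ::
  "'k ring \<Rightarrow> ('o, 'm, 'z) cat_scheme \<Rightarrow> ('k, 'o \<times> 'o, 'm \<times> 'm, 'm \<Rightarrow> 'k) mfnc" where
  "free_hom K C = \<lparr>om = (\<lambda>(x, y). free_mod K (Arr C x y)),
     mm = (\<lambda>(x, y) (x', y') (f, g).
        free_map K (Arr C x y) (\<lambda>h. cmp C x' y y' g (cmp C x' x y h f)))\<rparr>"

text \<open>\<open>T\<^sub>a = T(a,-)\<close>, and the transformation \<open>T\<^sub>x \<rightarrow> T\<^sub>y\<close> induced by \<open>f : x \<rightarrow> y\<close> in the opposite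
  category of \<open>C\<close>.\<close>

definition std ::
  "('o, 'm, 'z) cat_scheme \<Rightarrow> ('k, 'o \<times> 'o, 'm \<times> 'm, 'v) mfnc \<Rightarrow> 'o \<Rightarrow> ('k, 'o, 'm, 'v) mfnc" where
  "std C T a = \<lparr>om = (\<lambda>y. om T (a, y)), mm = (\<lambda>y z g. mm T (a, y) (a, z) (ide C a, g))\<rparr>"

definition std_map ::
  "('o, 'm, 'z) cat_scheme \<Rightarrow> ('k, 'o \<times> 'o, 'm \<times> 'm, 'v) mfnc \<Rightarrow> 'o \<Rightarrow> 'o \<Rightarrow> 'm \<Rightarrow> 'o \<Rightarrow> 'v \<Rightarrow> 'v" where
  "std_map C T x y f = (\<lambda>z\<in>Ob C. mm T (x, z) (y, z) (f, ide C z))"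

definition yoneda_bifunctor ::
  "'k ring \<Rightarrow> ('o, 'm, 'z) cat_scheme \<Rightarrow> ('k, 'o \<times> 'o, 'm \<times> 'm, 'v) mfnc
     \<Rightarrow> ('o \<times> 'o \<Rightarrow> ('m \<Rightarrow> 'k) \<Rightarrow> 'v) \<Rightarrow> bool" where
  "yoneda_bifunctor K C T \<mu> \<longleftrightarrow>
     is_functor (prod_cat (op_cat C) C) (kmod K) T \<and>
     \<mu> \<in> nat_trans K (prod_cat (op_cat C) C) (free_hom K C) T \<and>
     (\<forall>a\<in>Ob C. \<forall>b\<in>Ob C. \<mu> (a, b) ` carrier (om (free_hom K C) (a, b)) = carrier (om T (a, b))) \<and>
     (\<forall>a\<in>Ob C. \<forall>b\<in>Ob C.
        lin_iso K (homm (cmod K C) (std C T b) (std C T a)) (om T (a, b))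
          (\<lambda>F\<in>Arr (cmod K C) (std C T b) (std C T a). F b (\<mu> (b, b) (free_basis K (ide C b)))))"

text \<open>Index categories of limits and colimits are small relative to the universe \<open>'v\<close>:
  their objects and arrows are taken from \<open>'v\<close>.\<close>

definition lim_colim_stable ::
  "'k ring \<Rightarrow> ('o, 'm, 'z) cat_scheme \<Rightarrow> ('k, 'o, 'm, 'v) mfnc set \<Rightarrow> bool" where
  "lim_colim_stable K C S \<longleftrightarrow>
     (\<forall>(J :: ('v, 'v) cat) G L \<pi>.
        is_functor J (cmod K C) G \<and> (\<forall>j\<in>Ob J. om G j \<in> S) \<and>
        (is_limit (cmod K C) J G L \<pi> \<or> is_colimit (cmod K C) J G L \<pi>) \<longrightarrow> L \<in> S)"

definition tmod ::
  "'k ring \<Rightarrow> ('o, 'm, 'z) cat_scheme \<Rightarrow> ('k, 'o \<times> 'o, 'm \<times> 'm, 'v) mfnc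
     \<Rightarrow> ('k, ('k, 'o, 'm, 'v) mfnc, 'o \<Rightarrow> 'v \<Rightarrow> 'v) kcat" where
  "tmod K C T = full_subcat (cmod K C)
     (\<Inter>{S. S \<subseteq> Ob (cmod K C) \<and> (\<forall>a\<in>Ob C. std C T a \<in> S) \<and> lim_colim_stable K C S})"

definition finite_type ::
  "'k ring \<Rightarrow> ('o, 'm, 'z) cat_scheme \<Rightarrow> ('k, 'o \<times> 'o, 'm \<times> 'm, 'v) mfnc
     \<Rightarrow> ('k, 'o, 'm, 'v) mfnc \<Rightarrow> bool" where
  "finite_type K C T F \<longleftrightarrow> F \<in> Ob (tmod K C T) \<and>
     (\<exists>as S \<iota> e. set as \<subseteq> Ob C \<and> is_finite_sum (tmod K C T) (map (std C T) as) S \<iota> \<and>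
        is_epi (tmod K C T) S F e)"

section \<open>Complexes\<close>

record ('o, 'm) cx =
  cob :: "int \<Rightarrow> 'o"
  cd :: "int \<Rightarrow> 'm"

definition chain_mod ::
  "('k, 'o, 'm, 'z) kcat_scheme \<Rightarrow> ('o, 'm) cx \<Rightarrow> ('o, 'm) cx \<Rightarrow> ('k, int \<Rightarrow> 'm) module" where
  "chain_mod A X Y = \<lparr>
     carrier = {f. (\<forall>n. f n \<in> Arr A (cob X n) (cob Y n)) \<and>
        (\<forall>n. cmp A (cob X n) (cob Y n) (cob Y (n + 1)) (cd Y n) (f n) =
             cmp A (cob X n) (cob X (n + 1)) (cob Y (n + 1)) (f (n + 1)) (cd X n))},
     mult = undefined, one = undefined,
     zero = (\<lambda>n. \<zero>\<^bsub>homm A (cob X n) (cob Y n)\<^esub>),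
     add = (\<lambda>f g n. f n \<oplus>\<^bsub>homm A (cob X n) (cob Y n)\<^esub> g n),
     smult = (\<lambda>c f n. c \<odot>\<^bsub>homm A (cob X n) (cob Y n)\<^esub> f n)\<rparr>"

text \<open>The category of unbounded cochain complexes.\<close>

definition Ch :: "('k, 'o, 'm, 'z) kcat_scheme \<Rightarrow> ('k, ('o, 'm) cx, int \<Rightarrow> 'm) kcat" where
  "Ch A = \<lparr>
     Ob = {X. (\<forall>n. cob X n \<in> Ob A) \<and> (\<forall>n. cd X n \<in> Arr A (cob X n) (cob X (n + 1))) \<and>
        (\<forall>n. cmp A (cob X n) (cob X (n + 1)) (cob X (n + 1 + 1)) (cd X (n + 1)) (cd X n) =
             \<zero>\<^bsub>homm A (cob X n) (cob X (n + 1 + 1))\<^esub>)},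
     Arr = (\<lambda>X Y. carrier (chain_mod A X Y)),
     ide = (\<lambda>X n. ide A (cob X n)),
     cmp = (\<lambda>X Y Z g f n. cmp A (cob X n) (cob Y n) (cob Z n) (g n) (f n)),
     homm = chain_mod A\<rparr>"

definition bounded_cx :: "('k, 'o, 'm, 'z) kcat_scheme \<Rightarrow> ('o, 'm) cx \<Rightarrow> bool" where
  "bounded_cx A X \<longleftrightarrow> (\<exists>N. \<forall>n. \<bar>n\<bar> > N \<longrightarrow> zero_ob A (cob X n))"

text \<open>The elements of \<open>H\<^sup>n\<close> are the cosets \<open>z + B\<^sup>n\<close> of cocycles \<open>z\<close>.\<close>

definition coh_class :: "(('k, 'v) module, 'v \<Rightarrow> 'v) cx \<Rightarrow> int \<Rightarrow> 'v \<Rightarrow> 'v set" where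
  "coh_class X n z = {z \<oplus>\<^bsub>cob X n\<^esub> cd X (n - 1) y | y. y \<in> carrier (cob X (n - 1))}"

definition cohomology :: "(('k, 'v) module, 'v \<Rightarrow> 'v) cx \<Rightarrow> int \<Rightarrow> 'v set set" where
  "cohomology X n = coh_class X n ` {z \<in> carrier (cob X n). cd X n z = \<zero>\<^bsub>cob X (n + 1)\<^esub>}"

definition coh_map :: "(('k, 'v) module, 'v \<Rightarrow> 'v) cx \<Rightarrow> (int \<Rightarrow> 'v \<Rightarrow> 'v) \<Rightarrow> int \<Rightarrow> 'v set \<Rightarrow> 'v set" where
  "coh_map Y f n c = (\<Union>z\<in>c. coh_class Y n (f n z))"

definition qis_mod ::
  "(('k, 'v) module, 'v \<Rightarrow> 'v) cx \<Rightarrow> (('k, 'v) module, 'v \<Rightarrow> 'v) cx \<Rightarrow> (int \<Rightarrow> 'v \<Rightarrow> 'v) \<Rightarrow> bool" where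
  "qis_mod X Y f \<longleftrightarrow> (\<forall>n. bij_betw (coh_map Y f n) (cohomology X n) (cohomology Y n))"

text \<open>Kernels and cokernels in \<open>C-mod\<close>, hence in its full subcategories stable under limits and
  colimits, are computed objectwise; so cohomology is taken at each object of \<open>C\<close>.\<close>

type_synonym ('k, 'o, 'm, 'v) fcx = "(('k, 'o, 'm, 'v) mfnc, 'o \<Rightarrow> 'v \<Rightarrow> 'v) cx"

definition ev_cx :: "'o \<Rightarrow> ('k, 'o, 'm, 'v) fcx \<Rightarrow> (('k, 'v) module, 'v \<Rightarrow> 'v) cx" where
  "ev_cx x X = \<lparr>cob = (\<lambda>n. om (cob X n) x), cd = (\<lambda>n. cd X n x)\<rparr>"

definition qis_fnc ::
  "('o, 'm, 'z) cat_scheme \<Rightarrow> ('k, 'o, 'm, 'v) fcx \<Rightarrow> ('k, 'o, 'm, 'v) fcx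
     \<Rightarrow> (int \<Rightarrow> 'o \<Rightarrow> 'v \<Rightarrow> 'v) \<Rightarrow> bool" where
  "qis_fnc C X Y f \<longleftrightarrow> (\<forall>x\<in>Ob C. qis_mod (ev_cx x X) (ev_cx x Y) (\<lambda>n. f n x))"

section \<open>Localization and derived categories\<close>

text \<open>The localization \<open>A[W\<^sup>-\<^sup>1]\<close> of Gabriel and Zisman: arrows are zigzags modulo the congruence
  generated by functoriality and by making the elements of \<open>W\<close> invertible.
  Zigzags are read from left to right; \<open>Fwd x y f\<close> is a step from \<open>x\<close> to \<open>y\<close> along \<open>f : x \<rightarrow> y\<close>,
  and \<open>Bwd x y w\<close> is a step from \<open>x\<close> to \<open>y\<close> against \<open>w : y \<rightarrow> x\<close> in \<open>W\<close>.\<close>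

datatype ('o, 'm) zstep = Fwd 'o 'o 'm | Bwd 'o 'o 'm

fun is_zigzag ::
  "('o, 'm, 'z) cat_scheme \<Rightarrow> ('o \<Rightarrow> 'o \<Rightarrow> 'm \<Rightarrow> bool) \<Rightarrow> 'o \<Rightarrow> ('o, 'm) zstep list \<Rightarrow> 'o \<Rightarrow> bool" where
  "is_zigzag A W x [] y \<longleftrightarrow> x \<in> Ob A \<and> x = y"
| "is_zigzag A W x (Fwd a b f # ps) y \<longleftrightarrow>
     x = a \<and> a \<in> Ob A \<and> b \<in> Ob A \<and> f \<in> Arr A a b \<and> is_zigzag A W b ps y"
| "is_zigzag A W x (Bwd a b w # ps) y \<longleftrightarrow>
     x = a \<and> a \<in> Ob A \<and> b \<in> Ob A \<and> w \<in> Arr A b a \<and> W b a w \<and> is_zigzag A W b ps y"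

inductive zz_eq ::
  "('o, 'm, 'z) cat_scheme \<Rightarrow> ('o \<Rightarrow> 'o \<Rightarrow> 'm \<Rightarrow> bool) \<Rightarrow> 'o \<Rightarrow> ('o, 'm) zstep list \<Rightarrow> ('o, 'm) zstep list
     \<Rightarrow> 'o \<Rightarrow> bool"
  for A :: "('o, 'm, 'z) cat_scheme" and W :: "'o \<Rightarrow> 'o \<Rightarrow> 'm \<Rightarrow> bool" where
  zz_refl: "is_zigzag A W x ps y \<Longrightarrow> zz_eq A W x ps ps y"
| zz_sym: "zz_eq A W x ps qs y \<Longrightarrow> zz_eq A W x qs ps y"
| zz_trans: "zz_eq A W x ps qs y \<Longrightarrow> zz_eq A W x qs rs y \<Longrightarrow> zz_eq A W x ps rs y"
| zz_cong: "is_zigzag A W x l a \<Longrightarrow> zz_eq A W a ps qs b \<Longrightarrow> is_zigzag A W b r y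
     \<Longrightarrow> zz_eq A W x (l @ ps @ r) (l @ qs @ r) y"
| zz_ide: "a \<in> Ob A \<Longrightarrow> zz_eq A W a [Fwd a a (ide A a)] [] a"
| zz_cmp: "a \<in> Ob A \<Longrightarrow> b \<in> Ob A \<Longrightarrow> c \<in> Ob A \<Longrightarrow> f \<in> Arr A a b \<Longrightarrow> g \<in> Arr A b c
     \<Longrightarrow> zz_eq A W a [Fwd a b f, Fwd b c g] [Fwd a c (cmp A a b c g f)] c"
| zz_inv1: "a \<in> Ob A \<Longrightarrow> b \<in> Ob A \<Longrightarrow> w \<in> Arr A a b \<Longrightarrow> W a b w
     \<Longrightarrow> zz_eq A W a [Fwd a b w, Bwd b a w] [] a"
| zz_inv2: "a \<in> Ob A \<Longrightarrow> b \<in> Ob A \<Longrightarrow> w \<in> Arr A a b \<Longrightarrow> W a b w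
     \<Longrightarrow> zz_eq A W b [Bwd b a w, Fwd a b w] [] b"

definition zz_class ::
  "('o, 'm, 'z) cat_scheme \<Rightarrow> ('o \<Rightarrow> 'o \<Rightarrow> 'm \<Rightarrow> bool) \<Rightarrow> 'o \<Rightarrow> 'o \<Rightarrow> ('o, 'm) zstep list
     \<Rightarrow> ('o, 'm) zstep list set" where
  "zz_class A W x y ps = {qs. zz_eq A W x ps qs y}"

definition loc_cat ::
  "('o, 'm, 'z) cat_scheme \<Rightarrow> ('o \<Rightarrow> 'o \<Rightarrow> 'm \<Rightarrow> bool) \<Rightarrow> ('o, ('o, 'm) zstep list set) cat" where
  "loc_cat A W = \<lparr>Ob = Ob A,
     Arr = (\<lambda>x y. {zz_class A W x y ps | ps. is_zigzag A W x ps y}),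
     ide = (\<lambda>x. zz_class A W x x []),
     cmp = (\<lambda>x y z G F. {rs. \<exists>ps\<in>F. \<exists>qs\<in>G. zz_eq A W x (ps @ qs) rs z})\<rparr>"

definition loc_arr ::
  "('o, 'm, 'z) cat_scheme \<Rightarrow> ('o \<Rightarrow> 'o \<Rightarrow> 'm \<Rightarrow> bool) \<Rightarrow> 'o \<Rightarrow> 'o \<Rightarrow> 'm \<Rightarrow> ('o, 'm) zstep list set" where
  "loc_arr A W x y f = zz_class A W x y [Fwd x y f]"

text \<open>The functor induced between localizations by a functor \<open>F\<close> that sends \<open>W\<close> into \<open>W'\<close>.\<close>

fun zmap :: "('o, 'm, 'p, 'n) fnc \<Rightarrow> ('o, 'm) zstep \<Rightarrow> ('p, 'n) zstep" where
  "zmap F (Fwd a b f) = Fwd (om F a) (om F b) (mm F a b f)"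
| "zmap F (Bwd a b w) = Bwd (om F a) (om F b) (mm F b a w)"

definition loc_fnc ::
  "('p, 'n, 'y) cat_scheme \<Rightarrow> ('p \<Rightarrow> 'p \<Rightarrow> 'n \<Rightarrow> bool) \<Rightarrow> ('o, 'm, 'p, 'n) fnc
     \<Rightarrow> ('o, ('o, 'm) zstep list set, 'p, ('p, 'n) zstep list set) fnc" where
  "loc_fnc B W' F = \<lparr>om = om F,
     mm = (\<lambda>x y c. {qs. \<exists>ps\<in>c. zz_eq B W' (om F x) (map (zmap F) ps) qs (om F y)})\<rparr>"

text \<open>The same for a contravariant functor, given as a functor on the opposite category: an arrow
  \<open>f : a \<rightarrow> b\<close> is sent to \<open>mm F b a f : om F b \<rightarrow> om F a\<close>, and zigzags are reversed.\<close>

fun zmap_op :: "('o, 'm, 'p, 'n) fnc \<Rightarrow> ('o, 'm) zstep \<Rightarrow> ('p, 'n) zstep" where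
  "zmap_op F (Fwd a b f) = Fwd (om F b) (om F a) (mm F b a f)"
| "zmap_op F (Bwd a b w) = Bwd (om F b) (om F a) (mm F a b w)"

definition loc_fnc_op ::
  "('p, 'n, 'y) cat_scheme \<Rightarrow> ('p \<Rightarrow> 'p \<Rightarrow> 'n \<Rightarrow> bool) \<Rightarrow> ('o, 'm, 'p, 'n) fnc
     \<Rightarrow> ('o, ('o, 'm) zstep list set, 'p, ('p, 'n) zstep list set) fnc" where
  "loc_fnc_op B W' F = \<lparr>om = om F,
     mm = (\<lambda>x y c. {qs. \<exists>ps\<in>c. zz_eq B W' (om F x) (rev (map (zmap_op F) ps)) qs (om F y)})\<rparr>"

text \<open>The linear structure on the localization of a linear category of complexes: fractions with a
  common denominator are added by adding numerators,
  \<open>u s\<^sup>-\<^sup>1 + v s\<^sup>-\<^sup>1 = (u + v) s\<^sup>-\<^sup>1\<close>.\<close>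

definition fraction ::
  "('o, 'm, 'z) cat_scheme \<Rightarrow> ('o \<Rightarrow> 'o \<Rightarrow> 'm \<Rightarrow> bool) \<Rightarrow> 'o \<Rightarrow> 'o \<Rightarrow> 'o \<Rightarrow> 'm \<Rightarrow> 'm
     \<Rightarrow> ('o, 'm) zstep list set" where
  "fraction A W x z y u s = zz_class A W x y [Bwd x z s, Fwd z y u]"

definition derived_cat ::
  "('k, 'o, 'm, 'z) kcat_scheme \<Rightarrow> ('o \<Rightarrow> 'o \<Rightarrow> 'm \<Rightarrow> bool) \<Rightarrow> ('k, 'o, ('o, 'm) zstep list set) kcat" where
  "derived_cat A W = \<lparr>Ob = Ob (loc_cat A W), Arr = Arr (loc_cat A W),
     ide = ide (loc_cat A W), cmp = cmp (loc_cat A W),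
     homm = (\<lambda>x y. \<lparr>carrier = Arr (loc_cat A W) x y, mult = undefined, one = undefined,
        zero = loc_arr A W x y \<zero>\<^bsub>homm A x y\<^esub>,
        add = (\<lambda>\<phi> \<psi>. THE \<chi>. \<exists>z\<in>Ob A. \<exists>s\<in>Arr A z x. \<exists>u\<in>Arr A z y. \<exists>v\<in>Arr A z y. W z x s \<and>
           \<phi> = fraction A W x z y u s \<and> \<psi> = fraction A W x z y v s \<and>
           \<chi> = fraction A W x z y (u \<oplus>\<^bsub>homm A z y\<^esub> v) s),
        smult = (\<lambda>c \<phi>. cmp (loc_cat A W) x x y \<phi> (loc_arr A W x x (c \<odot>\<^bsub>homm A x x\<^esub> ide A x)))\<rparr>)\<rparr>"

definition Dkmod ::
  "'k ring \<Rightarrow> ('k, (('k, 'v) module, 'v \<Rightarrow> 'v) cx,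
      ((('k, 'v) module, 'v \<Rightarrow> 'v) cx, int \<Rightarrow> 'v \<Rightarrow> 'v) zstep list set) kcat" where
  "Dkmod K = derived_cat (Ch (kmod K)) qis_mod"

type_synonym ('k, 'o, 'm, 'v) darr =
  "(('k, 'o, 'm, 'v) fcx, int \<Rightarrow> 'o \<Rightarrow> 'v \<Rightarrow> 'v) zstep list set"

definition Dtmod ::
  "'k ring \<Rightarrow> ('o, 'm, 'z) cat_scheme \<Rightarrow> ('k, 'o \<times> 'o, 'm \<times> 'm, 'v) mfnc
     \<Rightarrow> ('k, ('k, 'o, 'm, 'v) fcx, ('k, 'o, 'm, 'v) darr) kcat" where
  "Dtmod K C T = derived_cat (Ch (tmod K C T)) (qis_fnc C)"

definition strictly_perfect ::
  "'k ring \<Rightarrow> ('o, 'm, 'z) cat_scheme \<Rightarrow> ('k, 'o \<times> 'o, 'm \<times> 'm, 'v) mfnc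
     \<Rightarrow> ('k, 'o, 'm, 'v) fcx \<Rightarrow> bool" where
  "strictly_perfect K C T P \<longleftrightarrow> P \<in> Ob (Ch (tmod K C T)) \<and> bounded_cx (tmod K C T) P \<and>
     (\<forall>n. finite_type K C T (cob P n) \<and> projective_ob (tmod K C T) (cob P n))"

definition perfect ::
  "'k ring \<Rightarrow> ('o, 'm, 'z) cat_scheme \<Rightarrow> ('k, 'o \<times> 'o, 'm \<times> 'm, 'v) mfnc
     \<Rightarrow> ('k, 'o, 'm, 'v) fcx \<Rightarrow> bool" where
  "perfect K C T X \<longleftrightarrow> X \<in> Ob (Dtmod K C T) \<and>
     (\<exists>P. strictly_perfect K C T P \<and> (\<exists>f. is_iso (Dtmod K C T) P X f))"

definition Dperf ::
  "'k ring \<Rightarrow> ('o, 'm, 'z) cat_scheme \<Rightarrow> ('k, 'o \<times> 'o, 'm \<times> 'm, 'v) mfnc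
     \<Rightarrow> ('k, ('k, 'o, 'm, 'v) fcx, ('k, 'o, 'm, 'v) darr) kcat" where
  "Dperf K C T = full_subcat (Dtmod K C T) {X. perfect K C T X}"

section \<open>Duality\<close>

definition signed :: "('k, 'v) module \<Rightarrow> int \<Rightarrow> 'v \<Rightarrow> 'v" where
  "signed M n x = (if even n then x else \<ominus>\<^bsub>M\<^esub> x)"

text \<open>\<open>DF(x) = Hom(F, T\<^sub>x)\<close>, a functor on the opposite category of \<open>C\<close>; for \<open>\<phi> : F \<rightarrow> G\<close>, the
  transformation \<open>D\<phi> : DG \<rightarrow> DF\<close>.\<close>

definition D_ob ::
  "'k ring \<Rightarrow> ('o, 'm, 'z) cat_scheme \<Rightarrow> ('k, 'o \<times> 'o, 'm \<times> 'm, 'v) mfnc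
     \<Rightarrow> ('k, 'o, 'm, 'v) mfnc \<Rightarrow> ('k, 'o, 'm, 'o \<Rightarrow> 'v \<Rightarrow> 'v) mfnc" where
  "D_ob K C T F = \<lparr>om = (\<lambda>x. homm (cmod K C) F (std C T x)),
     mm = (\<lambda>x y f. \<lambda>\<alpha>\<in>Arr (cmod K C) F (std C T x).
        cmp (cmod K C) F (std C T x) (std C T y) (std_map C T x y f) \<alpha>)\<rparr>"

definition D_arr ::
  "'k ring \<Rightarrow> ('o, 'm, 'z) cat_scheme \<Rightarrow> ('k, 'o \<times> 'o, 'm \<times> 'm, 'v) mfnc
     \<Rightarrow> ('k, 'o, 'm, 'v) mfnc \<Rightarrow> ('k, 'o, 'm, 'v) mfnc \<Rightarrow> ('o \<Rightarrow> 'v \<Rightarrow> 'v)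
     \<Rightarrow> 'o \<Rightarrow> ('o \<Rightarrow> 'v \<Rightarrow> 'v) \<Rightarrow> 'o \<Rightarrow> 'v \<Rightarrow> 'v" where
  "D_arr K C T F G \<phi> = (\<lambda>x\<in>Ob C. \<lambda>\<beta>\<in>Arr (cmod K C) G (std C T x).
     cmp (cmod K C) F G (std C T x) \<beta> \<phi>)"

definition D_cx ::
  "'k ring \<Rightarrow> ('o, 'm, 'z) cat_scheme \<Rightarrow> ('k, 'o \<times> 'o, 'm \<times> 'm, 'v) mfnc
     \<Rightarrow> ('k, 'o, 'm, 'v) fcx \<Rightarrow> ('k, 'o, 'm, 'o \<Rightarrow> 'v \<Rightarrow> 'v) fcx" where
  "D_cx K C T X = \<lparr>cob = (\<lambda>n. D_ob K C T (cob X (- n))),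
     cd = (\<lambda>n. signed (homm (cmod K (op_cat C)) (D_ob K C T (cob X (- n)))
                  (D_ob K C T (cob X (- (n + 1))))) (n + 1)
            (D_arr K C T (cob X (- (n + 1))) (cob X (- n)) (cd X (- (n + 1)))))\<rparr>"

definition D_cx_arr ::
  "'k ring \<Rightarrow> ('o, 'm, 'z) cat_scheme \<Rightarrow> ('k, 'o \<times> 'o, 'm \<times> 'm, 'v) mfnc
     \<Rightarrow> ('k, 'o, 'm, 'v) fcx \<Rightarrow> ('k, 'o, 'm, 'v) fcx \<Rightarrow> (int \<Rightarrow> 'o \<Rightarrow> 'v \<Rightarrow> 'v)
     \<Rightarrow> int \<Rightarrow> 'o \<Rightarrow> ('o \<Rightarrow> 'v \<Rightarrow> 'v) \<Rightarrow> 'o \<Rightarrow> 'v \<Rightarrow> 'v" where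
  "D_cx_arr K C T X Y f = (\<lambda>n. D_arr K C T (cob X (- n)) (cob Y (- n)) (f (- n)))"

text \<open>Postcomposition with \<open>V \<mapsto> V'\<close>. A functor \<open>F\<close> on \<open>B\<close> gives a functor \<open>F'\<close> on the opposite of
  \<open>B\<close>. On complexes the sign convention is that of \<open>D\<close>.\<close>

definition dual_fnc :: "'k ring \<Rightarrow> ('k, 'o, 'm, 'v) mfnc \<Rightarrow> ('k, 'o, 'm, 'v \<Rightarrow> 'k) mfnc" where
  "dual_fnc K F = \<lparr>om = (\<lambda>x. dual K (om F x)),
     mm = (\<lambda>x y f. dual_map K (om F y) (om F x) (mm F y x f))\<rparr>"

definition dual_nat ::
  "'k ring \<Rightarrow> ('o, 'm, 'z) cat_scheme \<Rightarrow> ('k, 'o, 'm, 'v) mfnc \<Rightarrow> ('k, 'o, 'm, 'v) mfnc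
     \<Rightarrow> ('o \<Rightarrow> 'v \<Rightarrow> 'v) \<Rightarrow> 'o \<Rightarrow> ('v \<Rightarrow> 'k) \<Rightarrow> 'v \<Rightarrow> 'k" where
  "dual_nat K C F G \<eta> = (\<lambda>x\<in>Ob C. dual_map K (om F x) (om G x) (\<eta> x))"

definition dual_fcx ::
  "'k ring \<Rightarrow> ('o, 'm, 'z) cat_scheme \<Rightarrow> ('k, 'o, 'm, 'v) fcx \<Rightarrow> ('k, 'o, 'm, 'v \<Rightarrow> 'k) fcx" where
  "dual_fcx K C X = \<lparr>cob = (\<lambda>n. dual_fnc K (cob X (- n))),
     cd = (\<lambda>n. signed (homm (cmod K C) (dual_fnc K (cob X (- n))) (dual_fnc K (cob X (- (n + 1))))) (n + 1)
            (dual_nat K C (cob X (- (n + 1))) (cob X (- n)) (cd X (- (n + 1)))))\<rparr>"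

definition dual_fcx_arr ::
  "'k ring \<Rightarrow> ('o, 'm, 'z) cat_scheme \<Rightarrow> ('k, 'o, 'm, 'v) fcx \<Rightarrow> ('k, 'o, 'm, 'v) fcx
     \<Rightarrow> (int \<Rightarrow> 'o \<Rightarrow> 'v \<Rightarrow> 'v) \<Rightarrow> int \<Rightarrow> 'o \<Rightarrow> ('v \<Rightarrow> 'k) \<Rightarrow> 'v \<Rightarrow> 'k" where
  "dual_fcx_arr K C X Y f = (\<lambda>n. dual_nat K C (cob X (- n)) (cob Y (- n)) (f (- n)))"

text \<open>The duality of complexes of modules, as a functor on the opposite of \<open>Ch (kmod K)\<close>.\<close>

definition dual_cx :: "'k ring \<Rightarrow> (('k, 'v) module, 'v \<Rightarrow> 'v) cx
     \<Rightarrow> (('k, 'v \<Rightarrow> 'k) module, ('v \<Rightarrow> 'k) \<Rightarrow> 'v \<Rightarrow> 'k) cx" where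
  "dual_cx K X = \<lparr>cob = (\<lambda>n. dual K (cob X (- n))),
     cd = (\<lambda>n. signed (homm (kmod K) (dual K (cob X (- n))) (dual K (cob X (- (n + 1))))) (n + 1)
            (dual_map K (cob X (- (n + 1))) (cob X (- n)) (cd X (- (n + 1)))))\<rparr>"

definition dual_cx_fnc :: "'k ring \<Rightarrow>
     ((('k, 'v) module, 'v \<Rightarrow> 'v) cx, int \<Rightarrow> 'v \<Rightarrow> 'v,
      (('k, 'v \<Rightarrow> 'k) module, ('v \<Rightarrow> 'k) \<Rightarrow> 'v \<Rightarrow> 'k) cx, int \<Rightarrow> ('v \<Rightarrow> 'k) \<Rightarrow> 'v \<Rightarrow> 'k) fnc" where
  "dual_cx_fnc K = \<lparr>om = dual_cx K,
     mm = (\<lambda>X Y f n. dual_map K (cob Y (- n)) (cob X (- n)) (f (- n)))\<rparr>"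

section \<open>Change of universe\<close>

text \<open>The constructions \<open>Hom\<close> and \<open>V'\<close> raise the type on which a module lives. The operators
  below move a module \<open>V\<close> to an isomorphic module on another type, along an injection of its carrier
  (chosen once for every \<open>V\<close>). They are meaningful only if such an injection exists.\<close>

definition emb :: "('k, 'v) module \<Rightarrow> 'v \<Rightarrow> 'w" where
  "emb V = (SOME e. inj_on e (carrier V))"

definition unemb :: "('k, 'v) module \<Rightarrow> 'w \<Rightarrow> 'v" where
  "unemb V = the_inv_into (carrier V) (emb V)"

definition cpy :: "('k, 'v) module \<Rightarrow> ('k, 'w) module" where
  "cpy V = \<lparr>carrier = emb V ` carrier V, mult = undefined, one = undefined,
     zero = emb V \<zero>\<^bsub>V\<^esub>,
     add = (\<lambda>x y. emb V (unemb V x \<oplus>\<^bsub>V\<^esub> unemb V y)),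
     smult = (\<lambda>c x. emb V (c \<odot>\<^bsub>V\<^esub> unemb V x))\<rparr>"

definition cpy_map :: "('k, 'v) module \<Rightarrow> ('k, 'v) module \<Rightarrow> ('v \<Rightarrow> 'v) \<Rightarrow> 'w \<Rightarrow> 'w" where
  "cpy_map U V f = (\<lambda>x\<in>emb U ` carrier U. emb V (f (unemb U x)))"

definition cpy_fnc :: "('k, 'o, 'm, 'v) mfnc \<Rightarrow> ('k, 'o, 'm, 'w) mfnc" where
  "cpy_fnc F = \<lparr>om = (\<lambda>x. cpy (om F x)), mm = (\<lambda>x y f. cpy_map (om F x) (om F y) (mm F x y f))\<rparr>"

definition cpy_nat ::
  "('o, 'm, 'z) cat_scheme \<Rightarrow> ('k, 'o, 'm, 'v) mfnc \<Rightarrow> ('k, 'o, 'm, 'v) mfnc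
     \<Rightarrow> ('o \<Rightarrow> 'v \<Rightarrow> 'v) \<Rightarrow> 'o \<Rightarrow> 'w \<Rightarrow> 'w" where
  "cpy_nat C F G \<eta> = (\<lambda>x\<in>Ob C. cpy_map (om F x) (om G x) (\<eta> x))"

definition cpy_fcx ::
  "('o, 'm, 'z) cat_scheme \<Rightarrow> ('k, 'o, 'm, 'v) fcx \<Rightarrow> ('k, 'o, 'm, 'w) fcx" where
  "cpy_fcx C X = \<lparr>cob = (\<lambda>n. cpy_fnc (cob X n)),
     cd = (\<lambda>n. cpy_nat C (cob X n) (cob X (n + 1)) (cd X n))\<rparr>"

definition cpy_fcx_arr ::
  "('o, 'm, 'z) cat_scheme \<Rightarrow> ('k, 'o, 'm, 'v) fcx \<Rightarrow> ('k, 'o, 'm, 'v) fcx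
     \<Rightarrow> (int \<Rightarrow> 'o \<Rightarrow> 'v \<Rightarrow> 'v) \<Rightarrow> int \<Rightarrow> 'o \<Rightarrow> 'w \<Rightarrow> 'w" where
  "cpy_fcx_arr C X Y f = (\<lambda>n. cpy_nat C (cob X n) (cob Y n) (f n))"

definition cpy_cx_fnc ::
    "((('k, 'v) module, 'v \<Rightarrow> 'v) cx, int \<Rightarrow> 'v \<Rightarrow> 'v,
      (('k, 'w) module, 'w \<Rightarrow> 'w) cx, int \<Rightarrow> 'w \<Rightarrow> 'w) fnc" where
  "cpy_cx_fnc = \<lparr>om = (\<lambda>X. \<lparr>cob = (\<lambda>n. cpy (cob X n)),
                           cd = (\<lambda>n. cpy_map (cob X n) (cob X (n + 1)) (cd X n))\<rparr>),
     mm = (\<lambda>X Y f n. cpy_map (cob X n) (cob Y n) (f n))\<rparr>"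

section \<open>Derived functors\<close>

text \<open>The projective resolution of a perfect complex is chosen among the bounded complexes of
  projectives of finite type.\<close>

definition is_resolution ::
  "'k ring \<Rightarrow> ('o, 'm, 'z) cat_scheme \<Rightarrow> ('k, 'o \<times> 'o, 'm \<times> 'm, 'v) mfnc
     \<Rightarrow> ('k, 'o, 'm, 'v) fcx \<Rightarrow> ('k, 'o, 'm, 'v) fcx \<times> (int \<Rightarrow> 'o \<Rightarrow> 'v \<Rightarrow> 'v) \<Rightarrow> bool" where
  "is_resolution K C T X = (\<lambda>(P, p). strictly_perfect K C T P \<and>
     p \<in> Arr (Ch (tmod K C T)) P X \<and> qis_fnc C P X p)"

definition res_ob ::
  "'k ring \<Rightarrow> ('o, 'm, 'z) cat_scheme \<Rightarrow> ('k, 'o \<times> 'o, 'm \<times> 'm, 'v) mfnc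
     \<Rightarrow> ('k, 'o, 'm, 'v) fcx \<Rightarrow> ('k, 'o, 'm, 'v) fcx" where
  "res_ob K C T X = fst (SOME Pp. is_resolution K C T X Pp)"

definition res_qis ::
  "'k ring \<Rightarrow> ('o, 'm, 'z) cat_scheme \<Rightarrow> ('k, 'o \<times> 'o, 'm \<times> 'm, 'v) mfnc
     \<Rightarrow> ('k, 'o, 'm, 'v) fcx \<Rightarrow> int \<Rightarrow> 'o \<Rightarrow> 'v \<Rightarrow> 'v" where
  "res_qis K C T X = snd (SOME Pp. is_resolution K C T X Pp)"

definition Dloc ::
  "'k ring \<Rightarrow> ('o, 'm, 'z) cat_scheme \<Rightarrow> ('k, 'o \<times> 'o, 'm \<times> 'm, 'v) mfnc
     \<Rightarrow> ('k, 'o, 'm, 'v) fcx \<Rightarrow> ('k, 'o, 'm, 'v) fcx \<Rightarrow> (int \<Rightarrow> 'o \<Rightarrow> 'v \<Rightarrow> 'v) \<Rightarrow> ('k, 'o, 'm, 'v) darr" where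
  "Dloc K C T = loc_arr (Ch (tmod K C T)) (qis_fnc C)"

text \<open>A chain map between the resolutions lifting an arrow \<open>\<phi> : X \<rightarrow> Y\<close> of the derived category
  (it is determined up to homotopy).\<close>

definition res_arr ::
  "'k ring \<Rightarrow> ('o, 'm, 'z) cat_scheme \<Rightarrow> ('k, 'o \<times> 'o, 'm \<times> 'm, 'v) mfnc
     \<Rightarrow> ('k, 'o, 'm, 'v) fcx \<Rightarrow> ('k, 'o, 'm, 'v) fcx \<Rightarrow> ('k, 'o, 'm, 'v) darr
     \<Rightarrow> int \<Rightarrow> 'o \<Rightarrow> 'v \<Rightarrow> 'v" where
  "res_arr K C T X Y \<phi> = (SOME g. g \<in> Arr (Ch (tmod K C T)) (res_ob K C T X) (res_ob K C T Y) \<and>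
     cmp (Dtmod K C T) (res_ob K C T X) (res_ob K C T Y) Y
       (Dloc K C T (res_ob K C T Y) Y (res_qis K C T Y))
       (Dloc K C T (res_ob K C T X) (res_ob K C T Y) g) =
     cmp (Dtmod K C T) (res_ob K C T X) X Y \<phi>
       (Dloc K C T (res_ob K C T X) X (res_qis K C T X)))"

text \<open>The functor \<open>RD(-)'\<close>, with values moved back to the universe \<open>'v\<close>.\<close>

definition RD_dual ::
  "'k ring \<Rightarrow> ('o, 'm, 'z) cat_scheme \<Rightarrow> ('k, 'o \<times> 'o, 'm \<times> 'm, 'v) mfnc
     \<Rightarrow> (('k, 'o, 'm, 'v) fcx, ('k, 'o, 'm, 'v) darr, ('k, 'o, 'm, 'v) fcx, ('k, 'o, 'm, 'v) darr) fnc" where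
  "RD_dual K C T =
    (let RD' = (\<lambda>X. dual_fcx K C (D_cx K C T (res_ob K C T X))) in
     \<lparr>om = (\<lambda>X. cpy_fcx C (RD' X)),
      mm = (\<lambda>X Y \<phi>. Dloc K C T (cpy_fcx C (RD' X)) (cpy_fcx C (RD' Y))
         (cpy_fcx_arr C (RD' X) (RD' Y)
            (dual_fcx_arr K C (D_cx K C T (res_ob K C T Y)) (D_cx K C T (res_ob K C T X))
               (D_cx_arr K C T (res_ob K C T X) (res_ob K C T Y) (res_arr K C T X Y \<phi>)))))\<rparr>)"

text \<open>The Hom complex: in degree \<open>n\<close> the families \<open>X\<^sup>i \<rightarrow> Y\<^sup>i\<^sup>+\<^sup>n\<close>, with differential
  \<open>f \<mapsto> d\<^sub>Y f - (-1)\<^sup>n f d\<^sub>X\<close>.\<close>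

definition hom_mod ::
  "('k, 'o, 'm, 'z) kcat_scheme \<Rightarrow> ('o, 'm) cx \<Rightarrow> ('o, 'm) cx \<Rightarrow> int \<Rightarrow> ('k, int \<Rightarrow> 'm) module" where
  "hom_mod A X Y n = \<lparr>
     carrier = {f. \<forall>i. f i \<in> Arr A (cob X i) (cob Y (i + n))},
     mult = undefined, one = undefined,
     zero = (\<lambda>i. \<zero>\<^bsub>homm A (cob X i) (cob Y (i + n))\<^esub>),
     add = (\<lambda>f g i. f i \<oplus>\<^bsub>homm A (cob X i) (cob Y (i + n))\<^esub> g i),
     smult = (\<lambda>c f i. c \<odot>\<^bsub>homm A (cob X i) (cob Y (i + n))\<^esub> f i)\<rparr>"

definition hom_cx ::
  "('k, 'o, 'm, 'z) kcat_scheme \<Rightarrow> ('o, 'm) cx \<Rightarrow> ('o, 'm) cx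
     \<Rightarrow> (('k, int \<Rightarrow> 'm) module, (int \<Rightarrow> 'm) \<Rightarrow> int \<Rightarrow> 'm) cx" where
  "hom_cx A X Y = \<lparr>cob = hom_mod A X Y,
     cd = (\<lambda>n. \<lambda>f\<in>carrier (hom_mod A X Y n). \<lambda>i.
        cmp A (cob X i) (cob Y (i + n)) (cob Y (i + (n + 1))) (cd Y (i + n)) (f i)
          \<ominus>\<^bsub>homm A (cob X i) (cob Y (i + (n + 1)))\<^esub>
        signed (homm A (cob X i) (cob Y (i + (n + 1)))) n
          (cmp A (cob X i) (cob X (i + 1)) (cob Y (i + (n + 1))) (f (i + 1)) (cd X i)))\<rparr>"

definition hom_cx_fnc ::
  "('k, 'o, 'm, 'z) kcat_scheme \<Rightarrow> ('o, 'm) cx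
     \<Rightarrow> (('o, 'm) cx, int \<Rightarrow> 'm, (('k, int \<Rightarrow> 'm) module, (int \<Rightarrow> 'm) \<Rightarrow> int \<Rightarrow> 'm) cx,
         int \<Rightarrow> (int \<Rightarrow> 'm) \<Rightarrow> int \<Rightarrow> 'm) fnc" where
  "hom_cx_fnc A X = \<lparr>om = hom_cx A X,
     mm = (\<lambda>Y Z g n. \<lambda>f\<in>carrier (hom_mod A X Y n). \<lambda>i.
        cmp A (cob X i) (cob Y (i + n)) (cob Z (i + n)) (g (i + n)) (f i))\<rparr>"

definition hom_cx_precomp ::
  "('k, 'o, 'm, 'z) kcat_scheme \<Rightarrow> ('o, 'm) cx \<Rightarrow> ('o, 'm) cx \<Rightarrow> ('o, 'm) cx \<Rightarrow> (int \<Rightarrow> 'm)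
     \<Rightarrow> int \<Rightarrow> (int \<Rightarrow> 'm) \<Rightarrow> int \<Rightarrow> 'm" where
  "hom_cx_precomp A X' X Y p = (\<lambda>n. \<lambda>f\<in>carrier (hom_mod A X Y n). \<lambda>i.
     cmp A (cob X' i) (cob X i) (cob Y (i + n)) (f i) (p i))"

type_synonym ('k, 'h) mcx = "(('k, 'h) module, 'h \<Rightarrow> 'h) cx"
type_synonym ('k, 'h) mdarr = "(('k, 'h) mcx, int \<Rightarrow> 'h \<Rightarrow> 'h) zstep list set"

text \<open>\<open>RHom\<close> as a functor from (perfect complexes, opposite) times the derived category of
  \<open>C\<^sub>T-mod\<close> to the derived category of \<open>k\<close>-modules: resolve the first argument.\<close>

definition RHom ::
  "'k ring \<Rightarrow> ('o, 'm, 'z) cat_scheme \<Rightarrow> ('k, 'o \<times> 'o, 'm \<times> 'm, 'v) mfnc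
     \<Rightarrow> (('k, 'o, 'm, 'v) fcx \<times> ('k, 'o, 'm, 'v) fcx, ('k, 'o, 'm, 'v) darr \<times> ('k, 'o, 'm, 'v) darr,
         ('k, int \<Rightarrow> 'o \<Rightarrow> 'v \<Rightarrow> 'v) mcx, ('k, int \<Rightarrow> 'o \<Rightarrow> 'v \<Rightarrow> 'v) mdarr) fnc" where
  "RHom K C T = (let H = (\<lambda>X. hom_cx_fnc (tmod K C T) (res_ob K C T X)) in
     \<lparr>om = (\<lambda>(X, Y). om (H X) Y),
      mm = (\<lambda>(X, Y) (X', Y') (f, g).
        cmp (Dkmod K) (om (H X) Y) (om (H X) Y') (om (H X') Y')
          (loc_arr (Ch (kmod K)) qis_mod (om (H X) Y') (om (H X') Y')
             (hom_cx_precomp (tmod K C T) (res_ob K C T X') (res_ob K C T X) Y' (res_arr K C T X' X f)))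
          (mm (loc_fnc (Ch (kmod K)) qis_mod (H X)) Y Y' g))\<rparr>)"

text \<open>The two functors \<open>(X, Y) \<mapsto> RHom(X, Y)'\<close> and \<open>(X, Y) \<mapsto> RHom(Y, RD(X)')\<close>, covariant in \<open>X\<close> and
  contravariant in \<open>Y\<close>. The second one is moved to the type on which the first one takes values,
  so that both have the same target category.\<close>

definition RHom_dual ::
  "'k ring \<Rightarrow> ('o, 'm, 'z) cat_scheme \<Rightarrow> ('k, 'o \<times> 'o, 'm \<times> 'm, 'v) mfnc
     \<Rightarrow> (('k, 'o, 'm, 'v) fcx \<times> ('k, 'o, 'm, 'v) fcx, ('k, 'o, 'm, 'v) darr \<times> ('k, 'o, 'm, 'v) darr,
         ('k, (int \<Rightarrow> 'o \<Rightarrow> 'v \<Rightarrow> 'v) \<Rightarrow> 'k) mcx, ('k, (int \<Rightarrow> 'o \<Rightarrow> 'v \<Rightarrow> 'v) \<Rightarrow> 'k) mdarr) fnc" where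
  "RHom_dual K C T = (let \<Delta> = loc_fnc_op (Ch (kmod K)) qis_mod (dual_cx_fnc K) in
     \<lparr>om = (\<lambda>(X, Y). om \<Delta> (om (RHom K C T) (X, Y))),
      mm = (\<lambda>(X, Y) (X', Y') (f, g). mm \<Delta> (om (RHom K C T) (X, Y)) (om (RHom K C T) (X', Y'))
              (mm (RHom K C T) (X', Y') (X, Y) (f, g)))\<rparr>)"

definition RHom_RD_dual ::
  "'k ring \<Rightarrow> ('o, 'm, 'z) cat_scheme \<Rightarrow> ('k, 'o \<times> 'o, 'm \<times> 'm, 'v) mfnc
     \<Rightarrow> (('k, 'o, 'm, 'v) fcx \<times> ('k, 'o, 'm, 'v) fcx, ('k, 'o, 'm, 'v) darr \<times> ('k, 'o, 'm, 'v) darr,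
         ('k, (int \<Rightarrow> 'o \<Rightarrow> 'v \<Rightarrow> 'v) \<Rightarrow> 'k) mcx, ('k, (int \<Rightarrow> 'o \<Rightarrow> 'v \<Rightarrow> 'v) \<Rightarrow> 'k) mdarr) fnc" where
  "RHom_RD_dual K C T =
    (let U = loc_fnc (Ch (kmod K)) qis_mod cpy_cx_fnc; S = RD_dual K C T in
     \<lparr>om = (\<lambda>(X, Y). om U (om (RHom K C T) (Y, om S X))),
      mm = (\<lambda>(X, Y) (X', Y') (f, g).
        mm U (om (RHom K C T) (Y, om S X)) (om (RHom K C T) (Y', om S X'))
          (mm (RHom K C T) (Y, om S X) (Y', om S X') (g, mm S X X' f)))\<rparr>)"

section \<open>Serre duality\<close>

text \<open>The condition on a functor \<open>S : A \<rightarrow> B\<close>, where \<open>A\<close> is a full subcategory of \<open>B\<close>, that there be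
  isomorphisms \<open>Hom\<^sub>B(b, Sa) \<rightarrow> Hom\<^sub>A(a, b)'\<close> natural in \<open>a\<close> and \<open>b\<close> in \<open>A\<close>.\<close>

definition serre_iso ::
  "'k ring \<Rightarrow> ('k, 'o, 'm, 'z) kcat_scheme \<Rightarrow> ('k, 'o, 'm, 'y) kcat_scheme \<Rightarrow> ('o, 'm, 'o, 'm) fnc
     \<Rightarrow> ('o \<Rightarrow> 'o \<Rightarrow> 'm \<Rightarrow> 'm \<Rightarrow> 'k) \<Rightarrow> bool" where
  "serre_iso K A B S \<phi> \<longleftrightarrow> klinear_category K A \<and> is_functor A B S \<and>
     (\<forall>a\<in>Ob A. \<forall>b\<in>Ob A. lin_iso K (homm B b (om S a)) (dual K (homm A a b)) (\<phi> a b)) \<and>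
     (\<forall>a\<in>Ob A. \<forall>a'\<in>Ob A. \<forall>b\<in>Ob A. \<forall>b'\<in>Ob A. \<forall>f\<in>Arr A a a'. \<forall>g\<in>Arr A b' b.
        \<forall>h\<in>Arr B b (om S a). \<forall>t\<in>Arr A a' b'.
        \<phi> a' b' (cmp B b' (om S a) (om S a') (mm S a a' f) (cmp B b' b (om S a) h g)) t =
        \<phi> a b h (cmp A a b' b g (cmp A a a' b' t f)))"

definition serre_duality ::
  "'k ring \<Rightarrow> ('k, 'o, 'm, 'z) kcat_scheme \<Rightarrow> ('o, 'm, 'o, 'm) fnc
     \<Rightarrow> ('o \<Rightarrow> 'o \<Rightarrow> 'm \<Rightarrow> 'm \<Rightarrow> 'k) \<Rightarrow> bool" where
  "serre_duality K A S \<phi> \<longleftrightarrow> serre_iso K A A S \<phi>"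

end

theory Submission
  imports Defs
begin

text \<open>
A finite type projective \<open>P\<close> has a dual basis, and evaluating a functional on \<open>Hom(P, F)\<close> at the composites of
elements of \<open>DP\<close> with Yoneda maps gives \<open>Hom(P, F)' \<cong> Hom(F, (DP)')\<close>, naturally in \<open>P\<close> and \<open>F\<close>. Applied degreewise
to a strictly perfect resolution \<open>P\<close> of \<open>X\<close>, this becomes an isomorphism between the dual of the Hom complex of \<open>P\<close> and
\<open>Y\<close> and the Hom complex of \<open>Y\<close> and \<open>(DP)'\<close>. As \<open>Hom(P, -)\<close> preserves quasi-isomorphisms and, over a field, dualization
is exact, both sides compute derived functors; Serre duality is the isomorphism in cohomological degree \<open>0\<close>. The
values of \<open>(DP)'\<close> are transported into the type \<open>'u\<close> along \<open>\<epsilon>\<close>.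
\<close>

text \<open>As an intersection of classes closed under limits and colimits, \<open>tmod\<close> says
  nothing usable about a single functor. It is replaced by a Yoneda property (\<open>good\<close>):
  every element of F(a) is the image of the class of the identity in T(a, a) under some T_a -> F.
  Closedness is a direct check; that each such functor lies in every closed class needs a colimit
  presentation by the T_a and T_a + T_a over an index category that fits into 'u. With this
  description (DP)' is recognised as an object of C_T-mod, hence as a possible target of Hom in the
  derived category.

  The injection \<epsilon> has three tasks. It makes 'u infinite, so that pairs are again elements
  and sums of functors exist; it names the objects of C for the index category; and it names the
  functionals on Hom(P, T_x), each determined by scalars indexed by finitely many Hom sets.

  Nothing in the construction makes (DP)' perfect. Serre duality is therefore obtained with values
  in the whole derived category, and as a statement on an endofunctor once RD(X)' is perfect for
  every perfect X.\<close>

abbreviation (input) madd ("(_ +[_]/ _)" [65, 0, 66] 65) where "x +[M] y \<equiv> x \<oplus>\<^bsub>M\<^esub> y"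
abbreviation (input) mzero ("0[_]" [0] 1000) where "0[M] \<equiv> \<zero>\<^bsub>M\<^esub>"
abbreviation (input) mneg ("-[_] _" [0, 81] 80) where "-[M] x \<equiv> \<ominus>\<^bsub>M\<^esub> x"
abbreviation (input) mminus ("(_ -[_]/ _)" [65, 0, 66] 65) where "x -[M] y \<equiv> x \<ominus>\<^bsub>M\<^esub> y"
abbreviation (input) msmult ("(_ *[_]/ _)" [71, 0, 70] 70) where "c *[M] x \<equiv> c \<odot>\<^bsub>M\<^esub> x"
abbreviation (input) elt ("(_/ <: _)" [51, 51] 50) where "x <: M \<equiv> x \<in> carrier M"
abbreviation (input) cx_ob ("_$_" [1000, 1000] 1000) where "X$n \<equiv> cob X n"

subsection \<open>Categories\<close>

lemma catD:
 assumes "category A"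
 shows cat_ide: "a: Ob A ==> ide A a: Arr A a a"
  and cat_cmp: "a: Ob A ==> b: Ob A ==> c: Ob A ==> f: Arr A a b ==> g: Arr A b c ==> cmp A a b c g f: Arr A a c"
  and cat_idr: "a: Ob A ==> b: Ob A ==> f: Arr A a b ==> cmp A a a b f (ide A a) = f"
  and cat_idl: "a: Ob A ==> b: Ob A ==> f: Arr A a b ==> cmp A a b b (ide A b) f = f"
  and cat_assoc: "a: Ob A ==> b: Ob A ==> c: Ob A ==> d: Ob A ==> f: Arr A a b ==> g: Arr A b c ==> h: Arr A c d ==>
    cmp A a b d (cmp A b c d h g) f = cmp A a c d h (cmp A a b c g f)"
 using assms[unfolded category_def, THEN conjunct1, rule_format]
  assms[unfolded category_def, THEN conjunct2, THEN conjunct1, rule_format, of a b c f g]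
  assms[unfolded category_def, THEN conjunct2, THEN conjunct2, THEN conjunct1, rule_format, of a b f]
  assms[unfolded category_def, THEN conjunct2, THEN conjunct2, THEN conjunct2, rule_format, of a b c d f g h, symmetric]
 by auto

lemma catI:
 assumes "!!a. a: Ob A ==> ide A a: Arr A a a"
  "!!a b c f g. a: Ob A ==> b: Ob A ==> c: Ob A ==> f: Arr A a b ==> g: Arr A b c ==> cmp A a b c g f: Arr A a c"
  "!!a b f. a: Ob A ==> b: Ob A ==> f: Arr A a b ==> cmp A a a b f (ide A a) = f"
  "!!a b f. a: Ob A ==> b: Ob A ==> f: Arr A a b ==> cmp A a b b (ide A b) f = f"
  "!!a b c d f g h. a: Ob A ==> b: Ob A ==> c: Ob A ==> d: Ob A ==> f: Arr A a b ==> g: Arr A b c ==> h: Arr A c d ==>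
    cmp A a b d (cmp A b c d h g) f = cmp A a c d h (cmp A a b c g f)"
 shows "category A"
 unfolding category_def using assms by simp

lemma fncD:
 assumes "is_functor A B F"
 shows fnc_cat: "category A" "category B"
  and fnc_ob: "a: Ob A ==> om F a: Ob B"
  and fnc_ide: "a: Ob A ==> mm F a a (ide A a) = ide B (om F a)"
  and fnc_arr: "a: Ob A ==> b: Ob A ==> f: Arr A a b ==> mm F a b f: Arr B (om F a) (om F b)"
  and fnc_cmp: "a: Ob A ==> b: Ob A ==> c: Ob A ==> f: Arr A a b ==> g: Arr A b c ==>
    mm F a c (cmp A a b c g f) = cmp B (om F a) (om F b) (om F c) (mm F b c g) (mm F a b f)"
 using assms unfolding is_functor_def by auto

lemma op_sel[simp]: "Ob (op_cat A) = Ob A" "Arr (op_cat A) a b = Arr A b a" "ide (op_cat A) = ide A"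
 "cmp (op_cat A) a b c g f = cmp A c b a f g"
 by (simp_all add: op_cat_def)

lemma op_category: "category A ==> category (op_cat A)"
 by (simp add: category_def[of "op_cat A"] catD)

lemma prod_sel[simp]: "Ob (prod_cat A B) = Ob A \<times> Ob B"
 "Arr (prod_cat A B) (a, b) (a', b') = Arr A a a' \<times> Arr B b b'"
 "ide (prod_cat A B) (a, b) = (ide A a, ide B b)"
 "cmp (prod_cat A B) (a, b) (a', b') (a'', b'') (g, g') (f, f') = (cmp A a a' a'' g f, cmp B b b' b'' g' f')"
 by (simp_all add: prod_cat_def)

lemma prod_category: "category A ==> category B ==> category (prod_cat A B)"
 unfolding category_def[of "prod_cat A B"]
proof (intro conjI ballI)
 assume A: "category A" and B: "category B"
 note c = cat_ide[OF A] cat_ide[OF B] cat_cmp[OF A] cat_cmp[OF B] cat_idr[OF A] cat_idr[OF B] cat_idl[OF A] cat_idl[OF B]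
  cat_assoc[OF A] cat_assoc[OF B]
 { fix a assume "a: Ob (prod_cat A B)" thus "ide (prod_cat A B) a: Arr (prod_cat A B) a a" by (cases a) (simp add: c) }
 fix a b c f assume o: "a: Ob (prod_cat A B)" "b: Ob (prod_cat A B)" "f: Arr (prod_cat A B) a b"
 thus "cmp (prod_cat A B) a a b f (ide (prod_cat A B) a) = f" "cmp (prod_cat A B) a b b (ide (prod_cat A B) b) f = f"
  by (cases a; cases b; cases f; simp add: c)+
 fix g assume g: "c: Ob (prod_cat A B)" "g: Arr (prod_cat A B) b c"
 thus "cmp (prod_cat A B) a b c g f: Arr (prod_cat A B) a c" using o
  by (cases a; cases b; cases c; cases f; cases g; simp add: c)
 fix d h assume "d: Ob (prod_cat A B)" "h: Arr (prod_cat A B) c d"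
 thus "cmp (prod_cat A B) a c d h (cmp (prod_cat A B) a b c g f) = cmp (prod_cat A B) a b d (cmp (prod_cat A B) b c d h g) f"
  using o g by (cases a; cases b; cases c; cases d; cases f; cases g; cases h; simp add: c)
qed

lemma sub_sel[simp]: "Ob (full_subcat A S) = Ob A \<inter> S" "Arr (full_subcat A S) = Arr A"
 "ide (full_subcat A S) = ide A" "cmp (full_subcat A S) = cmp A"
 by (simp_all add: full_subcat_def)

lemma sub_homm[simp]: "homm (full_subcat (A :: ('k, 'o, 'm, 'z) kcat_scheme) S) = homm A"
 by (simp add: full_subcat_def)

lemma sub_category: "category A ==> category (full_subcat A S)"
 by (simp add: category_def[of "full_subcat A S"] catD)

locale gf = field K for K :: "'k ring" (structure)
begin

abbreviation "CK == Ch (kmod K)"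

subsection \<open>Modules and linear maps\<close>

lemma mod_cl:
 assumes "module K M"
 shows mod_zero: "0[M] <: M"
  and mod_add: "x <: M ==> y <: M ==> x +[M] y <: M"
  and mod_neg: "x <: M ==> -[M] x <: M"
  and mod_sm: "c <: K ==> x <: M ==> c *[M] x <: M"
  and mod_ag: "abelian_group M"
proof -
 interpret module K M by fact
 show "0[M] <: M" "x <: M ==> y <: M ==> x +[M] y <: M"
  "x <: M ==> -[M] x <: M" "c <: K ==> x <: M ==> c *[M] x <: M"
  "abelian_group M"
  by (simp_all add: M.abelian_group_axioms)
qed

lemma mod_eq:
 assumes "module K M"
 shows mod_assoc: "x <: M ==> y <: M ==> z <: M ==>
     (x +[M] y) +[M] z = x +[M] (y +[M] z)"
  and mod_comm: "x <: M ==> y <: M ==> x +[M] y = y +[M] x"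
  and mod_lcomm: "x <: M ==> y <: M ==> z <: M ==>
     x +[M] (y +[M] z) = y +[M] (x +[M] z)"
  and mod_0l: "x <: M ==> 0[M] +[M] x = x"
  and mod_0r: "x <: M ==> x +[M] 0[M] = x"
  and mod_nl: "x <: M ==> -[M] x +[M] x = 0[M]"
  and mod_nr: "x <: M ==> x +[M] -[M] x = 0[M]"
  and mod_nl2: "x <: M ==> y <: M ==> -[M] x +[M] (x +[M] y) = y"
  and mod_nr2: "x <: M ==> y <: M ==> x +[M] (-[M] x +[M] y) = y"
  and mod_n0: "-[M] 0[M] = 0[M]"
  and mod_nn: "x <: M ==> -[M] (-[M] x) = x"
  and mod_nadd: "x <: M ==> y <: M ==> -[M] (x +[M] y) = -[M] x +[M] -[M] y"
  and mod_sadd: "c <: K ==> x <: M ==> y <: M ==>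
     c *[M] (x +[M] y) = c *[M] x +[M] c *[M] y"
  and mod_sneg: "c <: K ==> x <: M ==> c *[M] (-[M] x) = -[M] (c *[M] x)"
  and mod_s0: "c <: K ==> c *[M] 0[M] = 0[M]"
  and mod_0s: "x <: M ==> \<zero> *[M] x = 0[M]"
  and mod_1s: "x <: M ==> \<one> *[M] x = x"
  and mod_ss: "c <: K ==> d <: K ==> x <: M ==>
     c *[M] (d *[M] x) = (c \<otimes> d) *[M] x"
  and mod_adds: "c <: K ==> d <: K ==> x <: M ==>
     (c \<oplus> d) *[M] x = c *[M] x +[M] d *[M] x"
  and mod_negs: "c <: K ==> x <: M ==> (\<ominus> c) *[M] x = -[M] (c *[M] x)"
  and mod_lcancel: "x <: M ==> y <: M ==> z <: M ==>
     x +[M] y = x +[M] z \<longleftrightarrow> y = z"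
proof -
 interpret module K M by fact
 show "x <: M ==> y <: M ==> z <: M ==>
     (x +[M] y) +[M] z = x +[M] (y +[M] z)"
  "x <: M ==> y <: M ==> x +[M] y = y +[M] x"
  "x <: M ==> y <: M ==> z <: M ==>
     x +[M] (y +[M] z) = y +[M] (x +[M] z)"
  "x <: M ==> y <: M ==> -[M] (x +[M] y) = -[M] x +[M] -[M] y"
  by (simp_all add: M.a_ac M.minus_add)
 show "x <: M ==> 0[M] +[M] x = x" "x <: M ==> x +[M] 0[M] = x"
  "x <: M ==> -[M] x +[M] x = 0[M]" "x <: M ==> x +[M] -[M] x = 0[M]"
  "x <: M ==> y <: M ==> -[M] x +[M] (x +[M] y) = y"
  "x <: M ==> y <: M ==> x +[M] (-[M] x +[M] y) = y"
  by (simp_all add: M.l_neg M.r_neg M.r_neg1 M.r_neg2)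
 show "-[M] 0[M] = 0[M]" "x <: M ==> -[M] (-[M] x) = x"
  "c <: K ==> c *[M] 0[M] = 0[M]" "x <: M ==> \<zero> *[M] x = 0[M]"
  "x <: M ==> \<one> *[M] x = x"
  "x <: M ==> y <: M ==> z <: M ==> x +[M] y = x +[M] z \<longleftrightarrow> y = z"
  by simp_all
 show "c <: K ==> x <: M ==> y <: M ==>
     c *[M] (x +[M] y) = c *[M] x +[M] c *[M] y" by (rule smult_r_distr)
 show "c <: K ==> x <: M ==> c *[M] (-[M] x) = -[M] (c *[M] x)" by (rule smult_r_minus)
 show "c <: K ==> d <: K ==> x <: M ==>
     c *[M] (d *[M] x) = (c \<otimes> d) *[M] x" by (simp add: smult_assoc1)
 show "c <: K ==> d <: K ==> x <: M ==>
     (c \<oplus> d) *[M] x = c *[M] x +[M] d *[M] x" by (rule smult_l_distr)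
 show "c <: K ==> x <: M ==> (\<ominus> c) *[M] x = -[M] (c *[M] x)" by (rule smult_l_minus)
qed

lemmas md_cl = mod_zero mod_add mod_neg mod_sm
lemmas md_ac = mod_assoc mod_comm mod_lcomm
lemmas md_eq = mod_0l mod_0r mod_nl mod_nr mod_nl2 mod_nr2 mod_n0 mod_nn mod_nadd mod_s0 mod_0s mod_1s

lemma mod_minus: "x -[M] y = x +[M] -[M] y" by (simp add: a_minus_def)

lemma mod_neg_eq: assumes "module K M" "x <: M" "y <: M" "x +[M] y = 0[M]"
 shows "y = -[M] x"
 by (metis assms mod_0r mod_neg mod_nl2)

lemma mod_move: assumes "module K M" "x <: M" "y <: M" "z <: M"
 shows "x +[M] y = z \<longleftrightarrow> x = z +[M] -[M] y"
proof -
 have "y +[M] (z +[M] -[M] y) = z"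
  using assms by (simp add: md_cl mod_comm[of M z] mod_nr2)
 thus ?thesis using assms by (auto simp: md_cl md_eq md_ac)
qed

lemma mod_neg_smult: "module K M ==> x <: M ==> -[M] x = (\<ominus> \<one>) *[M] x"
 by (simp add: mod_negs mod_1s)

text \<open>Additive inverses are not asked for: multiplication by -1 provides them, so closed
  operations and equations suffice.\<close>

lemma modI:
 fixes M :: "('k, 'v) module"
 assumes "!!x y. x <: M ==> y <: M ==> x +[M] y <: M" "0[M] <: M"
  "!!c x. c <: K ==> x <: M ==> c *[M] x <: M"
  and asm: "!!x y z. x <: M ==> y <: M ==> z <: M ==> (x +[M] y) +[M] z = x +[M] (y +[M] z)"
  and com: "!!x y. x <: M ==> y <: M ==> x +[M] y = y +[M] x"
  and z: "!!x. x <: M ==> 0[M] +[M] x = x"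
  and zs: "!!x. x <: M ==> \<zero> *[M] x = 0[M]"
  and l: "!!c d x. c <: K ==> d <: K ==> x <: M ==> (c \<oplus> d) *[M] x = c *[M] x +[M] d *[M] x"
  and "!!c x y. c <: K ==> x <: M ==> y <: M ==> c *[M] (x +[M] y) = c *[M] x +[M] c *[M] y"
  and "!!c d x. c <: K ==> d <: K ==> x <: M ==> (c \<otimes> d) *[M] x = c *[M] (d *[M] x)"
  and o: "!!x. x <: M ==> \<one> *[M] x = x"
 shows "module K M"
proof (rule moduleI)
 show "abelian_group M"
 proof (rule abelian_groupI)
  fix x assume x: "x <: M"
  have "(\<ominus> \<one>) *[M] x +[M] x = (\<ominus> \<one> \<oplus> \<one>) *[M] x" using x by (subst l) (auto simp: o)
  thus "EX y:carrier M. y +[M] x = 0[M]" using x assms(3)[of "\<ominus> \<one>" x] by (auto simp: zs l_neg)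
 qed (use assms in auto)
qed (use assms is_cring in auto)

text \<open>The module axioms are equations, so they hold in N as soon as they hold after a jointly
  injective family of homomorphisms \<open>ro i\<close>. Spaces of linear maps, natural
  transformations, chain maps and Hom families are treated this way, with \<open>ro\<close> the
  evaluations.\<close>

lemma mod_inj:
 fixes N :: "('k, 'n) module" and M :: "'i => ('k, 'v) module"
 assumes M: "!!i. i: I ==> module K (M i)"
  and cl: "!!i x. i: I ==> x <: N ==> ro i x <: (M i)"
  and inj: "!!x y. x <: N ==> y <: N ==> (!!i. i: I ==> ro i x = ro i y) ==> x = y"
  and c: "!!x y. x <: N ==> y <: N ==> x +[N] y <: N" "0[N] <: N"
   "!!c x. c <: K ==> x <: N ==> c *[N] x <: N"
  and h: "!!i x y. i: I ==> x <: N ==> y <: N ==> ro i (x +[N] y) = ro i x +[M i] ro i y"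
   "!!i. i: I ==> ro i 0[N] = 0[M i]"
   "!!i c x. i: I ==> c <: K ==> x <: N ==> ro i (c *[N] x) = c *[M i] ro i x"
 shows "module K N"
 by (rule modI; (intro c; assumption)?; (intro inj)?;
   (simp_all add: c h cl M mod_assoc[OF M] mod_0l[OF M] mod_0s[OF M] mod_adds[OF M] mod_sadd[OF M]
     mod_ss[OF M] mod_1s[OF M])?; (rule mod_comm[OF M]; simp add: cl)?)

text \<open>The equations pass along a surjection that respects the operations. This serves where
  the operations of N are awkward to compute with: copies on another type, and Hom in the derived
  category, whose addition is a definite description.\<close>

lemma mod_surj:
 fixes N :: "('k, 'n) module" and M :: "('k, 'v) module"
 assumes M: "module K M" and on: "pj ` carrier M = carrier N"
  and a: "!!x y. x <: M ==> y <: M ==> pj x +[N] pj y = pj (x +[M] y)"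
  and z: "0[N] = pj 0[M]"
  and s: "!!c x. c <: K ==> x <: M ==> c *[N] pj x = pj (c *[M] x)"
 shows "module K N"
proof -
 have e: "!!y. y <: N ==> EX x:carrier M. y = pj x" and pj: "!!x. x <: M ==> pj x <: N"
  using on by auto
 note r = a s z pj md_cl[OF M] mod_assoc[OF M] mod_0l[OF M]
   mod_0s[OF M] mod_adds[OF M] mod_sadd[OF M] mod_ss[OF M] mod_1s[OF M]
 show ?thesis
  by (rule modI) (auto dest!: e simp: r mod_0r[OF M] mod_comm[OF M] mod_lcomm[OF M])
qed

lemma linI:
 assumes "!!x. x <: V ==> f x <: W" "!!x. x \<notin> carrier V ==> f x = undefined"
  "!!x y. x <: V ==> y <: V ==> f (x +[V] y) = f x +[W] f y"
  "!!c x. c <: K ==> x <: V ==> f (c *[V] x) = c *[W] f x"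
 shows "f: lin K V W"
 using assms by (auto simp: lin_def PiE_def extensional_def)

lemma lin_cl: "f: lin K V W ==> x <: V ==> f x <: W"
 and lin_add: "f: lin K V W ==> x <: V ==> y <: V ==> f (x +[V] y) = f x +[W] f y"
 and lin_sm: "f: lin K V W ==> c <: K ==> x <: V ==> f (c *[V] x) = c *[W] f x"
 and lin_undef: "f: lin K V W ==> x \<notin> carrier V ==> f x = undefined"
 by (auto simp: lin_def PiE_def extensional_def)

lemma lin_ext: "f: lin K V W ==> g: lin K V W ==> (!!x. x <: V ==> f x = g x) ==> f = g"
 by (rule ext) (metis lin_undef)

lemma lin_0: assumes "module K V" "module K W" "f: lin K V W" shows "f 0[V] = 0[W]"
 using lin_sm[OF assms(3), of \<zero> "0[V]"] assms by (simp add: mod_0s mod_zero lin_cl)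

lemma lin_neg: assumes "module K V" "module K W" "f: lin K V W" "x <: V"
 shows "f (-[V] x) = -[W] f x"
 using lin_sm[OF assms(3), of "\<ominus> \<one>" x] assms by (simp add: mod_neg_smult lin_cl)

lemma lin_finsum:
 assumes "module K V" "module K W" "f: lin K V W" "finite I" "!!i. i: I ==> v i <: V"
 shows "f (finsum V v I) = finsum W (%i. f (v i)) I"
proof -
 interpret V: abelian_group V by (rule mod_ag) fact
 interpret W: abelian_group W by (rule mod_ag) fact
 show ?thesis using assms(4,5)
  by (induction rule: finite_induct)
    (auto simp: lin_0[OF assms(1-3)] lin_add[OF assms(3)] Pi_iff lin_cl[OF assms(3)])
qed

lemma mod_finsum_cl: "module K V ==> (!!i. i: I ==> v i <: V) ==> finsum V v I <: V"
 by (simp add: abelian_monoid.finsum_closed abelian_group.axioms(1) mod_ag)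

lemma lin_comp: "f: lin K U V ==> g: lin K V W ==> compose (carrier U) g f: lin K U W"
 if "module K U" using that
 by (intro linI) (auto simp: compose_def lin_cl lin_add lin_sm md_cl)

lemma lin_mod_sel[simp]: "carrier (lin_mod K V W) = lin K V W"
 "x <: V ==> 0[lin_mod K V W] x = 0[W]"
 "x <: V ==> (f +[lin_mod K V W] g) x = f x +[W] g x"
 "x <: V ==> (c *[lin_mod K V W] f) x = c *[W] f x"
 by (simp_all add: lin_mod_def)

lemma module_lin_mod:
 assumes V: "module K V" and W: "module K W" shows "module K (lin_mod K V W)"
proof (rule mod_inj[where I="carrier V" and M="%_. W" and ro="%x f. f x"])
 fix f g assume "f <: (lin_mod K V W)" "g <: (lin_mod K V W)"
 hence fg: "f: lin K V W" "g: lin K V W" by auto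
 show "f +[lin_mod K V W] g <: (lin_mod K V W)" using fg V W
  by (simp, intro linI) (auto simp: lin_add lin_sm lin_cl md_cl md_ac mod_sadd, simp add: lin_mod_def)
next
 fix c f assume "c <: K" "f <: (lin_mod K V W)"
 hence f: "f: lin K V W" "c <: K" by auto
 show "c *[lin_mod K V W] f <: (lin_mod K V W)" using f V W
  by (simp, intro linI) (auto simp: lin_add lin_sm lin_cl md_cl mod_sadd mod_ss m_comm, simp add: lin_mod_def)
next
 show "0[lin_mod K V W] <: (lin_mod K V W)" using V W
  by (simp, intro linI) (auto simp: md_cl md_eq, simp add: lin_mod_def)
qed (use V W in "auto intro: lin_ext simp: lin_cl")

lemma lin_mod_neg:
 assumes "module K V" "module K W" "f: lin K V W" "x <: V"
 shows "(-[lin_mod K V W] f) x = -[W] f x"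
 using assms by (simp add: mod_neg_smult module_lin_mod lin_cl)

lemma module_ground: "module K (ground K)"
 by (rule modI) (auto simp: ground_def a_ac m_assoc l_distr r_distr)

lemma ground_sel[simp]: "carrier (ground K) = carrier K" "0[ground K] = \<zero>" "x +[ground K] y = x \<oplus> y"
 "c *[ground K] x = c \<otimes> x"
 by (simp_all add: ground_def)

lemma ground_neg[simp]: "x <: K ==> -[ground K] x = \<ominus> x"
 using mod_neg_smult[OF module_ground, of x] by (simp add: l_minus)

subsection \<open>Linear categories\<close>

lemma klD:
 assumes "klinear_category K A"
 shows kl_cat: "category A"
  and kl_mod: "a: Ob A ==> b: Ob A ==> module K (homm A a b)"
  and kl_car: "a: Ob A ==> b: Ob A ==> carrier (homm A a b) = Arr A a b"
  and kl_r: "a: Ob A ==> b: Ob A ==> c: Ob A ==> g: Arr A b c ==>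
    (\<lambda>f\<in>Arr A a b. cmp A a b c g f): lin K (homm A a b) (homm A a c)"
  and kl_l: "a: Ob A ==> b: Ob A ==> c: Ob A ==> f: Arr A a b ==>
    (\<lambda>g\<in>Arr A b c. cmp A a b c g f): lin K (homm A b c) (homm A a c)"
 using assms unfolding klinear_category_def by blast+

lemma sub_klinear: "klinear_category K A ==> klinear_category K (full_subcat A S)"
 unfolding klinear_category_def sub_sel sub_homm using sub_category[of A S] by blast

lemma klI:
 assumes "category A"
  "!!a b. a: Ob A ==> b: Ob A ==> module K (homm A a b)"
  "!!a b. a: Ob A ==> b: Ob A ==> carrier (homm A a b) = Arr A a b"
  "!!a b c f f' g. a: Ob A ==> b: Ob A ==> c: Ob A ==> f: Arr A a b ==> f': Arr A a b ==> g: Arr A b c ==>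
   cmp A a b c g (f +[homm A a b] f') = cmp A a b c g f +[homm A a c] cmp A a b c g f'"
  "!!a b c f f' g. a: Ob A ==> b: Ob A ==> c: Ob A ==> f: Arr A b c ==> f': Arr A b c ==> g: Arr A a b ==>
   cmp A a b c (f +[homm A b c] f') g = cmp A a b c f g +[homm A a c] cmp A a b c f' g"
  "!!a b c f g k. a: Ob A ==> b: Ob A ==> c: Ob A ==> f: Arr A a b ==> k <: K ==> g: Arr A b c ==>
   cmp A a b c g (k *[homm A a b] f) = k *[homm A a c] cmp A a b c g f"
  "!!a b c f g k. a: Ob A ==> b: Ob A ==> c: Ob A ==> f: Arr A a b ==> k <: K ==> g: Arr A b c ==>
   cmp A a b c (k *[homm A b c] g) f = k *[homm A a c] cmp A a b c g f"
 shows "klinear_category K A"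
 unfolding klinear_category_def
proof (intro conjI ballI)
 fix a b c f assume o: "a: Ob A" "b: Ob A" "c: Ob A"
 { fix g assume g: "g: Arr A b c"
  show "(\<lambda>f\<in>Arr A a b. cmp A a b c g f): lin K (homm A a b) (homm A a c)"
   using o g assms mod_add[OF assms(2)] mod_sm[OF assms(2)] by (intro linI) (auto simp: cat_cmp) }
 { fix g assume g: "g: Arr A a b"
  show "(\<lambda>f\<in>Arr A b c. cmp A a b c f g): lin K (homm A b c) (homm A a c)"
   using o g assms mod_add[OF assms(2)] mod_sm[OF assms(2)] by (intro linI) (auto simp: cat_cmp) }
qed (use assms in auto)

lemma kmod_sel[simp]: "Ob (kmod K) = {V. module K V}" "Arr (kmod K) = lin K" "ide (kmod K) V = (\<lambda>x\<in>carrier V. x)"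
 "cmp (kmod K) U V W g f = compose (carrier U) g f" "homm (kmod K) = lin_mod K"
 by (simp_all add: kmod_def)

lemma lin_id: "module K V ==> (\<lambda>x\<in>carrier V. x): lin K V V"
 by (intro linI) (auto simp: md_cl)

lemma kmod_category: "category (kmod K)"
proof (rule catI; simp)
 fix a b c d :: "('k, 'd) module" and f g h
 assume m: "module K a" "module K b" and f: "f: lin K a b"
 show "compose (carrier a) f (\<lambda>x\<in>carrier a. x) = f" "compose (carrier a) (\<lambda>x\<in>carrier b. x) f = f"
  using lin_comp[OF m(1) lin_id[OF m(1)] f] lin_comp[OF m(1) f lin_id[OF m(2)]] f lin_cl[OF f]
  by (auto intro!: lin_ext[of _ a b] simp: compose_def)
 assume "module K c" "module K d" "g: lin K b c" "h: lin K c d"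
 thus "compose (carrier a) (compose (carrier b) h g) f = compose (carrier a) h (compose (carrier a) g f)"
  using lin_cl[OF f] by (auto simp: compose_def fun_eq_iff)
qed (auto simp: lin_comp lin_id)

lemma kmod_klinear: "klinear_category K (kmod K)"
proof (rule klI)
 fix a b c :: "('k, 'v) module" and f f' g
 assume "a: Ob (kmod K)" "b: Ob (kmod K)" "c: Ob (kmod K)" "f: Arr (kmod K) a b" "f': Arr (kmod K) a b" "g: Arr (kmod K) b c"
 thus "cmp (kmod K) a b c g (f +[homm (kmod K) a b] f') = cmp (kmod K) a b c g f +[homm (kmod K) a c] cmp (kmod K) a b c g f'"
  by (auto simp: compose_def lin_mod_def fun_eq_iff lin_add lin_cl)
next
 fix a b c :: "('k, 'v) module" and f f' g
 assume "a: Ob (kmod K)" "b: Ob (kmod K)" "c: Ob (kmod K)" "f: Arr (kmod K) b c" "f': Arr (kmod K) b c" "g: Arr (kmod K) a b"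
 thus "cmp (kmod K) a b c (f +[homm (kmod K) b c] f') g = cmp (kmod K) a b c f g +[homm (kmod K) a c] cmp (kmod K) a b c f' g"
  by (auto simp: compose_def lin_mod_def fun_eq_iff lin_add lin_cl)
qed (auto simp: kmod_category module_lin_mod, auto simp: compose_def lin_mod_def fun_eq_iff lin_sm lin_cl)

subsection \<open>Module-valued functors\<close>

lemma mf:
 assumes "is_functor C (kmod K) F"
 shows mf_mod: "x: Ob C ==> module K (om F x)"
  and mf_lin: "x: Ob C ==> y: Ob C ==> f: Arr C x y ==> mm F x y f: lin K (om F x) (om F y)"
  and mf_ide: "x: Ob C ==> v <: (om F x) ==> mm F x x (ide C x) v = v"
  and mf_cmp: "x: Ob C ==> y: Ob C ==> z: Ob C ==> f: Arr C x y ==> g: Arr C y z ==> v <: (om F x) ==>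
    mm F x z (cmp C x y z g f) v = mm F y z g (mm F x y f v)"
  and mf_cl: "x: Ob C ==> y: Ob C ==> f: Arr C x y ==> v <: (om F x) ==> mm F x y f v <: (om F y)"
 using fncD[OF assms] lin_cl[of "mm F x y f" "om F x" "om F y"] by (auto simp: compose_def)

lemma mfI:
 assumes "category C" "!!x. x: Ob C ==> module K (om F x)"
  "!!x y f. x: Ob C ==> y: Ob C ==> f: Arr C x y ==> mm F x y f: lin K (om F x) (om F y)"
  "!!x v. x: Ob C ==> v <: (om F x) ==> mm F x x (ide C x) v = v"
  "!!x y z f g v. x: Ob C ==> y: Ob C ==> z: Ob C ==> f: Arr C x y ==> g: Arr C y z ==> v <: (om F x) ==>
    mm F x z (cmp C x y z g f) v = mm F y z g (mm F x y f v)"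
 shows "is_functor C (kmod K) F"
 unfolding is_functor_def
 apply (intro conjI ballI)
 using assms
   apply (simp_all add: kmod_category)
  apply (rule lin_ext[OF assms(3) lin_id]; simp add: cat_ide)
 apply (rule lin_ext[OF assms(3) lin_comp[OF _ assms(3) assms(3)]]; simp add: cat_cmp compose_def)
 done

lemma ntI:
 assumes "!!x. x \<notin> Ob C ==> et x = undefined" "!!x. x: Ob C ==> et x: lin K (om F x) (om G x)"
  "!!x y f v. x: Ob C ==> y: Ob C ==> f: Arr C x y ==> v <: (om F x) ==> et y (mm F x y f v) = mm G x y f (et x v)"
 shows "et: nat_trans K C F G"
 using assms by (auto simp: nat_trans_def extensional_def)

lemma nt:
 assumes "et: nat_trans K C F G"
 shows nt_lin: "x: Ob C ==> et x: lin K (om F x) (om G x)"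
  and nt_nat: "x: Ob C ==> y: Ob C ==> f: Arr C x y ==> v <: (om F x) ==> et y (mm F x y f v) = mm G x y f (et x v)"
  and nt_und: "x \<notin> Ob C ==> et x = undefined"
  and nt_cl: "x: Ob C ==> v <: (om F x) ==> et x v <: (om G x)"
  and nt_add: "x: Ob C ==> v <: (om F x) ==> w <: (om F x) ==>
    et x (v +[om F x] w) = et x v +[om G x] et x w"
  and nt_sm: "x: Ob C ==> v <: (om F x) ==> c <: K ==> et x (c *[om F x] v) = c *[om G x] et x v"
 using assms by (auto simp: nat_trans_def extensional_def lin_cl lin_add lin_sm)

lemma nt_ext:
 assumes "et: nat_trans K C F G" "th: nat_trans K C F G" "!!x v. x: Ob C ==> v <: (om F x) ==> et x v = th x v"
 shows "et = th"
proof (rule ext)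
 fix x show "et x = th x"
  using assms(3) nt_und[OF assms(1)] nt_und[OF assms(2)] lin_ext[OF nt_lin[OF assms(1)] nt_lin[OF assms(2)], of x]
  by (cases "x: Ob C") auto
qed

lemma cmod_sel[simp]: "Ob (cmod K C) = {F. is_functor C (kmod K) F}" "Arr (cmod K C) = nat_trans K C"
 "homm (cmod K C) = nat_mod K C"
 "x: Ob C ==> v <: (om F x) ==> ide (cmod K C) F x v = v"
 "x: Ob C ==> v <: (om F x) ==> cmp (cmod K C) F G H th et x v = th x (et x v)"
 by (simp_all add: cmod_def compose_def)

lemma nat_mod_sel[simp]: "carrier (nat_mod K C F G) = nat_trans K C F G"
 "x: Ob C ==> v <: (om F x) ==> (et +[nat_mod K C F G] th) x v = et x v +[om G x] th x v"
 "x: Ob C ==> v <: (om F x) ==> (c *[nat_mod K C F G] et) x v = c *[om G x] et x v"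
 "x: Ob C ==> v <: (om F x) ==> 0[nat_mod K C F G] x v = 0[om G x]"
 by (simp_all add: nat_mod_def)

lemma module_nat_mod:
 assumes F: "is_functor C (kmod K) F" and G: "is_functor C (kmod K) G"
 shows "module K (nat_mod K C F G)"
proof (rule mod_inj[where I="{(x, v). x: Ob C & v <: (om F x)}" and M="%(x, v). om G x" and ro="%(x, v) f. f x v"])
 note [simp] = mf_mod[OF F] mf_mod[OF G] mf_lin[OF F] mf_lin[OF G]
 fix et th assume "et <: (nat_mod K C F G)" "th <: (nat_mod K C F G)"
 hence e: "et: nat_trans K C F G" and t: "th: nat_trans K C F G" by auto
 have l: "x: Ob C ==> (et +[nat_mod K C F G] th) x: lin K (om F x) (om G x)" for x
  using mod_add[OF module_lin_mod[of "om F x" "om G x"], of "et x" "th x"] nt_lin[OF e] nt_lin[OF t] by (simp add: nat_mod_def)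
 show "et +[nat_mod K C F G] th <: (nat_mod K C F G)"
  unfolding nat_mod_sel(1)
  by (rule ntI[OF _ l]) (simp_all add: nat_mod_sel(2) mf_cl[OF F] nt_nat[OF e] nt_nat[OF t] nt_cl[OF e] nt_cl[OF t] lin_add[OF mf_lin[OF G]],
   simp add: nat_mod_def)
next
 note [simp] = mf_mod[OF F] mf_mod[OF G] mf_lin[OF F] mf_lin[OF G]
 fix c et assume "c <: K" "et <: (nat_mod K C F G)"
 hence e: "et: nat_trans K C F G" and c: "c <: K" by auto
 have l: "x: Ob C ==> (c *[nat_mod K C F G] et) x: lin K (om F x) (om G x)" for x
  using mod_sm[OF module_lin_mod[of "om F x" "om G x"] c, of "et x"] nt_lin[OF e] by (simp add: nat_mod_def)
 show "c *[nat_mod K C F G] et <: (nat_mod K C F G)"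
  unfolding nat_mod_sel(1)
  by (rule ntI[OF _ l]) (simp_all add: c mf_cl[OF F] nt_nat[OF e] nt_cl[OF e] lin_sm[OF mf_lin[OF G]],
   simp add: nat_mod_def)
next
 note [simp] = mf_mod[OF F] mf_mod[OF G]
 have l: "x: Ob C ==> 0[nat_mod K C F G] x: lin K (om F x) (om G x)" for x
  using mod_zero[OF module_lin_mod[of "om F x" "om G x"]] by (simp add: nat_mod_def)
 show "0[nat_mod K C F G] <: (nat_mod K C F G)"
  unfolding nat_mod_sel(1)
  by (rule ntI[OF _ l]) (simp_all add: mf_cl[OF F] lin_0[OF _ _ mf_lin[OF G]], simp add: nat_mod_def)
qed (auto simp: mf_mod[OF G] nt_cl intro: nt_ext)

lemma nat_mod_neg:
 assumes "is_functor C (kmod K) F" "is_functor C (kmod K) G" "et: nat_trans K C F G" "x: Ob C" "v <: (om F x)"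
 shows "(-[nat_mod K C F G] et) x v = -[om G x] et x v"
 using assms by (simp add: mod_neg_smult module_nat_mod nt_cl mf_mod)

lemma cmod_ide: "is_functor C (kmod K) F ==> ide (cmod K C) F: nat_trans K C F F"
 by (rule ntI) (auto simp: cmod_def mf_mod lin_id mf_cl)

lemma cmod_cmp:
 assumes "is_functor C (kmod K) F" "et: nat_trans K C F G" "th: nat_trans K C G H"
 shows "cmp (cmod K C) F G H th et: nat_trans K C F H"
 using assms
 by (intro ntI) (auto simp: mf_cl nt_nat nt_cl, auto simp: cmod_def intro: lin_comp[OF mf_mod nt_lin nt_lin])

lemma cmod_klinear:
 fixes C :: "('o, 'm, 'z) cat_scheme"
 shows "klinear_category K (cmod K C :: ('k, ('k, 'o, 'm, 'v) mfnc, 'o => 'v => 'v) kcat)"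
proof (rule klI)
 show "category (cmod K C)"
 proof (rule catI; simp)
  show "is_functor C (kmod K) a ==> is_functor C (kmod K) b ==> f: nat_trans K C a b ==> cmp (cmod K C) a a b f (ide (cmod K C) a) = f" for a b f
   by (rule nt_ext) (auto intro: cmod_cmp cmod_ide)
  show "is_functor C (kmod K) a ==> is_functor C (kmod K) b ==> f: nat_trans K C a b ==> cmp (cmod K C) a b b (ide (cmod K C) b) f = f" for a b f
   by (rule nt_ext) (auto intro: cmod_cmp cmod_ide simp: nt_cl)
  show "is_functor C (kmod K) a ==> is_functor C (kmod K) b ==> is_functor C (kmod K) c ==> is_functor C (kmod K) d ==>
    f: nat_trans K C a b ==> g: nat_trans K C b c ==> h: nat_trans K C c d ==>
    cmp (cmod K C) a b d (cmp (cmod K C) b c d h g) f = cmp (cmod K C) a c d h (cmp (cmod K C) a b c g f)" for a b c d f g h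
   by (rule nt_ext) (auto intro!: cmod_cmp simp: nt_cl)
 qed (auto intro: cmod_cmp cmod_ide)
 note i = cmod_cmp mod_add[OF module_nat_mod, simplified] mod_sm[OF module_nat_mod, simplified]
 fix a b c :: "('k, 'o, 'm, 'v) mfnc"
 assume "a: Ob (cmod K C)" "b: Ob (cmod K C)" "c: Ob (cmod K C)"
 hence o: "is_functor C (kmod K) a" "is_functor C (kmod K) b" "is_functor C (kmod K) c" by auto
 { fix f f' g assume a: "f: Arr (cmod K C) a b" "f': Arr (cmod K C) a b" "g: Arr (cmod K C) b c"
  show "cmp (cmod K C) a b c g (f +[homm (cmod K C) a b] f') = cmp (cmod K C) a b c g f +[homm (cmod K C) a c] cmp (cmod K C) a b c g f'"
   using o a by (intro nt_ext[of _ C a c]) (auto intro!: i simp: nt_cl nt_add) }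
 { fix f f' g assume a: "f: Arr (cmod K C) b c" "f': Arr (cmod K C) b c" "g: Arr (cmod K C) a b"
  show "cmp (cmod K C) a b c (f +[homm (cmod K C) b c] f') g = cmp (cmod K C) a b c f g +[homm (cmod K C) a c] cmp (cmod K C) a b c f' g"
   using o a by (intro nt_ext[of _ C a c]) (auto intro!: i simp: nt_cl nt_add) }
 fix f k g assume a: "f: Arr (cmod K C) a b" "k <: K" "g: Arr (cmod K C) b c"
 show "cmp (cmod K C) a b c g (k *[homm (cmod K C) a b] f) = k *[homm (cmod K C) a c] cmp (cmod K C) a b c g f"
  using o a by (intro nt_ext[of _ C a c]) (auto intro!: i simp: nt_cl nt_sm)
 show "cmp (cmod K C) a b c (k *[homm (cmod K C) b c] g) f = k *[homm (cmod K C) a c] cmp (cmod K C) a b c g f"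
  using o a by (intro nt_ext[of _ C a c]) (auto intro!: i simp: nt_cl nt_sm)
qed (auto simp: module_nat_mod)

end

subsection \<open>Localization\<close>

lemma zz_mem: "category A ==> is_zigzag A W x ps y ==> x: Ob A & y: Ob A"
 by (induction A W x ps y rule: is_zigzag.induct) auto

lemma zz_app: "category A ==> is_zigzag A W x (ps @ qs) z \<longleftrightarrow> (EX y. is_zigzag A W x ps y & is_zigzag A W y qs z)"
proof (induction ps arbitrary: x)
 case Nil thus ?case by (auto dest: zz_mem)
next
 case (Cons p ps) thus ?case by (cases p) auto
qed

lemma zz_zigzag:
 assumes "category A" shows "zz_eq A W x ps qs y ==> is_zigzag A W x ps y & is_zigzag A W x qs y"
proof (induction rule: zz_eq.induct)
 case (zz_cong x l a ps qs b r y) thus ?case by (auto simp: zz_app[OF assms])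
qed (auto simp: cat_ide[OF assms] cat_cmp[OF assms])

lemma zz_append:
 assumes A: "category A" and p: "zz_eq A W x ps ps' y" and q: "zz_eq A W y qs qs' z"
 shows "zz_eq A W x (ps @ qs) (ps' @ qs') z"
proof -
 have z: "is_zigzag A W x [] x" "is_zigzag A W z [] z" "is_zigzag A W y qs z" "is_zigzag A W x ps' y"
  using zz_zigzag[OF A p] zz_zigzag[OF A q] zz_mem[OF A] by auto
 from zz_cong[OF z(1) p z(3)] zz_cong[OF z(4) q z(2)] show ?thesis by (auto intro: zz_trans)
qed

lemma zz_class_eq:
 assumes "category A" "is_zigzag A W x ps y" "is_zigzag A W x qs y"
 shows "zz_class A W x y ps = zz_class A W x y qs \<longleftrightarrow> zz_eq A W x ps qs y"
 unfolding zz_class_def using assms(2,3) by (blast intro: zz_refl zz_sym zz_trans)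

lemma loc_sel[simp]: "Ob (loc_cat A W) = Ob A" "ide (loc_cat A W) x = zz_class A W x x []"
 "Arr (loc_cat A W) x y = {zz_class A W x y ps | ps. is_zigzag A W x ps y}"
 by (simp_all add: loc_cat_def)

lemma loc_cmp:
 assumes A: "category A" and "is_zigzag A W x ps y" "is_zigzag A W y qs z"
 shows "cmp (loc_cat A W) x y z (zz_class A W y z qs) (zz_class A W x y ps) = zz_class A W x z (ps @ qs)"
 unfolding loc_cat_def zz_class_def using assms(2,3)
 by (auto intro: zz_refl) (blast intro: zz_trans[OF zz_append[OF A]])

lemma loc_category: assumes A: "category A" shows "category (loc_cat A W)"
proof (rule catI)
 fix a b c d f g h assume "f: Arr (loc_cat A W) a b" "g: Arr (loc_cat A W) b c" "h: Arr (loc_cat A W) c d"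
 then obtain p q r where z: "is_zigzag A W a p b" "is_zigzag A W b q c" "is_zigzag A W c r d"
  "f = zz_class A W a b p" "g = zz_class A W b c q" "h = zz_class A W c d r" by auto
 hence "is_zigzag A W a (p @ q) c" "is_zigzag A W b (q @ r) d" using zz_app[OF A] by auto
 thus "cmp (loc_cat A W) a b d (cmp (loc_cat A W) b c d h g) f = cmp (loc_cat A W) a c d h (cmp (loc_cat A W) a b c g f)"
  using z by (simp add: loc_cmp[OF A])
qed (fastforce simp: loc_cmp[OF A] zz_app[OF A] dest: zz_mem[OF A])+

definition loc_inv :: "('o, 'm, 'z) cat_scheme => ('o => 'o => 'm => bool) => 'o => 'o => 'm => ('o, 'm) zstep list set" where
 "loc_inv A W x y w = zz_class A W y x [Bwd y x w]"

lemma loc_arr_in: "x: Ob A ==> y: Ob A ==> f: Arr A x y ==> loc_arr A W x y f: Arr (loc_cat A W) x y"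
 by (auto simp: loc_arr_def)

lemma loc_inv_in: "x: Ob A ==> y: Ob A ==> w: Arr A x y ==> W x y w ==> loc_inv A W x y w: Arr (loc_cat A W) y x"
 by (fastforce simp: loc_inv_def)

lemma loc_arr_cmp: "category A ==> x: Ob A ==> y: Ob A ==> z: Ob A ==> f: Arr A x y ==> g: Arr A y z ==>
 cmp (loc_cat A W) x y z (loc_arr A W y z g) (loc_arr A W x y f) = loc_arr A W x z (cmp A x y z g f)"
 unfolding loc_arr_def by (simp add: loc_cmp zz_class_eq zz_cmp cat_cmp)

lemma loc_arr_ide: "category A ==> x: Ob A ==> loc_arr A W x x (ide A x) = ide (loc_cat A W) x"
 unfolding loc_arr_def by (simp add: zz_class_eq zz_ide cat_ide)

lemma loc_inv1: "category A ==> x: Ob A ==> y: Ob A ==> w: Arr A x y ==> W x y w ==>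
  cmp (loc_cat A W) x y x (loc_inv A W x y w) (loc_arr A W x y w) = ide (loc_cat A W) x"
 and loc_inv2: "category A ==> x: Ob A ==> y: Ob A ==> w: Arr A x y ==> W x y w ==>
  cmp (loc_cat A W) y x y (loc_arr A W x y w) (loc_inv A W x y w) = ide (loc_cat A W) y"
 unfolding loc_arr_def loc_inv_def by (simp_all add: loc_cmp zz_class_eq zz_inv1 zz_inv2)

lemma loc_iso: "category A ==> x: Ob A ==> y: Ob A ==> w: Arr A x y ==> W x y w ==>
  is_iso (loc_cat A W) x y (loc_arr A W x y w)"
 unfolding is_iso_def inverse_arrows_def
 using loc_arr_in loc_inv_in loc_inv1 loc_inv2 by meson

text \<open>Peeling the last step off a zigzag leaves a shorter one, so a property of arrows out of
  a fixed x needs to be checked only under composition with an arrow of A and with a formal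
  inverse.\<close>

lemma loc_induct:
 assumes A: "category A" and f: "fi: Arr (loc_cat A W) x y" and x: "x: Ob A"
  and i: "P x (ide (loc_cat A W) x)"
  and s1: "!!y z fi f. fi: Arr (loc_cat A W) x y ==> P y fi ==> y: Ob A ==> z: Ob A ==> f: Arr A y z ==>
    P z (cmp (loc_cat A W) x y z (loc_arr A W y z f) fi)"
  and s2: "!!y z fi w. fi: Arr (loc_cat A W) x y ==> P y fi ==> y: Ob A ==> z: Ob A ==> w: Arr A z y ==> W z y w ==>
    P z (cmp (loc_cat A W) x y z (loc_inv A W z y w) fi)"
 shows "P y fi"
proof -
 have "is_zigzag A W x ps y ==> P y (zz_class A W x y ps)" for ps y
 proof (induction ps arbitrary: y rule: rev_induct)
  case Nil thus ?case using i by simp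
 next
  case (snoc p ps)
  then obtain z where z: "is_zigzag A W x ps z" "is_zigzag A W z [p] y" by (auto simp: zz_app[OF A])
  have in1: "zz_class A W x z ps: Arr (loc_cat A W) x z" using z by auto
  have e: "zz_class A W x y (ps @ [p]) = cmp (loc_cat A W) x z y (zz_class A W z y [p]) (zz_class A W x z ps)"
   using loc_cmp[OF A z] by simp
  show ?case
  proof (cases p)
   case (Fwd a b f) thus ?thesis using s1[OF in1 snoc.IH[OF z(1)], of y f] z(2) e by (auto simp: loc_arr_def)
  next
   case (Bwd a b f) thus ?thesis using s2[OF in1 snoc.IH[OF z(1)], of y f] z(2) e by (auto simp: loc_inv_def)
  qed
 qed
 thus ?thesis using f by auto
qed

text \<open>Cancelling f and f' in the square for s and t leaves the square for their inverses,
  which is what the backward steps in \<open>loc_natural\<close> need.\<close>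

lemma iso_inverse_natural:
 assumes D: "category D" and o: "a: Ob D" "b: Ob D" "a': Ob D" "b': Ob D"
  and i: "inverse_arrows D a b f g" "inverse_arrows D a' b' f' g'"
  and s: "s: Arr D a a'" "t: Arr D b b'"
  and c: "cmp D a b b' t f = cmp D a a' b' f' s"
 shows "cmp D b a a' s g = cmp D b b' a' g' t"
proof -
 note [simp] = catD[OF D] o s
 have m: "f: Arr D a b" "g: Arr D b a" "f': Arr D a' b'" "g': Arr D b' a'"
  "cmp D a b a g f = ide D a" "cmp D b a b f g = ide D b" "cmp D a' b' a' g' f' = ide D a'"
  using i by (auto simp: inverse_arrows_def)
 have "cmp D b b' a' g' t = cmp D b b' a' g' (cmp D b b b' t (cmp D b a b f g))" by (simp add: m)
 also have "... = cmp D b b' a' g' (cmp D b a b' (cmp D a b b' t f) g)" using m by simp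
 also have "... = cmp D b a a' (cmp D a b' a' g' (cmp D a a' b' f' s)) g" using m unfolding c by simp
 also have "cmp D a b' a' g' (cmp D a a' b' f' s) = cmp D a a' a' (cmp D a' b' a' g' f') s"
  using m(1-4) by simp
 finally show ?thesis using m by simp
qed

lemma fnc_inverse: "is_functor A B F ==> a: Ob A ==> b: Ob A ==> inverse_arrows A a b f g ==>
 inverse_arrows B (om F a) (om F b) (mm F a b f) (mm F b a g)"
 unfolding inverse_arrows_def
 using fnc_arr[of A B F a b f] fnc_arr[of A B F b a g] fnc_cmp[of A B F a b a f g] fnc_cmp[of A B F b a b g f] fnc_ide[of A B F]
 by simp

text \<open>Induction along the zigzag: a forward step is the hypothesis \<open>nat\<close>, and a
  backward step follows from it because functors preserve inverses. Naturality between functors on a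
  localization thus becomes a matter of the arrows of A alone.\<close>

lemma loc_natural:
 assumes A: "category A" and F: "is_functor (loc_cat A W) D F" and G: "is_functor (loc_cat A W) D G"
  and th: "!!x. x: Ob A ==> th x: Arr D (om F x) (om G x)"
  and nat: "!!x y f. x: Ob A ==> y: Ob A ==> f: Arr A x y ==>
    cmp D (om F x) (om F y) (om G y) (th y) (mm F x y (loc_arr A W x y f)) =
    cmp D (om F x) (om G x) (om G y) (mm G x y (loc_arr A W x y f)) (th x)"
  and x: "x: Ob A" and f: "fi: Arr (loc_cat A W) x y"
 shows "cmp D (om F x) (om F y) (om G y) (th y) (mm F x y fi) = cmp D (om F x) (om G x) (om G y) (mm G x y fi) (th x)"
proof (rule loc_induct[OF A f x])
 let ?L = "loc_cat A W"
 have D: "category D" using F by (rule fnc_cat)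
 have ob: "!!x. x: Ob A ==> om F x: Ob D" "!!x. x: Ob A ==> om G x: Ob D" using fnc_ob[OF F] fnc_ob[OF G] by auto
 note ar = fnc_arr[OF F, unfolded loc_sel(1)] fnc_arr[OF G, unfolded loc_sel(1)]
 show "cmp D (om F x) (om F x) (om G x) (th x) (mm F x x (ide ?L x)) = cmp D (om F x) (om G x) (om G x) (mm G x x (ide ?L x)) (th x)"
  using x by (simp add: fnc_ide[OF F, unfolded loc_sel] fnc_ide[OF G, unfolded loc_sel] cat_idl[OF D] cat_idr[OF D] ob th)
 have step: "cmp D (om F x) (om F z) (om G z) (th z) (mm F x z (cmp ?L x y z sy fi)) =
   cmp D (om F x) (om G x) (om G z) (mm G x z (cmp ?L x y z sy fi)) (th x)"
  if p: "fi: Arr ?L x y" "sy: Arr ?L y z" and o: "y: Ob A" "z: Ob A"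
   and 1: "cmp D (om F x) (om F y) (om G y) (th y) (mm F x y fi) = cmp D (om F x) (om G x) (om G y) (mm G x y fi) (th x)"
   and 2: "cmp D (om F y) (om F z) (om G z) (th z) (mm F y z sy) = cmp D (om F y) (om G y) (om G z) (mm G y z sy) (th y)"
  for y z fi sy
 proof -
  note [simp] = catD[OF D] ob th ar[OF _ _ p(1)] ar[OF _ _ p(2)] x o
  have "cmp D (om F x) (om F z) (om G z) (th z) (mm F x z (cmp ?L x y z sy fi)) =
    cmp D (om F x) (om F y) (om G z) (cmp D (om F y) (om F z) (om G z) (th z) (mm F y z sy)) (mm F x y fi)"
   using fnc_cmp[OF F _ _ _ p] by simp
  also have "... = cmp D (om F x) (om G y) (om G z) (mm G y z sy) (cmp D (om F x) (om F y) (om G y) (th y) (mm F x y fi))"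
   unfolding 2 by simp
  also have "... = cmp D (om F x) (om G x) (om G z) (mm G x z (cmp ?L x y z sy fi)) (th x)"
   unfolding 1 using fnc_cmp[OF G _ _ _ p] by simp
  finally show ?thesis .
 qed
 show "cmp D (om F x) (om F z) (om G z) (th z) (mm F x z (cmp ?L x y z (loc_arr A W y z f) fi)) =
   cmp D (om F x) (om G x) (om G z) (mm G x z (cmp ?L x y z (loc_arr A W y z f) fi)) (th x)"
  if "fi: Arr ?L x y" "cmp D (om F x) (om F y) (om G y) (th y) (mm F x y fi) = cmp D (om F x) (om G x) (om G y) (mm G x y fi) (th x)"
   "y: Ob A" "z: Ob A" "f: Arr A y z" for y z fi f
  using step[OF that(1) loc_arr_in[OF that(3-5)] that(3,4,2) nat[OF that(3-5)]] .
 show "cmp D (om F x) (om F z) (om G z) (th z) (mm F x z (cmp ?L x y z (loc_inv A W z y w) fi)) =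
   cmp D (om F x) (om G x) (om G z) (mm G x z (cmp ?L x y z (loc_inv A W z y w) fi)) (th x)"
  if a: "fi: Arr ?L x y" "cmp D (om F x) (om F y) (om G y) (th y) (mm F x y fi) = cmp D (om F x) (om G x) (om G y) (mm G x y fi) (th x)"
   "y: Ob A" "z: Ob A" "w: Arr A z y" "W z y w" for y z fi w
 proof -
  have i: "inverse_arrows ?L z y (loc_arr A W z y w) (loc_inv A W z y w)"
   unfolding inverse_arrows_def using a loc_arr_in loc_inv_in loc_inv1[OF A] loc_inv2[OF A] by metis
  have "cmp D (om F y) (om F z) (om G z) (th z) (mm F y z (loc_inv A W z y w)) =
    cmp D (om F y) (om G y) (om G z) (mm G y z (loc_inv A W z y w)) (th y)"
   by (rule iso_inverse_natural[OF D _ _ _ _ fnc_inverse[OF F _ _ i] fnc_inverse[OF G _ _ i]])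
     (use a ob th nat in auto)
  thus ?thesis by (intro step[OF a(1) loc_inv_in[where W=W, OF a(4,3,5,6)] a(3,4,2)])
 qed
qed

definition sends :: "('o, 'm, 'z) cat_scheme => ('o => 'o => 'm => bool) => ('p => 'p => 'n => bool) => ('o, 'm, 'p, 'n) fnc => bool" where
 "sends A W W' F \<longleftrightarrow> (ALL a:Ob A. ALL b:Ob A. ALL w:Arr A a b. W a b w \<longrightarrow> W' (om F a) (om F b) (mm F a b w))"

lemma zmap_zigzag:
 assumes F: "is_functor A B F" and W: "sends A W W' F"
 shows "is_zigzag A W x ps y ==> is_zigzag B W' (om F x) (map (zmap F) ps) (om F y)"
proof (induction ps arbitrary: x)
 case Nil thus ?case using fnc_ob[OF F] by auto
next
 case (Cons p ps) thus ?case using fnc_ob[OF F] fnc_arr[OF F] W unfolding sends_def by (cases p) auto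
qed

lemma zmap_eq:
 assumes F: "is_functor A B F" and W: "sends A W W' F"
 shows "zz_eq A W x ps qs y ==> zz_eq B W' (om F x) (map (zmap F) ps) (map (zmap F) qs) (om F y)"
proof (induction rule: zz_eq.induct)
 case (zz_refl x ps y) thus ?case by (intro zz_eq.zz_refl zmap_zigzag[OF F W])
next
 case (zz_cong x l a ps qs b r y)
 show ?case unfolding map_append
  by (rule zz_eq.zz_cong[OF zmap_zigzag[OF F W] zz_cong.IH zmap_zigzag[OF F W]]) (fact zz_cong.hyps)+
next
 case (zz_trans x ps qs y rs) thus ?case by (blast intro: zz_eq.zz_trans)
next
 case (zz_ide a) thus ?case using zz_eq.zz_ide[OF fnc_ob[OF F zz_ide]] by (simp add: fnc_ide[OF F])
next
 case (zz_cmp a b c f g) thus ?case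
  by (simp add: fnc_cmp[OF F]) (intro zz_eq.zz_cmp fnc_ob[OF F] fnc_arr[OF F])
qed (auto intro: zz_eq.intros simp: fnc_ob[OF F] fnc_arr[OF F] W[unfolded sends_def, rule_format])

lemma loc_fnc_class:
 assumes F: "is_functor A B F" and W: "sends A W W' F"
  and z: "is_zigzag A W x ps y"
 shows "mm (loc_fnc B W' F) x y (zz_class A W x y ps) = zz_class B W' (om F x) (om F y) (map (zmap F) ps)"
 unfolding loc_fnc_def zz_class_def using z
 by (auto intro: zz_refl zz_trans zmap_eq[OF F W])

lemma loc_fnc_arr:
 assumes F: "is_functor A B F" and W: "sends A W W' F"
  and z: "x: Ob A" "y: Ob A" "f: Arr A x y"
 shows "mm (loc_fnc B W' F) x y (loc_arr A W x y f) = loc_arr B W' (om F x) (om F y) (mm F x y f)"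
 unfolding loc_arr_def using loc_fnc_class[OF F W, of x "[Fwd x y f]" y] z by simp

lemma loc_fnc_functor:
 assumes F: "is_functor A B F" and W: "sends A W W' F"
 shows "is_functor (loc_cat A W) (loc_cat B W') (loc_fnc B W' F)"
proof -
 have A: "category A" and B: "category B" using fnc_cat[OF F] .
 note cl = loc_fnc_class[OF F W] and zz = zmap_zigzag[OF F W]
 have om: "om (loc_fnc B W' F) = om F" by (simp add: loc_fnc_def)
 show ?thesis unfolding is_functor_def om
 proof (intro conjI ballI)
  fix a b c f g assume "a: Ob (loc_cat A W)" "b: Ob (loc_cat A W)" "c: Ob (loc_cat A W)"
   "f: Arr (loc_cat A W) a b" "g: Arr (loc_cat A W) b c"
  then obtain ps qs where z: "is_zigzag A W a ps b" "is_zigzag A W b qs c" "f = zz_class A W a b ps" "g = zz_class A W b c qs" by auto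
  hence "is_zigzag A W a (ps @ qs) c" using zz_app[OF A] by auto
  thus "mm (loc_fnc B W' F) a c (cmp (loc_cat A W) a b c g f) =
    cmp (loc_cat B W') (om F a) (om F b) (om F c) (mm (loc_fnc B W' F) b c g) (mm (loc_fnc B W' F) a b f)"
   using z by (simp add: loc_cmp[OF A] loc_cmp[OF B zz zz] cl)
 qed (use A B in "auto simp: loc_category fnc_ob[OF F] cl intro: zz")
qed

lemma zmapo_zigzag:
 assumes F: "is_functor (op_cat A) B F" and W: "sends (op_cat A) (%a b. W b a) W' F"
 shows "is_zigzag A W x ps y ==> is_zigzag B W' (om F y) (rev (map (zmap_op F) ps)) (om F x)"
proof (induction ps arbitrary: x)
 case Nil thus ?case using fnc_ob[OF F] by auto
next
 case (Cons p ps)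
 have B: "category B" using fnc_cat[OF F] by simp
 show ?case using Cons fnc_ob[OF F] fnc_arr[OF F] W unfolding sends_def by (cases p) (auto simp: zz_app[OF B])
qed

lemma zmapo_eq:
 assumes F: "is_functor (op_cat A) B F" and W: "sends (op_cat A) (%a b. W b a) W' F"
 shows "zz_eq A W x ps qs y ==> zz_eq B W' (om F y) (rev (map (zmap_op F) ps)) (rev (map (zmap_op F) qs)) (om F x)"
proof (induction rule: zz_eq.induct)
 case (zz_refl x ps y) thus ?case by (intro zz_eq.zz_refl zmapo_zigzag[OF F W])
next
 case (zz_cong x l a ps qs b r y)
 show ?case unfolding map_append rev_append append_assoc
  by (rule zz_eq.zz_cong[OF zmapo_zigzag[OF F W] zz_cong.IH zmapo_zigzag[OF F W]]) (fact zz_cong.hyps)+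
next
 case (zz_trans x ps qs y rs) thus ?case by (blast intro: zz_eq.zz_trans)
next
 case (zz_ide a) thus ?case using zz_eq.zz_ide[of "om F a" B W'] fnc_ob[OF F] by (simp add: fnc_ide[OF F, simplified])
next
 case (zz_cmp a b c f g) thus ?case
  using zz_eq.zz_cmp[of "om F c" B "om F b" "om F a" "mm F c b g" "mm F b a f" W'] fnc_ob[OF F] fnc_arr[OF F]
   fnc_cmp[OF F, of c b a g f] by simp
next
 case (zz_inv1 a b w) thus ?case using zz_eq.zz_inv2[of "om F b" B "om F a" "mm F b a w" W'] fnc_ob[OF F] fnc_arr[OF F] W unfolding sends_def by simp
next
 case (zz_inv2 a b w) thus ?case using zz_eq.zz_inv1[of "om F b" B "om F a" "mm F b a w" W'] fnc_ob[OF F] fnc_arr[OF F] W unfolding sends_def by simp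
qed (auto intro: zz_eq.intros)

lemma loc_fnco_class:
 assumes F: "is_functor (op_cat A) B F" and W: "sends (op_cat A) (%a b. W b a) W' F"
  and z: "is_zigzag A W x ps y"
 shows "mm (loc_fnc_op B W' F) y x (zz_class A W x y ps) = zz_class B W' (om F y) (om F x) (rev (map (zmap_op F) ps))"
 unfolding loc_fnc_op_def zz_class_def using z
 by (auto intro: zz_refl zz_trans zmapo_eq[OF F W])

lemma loc_fnco_arr:
 assumes F: "is_functor (op_cat A) B F" and W: "sends (op_cat A) (%a b. W b a) W' F"
  and z: "x: Ob A" "y: Ob A" "f: Arr A x y"
 shows "mm (loc_fnc_op B W' F) y x (loc_arr A W x y f) = loc_arr B W' (om F y) (om F x) (mm F y x f)"
 unfolding loc_arr_def using loc_fnco_class[OF F W, of x "[Fwd x y f]" y] z by simp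

lemma loc_fnco_functor:
 assumes F: "is_functor (op_cat A) B F" and A: "category A"
  and W: "sends (op_cat A) (%a b. W b a) W' F"
 shows "is_functor (op_cat (loc_cat A W)) (loc_cat B W') (loc_fnc_op B W' F)"
proof -
 have B: "category B" using fnc_cat[OF F] by simp
 note cl = loc_fnco_class[OF F W] and zz = zmapo_zigzag[OF F W]
 have om: "om (loc_fnc_op B W' F) = om F" by (simp add: loc_fnc_op_def)
 show ?thesis unfolding is_functor_def om
 proof (intro conjI ballI)
  fix a b c f g assume "a: Ob (op_cat (loc_cat A W))" "b: Ob (op_cat (loc_cat A W))" "c: Ob (op_cat (loc_cat A W))"
   "f: Arr (op_cat (loc_cat A W)) a b" "g: Arr (op_cat (loc_cat A W)) b c"
  then obtain ps qs where z: "is_zigzag A W b ps a" "is_zigzag A W c qs b" "f = zz_class A W b a ps" "g = zz_class A W c b qs" by auto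
  hence "is_zigzag A W c (qs @ ps) a" using zz_app[OF A] by auto
  thus "mm (loc_fnc_op B W' F) a c (cmp (op_cat (loc_cat A W)) a b c g f) =
    cmp (loc_cat B W') (om F a) (om F b) (om F c) (mm (loc_fnc_op B W' F) b c g) (mm (loc_fnc_op B W' F) a b f)"
   using z by (simp add: loc_cmp[OF A] loc_cmp[OF B zz zz] cl)
 qed (use A B fnc_ob[OF F] in "auto simp: loc_category op_category cl intro: zz")
qed

section \<open>Functors to sets that invert W, and the action of zigzags on them\<close>

fun zact :: "('o => 's set) => ('o => 'o => 'm => 's => 's) => ('o, 'm) zstep list => 's => 's" where
 "zact S M [] s = s"
| "zact S M (Fwd a b f # ps) s = zact S M ps (M a b f s)"
| "zact S M (Bwd a b w # ps) s = zact S M ps (inv_into (S b) (M b a w) s)"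

lemma zact_append: "zact S M (ps @ qs) s = zact S M qs (zact S M ps s)"
 by (induction S M ps s rule: zact.induct) auto

text \<open>Two plain functions stand for the functor because only its action on elements matters.
  Such functors detect equality and invertibility of arrows in the localization without a calculus
  of fractions; cohomology and its pullbacks are the instances.\<close>

definition set_fnc :: "('o, 'm, 'z) cat_scheme => ('o => 'o => 'm => bool) => ('o => 's set) => ('o => 'o => 'm => 's => 's) => bool" where
 "set_fnc A W S M \<longleftrightarrow> category A & (ALL a:Ob A. ALL s:S a. M a a (ide A a) s = s) \<and>
  (ALL a:Ob A. ALL b:Ob A. ALL f:Arr A a b. ALL s:S a. M a b f s: S b) \<and>
  (ALL a:Ob A. ALL b:Ob A. ALL c:Ob A. ALL f:Arr A a b. ALL g:Arr A b c. ALL s:S a. M a c (cmp A a b c g f) s = M b c g (M a b f s)) \<and>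
  (ALL a:Ob A. ALL b:Ob A. ALL w:Arr A a b. W a b w \<longrightarrow> bij_betw (M a b w) (S a) (S b))"

context
 fixes A :: "('o, 'm, 'z) cat_scheme" and W S M
 assumes sf: "set_fnc A W S M"
begin

lemma sf_simps:
 "a: Ob A ==> s: S a ==> M a a (ide A a) s = s"
 "a: Ob A ==> b: Ob A ==> f: Arr A a b ==> s: S a ==> M a b f s: S b"
 "a: Ob A ==> b: Ob A ==> c: Ob A ==> f: Arr A a b ==> g: Arr A b c ==> s: S a ==> M a c (cmp A a b c g f) s = M b c g (M a b f s)"
 "a: Ob A ==> b: Ob A ==> w: Arr A a b ==> W a b w ==> bij_betw (M a b w) (S a) (S b)"
 using sf unfolding set_fnc_def by blast+

lemma sf_inv:
 assumes "a: Ob A" "b: Ob A" "w: Arr A a b" "W a b w"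
 shows "s: S a ==> inv_into (S a) (M a b w) (M a b w s) = s"
  "s: S b ==> M a b w (inv_into (S a) (M a b w) s) = s"
  "s: S b ==> inv_into (S a) (M a b w) s: S a"
 using sf_simps(4)[OF assms] unfolding bij_betw_def by (auto intro: f_inv_into_f inv_into_into)

lemma zact_in: "is_zigzag A W x ps y ==> s: S x ==> zact S M ps s: S y"
proof (induction ps arbitrary: x s)
 case (Cons p ps) thus ?case using sf_simps sf_inv by (cases p) auto
qed auto

text \<open>Each generating relation of the congruence holds for the action, so the action depends
  only on the class of a zigzag.\<close>

lemma zact_eq: "zz_eq A W x ps qs y ==> s: S x ==> zact S M ps s = zact S M qs s"
proof (induction arbitrary: s rule: zz_eq.induct)
 case (zz_cong x l a ps qs b r y) thus ?case using zact_in by (simp add: zact_append)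
qed (auto simp: sf_simps sf_inv)

lemma loc_arr_act:
 assumes "loc_arr A W x y f = loc_arr A W x y g" "x: Ob A" "y: Ob A" "f: Arr A x y" "g: Arr A x y" "s: S x"
 shows "M x y f s = M x y g s"
proof -
 have "category A" using sf by (simp add: set_fnc_def)
 hence "zz_eq A W x [Fwd x y f] [Fwd x y g] y" using assms unfolding loc_arr_def by (subst (asm) zz_class_eq) auto
 from zact_eq[OF this assms(6)] show ?thesis by simp
qed

text \<open>An inverse in the localization is represented by a zigzag, and the action of that zigzag
  inverts \<open>M x y f\<close>.\<close>

lemma loc_iso_bij:
 assumes "is_iso (loc_cat A W) x y (loc_arr A W x y f)" "x: Ob A" "y: Ob A" "f: Arr A x y"
 shows "bij_betw (M x y f) (S x) (S y)"
proof -
 have A: "category A" using sf by (simp add: set_fnc_def)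
 obtain ps where ps: "is_zigzag A W y ps x" and i: "inverse_arrows (loc_cat A W) x y (loc_arr A W x y f) (zz_class A W y x ps)"
  using assms(1) by (auto simp: is_iso_def inverse_arrows_def)
 have z: "is_zigzag A W x [Fwd x y f] y" using assms by simp
 have "zz_eq A W x ([Fwd x y f] @ ps) [] x" "zz_eq A W y (ps @ [Fwd x y f]) [] y"
  using i loc_cmp[OF A z ps] loc_cmp[OF A ps z] ps assms(2-4)
  by (auto simp: inverse_arrows_def loc_arr_def zz_class_eq[OF A] zz_app[OF A])
 from zact_eq[OF this(1)] zact_eq[OF this(2)] show ?thesis
  by (intro bij_betw_byWitness[where f'="zact S M ps"]) (auto simp: zact_append zact_in[OF ps] sf_simps assms)
qed

end

lemma derived_sel[simp]: "Ob (derived_cat A W) = Ob A" "Arr (derived_cat A W) = Arr (loc_cat A W)"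
 "ide (derived_cat A W) = ide (loc_cat A W)" "cmp (derived_cat A W) = cmp (loc_cat A W)"
 by (simp_all add: derived_cat_def)

declare loc_sel(2,3)[simp del]

subsection \<open>Complexes in a linear category\<close>

locale kl = gf K for K :: "'k ring" (structure) +
 fixes A :: "('k, 'o, 'm, 'z) kcat_scheme"
 assumes kl: "klinear_category K A"
begin

lemmas A_cat = kl_cat[OF kl]

lemma A_mod[simp]: "a: Ob A ==> b: Ob A ==> module K (homm A a b)"
 "a: Ob A ==> b: Ob A ==> carrier (homm A a b) = Arr A a b"
 using kl_mod[OF kl] kl_car[OF kl] by auto

lemma A_cl[simp]: "a: Ob A ==> ide A a: Arr A a a"
 "a: Ob A ==> b: Ob A ==> c: Ob A ==> f: Arr A a b ==> g: Arr A b c ==> cmp A a b c g f: Arr A a c"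
 "a: Ob A ==> b: Ob A ==> 0[homm A a b]: Arr A a b"
 "a: Ob A ==> b: Ob A ==> f: Arr A a b ==> g: Arr A a b ==> f +[homm A a b] g: Arr A a b"
 "a: Ob A ==> b: Ob A ==> f: Arr A a b ==> -[homm A a b] f: Arr A a b"
 "a: Ob A ==> b: Ob A ==> f: Arr A a b ==> k <: K ==> k *[homm A a b] f: Arr A a b"
 using md_cl[of "homm A a b"] by (auto simp: catD[OF A_cat])

lemma A_eq[simp]: "a: Ob A ==> b: Ob A ==> f: Arr A a b ==> cmp A a a b f (ide A a) = f"
 "a: Ob A ==> b: Ob A ==> f: Arr A a b ==> cmp A a b b (ide A b) f = f"
 "a: Ob A ==> b: Ob A ==> c: Ob A ==> d: Ob A ==> f: Arr A a b ==> g: Arr A b c ==> h: Arr A c d ==>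
  cmp A a b d (cmp A b c d h g) f = cmp A a c d h (cmp A a b c g f)"
 by (simp_all add: catD[OF A_cat])

lemma A_bil[simp]:
 assumes "a: Ob A" "b: Ob A" "c: Ob A"
 shows "f: Arr A a b ==> f': Arr A a b ==> g: Arr A b c ==>
   cmp A a b c g (f +[homm A a b] f') = cmp A a b c g f +[homm A a c] cmp A a b c g f'"
  "f: Arr A b c ==> f': Arr A b c ==> g: Arr A a b ==>
   cmp A a b c (f +[homm A b c] f') g = cmp A a b c f g +[homm A a c] cmp A a b c f' g"
  "f: Arr A a b ==> k <: K ==> g: Arr A b c ==>
   cmp A a b c g (k *[homm A a b] f) = k *[homm A a c] cmp A a b c g f"
  "f: Arr A a b ==> k <: K ==> g: Arr A b c ==>
   cmp A a b c (k *[homm A b c] g) f = k *[homm A a c] cmp A a b c g f"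
  "f: Arr A a b ==> g: Arr A b c ==>
   cmp A a b c g (-[homm A a b] f) = -[homm A a c] cmp A a b c g f"
  "f: Arr A a b ==> g: Arr A b c ==>
   cmp A a b c (-[homm A b c] g) f = -[homm A a c] cmp A a b c g f"
  "g: Arr A b c ==> cmp A a b c g 0[homm A a b] = 0[homm A a c]"
  "f: Arr A a b ==> cmp A a b c 0[homm A b c] f = 0[homm A a c]"
proof -
 note r = kl_r[OF kl assms] and l = kl_l[OF kl assms]
 { fix g assume g: "g: Arr A b c"
  show "f: Arr A a b ==> f': Arr A a b ==> cmp A a b c g (f +[homm A a b] f') = cmp A a b c g f +[homm A a c] cmp A a b c g f'"
   "f: Arr A a b ==> k <: K ==> cmp A a b c g (k *[homm A a b] f) = k *[homm A a c] cmp A a b c g f"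
   "f: Arr A a b ==> cmp A a b c g (-[homm A a b] f) = -[homm A a c] cmp A a b c g f"
   "cmp A a b c g 0[homm A a b] = 0[homm A a c]"
   using lin_add[OF r[OF g], of f f'] lin_sm[OF r[OF g], of k f] lin_neg[OF _ _ r[OF g], of f] lin_0[OF _ _ r[OF g]] assms
   by simp_all }
 { fix f assume g: "f: Arr A a b"
  show "g: Arr A b c ==> g': Arr A b c ==> cmp A a b c (g +[homm A b c] g') f = cmp A a b c g f +[homm A a c] cmp A a b c g' f"
   "g: Arr A b c ==> k <: K ==> cmp A a b c (k *[homm A b c] g) f = k *[homm A a c] cmp A a b c g f"
   "g: Arr A b c ==> cmp A a b c (-[homm A b c] g) f = -[homm A a c] cmp A a b c g f"
   "cmp A a b c 0[homm A b c] f = 0[homm A a c]" for g g'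
   using lin_add[OF l[OF g], of g g'] lin_sm[OF l[OF g], of k g] lin_neg[OF _ _ l[OF g], of g] lin_0[OF _ _ l[OF g]] assms
   by simp_all }
qed

text \<open>Simplification brackets composites to the right, and there an equation g f = h no longer
  matches once a further arrow k is applied first. This supplies the missing form of the
  equation.\<close>

lemma A_nest: "x: Ob A ==> a: Ob A ==> b: Ob A ==> c: Ob A ==> k: Arr A x a ==> f: Arr A a b ==> g: Arr A b c ==>
 cmp A a b c g f = h ==> cmp A x b c g (cmp A x a b f k) = cmp A x a c h k"
 by auto

lemma Ch_sel[simp]: "ide (Ch A) X = (%n. ide A X$n)"
 "cmp (Ch A) X Y Z g f = (%n. cmp A X$n Y$n Z$n (g n) (f n))"
 "homm (Ch A) = chain_mod A"
 "0[chain_mod A X Y] = (%n. 0[homm A X$n Y$n])"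
 "f +[chain_mod A X Y] g = (%n. f n +[homm A X$n Y$n] g n)"
 "k *[chain_mod A X Y] f = (%n. k *[homm A X$n Y$n] f n)"
 "carrier (chain_mod A X Y) = Arr (Ch A) X Y"
 by (simp_all add: Ch_def chain_mod_def)

text \<open>Degrees enter as variables with equations as premises, so that the rules also fire on
  indices that agree only after arithmetic. \<open>ch_dd2\<close> is the right-bracketed form of
  \<open>ch_dd\<close>.\<close>

lemma Ch_ob:
 assumes "X: Ob (Ch A)"
 shows ch_ob: "X$n: Ob A" and ch_d: "a = n ==> b = n+1 ==> cd X n: Arr A X$a X$b"
  and ch_dd: "a = n ==> b = m ==> m = n+1 ==> c = n + 2 ==>
   cmp A X$a X$b X$c (cd X m) (cd X n) = 0[homm A X$a X$c]"
  and ch_dd2: "a = n ==> b = m ==> m = n+1 ==> c = n + 2 ==> x: Ob A ==> f: Arr A x X$a ==>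
   cmp A x X$b X$c (cd X m) (cmp A x X$a X$b (cd X n) f) = 0[homm A x X$c]"
proof -
 have 1: "X$n: Ob A" "cd X n: Arr A X$n X$(n+1)"
  "cmp A X$n X$(n+1) X$(n+1+1) (cd X (n+1)) (cd X n) = 0[homm A X$n X$(n+1+1)]" for n
  using assms by (auto simp: Ch_def simp del: Ch_sel)
 thus o: "X$n: Ob A" and d: "a = n ==> b = n+1 ==> cd X n: Arr A X$a X$b" for n a b by auto
 show dd: "a = n ==> b = m ==> m = n+1 ==> c = n + 2 ==>
   cmp A X$a X$b X$c (cd X m) (cd X n) = 0[homm A X$a X$c]"
  using 1(3)[of n] by (simp add: add.assoc)
 show "a = n ==> b = m ==> m = n+1 ==> c = n + 2 ==> x: Ob A ==> f: Arr A x X$a ==>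
   cmp A x X$b X$c (cd X m) (cmp A x X$a X$b (cd X n) f) = 0[homm A x X$c]"
  using A_nest[of x "X$a" "X$b" "X$c" f "cd X n" "cd X m", OF _ o o o _ d d dd] A_bil(8)[of x "X$a" "X$c" f] by (simp add: o)
qed

lemma Ch_obI: "(!!n. X$n: Ob A) ==> (!!n. cd X n: Arr A X$n X$(n+1)) ==>
  (!!n. cmp A X$n X$(n+1) X$(n+1+1) (cd X (n+1)) (cd X n) = 0[homm A X$n X$(n+1+1)]) ==> X: Ob (Ch A)"
 by (simp add: Ch_def del: Ch_sel)

lemma Ch_arr:
 assumes f: "f: Arr (Ch A) X Y"
 shows ch_in: "a = n ==> b = n ==> f n: Arr A X$a Y$b"
  and ch_comm: "b = n ==> a = n ==> c = n+1 ==> m = n+1 ==> cmp A X$a Y$b Y$c (cd Y n) (f n) = cmp A X$a X$m Y$c (f m) (cd X n)"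
  and ch_comm2: "b = n ==> a = n ==> c = n+1 ==> m = n+1 ==> X: Ob (Ch A) ==> Y: Ob (Ch A) ==> x: Ob A ==> h: Arr A x X$a ==>
   cmp A x Y$b Y$c (cd Y n) (cmp A x X$a Y$b (f n) h) =
   cmp A x X$m Y$c (f m) (cmp A x X$a X$m (cd X n) h)"
proof -
 have 1: "f n: Arr A X$n Y$n"
  "cmp A X$n Y$n Y$(n+1) (cd Y n) (f n) = cmp A X$n X$(n+1) Y$(n+1) (f (n+1)) (cd X n)" for n
  using f by (auto simp: Ch_def chain_mod_def simp del: Ch_sel)
 show i: "a = n ==> b = n ==> f n: Arr A X$a Y$b" for n a b using 1 by auto
 show c: "b = n ==> a = n ==> c = n+1 ==> m = n+1 ==> cmp A X$a Y$b Y$c (cd Y n) (f n) = cmp A X$a X$m Y$c (f m) (cd X n)"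
  using 1 by auto
 show "b = n ==> a = n ==> c = n+1 ==> m = n+1 ==> X: Ob (Ch A) ==> Y: Ob (Ch A) ==> x: Ob A ==> h: Arr A x X$a ==>
   cmp A x Y$b Y$c (cd Y n) (cmp A x X$a Y$b (f n) h) =
   cmp A x X$m Y$c (f m) (cmp A x X$a X$m (cd X n) h)"
  using A_nest[of x "X$a" "Y$b" "Y$c" h "f n" "cd Y n", OF _ _ _ _ _ i ch_d[of Y] c] ch_ob[of X] ch_ob[of Y] ch_d[of X] ch_d[of Y] A_eq(3)[of x "X$a" "X$m" "Y$c" h "cd X n" "f m"]
  by (simp add: i)
qed

lemma Ch_arrI: "(!!n. f n: Arr A X$n Y$n) ==>
  (!!n. cmp A X$n Y$n Y$(n+1) (cd Y n) (f n) = cmp A X$n X$(n+1) Y$(n+1) (f (n+1)) (cd X n)) ==>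
  f: Arr (Ch A) X Y"
 by (simp add: Ch_def chain_mod_def del: Ch_sel)

lemma chain_module:
 assumes X: "X: Ob (Ch A)" and Y: "Y: Ob (Ch A)"
 shows "module K (chain_mod A X Y)"
proof (rule mod_inj[where I=UNIV and ro="%n f. f n" and M="%n. homm A X$n Y$n"])
 note [simp] = Ch_ob[OF X] Ch_ob[OF Y]
 fix f g assume f: "f <: (chain_mod A X Y)"
 note [simp] = Ch_arr[OF f[unfolded Ch_sel]]
 { fix k assume k: "k <: K"
  show "k *[chain_mod A X Y] f <: (chain_mod A X Y)"
   unfolding Ch_sel(7) by (rule Ch_arrI) (simp_all add: k) }
 assume g: "g <: (chain_mod A X Y)"
 note [simp] = Ch_arr[OF g[unfolded Ch_sel]]
 show "f +[chain_mod A X Y] g <: (chain_mod A X Y)"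
  unfolding Ch_sel(7) by (rule Ch_arrI) (simp_all)
next
 note [simp] = Ch_ob[OF X] Ch_ob[OF Y]
 show "0[chain_mod A X Y] <: (chain_mod A X Y)"
  unfolding Ch_sel(7) by (rule Ch_arrI) (simp_all)
qed (use Ch_ob[OF X] Ch_ob[OF Y] in "auto simp: fun_eq_iff Ch_arr")

lemma Ch_klinear: "klinear_category K (Ch A)"
proof (rule klI)
 show "category (Ch A)"
 proof (rule catI)
  fix X Y Z f g assume o: "X: Ob (Ch A)" "Y: Ob (Ch A)" "Z: Ob (Ch A)" "f: Arr (Ch A) X Y" "g: Arr (Ch A) Y Z"
  show "cmp (Ch A) X Y Z g f: Arr (Ch A) X Z"
   by (rule Ch_arrI) (simp_all add: Ch_ob[OF o(1)] Ch_ob[OF o(2)] Ch_ob[OF o(3)] Ch_arr[OF o(4)] Ch_arr[OF o(5)] o)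
 next
  fix X assume "X: Ob (Ch A)" thus "ide (Ch A) X: Arr (Ch A) X X"
   by (intro Ch_arrI) (simp_all add: Ch_ob)
 qed (auto simp: Ch_ob Ch_arr fun_eq_iff)
qed (auto simp: chain_module Ch_ob Ch_arr fun_eq_iff)

definition htp where
 "htp X Y f g \<longleftrightarrow> (EX h. (ALL n. h n: Arr A X$n Y$(n-1)) & (ALL n. f n = g n +[homm A X$n Y$n]
   (cmp A X$n Y$(n-1) Y$n (cd Y (n-1)) (h n) +[homm A X$n Y$n]
   cmp A X$n X$(n+1) Y$n (h (n+1)) (cd X n))))"

lemma htp_refl: assumes "X: Ob (Ch A)" "Y: Ob (Ch A)" "f: Arr (Ch A) X Y" shows "htp X Y f f"
 unfolding htp_def by (rule exI[of _ "%n. 0[homm A X$n Y$(n-1)]"])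
   (simp add: Ch_ob[OF assms(1)] Ch_ob[OF assms(2)] Ch_arr[OF assms(3)] md_eq)

lemma htp_add:
 assumes X: "X: Ob (Ch A)" and Y: "Y: Ob (Ch A)" and f: "f: Arr (Ch A) X Y" and g: "g: Arr (Ch A) X Y"
  and f': "f': Arr (Ch A) X Y" and g': "g': Arr (Ch A) X Y" and 1: "htp X Y f g" and 2: "htp X Y f' g'"
 shows "htp X Y (f +[chain_mod A X Y] f') (g +[chain_mod A X Y] g')"
proof -
 obtain h h' where h: "!!n. h n: Arr A X$n Y$(n-1)" "!!n. f n = g n +[homm A X$n Y$n]
   (cmp A X$n Y$(n-1) Y$n (cd Y (n-1)) (h n) +[homm A X$n Y$n]
   cmp A X$n X$(n+1) Y$n (h (n+1)) (cd X n))"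
  "!!n. h' n: Arr A X$n Y$(n-1)" "!!n. f' n = g' n +[homm A X$n Y$n]
   (cmp A X$n Y$(n-1) Y$n (cd Y (n-1)) (h' n) +[homm A X$n Y$n]
   cmp A X$n X$(n+1) Y$n (h' (n+1)) (cd X n))"
  using 1 2 unfolding htp_def by blast
 note i = h(1,3) h(1)[of "n + 1" for n, simplified] h(3)[of "n + 1" for n, simplified]
 show ?thesis unfolding htp_def
  by (rule exI[of _ "%n. h n +[homm A X$n Y$(n-1)] h' n"])
    (simp add: h(2,4) i Ch_ob[OF X] Ch_ob[OF Y] Ch_arr[OF f] Ch_arr[OF g] Ch_arr[OF f'] Ch_arr[OF g'] md_ac)
qed

lemma htp_sm:
 assumes X: "X: Ob (Ch A)" and Y: "Y: Ob (Ch A)" and f: "f: Arr (Ch A) X Y" and g: "g: Arr (Ch A) X Y"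
  and 1: "htp X Y f g" and k: "k <: K"
 shows "htp X Y (k *[chain_mod A X Y] f) (k *[chain_mod A X Y] g)"
proof -
 obtain h where h: "!!n. h n: Arr A X$n Y$(n-1)" "!!n. f n = g n +[homm A X$n Y$n]
   (cmp A X$n Y$(n-1) Y$n (cd Y (n-1)) (h n) +[homm A X$n Y$n]
   cmp A X$n X$(n+1) Y$n (h (n+1)) (cd X n))"
  using 1 unfolding htp_def by blast
 note i = h(1) h(1)[of "n + 1" for n, simplified]
 show ?thesis unfolding htp_def
  by (rule exI[of _ "%n. k *[homm A X$n Y$(n-1)] h n"])
    (simp add: h(2) i Ch_ob[OF X] Ch_ob[OF Y] Ch_arr[OF f] Ch_arr[OF g] k mod_sadd)
qed

lemma htp_comp:
 assumes X: "X: Ob (Ch A)" and Y: "Y: Ob (Ch A)" and Z: "Z: Ob (Ch A)" and f: "f: Arr (Ch A) X Y" and g: "g: Arr (Ch A) X Y"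
  and 1: "htp X Y f g"
 shows htp_post: "k: Arr (Ch A) Y Z ==> htp X Z (cmp (Ch A) X Y Z k f) (cmp (Ch A) X Y Z k g)"
  and htp_pre: "j: Arr (Ch A) Z X ==> htp Z Y (cmp (Ch A) Z X Y f j) (cmp (Ch A) Z X Y g j)"
proof -
 obtain h where h: "!!n. h n: Arr A X$n Y$(n-1)" "!!n. f n = g n +[homm A X$n Y$n]
   (cmp A X$n Y$(n-1) Y$n (cd Y (n-1)) (h n) +[homm A X$n Y$n]
   cmp A X$n X$(n+1) Y$n (h (n+1)) (cd X n))"
  using 1 unfolding htp_def by blast
 note i = h(1) h(1)[of "n + 1" for n, simplified]
 note s = Ch_ob[OF X] Ch_ob[OF Y] Ch_ob[OF Z]
 show "htp X Z (cmp (Ch A) X Y Z k f) (cmp (Ch A) X Y Z k g)" if k: "k: Arr (Ch A) Y Z" unfolding htp_def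
  by (rule exI[of _ "%n. cmp A X$n Y$(n-1) Z$(n-1) (k (n-1)) (h n)"])
    (simp add: h(2) i s Ch_arr[OF g] ch_in[OF k] ch_comm2[OF k] Y Z)
 show "htp Z Y (cmp (Ch A) Z X Y f j) (cmp (Ch A) Z X Y g j)" if j: "j: Arr (Ch A) Z X" unfolding htp_def
  by (rule exI[of _ "%n. cmp A Z$n X$n Y$(n-1) (h n) (j n)"])
    (simp add: h(2) i s ch_in[OF g] ch_in[OF j] ch_comm[OF j] X Z)
qed

definition biprod where
 "biprod a b s i1 i2 p1 p2 \<longleftrightarrow> s: Ob A & i1: Arr A a s & i2: Arr A b s & p1: Arr A s a & p2: Arr A s b \<and>
   cmp A a s a p1 i1 = ide A a & cmp A b s b p2 i2 = ide A b \<and>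
   cmp A b s a p1 i2 = 0[homm A b a] & cmp A a s b p2 i1 = 0[homm A a b] \<and>
   cmp A s a s i1 p1 +[homm A s s] cmp A s b s i2 p2 = ide A s"

definition has_biprods where
 "has_biprods \<longleftrightarrow> (ALL a:Ob A. ALL b:Ob A. EX s i1 i2 p1 p2. biprod a b s i1 i2 p1 p2)"

lemma biprodD:
 assumes "biprod a b s i1 i2 p1 p2"
 shows "s: Ob A" "i1: Arr A a s" "i2: Arr A b s" "p1: Arr A s a" "p2: Arr A s b"
  and "cmp A a s a p1 i1 = ide A a" "cmp A b s b p2 i2 = ide A b"
   "cmp A b s a p1 i2 = 0[homm A b a]" "cmp A a s b p2 i1 = 0[homm A a b]"
   "cmp A s a s i1 p1 +[homm A s s] cmp A s b s i2 p2 = ide A s"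
 using assms unfolding biprod_def by auto

lemma biprod_nest:
 assumes B: "biprod a b s i1 i2 p1 p2" and o: "a: Ob A" "b: Ob A" "x: Ob A"
 shows "f: Arr A x a ==> cmp A x s a p1 (cmp A x a s i1 f) = f"
  "f: Arr A x b ==> cmp A x s b p2 (cmp A x b s i2 f) = f"
  "f: Arr A x b ==> cmp A x s a p1 (cmp A x b s i2 f) = 0[homm A x a]"
  "f: Arr A x a ==> cmp A x s b p2 (cmp A x a s i1 f) = 0[homm A x b]"
 using A_nest[OF o(3,1) biprodD(1)[OF B] o(1) _ biprodD(2,4,6)[OF B], of f] A_nest[OF o(3,2) biprodD(1)[OF B] o(2) _ biprodD(3,5,7)[OF B], of f]
  A_nest[OF o(3,2) biprodD(1)[OF B] o(1) _ biprodD(3,4,8)[OF B], of f] A_nest[OF o(3,1) biprodD(1)[OF B] o(2) _ biprodD(2,5,9)[OF B], of f] o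
 by simp_all

lemma biprod_sum:
 assumes B: "biprod a b s i1 i2 p1 p2" and o: "a: Ob A" "b: Ob A" "x: Ob A"
 shows "f: Arr A s x ==> cmp A s a x (cmp A a s x f i1) p1 +[homm A s x] cmp A s b x (cmp A b s x f i2) p2 = f"
  "f: Arr A x s ==> cmp A x a s i1 (cmp A x s a p1 f) +[homm A x s] cmp A x b s i2 (cmp A x s b p2 f) = f"
proof -
 note [simp] = o biprodD(1-5)[OF B]
 show "cmp A s a x (cmp A a s x f i1) p1 +[homm A s x] cmp A s b x (cmp A b s x f i2) p2 = f" if f: "f: Arr A s x"
  using f arg_cong[OF biprodD(10)[OF B], of "cmp A s s x f"] by simp
 show "cmp A x a s i1 (cmp A x s a p1 f) +[homm A x s] cmp A x b s i2 (cmp A x s b p2 f) = f" if f: "f: Arr A x s"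
  using f arg_cong[OF biprodD(10)[OF B], of "%g. cmp A x s s g f"] by simp
qed

lemma biprod_choice:
 assumes has_biprods "!!n. a n: Ob A" "!!n. b n: Ob A"
 obtains s i1 i2 p1 p2 where "!!n. biprod (a n) (b n) (s n) (i1 n) (i2 n) (p1 n) (p2 n)"
proof -
 have "ALL n. EX t. biprod (a n) (b n) (fst t) (fst (snd t)) (fst (snd (snd t))) (fst (snd (snd (snd t)))) (snd (snd (snd (snd t))))"
  using assms unfolding has_biprods_def by fastforce
 then obtain t where "!!n. biprod (a n) (b n) (fst (t n)) (fst (snd (t n))) (fst (snd (snd (t n)))) (fst (snd (snd (snd (t n))))) (snd (snd (snd (snd (t n)))))"
  by metis
 thus thesis by (rule that)
qed

lemma Ch_has_biprods:
 assumes has_biprods "X: Ob (Ch A)" "Y: Ob (Ch A)"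
 shows "EX Z i1 i2 p1 p2. kl.biprod (Ch A) X Y Z i1 i2 p1 p2"
proof -
 interpret C: kl K "Ch A" by unfold_locales (rule Ch_klinear)
 note [simp] = Ch_ob[OF assms(2)] Ch_ob[OF assms(3)]
 obtain s i1 i2 p1 p2 where B: "!!n. biprod X$n Y$n (s n) (i1 n) (i2 n) (p1 n) (p2 n)"
  by (rule biprod_choice[OF assms(1), of "cob X" "cob Y"], simp, simp, rule that, assumption)
 note [simp] = biprodD[OF B] biprod_nest[OF B]
 let ?d = "%n. cmp A (s n) X$n (s (n+1)) (cmp A X$n X$(n+1) (s (n+1)) (i1 (n+1)) (cd X n)) (p1 n) +[homm A (s n) (s (n+1))]
   cmp A (s n) Y$n (s (n+1)) (cmp A Y$n Y$(n+1) (s (n+1)) (i2 (n+1)) (cd Y n)) (p2 n)"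
 let ?Z = "\<lparr>cob = s, cd = ?d\<rparr>"
 have Z: "?Z: Ob (Ch A)"
  by (rule Ch_obI) (simp_all add: md_eq)
 have "i1: Arr (Ch A) X ?Z" "i2: Arr (Ch A) Y ?Z" "p1: Arr (Ch A) ?Z X" "p2: Arr (Ch A) ?Z Y"
  by (rule Ch_arrI; simp add: md_eq)+
 thus ?thesis using Z unfolding C.biprod_def by (intro exI[of _ ?Z] exI[of _ i1] exI[of _ i2] exI[of _ p1] exI[of _ p2]) (simp add: fun_eq_iff)
qed

text \<open>Z is the cone of the identity of X, with Z^n = X^(n+1) + X^n, and u is the inclusion of
  the second summand. The contraction shifts X^n from the second summand of Z^n to the first summand
  of Z^(n-1). A null-homotopy h of k is the same thing as an extension of k to Z, with h as its
  value on the first summand.\<close>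

lemma contractible_cone:
 assumes bp: has_biprods and X: "X: Ob (Ch A)"
 obtains Z u where "Z: Ob (Ch A)" "u: Arr (Ch A) X Z" "htp Z Z (ide (Ch A) Z) 0[chain_mod A Z Z]"
  "!!Y k. Y: Ob (Ch A) ==> k: Arr (Ch A) X Y ==> htp X Y k 0[chain_mod A X Y] ==> EX k':Arr (Ch A) Z Y. cmp (Ch A) X Z Y k' u = k"
proof -
 note [simp] = Ch_ob[OF X]
 obtain s i1 i2 p1 p2 where B: "!!n. biprod X$(n+1) X$n (s n) (i1 n) (i2 n) (p1 n) (p2 n)"
  by (rule biprod_choice[OF bp, of "%n. X$(n+1)" "cob X"], simp, simp, rule that, assumption)
 note B1 = B[of "n - 1" for n, simplified]
 note B2 = B[of "n + 1" for n, simplified add.assoc, simplified] and B3 = B[of "n + 2" for n, simplified add.assoc, simplified]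
 note [simp] = biprodD(1-9)[OF B] biprod_nest[OF B] biprodD(1-9)[OF B1] biprod_nest[OF B1] biprodD(1-9)[OF B2] biprod_nest[OF B2] biprodD(1-9)[OF B3] biprod_nest[OF B3]
 let ?d = "%n. -[homm A (s n) (s (n+1))] cmp A (s n) X$(n+1) (s (n+1)) (cmp A X$(n+1) X$(n + 2) (s (n+1)) (i1 (n+1)) (cd X (n+1))) (p1 n) +[homm A (s n) (s (n+1))]
   (cmp A (s n) X$(n+1) (s (n+1)) (i2 (n+1)) (p1 n) +[homm A (s n) (s (n+1))]
   cmp A (s n) X$n (s (n+1)) (cmp A X$n X$(n+1) (s (n+1)) (i2 (n+1)) (cd X n)) (p2 n))"
 let ?Z = "\<lparr>cob = s, cd = ?d\<rparr>"
 have Z: "?Z: Ob (Ch A)"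
  by (rule Ch_obI) (simp_all add: md_eq add.assoc)
 have i2: "i2: Arr (Ch A) X ?Z"
  by (rule Ch_arrI; simp add: md_eq)
 have c: "htp ?Z ?Z (ide (Ch A) ?Z) 0[chain_mod A ?Z ?Z]"
  unfolding htp_def
  by (rule exI[of _ "%n. cmp A (s n) X$n (s (n-1)) (i1 (n-1)) (p2 n)"])
    (simp add: md_eq md_ac add.commute[of "1::int"] flip: biprodD(10)[OF B])
 have e: "EX k':Arr (Ch A) ?Z Y. cmp (Ch A) X ?Z Y k' i2 = k"
  if Y: "Y: Ob (Ch A)" and k: "k: Arr (Ch A) X Y" and n: "htp X Y k 0[chain_mod A X Y]" for Y k
 proof -
  note [simp] = Ch_ob[OF Y] ch_in[OF k]
  obtain h where h: "!!n. h n: Arr A X$n Y$(n-1)" and kh0: "!!n. k n = 0[chain_mod A X Y] n +[homm A X$n Y$n]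
   (cmp A X$n Y$(n-1) Y$n (cd Y (n-1)) (h n) +[homm A X$n Y$n]
   cmp A X$n X$(n+1) Y$n (h (n+1)) (cd X n))"
   using n unfolding htp_def by blast
  note h1 = h[of "n + 1" for n, simplified]
  have kh: "k n = cmp A X$n Y$(n-1) Y$n (cd Y (n-1)) (h n) +[homm A X$n Y$n]
   cmp A X$n X$(n+1) Y$n (h (n+1)) (cd X n)" for n using kh0[of n] h[of n] h1[of n] by (simp add: md_eq)
  have h2': "h (n + 2): Arr A X$(n + 2) Y$(n+1)" for n using h[of "n + 2"] by (simp add: add.commute[of "1::int"])
  let ?k = "%n. cmp A (s n) X$(n+1) Y$n (h (n+1)) (p1 n) +[homm A (s n) Y$n] cmp A (s n) X$n Y$n (k n) (p2 n)"
  have "?k: Arr (Ch A) ?Z Y"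
  proof (rule Ch_arrI)
   fix n
   have kn: "k (n+1) = cmp A X$(n+1) Y$n Y$(n+1) (cd Y n) (h (n+1)) +[homm A X$(n+1) Y$(n+1)]
    cmp A X$(n+1) X$(n + 2) Y$(n+1) (h (n + 2)) (cd X (n+1))" using kh[of "n + 1"] by (simp add: add.assoc)
   have "cmp A (s n) Y$n Y$(n+1) (cd Y n) (?k n) = cmp A (s n) X$(n+1) Y$(n+1) (cmp A X$(n+1) Y$n Y$(n+1) (cd Y n) (h (n+1))) (p1 n)
     +[homm A (s n) Y$(n+1)] cmp A (s n) X$(n+1) Y$(n+1) (k (n+1)) (cmp A (s n) X$n X$(n+1) (cd X n) (p2 n))"
    using ch_comm2[OF k, of n n n "n + 1" "n + 1" "s n" "p2 n"] X Y by (simp add: h1)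
   also have "cmp A X$(n+1) Y$n Y$(n+1) (cd Y n) (h (n+1)) =
     k (n+1) +[homm A X$(n+1) Y$(n+1)] -[homm A X$(n+1) Y$(n+1)]
     cmp A X$(n+1) X$(n + 2) Y$(n+1) (h (n + 2)) (cd X (n+1))"
    by (simp add: kn h1 h2' md_eq md_ac)
   finally show "cmp A ?Z$n Y$n Y$(n+1) (cd Y n) (?k n) = cmp A ?Z$n ?Z$(n+1) Y$(n+1) (?k (n+1)) (cd ?Z n)"
    by (simp add: h2' md_eq md_ac add.assoc)
  qed (simp add: h1)
  moreover have "cmp (Ch A) X ?Z Y ?k i2 = k" by (simp add: h1 fun_eq_iff md_eq)
  ultimately show ?thesis by blast
 qed
 show thesis by (rule that[OF Z i2 c e])
qed

text \<open>Put S = X + Z with Z the contractible cone of X. The projection p1 to X is a homotopy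
  equivalence, hence inverted, so its two sections i1 and j = i1 + i2 u become equal. Since f - g is
  null-homotopic it extends to Z, and the map F on S given by g and this extension satisfies F i1 =
  g and F j = f. No calculus of fractions enters; the only demand on W is that it contains the
  homotopy equivalences.\<close>

lemma loc_htp:
 assumes bp: has_biprods and X: "X: Ob (Ch A)" and Y: "Y: Ob (Ch A)" and f: "f: Arr (Ch A) X Y" and g: "g: Arr (Ch A) X Y"
  and h: "htp X Y f g"
  and W: "!!X Y w v. X: Ob (Ch A) ==> Y: Ob (Ch A) ==> w: Arr (Ch A) X Y ==> v: Arr (Ch A) Y X ==>
   htp Y Y (ide (Ch A) Y) (cmp (Ch A) Y X Y w v) ==> htp X X (ide (Ch A) X) (cmp (Ch A) X Y X v w) ==> W X Y w"
 shows "loc_arr (Ch A) W X Y f = loc_arr (Ch A) W X Y g"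
proof -
 interpret C: kl K "Ch A" by unfold_locales (rule Ch_klinear)
 let ?H = "homm (Ch A)" and ?c = "cmp (Ch A)"
 obtain Z u where Z: "Z: Ob (Ch A)" "u: Arr (Ch A) X Z" "htp Z Z (ide (Ch A) Z) 0[?H Z Z]"
  and e: "!!Y k. Y: Ob (Ch A) ==> k: Arr (Ch A) X Y ==> htp X Y k 0[?H X Y] ==> EX k':Arr (Ch A) Z Y. ?c X Z Y k' u = k"
  using contractible_cone[OF bp X] unfolding Ch_sel(3) by metis
 obtain S i1 i2 p1 p2 where B: "C.biprod X Z S i1 i2 p1 p2" using Ch_has_biprods[OF bp X Z(1)] by blast
 note Bs = C.biprodD[OF B]
 note [simp del] = Ch_sel
 note [simp] = X Y f g Z(1,2) Bs(1-9) C.biprod_nest[OF B]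
 define k where "k = f +[?H X Y] -[?H X Y] g"
 have k: "k: Arr (Ch A) X Y" by (simp add: k_def)
 have "htp X Y (f +[?H X Y] (-[?H X Y] g)) (g +[?H X Y] (-[?H X Y] g))"
  unfolding Ch_sel(3) by (rule htp_add) (use htp_refl[OF X Y] C.A_cl(5) h Ch_sel(3) in auto)
 hence "htp X Y k 0[?H X Y]" by (simp add: k_def md_eq)
 then obtain k' where k': "k': Arr (Ch A) Z Y" "?c X Z Y k' u = k" using e[OF Y k] by blast
 note [simp] = k k'
 let ?L = "loc_arr (Ch A) W"
 define j where "j = i1 +[?H X S] ?c X Z S i2 u"
 define F where "F = ?c S X Y g p1 +[?H S Y] ?c S Z Y k' p2"
 have jF: "j: Arr (Ch A) X S" "F: Arr (Ch A) S Y" by (simp_all add: j_def F_def)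
 have 1: "?c X S Y F i1 = g" "?c X S Y F j = f" "?c X S X p1 i1 = ide (Ch A) X" "?c X S X p1 j = ide (Ch A) X"
  by (simp_all add: F_def j_def md_eq) (simp add: k_def md_eq md_ac)
 \<comment> \<open>The identity of S is i1 p1 + i2 p2, and the second summand is null-homotopic
   because it factors through the contractible Z.\<close>
 have hz: "htp S S (ide (Ch A) S) (?c S X S i1 p1)"
 proof -
  have "htp S S (?c S Z S i2 (?c S Z Z (ide (Ch A) Z) p2)) (?c S Z S i2 (?c S Z Z 0[?H Z Z] p2))"
   by (rule htp_post, (simp; fail)+, rule htp_pre) (use Z Bs in auto)
  from htp_add[OF _ _ _ _ _ _ htp_refl[of S S "?c S X S i1 p1"] this, folded Ch_sel(3)] show ?thesis using Bs(10) by (simp add: md_eq)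
 qed
 have "W S X p1" by (rule W[OF _ _ _ Bs(2)]) (use hz htp_refl[OF X X] in "auto simp: C.A_cl")
 hence w: "is_iso (loc_cat (Ch A) W) S X (?L S X p1)" by (intro loc_iso C.A_cat) auto
 have lc: "category (loc_cat (Ch A) W)" by (rule loc_category[OF C.A_cat])
 obtain q where q: "q: Arr (loc_cat (Ch A) W) X S" "cmp (loc_cat (Ch A) W) S X S q (?L S X p1) = ide (loc_cat (Ch A) W) S"
  using w unfolding is_iso_def inverse_arrows_def by blast
 have in1: "?L S X p1: Arr (loc_cat (Ch A) W) S X" "?L X S i1: Arr (loc_cat (Ch A) W) X S" "?L X S j: Arr (loc_cat (Ch A) W) X S"
  using jF by (auto intro!: loc_arr_in)
 have "?L X S i = q" if "?c X S X p1 i = ide (Ch A) X" "i: Arr (Ch A) X S" for i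
 proof -
  have i: "?L X S i: Arr (loc_cat (Ch A) W) X S" by (intro loc_arr_in) (use that in auto)
  have "cmp (loc_cat (Ch A) W) X S S (cmp (loc_cat (Ch A) W) S X S q (?L S X p1)) (?L X S i) =
    cmp (loc_cat (Ch A) W) X X S q (cmp (loc_cat (Ch A) W) X S X (?L S X p1) (?L X S i))"
   by (rule cat_assoc[OF lc]) (use q(1) in1 i in auto)
  also have "cmp (loc_cat (Ch A) W) X S X (?L S X p1) (?L X S i) = ide (loc_cat (Ch A) W) X"
   using that by (subst loc_arr_cmp[OF C.A_cat]) (auto simp: loc_arr_ide[OF C.A_cat])
  finally show ?thesis using q i cat_idl[OF lc _ _ i] cat_idr[OF lc _ _ q(1)] by simp
 qed
 hence "?L X S j = ?L X S i1" using 1 jF by simp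
 hence "cmp (loc_cat (Ch A) W) X S Y (?L S Y F) (?L X S j) = cmp (loc_cat (Ch A) W) X S Y (?L S Y F) (?L X S i1)" by simp
 thus ?thesis using jF 1 by (simp add: loc_arr_cmp[OF C.A_cat])
qed

end

subsection \<open>The Hom complex\<close>

context kl
begin

lemma hom_mod_sel[simp]:
 "f <: (hom_mod A X Y n) \<longleftrightarrow> (ALL i. f i: Arr A X$i Y$(i + n))"
 "0[hom_mod A X Y n] = (%i. 0[homm A X$i Y$(i + n)])"
 "f +[hom_mod A X Y n] g = (%i. f i +[homm A X$i Y$(i + n)] g i)"
 "c *[hom_mod A X Y n] f = (%i. c *[homm A X$i Y$(i + n)] f i)"
 by (simp_all add: hom_mod_def)

lemma hom_in: "f <: (hom_mod A X Y n) ==> a = i ==> b = i + n ==> f i: Arr A X$a Y$b"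
 by simp

lemma module_hom_mod:
 assumes X: "X: Ob (Ch A)" and Y: "Y: Ob (Ch A)"
 shows "module K (hom_mod A X Y n)"
 by (rule mod_inj[where I=UNIV and ro="%i f. f i" and M="%i. homm A X$i Y$(i + n)"])
   (auto simp: fun_eq_iff Ch_ob[OF X] Ch_ob[OF Y])

lemma hom_mod_neg:
 assumes X: "X: Ob (Ch A)" and Y: "Y: Ob (Ch A)" and f: "f <: (hom_mod A X Y n)"
 shows "-[hom_mod A X Y n] f = (%i. -[homm A X$i Y$(i + n)] f i)"
 using f by (simp add: mod_neg_smult[OF module_hom_mod[OF X Y]] mod_neg_smult Ch_ob[OF X] Ch_ob[OF Y])

text \<open>The differential of \<open>hom_cx\<close> freed from its restriction to the carrier, so
  that it can be rewritten at a single index.\<close>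

definition dh where
 "dh X Y n f = (%i. cmp A X$i Y$(i + n) Y$(i + (n+1)) (cd Y (i + n)) (f i)
     -[homm A X$i Y$(i + (n+1))]
    signed (homm A X$i Y$(i + (n+1))) n
     (cmp A X$i X$(i+1) Y$(i + (n+1)) (f (i+1)) (cd X i)))"

lemma hom_cx_sel[simp]: "(hom_cx A X Y)$n = hom_mod A X Y n"
 "f <: (hom_mod A X Y n) ==> cd (hom_cx A X Y) n f = dh X Y n f"
 by (simp_all add: hom_cx_def dh_def)

lemma sgn_cl[simp]: "a: Ob A ==> b: Ob A ==> f: Arr A a b ==> signed (homm A a b) n f: Arr A a b"
 by (simp add: signed_def)

lemma dh_in:
 assumes X: "X: Ob (Ch A)" and Y: "Y: Ob (Ch A)" and f: "f <: (hom_mod A X Y n)"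
 shows "dh X Y n f <: (hom_mod A X Y (n+1))"
 by (auto simp: dh_def mod_minus Ch_ob[OF X] Ch_ob[OF Y] hom_in[OF f] intro!: A_cl sgn_cl)

lemma dh_lin:
 assumes X: "X: Ob (Ch A)" and Y: "Y: Ob (Ch A)"
 shows "cd (hom_cx A X Y) n: lin K (hom_mod A X Y n) (hom_mod A X Y (n+1))"
proof (rule linI)
 note [simp] = Ch_ob[OF X] Ch_ob[OF Y]
 note s = module_hom_mod[OF X Y]
 have [simp]: "i+1 + n = i + n + 1" "i + (n+1) = i + n + 1" for i by auto
 fix f assume f: "f <: (hom_mod A X Y n)"
 note [simp] = hom_in[OF f]
 show "cd (hom_cx A X Y) n f <: (hom_mod A X Y (n+1))" using f dh_in[OF X Y f] by (simp del: hom_mod_sel)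
 { fix c assume c: "c <: K"
  have "c *[hom_mod A X Y n] f <: (hom_mod A X Y n)" using mod_sm[OF s c f] .
  thus "cd (hom_cx A X Y) n (c *[hom_mod A X Y n] f) = c *[hom_mod A X Y (n+1)] cd (hom_cx A X Y) n f"
   using f by (simp only: hom_cx_sel) (simp add: c dh_def fun_eq_iff mod_minus signed_def mod_sadd mod_sneg) }
 fix g assume g: "g <: (hom_mod A X Y n)"
 note [simp] = hom_in[OF g]
 have "f +[hom_mod A X Y n] g <: (hom_mod A X Y n)" using mod_add[OF s f g] .
 thus "cd (hom_cx A X Y) n (f +[hom_mod A X Y n] g) = cd (hom_cx A X Y) n f +[hom_mod A X Y (n+1)] cd (hom_cx A X Y) n g"
  using f g by (simp only: hom_cx_sel) (simp add: dh_def fun_eq_iff mod_minus signed_def md_eq md_ac)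
qed (auto simp: hom_cx_def)

lemma dh_dh:
 assumes X: "X: Ob (Ch A)" and Y: "Y: Ob (Ch A)" and f: "f <: (hom_mod A X Y n)"
 shows "dh X Y (n+1) (dh X Y n f) = (%i. 0[homm A X$i Y$(i + (n+1+1))])"
proof
 fix i
 note [simp] = Ch_ob[OF X] Ch_ob[OF Y] hom_in[OF f]
 have [simp]: "i+1 + n = i + n + 1" "i+1 + (n+1) = i + n + 2" "i + (n+1) = i + n + 1" "i + (n + 2) = i + n + 2"
  "n+1+1 = n + 2" "i + (n+1)+1 = i + n + 2" "i+1+1 = i + 2" "i + n+1+1 = i + n + 2" "2 + (i + n) = i + n + 2" "2 + i = i + 2" by auto
 show "dh X Y (n+1) (dh X Y n f) i = 0[homm A X$i Y$(i + (n+1+1))]"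
  by (cases "even n"; simp add: dh_def mod_minus signed_def md_eq)
qed

lemma hom_cx_ob:
 assumes X: "X: Ob (Ch A)" and Y: "Y: Ob (Ch A)"
 shows "hom_cx A X Y: Ob CK"
proof -
 interpret Kc: kl K "kmod K" by unfold_locales (rule kmod_klinear)
 show ?thesis
 proof (rule Kc.Ch_obI)
  fix n
  show "(hom_cx A X Y)$n: Ob (kmod K)" by (simp add: module_hom_mod[OF X Y])
  show "cd (hom_cx A X Y) n: Arr (kmod K) (hom_cx A X Y)$n (hom_cx A X Y)$(n+1)"
   using dh_lin[OF X Y] by simp
  have "compose (carrier (hom_mod A X Y n)) (cd (hom_cx A X Y) (n+1)) (cd (hom_cx A X Y) n) = 0[lin_mod K (hom_mod A X Y n) (hom_mod A X Y (n+1+1))]"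
   using dh_dh[OF X Y, of _ n] dh_in[OF X Y, of _ n] by (auto simp: compose_def lin_mod_def fun_eq_iff simp del: hom_mod_sel(1))
  thus "cmp (kmod K) (hom_cx A X Y)$n (hom_cx A X Y)$(n+1) (hom_cx A X Y)$(n+1+1) (cd (hom_cx A X Y) (n+1)) (cd (hom_cx A X Y) n) =
    0[homm (kmod K) (hom_cx A X Y)$n (hom_cx A X Y)$(n+1+1)]" by simp
 qed
qed

end

section \<open>Complexes of modules, described elementwise\<close>

lemma (in gf) Ch_kmod_arrI:
 assumes "!!n. f n: lin K X$n Y$n"
  "!!n x. x <: X$n ==> cd Y n (f n x) = f (n+1) (cd X n x)"
 shows "f: Arr CK X Y"
proof -
 interpret Kc: kl K "kmod K" by unfold_locales (rule kmod_klinear)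
 show ?thesis by (rule Kc.Ch_arrI) (simp_all add: assms(1) compose_def restrict_def assms(2) cong: if_cong)
qed

lemma (in gf) Ch_kmod_arr:
 assumes "f: Arr CK X Y"
 shows ck_lin: "f n: lin K X$n Y$n"
  and ck_comm: "x <: X$n ==> cd Y n (f n x) = f (n+1) (cd X n x)"
  and ck_cl: "x <: X$n ==> f n x <: Y$n"
proof -
 interpret Kc: kl K "kmod K" by unfold_locales (rule kmod_klinear)
 show 1: "f n: lin K X$n Y$n" using Kc.ch_in[OF assms, of n n n] by simp
 show "x <: X$n ==> cd Y n (f n x) = f (n+1) (cd X n x)"
  using fun_cong[OF Kc.ch_comm[OF assms, of n n n "n + 1" "n + 1"], of x] by (simp add: compose_def)
 show "x <: X$n ==> f n x <: Y$n" by (rule lin_cl[OF 1])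
qed

lemma (in gf) Ch_kmod_ob:
 assumes X: "X: Ob CK"
 shows ck_mod: "module K X$n"
  and ck_d: "cd X n: lin K X$n X$(n+1)"
  and ck_dd: "x <: X$n ==> cd X (n+1) (cd X n x) = 0[X$(n+1+1)]"
  and ck_dcl: "x <: X$n ==> cd X n x <: X$(n+1)"
proof -
 interpret Kc: kl K "kmod K" by unfold_locales (rule kmod_klinear)
 show "module K X$n" "cd X n: lin K X$n X$(n+1)"
  using Kc.ch_ob[OF X] Kc.ch_d[OF X, of n n "n + 1"] by simp_all
 thus "x <: X$n ==> cd X n x <: X$(n+1)" using lin_cl[of "cd X n"] by blast
 show "x <: X$n ==> cd X (n+1) (cd X n x) = 0[X$(n+1+1)]"
  using fun_cong[OF Kc.ch_dd[OF X, of n n "n + 1" "n + 1" "n + 2"], of x] by (simp add: compose_def lin_mod_def add.assoc)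
qed

lemma (in gf) Ch_kmod_obI:
 assumes "!!n. module K X$n" and d: "!!n. cd X n: lin K X$n X$(n+1)"
  and dd: "!!n x. x <: X$n ==> cd X (n+1) (cd X n x) = 0[X$(n+1+1)]"
 shows "X: Ob CK"
proof -
 interpret Kc: kl K "kmod K" by unfold_locales (rule kmod_klinear)
 show ?thesis
 proof (rule Kc.Ch_obI)
  fix n
  show "X$n: Ob (kmod K)" "cd X n: Arr (kmod K) X$n X$(n+1)" using assms(1) d by simp_all
  have "compose (carrier X$n) (cd X (n+1)) (cd X n) = 0[lin_mod K X$n X$(n+1+1)]"
   using dd[of _ n] by (auto simp: compose_def lin_mod_def fun_eq_iff)
  thus "cmp (kmod K) X$n X$(n+1) X$(n+1+1) (cd X (n+1)) (cd X n) = 0[homm (kmod K) X$n X$(n+1+1)]"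
   by simp
 qed
qed

lemma (in gf) Ch_kmod_ext:
 assumes "f: Arr CK X Y" "g: Arr CK X Y" "!!n x. x <: X$n ==> f n x = g n x"
 shows "f = g"
 by (rule ext) (rule lin_ext[OF ck_lin[OF assms(1)] ck_lin[OF assms(2)] assms(3)])

lemma (in gf) Ch_kmod_cmp[simp]: "cmp CK X Y Z g f n = compose (carrier X$n) (g n) (f n)"
  "ide CK X n = (\<lambda>x\<in>carrier X$n. x)"
 by (simp_all add: Ch_def)

lemma (in gf) Ch_kmod_cat: "category CK"
proof -
 interpret Kc: kl K "kmod K" by unfold_locales (rule kmod_klinear)
 show ?thesis by (rule kl_cat[OF Kc.Ch_klinear])
qed

context kl
begin

lemma hom_fnc_sel[simp]: "om (hom_cx_fnc A X) = hom_cx A X"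
 "f <: (hom_mod A X Y n) ==> mm (hom_cx_fnc A X) Y Z g n f = (%i. cmp A X$i Y$(i + n) Z$(i + n) (g (i + n)) (f i))"
 by (simp_all add: hom_cx_fnc_def)

lemma hom_fnc_arr:
 assumes X: "X: Ob (Ch A)" and Y: "Y: Ob (Ch A)" and Z: "Z: Ob (Ch A)" and g: "g: Arr (Ch A) Y Z"
 shows "mm (hom_cx_fnc A X) Y Z g: Arr CK (hom_cx A X Y) (hom_cx A X Z)"
proof (rule Ch_kmod_arrI)
 note [simp] = Ch_ob[OF X] Ch_ob[OF Y] Ch_ob[OF Z] ch_in[OF g]
 show "mm (hom_cx_fnc A X) Y Z g n: lin K (hom_cx A X Y)$n (hom_cx A X Z)$n" for n
  by (rule linI) (auto simp: hom_cx_fnc_def)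
 fix n f assume "f <: (hom_cx A X Y)$n"
 hence f: "f <: (hom_mod A X Y n)" by simp
 note [simp] = hom_in[OF f]
 have gf: "(%i. cmp A X$i Y$(i + n) Z$(i + n) (g (i + n)) (f i)) <: (hom_mod A X Z n)" by simp
 have "dh X Z n (%i. cmp A X$i Y$(i + n) Z$(i + n) (g (i + n)) (f i)) i =
   cmp A X$i Y$(i + (n+1)) Z$(i + (n+1)) (g (i + (n+1))) (dh X Y n f i)" for i
 proof -
  have [simp]: "i+1 + n = i + n + 1" "i + (n+1) = i + n + 1" by auto
  show ?thesis using ch_comm2[OF g, of "i + n" "i + n" "i + n" "i + n + 1" "i + n + 1" "X$i" "f i"] Y Z
   by (cases "even n"; simp add: dh_def mod_minus signed_def)
 qed
 from ext[OF this] show "cd (hom_cx A X Z) n (mm (hom_cx_fnc A X) Y Z g n f) = mm (hom_cx_fnc A X) Y Z g (n+1) (cd (hom_cx A X Y) n f)"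
  using f gf dh_in[OF X Y f] by (simp del: hom_mod_sel)
qed

lemma hom_fnc_functor:
 assumes X: "X: Ob (Ch A)"
 shows "is_functor (Ch A) CK (hom_cx_fnc A X)"
 unfolding is_functor_def hom_fnc_sel
proof (intro conjI ballI)
 show "category (Ch A)" by (rule kl_cat[OF Ch_klinear])
 hence c: "category (Ch A)" .
 show k: "category CK" by (rule Ch_kmod_cat)
 fix Y assume Y: "Y: Ob (Ch A)"
 show h: "hom_cx A X Y: Ob CK" by (rule hom_cx_ob[OF X Y])
 show "mm (hom_cx_fnc A X) Y Y (ide (Ch A) Y) = ide CK (hom_cx A X Y)"
  by (rule Ch_kmod_ext[OF hom_fnc_arr[OF X Y Y] cat_ide[OF k h]]) (use c Y in \<open>auto simp: cat_ide Ch_ob[OF X] Ch_ob[OF Y] simp del: Ch_sel(1)\<close>,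
    auto simp: Ch_ob[OF X] Ch_ob[OF Y])
 fix Z f assume Z: "Z: Ob (Ch A)" and f: "f: Arr (Ch A) Y Z"
 show "mm (hom_cx_fnc A X) Y Z f: Arr CK (hom_cx A X Y) (hom_cx A X Z)" by (rule hom_fnc_arr[OF X Y Z f])
 fix V g assume V: "V: Ob (Ch A)" and g: "g: Arr (Ch A) Z V"
 show "mm (hom_cx_fnc A X) Y V (cmp (Ch A) Y Z V g f) = cmp CK (hom_cx A X Y) (hom_cx A X Z) (hom_cx A X V)
   (mm (hom_cx_fnc A X) Z V g) (mm (hom_cx_fnc A X) Y Z f)"
 proof (rule Ch_kmod_ext[OF hom_fnc_arr[OF X Y V] cat_cmp[OF k]])
  fix n x assume "x <: (hom_cx A X Y)$n"
  thus "mm (hom_cx_fnc A X) Y V (cmp (Ch A) Y Z V g f) n x = cmp CK (hom_cx A X Y) (hom_cx A X Z) (hom_cx A X V)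
   (mm (hom_cx_fnc A X) Z V g) (mm (hom_cx_fnc A X) Y Z f) n x"
   by (simp add: compose_def Ch_ob[OF X] Ch_ob[OF Y] Ch_ob[OF Z] Ch_ob[OF V] ch_in[OF f] ch_in[OF g])
 qed (use hom_cx_ob hom_fnc_arr X Y Z V f g cat_cmp[OF c] in auto)
qed

lemma precomp_sel: "f <: (hom_mod A X Y n) ==>
  hom_cx_precomp A X' X Y p n f = (%i. cmp A X'$i X$i Y$(i + n) (f i) (p i))"
 by (simp add: hom_cx_precomp_def)

lemma precomp_arr:
 assumes X: "X: Ob (Ch A)" and X': "X': Ob (Ch A)" and Y: "Y: Ob (Ch A)" and p: "p: Arr (Ch A) X' X"
 shows "hom_cx_precomp A X' X Y p: Arr CK (hom_cx A X Y) (hom_cx A X' Y)"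
proof (rule Ch_kmod_arrI)
 note [simp] = Ch_ob[OF X] Ch_ob[OF Y] Ch_ob[OF X'] ch_in[OF p]
 show "hom_cx_precomp A X' X Y p n: lin K (hom_cx A X Y)$n (hom_cx A X' Y)$n" for n
  by (rule linI) (auto simp: hom_cx_precomp_def)
 fix n f assume "f <: (hom_cx A X Y)$n"
 hence f: "f <: (hom_mod A X Y n)" by simp
 note [simp] = hom_in[OF f]
 have gf: "(%i. cmp A X'$i X$i Y$(i + n) (f i) (p i)) <: (hom_mod A X' Y n)" by simp
 have "dh X' Y n (%i. cmp A X'$i X$i Y$(i + n) (f i) (p i)) i =
   cmp A X'$i X$i Y$(i + (n+1)) (dh X Y n f i) (p i)" for i
 proof -
  have [simp]: "i+1 + n = i + n + 1" "i + (n+1) = i + n + 1" by auto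
  show ?thesis using ch_comm[OF p, of i i i "i + 1" "i + 1"]
   by (cases "even n"; simp add: dh_def mod_minus signed_def)
 qed
 from ext[OF this] show "cd (hom_cx A X' Y) n (hom_cx_precomp A X' X Y p n f) = hom_cx_precomp A X' X Y p (n+1) (cd (hom_cx A X Y) n f)"
  using f gf dh_in[OF X Y f] by (simp add: precomp_sel del: hom_mod_sel)
qed

lemma precomp_ide:
 assumes X: "X: Ob (Ch A)" and Y: "Y: Ob (Ch A)"
 shows "hom_cx_precomp A X X Y (ide (Ch A) X) = ide CK (hom_cx A X Y)"
 by (rule Ch_kmod_ext[OF precomp_arr[OF X X Y cat_ide[OF kl_cat[OF Ch_klinear]]] cat_ide[OF Ch_kmod_cat]])
   (auto simp: hom_cx_ob X Y precomp_sel Ch_ob[OF X] Ch_ob[OF Y])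

lemma precomp_cmp:
 assumes X: "X: Ob (Ch A)" and X': "X': Ob (Ch A)" and X'': "X'': Ob (Ch A)" and Y: "Y: Ob (Ch A)" and p: "p: Arr (Ch A) X' X"
  and q: "q: Arr (Ch A) X'' X'"
 shows "hom_cx_precomp A X'' X Y (cmp (Ch A) X'' X' X p q) =
  cmp CK (hom_cx A X Y) (hom_cx A X' Y) (hom_cx A X'' Y) (hom_cx_precomp A X'' X' Y q) (hom_cx_precomp A X' X Y p)"
 by (rule Ch_kmod_ext[OF precomp_arr[OF X X'' Y cat_cmp[OF kl_cat[OF Ch_klinear] X'' X' X q p]]
    cat_cmp[OF Ch_kmod_cat _ _ _ precomp_arr[OF X X' Y p] precomp_arr[OF X' X'' Y q]]])
  (auto simp: hom_cx_ob X X' X'' Y precomp_sel compose_def Ch_ob[OF X] Ch_ob[OF Y] Ch_ob[OF X'] Ch_ob[OF X''] ch_in[OF p] ch_in[OF q])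

lemma precomp_natural:
 assumes X: "X: Ob (Ch A)" and X': "X': Ob (Ch A)" and Y: "Y: Ob (Ch A)" and Z: "Z: Ob (Ch A)" and p: "p: Arr (Ch A) X' X"
  and g: "g: Arr (Ch A) Y Z"
 shows "cmp CK (hom_cx A X Y) (hom_cx A X Z) (hom_cx A X' Z) (hom_cx_precomp A X' X Z p) (mm (hom_cx_fnc A X) Y Z g) =
   cmp CK (hom_cx A X Y) (hom_cx A X' Y) (hom_cx A X' Z) (mm (hom_cx_fnc A X') Y Z g) (hom_cx_precomp A X' X Y p)"
 by (rule Ch_kmod_ext[OF cat_cmp[OF Ch_kmod_cat _ _ _ hom_fnc_arr[OF X Y Z g] precomp_arr[OF X X' Z p]]
    cat_cmp[OF Ch_kmod_cat _ _ _ precomp_arr[OF X X' Y p] hom_fnc_arr[OF X' Y Z g]]])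
  (auto simp: hom_cx_ob X X' Y Z precomp_sel compose_def Ch_ob[OF X] Ch_ob[OF Y] Ch_ob[OF X'] Ch_ob[OF Z] ch_in[OF p] ch_in[OF g])

lemma precomp_htp:
 assumes X: "X: Ob (Ch A)" and X': "X': Ob (Ch A)" and Y: "Y: Ob (Ch A)" and p: "p: Arr (Ch A) X' X" and q: "q: Arr (Ch A) X' X"
  and h: "htp X' X p q"
 shows "kl.htp (kmod K) (hom_cx A X Y) (hom_cx A X' Y) (hom_cx_precomp A X' X Y p) (hom_cx_precomp A X' X Y q)"
proof -
 interpret Kc: kl K "kmod K" by unfold_locales (rule kmod_klinear)
 note [simp] = Ch_ob[OF X] Ch_ob[OF Y] Ch_ob[OF X'] ch_in[OF p] ch_in[OF q]
 obtain h where h: "!!n. h n: Arr A X'$n X$(n-1)" and ph: "!!n. p n = q n +[homm A X'$n X$n]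
   (cmp A X'$n X$(n-1) X$n (cd X (n-1)) (h n) +[homm A X'$n X$n]
   cmp A X'$n X'$(n+1) X$n (h (n+1)) (cd X' n))"
  using h unfolding htp_def by blast
 have [simp]: "b = i-1 ==> h i: Arr A X'$i X$b" for i b using h by simp
 \<comment> \<open>A homotopy h acts by f |-> f h up to a sign. The sign (-1)^n is chosen against
   the one in the differential of the Hom complex: with it the mixed terms d f h cancel, without it
   they would add up.\<close>
 define k where "k = (%n. \<lambda>f\<in>carrier (hom_mod A X Y n). %i. signed (homm A X'$i Y$(i + (n-1))) n
  (cmp A X'$i X$(i-1) Y$(i + (n-1)) (f (i-1)) (h i)))"
 have [simp]: "i + (n-1) = i + n - 1" "i-1 + n = i + n - 1" for i n :: int by auto
 have kl: "k n: lin K (hom_mod A X Y n) (hom_mod A X' Y (n-1))" for n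
 proof (rule linI)
  fix f assume f: "f <: (hom_mod A X Y n)"
  note [simp] = hom_in[OF f]
  show "k n f <: (hom_mod A X' Y (n-1))" using f by (auto simp: k_def intro!: sgn_cl)
  show "k n (c *[hom_mod A X Y n] f) = c *[hom_mod A X' Y (n-1)] k n f" if "c <: K" for c
   using that by (simp add: k_def fun_eq_iff signed_def mod_sneg)
  fix g assume g: "g <: (hom_mod A X Y n)"
  note [simp] = hom_in[OF g]
  show "k n (f +[hom_mod A X Y n] g) = k n f +[hom_mod A X' Y (n-1)] k n g"
   by (simp add: k_def fun_eq_iff signed_def md_eq)
 qed (auto simp: k_def)
 have eq: "hom_cx_precomp A X' X Y p n f = hom_cx_precomp A X' X Y q n f +[hom_mod A X' Y n]
   (cd (hom_cx A X' Y) (n-1) (k n f) +[hom_mod A X' Y n] k (n+1) (cd (hom_cx A X Y) n f))"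
  if f: "f <: (hom_mod A X Y n)" for n f
 proof
  fix i
  note [simp] = hom_in[OF f]
  have kf: "k n f <: (hom_mod A X' Y (n-1))" using lin_cl[OF kl f] .
  have [simp]: "i + (n-1) = i + n - 1" "i+1 + (n-1) = i + n" "i-1 + n = i + n - 1" "i-1 + (n+1) = i + n" "i + (1 + n-1) = i + n"
   by auto
  have "cmp A X'$i X$i Y$(i + n) (f i) (p i) = cmp A X'$i X$i Y$(i + n) (f i) (q i) +[homm A X'$i Y$(i + n)]
   (dh X' Y (n-1) (%i. signed (homm A X'$i Y$(i + (n-1))) n
  (cmp A X'$i X$(i-1) Y$(i + (n-1)) (f (i-1)) (h i))) i +[homm A X'$i Y$(i + n)]
   signed (homm A X'$i Y$(i + n)) (n+1) (cmp A X'$i X$(i-1) Y$(i + n) (dh X Y n f (i-1)) (h i)))"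
   unfolding ph by (cases "even n"; simp add: dh_def mod_minus signed_def md_eq md_ac)
  thus "hom_cx_precomp A X' X Y p n f i = (hom_cx_precomp A X' X Y q n f +[hom_mod A X' Y n]
   (cd (hom_cx A X' Y) (n-1) (k n f) +[hom_mod A X' Y n] k (n+1) (cd (hom_cx A X Y) n f))) i"
   using f kf dh_in[OF X Y f] by (simp add: precomp_sel k_def del: hom_mod_sel(1))
 qed
 show ?thesis unfolding Kc.htp_def
  apply (rule exI[of _ k])
  using kl eq kl[of "n + 1" for n, simplified]
   dh_lin[OF X Y] dh_lin[OF X' Y, of "n - 1" for n, simplified] precomp_arr[OF X X' Y p]
  apply (auto simp: lin_mod_def compose_def fun_eq_iff hom_cx_precomp_def simp del: hom_mod_sel hom_cx_sel(2))
  done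
qed

end

context gf
begin

lemma mod_conj: "module K M ==> x <: M ==> y <: M ==> x +[M] (y +[M] -[M] x) = y"
 by (simp add: mod_comm[of M y] md_cl mod_nr2)

subsection \<open>Quasi-isomorphisms of complexes of modules\<close>

text \<open>Acyclicity of the mapping cone of \<open>f\<close>, up to signs.\<close>

definition cone_acyclic where
 "cone_acyclic X Y f \<longleftrightarrow> (ALL n. ALL y:carrier X$(n+1). ALL y':carrier Y$n.
   cd X (n+1) y = 0[X$(n+1+1)] & f (n+1) y = cd Y n y' \<longrightarrow>
   (EX z:carrier X$n. EX z':carrier Y$(n-1). cd X n z = y & y' = f n z +[Y$n] cd Y (n-1) z'))"

lemma coh_class_eq:
 assumes X: "X: Ob CK" and z: "z <: X$n" "z' <: X$n"
 shows "coh_class X n z = coh_class X n z' \<longleftrightarrow> (EX y:carrier X$(n-1). z = z' +[X$n] cd X (n-1) y)"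
proof -
 note m = ck_mod[OF X] and d = ck_dcl[OF X, of _ "n - 1", simplified]
 note l = ck_d[OF X, of "n - 1", simplified]
 have sub: "coh_class X n z <= coh_class X n z'" if "y <: X$(n-1)" "z = z' +[X$n] cd X (n-1) y"
  "z' <: X$n" for y z z'
 proof
  fix u assume "u: coh_class X n z"
  then obtain w where w: "w <: X$(n-1)" "u = z +[X$n] cd X (n-1) w" by (auto simp: coh_class_def)
  hence "u = z' +[X$n] cd X (n-1) (y +[X$(n-1)] w)"
   using that d[OF w(1)] d[OF that(1)] by (simp add: lin_add[OF l] mod_assoc[OF m])
  thus "u: coh_class X n z'" using that w mod_add[OF m] by (auto simp: coh_class_def)
 qed
 show ?thesis
 proof
  assume e: "coh_class X n z = coh_class X n z'"
  have "z: coh_class X n z" unfolding coh_class_def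
   using lin_0[OF m m l] mod_zero[OF m] mod_0r[OF m[of n] z(1)] by (metis (mono_tags, lifting) mem_Collect_eq)
  thus "EX y:carrier X$(n-1). z = z' +[X$n] cd X (n-1) y" unfolding e by (auto simp: coh_class_def)
 next
  assume "EX y:carrier X$(n-1). z = z' +[X$n] cd X (n-1) y"
  then obtain y where y: "y <: X$(n-1)" "z = z' +[X$n] cd X (n-1) y" by blast
  have "z' = z +[X$n] cd X (n-1) (-[X$(n-1)] y)"
   using y z lin_neg[OF m m l y(1)] d[OF y(1)] by (simp add: md_eq[OF m] mod_assoc[OF m] md_cl[OF m])
  thus "coh_class X n z = coh_class X n z'" using sub[OF y z(2)] sub[OF mod_neg[OF m y(1)] _ z(1), of z'] by blast
 qed
qed

lemma coh_classI:
 assumes "X: Ob CK" "z' <: X$n" "y <: X$(n-1)" "z = z' +[X$n] cd X (n-1) y"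
 shows "coh_class X n z = coh_class X n z'"
proof -
 have "z <: X$n" using assms mod_add[OF ck_mod] ck_dcl[of X y "n - 1"] by simp
 thus ?thesis using assms by (subst coh_class_eq) auto
qed

lemma coh_map_class:
 assumes X: "X: Ob CK" and Y: "Y: Ob CK" and f: "f: Arr CK X Y" and z: "z <: X$n"
 shows "coh_map Y f n (coh_class X n z) = coh_class Y n (f n z)"
proof -
 note m = ck_mod[OF X] and d = ck_dcl[OF X, of _ "n - 1", simplified]
 note l = ck_d[OF X, of "n - 1", simplified]
 have "coh_class Y n (f n (z +[X$n] cd X (n-1) y)) = coh_class Y n (f n z)" if y: "y <: X$(n-1)" for y
 proof -
  have "f n (z +[X$n] cd X (n-1) y) = f n z +[Y$n] cd Y (n-1) (f (n-1) y)"
   using lin_add[OF ck_lin[OF f] z d[OF y]] ck_comm[OF f y] by simp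
  thus ?thesis by (rule coh_classI[OF Y ck_cl[OF f z] ck_cl[OF f y]])
 qed
 moreover have "0[X$(n-1)] <: X$(n-1)" using mod_zero[OF m] .
 ultimately show ?thesis unfolding coh_map_def by (auto simp: coh_class_def[of X])
qed

lemma cohomologyE:
 assumes "c: cohomology X n"
 obtains z where "z <: X$n" "cd X n z = 0[X$(n+1)]" "c = coh_class X n z"
 using assms unfolding cohomology_def by blast

lemma coh_map_in:
 assumes X: "X: Ob CK" and Y: "Y: Ob CK" and f: "f: Arr CK X Y" and c: "c: cohomology X n"
 shows "coh_map Y f n c: cohomology Y n"
 using c by (elim cohomologyE) (auto simp: coh_map_class[OF X Y f] cohomology_def ck_cl[OF f] ck_comm[OF f] lin_0[OF ck_mod[OF X] ck_mod[OF Y] ck_lin[OF f]])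

text \<open>If f is bijective on cohomology, injectivity gives y = d z0, and surjectivity applied to
  the cocycle y' - f z0 provides the cocycle by which z0 must be corrected. Conversely, surjectivity
  is the case y = 0 of acyclicity, and injectivity is the case where y is the difference of two
  cocycles. The cone condition is preferred from here on because it avoids sets of cosets.\<close>

lemma qis_iff:
 assumes X: "X: Ob CK" and Y: "Y: Ob CK" and f: "f: Arr CK X Y"
 shows "qis_mod X Y f \<longleftrightarrow> cone_acyclic X Y f"
proof
 note mX = ck_mod[OF X] and mY = ck_mod[OF Y]
 note l = ck_d[OF X] and lY = ck_d[OF Y]
 note dX1 = ck_dcl[OF X, of _ "n - 1" for n, simplified] and dY1 = ck_dcl[OF Y, of _ "n - 1" for n, simplified]
 assume q: "qis_mod X Y f"
 show "cone_acyclic X Y f" unfolding cone_acyclic_def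
 proof (intro allI ballI impI)
  fix n y y' assume y: "y <: X$(n+1)" and y': "y' <: Y$n"
   and e: "cd X (n+1) y = 0[X$(n+1+1)] & f (n+1) y = cd Y n y'"
  have inj: "inj_on (coh_map Y f (n+1)) (cohomology X (n+1))" and surj: "coh_map Y f n ` cohomology X n = cohomology Y n"
   using q unfolding qis_mod_def bij_betw_def by auto
  let ?o = "0[X$(n+1)]"
  have o: "?o <: X$(n+1)" "cd X (n+1) ?o = 0[X$(n+1+1)]" "f (n+1) ?o = 0[Y$(n+1)]"
   using mod_zero[OF mX] lin_0[OF mX mX l] lin_0[OF mX mY ck_lin[OF f]] by auto
  have "coh_class Y (n+1) (f (n+1) y) = coh_class Y (n+1) (f (n+1) ?o)"
   using e y' o(3) mod_0l[OF mY] ck_dcl[OF Y] by (intro coh_classI[OF Y _, where y=y']) (auto simp: mod_zero[OF mY])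
  hence "coh_map Y f (n+1) (coh_class X (n+1) y) = coh_map Y f (n+1) (coh_class X (n+1) ?o)"
   by (simp add: coh_map_class[OF X Y f] y o)
  hence "coh_class X (n+1) y = coh_class X (n+1) ?o"
  proof (rule inj_onD[OF inj])
   show "coh_class X (n+1) y: cohomology X (n+1)" "coh_class X (n+1) ?o: cohomology X (n+1)"
    unfolding cohomology_def using y conjunct1[OF e] o(1,2) by blast+
  qed
  then obtain z0 where z0: "z0 <: X$n" "y = cd X n z0"
   using y o(1) coh_class_eq[OF X y o(1)] mod_0l[OF mX] ck_dcl[OF X] by force
  define c where "c = y' +[Y$n] -[Y$n] f n z0"
  have c: "c <: Y$n" using y' z0 by (simp add: c_def md_cl[OF mY] ck_cl[OF f])
  have "cd Y n c = 0[Y$(n+1)]"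
   using y' z0 e by (simp add: c_def lin_add[OF lY] lin_neg[OF mY mY lY] md_cl[OF mY] ck_cl[OF f] ck_comm[OF f] mod_nr[OF mY] ck_dcl[OF Y])
  hence "coh_class Y n c: cohomology Y n" using c by (auto simp: cohomology_def)
  then obtain x where x: "x <: X$n" "cd X n x = 0[X$(n+1)]" "coh_class Y n c = coh_class Y n (f n x)"
   unfolding surj[symmetric] by (auto simp: coh_map_class[OF X Y f] elim!: cohomologyE)
  then obtain z' where z': "z' <: Y$(n-1)" "c = f n x +[Y$n] cd Y (n-1) z'"
   using coh_class_eq[OF Y c ck_cl[OF f x(1)]] by blast
  have fz: "f n z0 <: Y$n" "f n x <: Y$n" using z0(1) x(1) ck_cl[OF f] by auto
  have "y' = c +[Y$n] f n z0" unfolding c_def using y' fz by (simp add: mod_assoc[OF mY] md_cl[OF mY] mod_nl[OF mY] mod_0r[OF mY])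
  also have "... = (f n z0 +[Y$n] f n x) +[Y$n] cd Y (n-1) z'"
   unfolding z'(2) using fz dY1[OF z'(1)] by (simp add: md_ac[OF mY] md_cl[OF mY])
  finally have "y' = f n (z0 +[X$n] x) +[Y$n] cd Y (n-1) z'"
   using z0(1) x(1) by (simp add: lin_add[OF ck_lin[OF f]])
  moreover have "cd X n (z0 +[X$n] x) = y" using x z0 by (simp add: lin_add[OF l] mod_0r[OF mX] ck_dcl[OF X])
  ultimately show "EX z:carrier X$n. EX z':carrier Y$(n-1). cd X n z = y & y' = f n z +[Y$n] cd Y (n-1) z'"
   using z0 x z' mod_add[OF mX] by blast
 qed
next
 note mX = ck_mod[OF X] and mY = ck_mod[OF Y]
 note l = ck_d[OF X] and lY = ck_d[OF Y]
 note dX1 = ck_dcl[OF X, of _ "n - 1" for n, simplified] and dY1 = ck_dcl[OF Y, of _ "n - 1" for n, simplified]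
 assume q: "cone_acyclic X Y f"
 show "qis_mod X Y f" unfolding qis_mod_def bij_betw_def
 proof (intro allI conjI inj_onI)
  fix n c c' assume "c: cohomology X n" "c': cohomology X n" and e: "coh_map Y f n c = coh_map Y f n c'"
  then obtain z z' where z: "z <: X$n" "cd X n z = 0[X$(n+1)]" "c = coh_class X n z"
    "z' <: X$n" "cd X n z' = 0[X$(n+1)]" "c' = coh_class X n z'" by (metis cohomologyE)
  hence "coh_class Y n (f n z) = coh_class Y n (f n z')" using e by (simp add: coh_map_class[OF X Y f])
  then obtain w where w: "w <: Y$(n-1)" "f n z = f n z' +[Y$n] cd Y (n-1) w"
   using coh_class_eq[OF Y ck_cl[OF f z(1)] ck_cl[OF f z(4)]] by blast
  let ?y = "z +[X$n] -[X$n] z'"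
  have "?y <: X$n" "cd X n ?y = 0[X$(n+1)]"
   using z mod_zero[OF mX] by (simp_all add: md_cl[OF mX] lin_add[OF l] lin_neg[OF mX mX l] mod_n0[OF mX] mod_0r[OF mX])
  moreover have "f n ?y = cd Y (n-1) w" using z w dY1[OF w(1)]
   by (simp add: lin_add[OF ck_lin[OF f]] lin_neg[OF mX mY ck_lin[OF f]] md_cl[OF mX] ck_cl[OF f] md_cl[OF mY] md_ac[OF mY] md_eq[OF mY] mod_conj[OF mY])
  ultimately obtain u where u: "u <: X$(n-1)" "cd X (n-1) u = ?y"
   using q[unfolded cone_acyclic_def, rule_format, of ?y "n - 1" w] w by auto
  have "z = z' +[X$n] cd X (n-1) u" unfolding u(2) using z by (simp add: md_cl[OF mX] mod_conj[OF mX])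
  thus "c = c'" unfolding z(3,6) by (rule coh_classI[OF X z(4) u(1)])
 next
  fix n
  show "coh_map Y f n ` cohomology X n = cohomology Y n"
  proof
   show "coh_map Y f n ` cohomology X n <= cohomology Y n" using coh_map_in[OF X Y f] by blast
   show "cohomology Y n <= coh_map Y f n ` cohomology X n"
   proof
    fix c assume "c: cohomology Y n"
    then obtain y' where y': "y' <: Y$n" "cd Y n y' = 0[Y$(n+1)]" "c = coh_class Y n y'" by (metis cohomologyE)
    have o: "0[X$(n+1)] <: X$(n+1)" "cd X (n+1) 0[X$(n+1)] = 0[X$(n+1+1)]" "f (n+1) 0[X$(n+1)] = 0[Y$(n+1)]"
     using mod_zero[OF mX] lin_0[OF mX mX l] lin_0[OF mX mY ck_lin[OF f]] by auto
    obtain z z' where z: "z <: X$n" "z' <: Y$(n-1)" "cd X n z = 0[X$(n+1)]" "y' = f n z +[Y$n] cd Y (n-1) z'"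
     using q[unfolded cone_acyclic_def, rule_format, of "0[X$(n+1)]" n y'] o y' by auto
    have "c = coh_class Y n (f n z)" unfolding y'(3) by (rule coh_classI[OF Y ck_cl[OF f z(1)] z(2,4)])
    thus "c: coh_map Y f n ` cohomology X n" using z by (auto simp: cohomology_def coh_map_class[OF X Y f] image_iff)
   qed
  qed
 qed
qed

lemma coh_set_fnc: "set_fnc CK qis_mod (%X. cohomology X n) (%X Y f. coh_map Y f n)"
 unfolding set_fnc_def
proof (intro conjI ballI impI)
 show c: "category CK" by (rule Ch_kmod_cat)
 fix X c assume X: "X: Ob CK" and c: "c: cohomology X n"
 show "coh_map X (ide CK X) n c = c"
  using c by (elim cohomologyE) (simp add: coh_map_class[OF X X cat_ide[OF Ch_kmod_cat X]])
 fix Y f assume Y: "Y: Ob CK" and f: "f: Arr CK X Y"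
 show "coh_map Y f n c: cohomology Y n" by (rule coh_map_in[OF X Y f c])
 fix Z g assume Z: "Z: Ob CK" and g: "g: Arr CK Y Z"
 show "coh_map Z (cmp CK X Y Z g f) n c = coh_map Z g n (coh_map Y f n c)"
  using c by (elim cohomologyE) (simp add: coh_map_class[OF X Z cat_cmp[OF Ch_kmod_cat X Y Z f g]] coh_map_class[OF X Y f]
    coh_map_class[OF Y Z g] ck_cl[OF f] compose_def)
qed (simp add: qis_mod_def)

lemma htp_coh_map:
 assumes X: "X: Ob CK" and Y: "Y: Ob CK" and f: "f: Arr CK X Y" and g: "g: Arr CK X Y"
  and h: "kl.htp (kmod K) X Y f g" and c: "c: cohomology X n"
 shows "coh_map Y f n c = coh_map Y g n c"
proof -
 interpret Kc: kl K "kmod K" by unfold_locales (rule kmod_klinear)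
 note mX = ck_mod[OF X] and mY = ck_mod[OF Y]
 obtain h where h: "!!n. h n: lin K X$n Y$(n-1)" and e: "!!n. f n = g n +[lin_mod K X$n Y$n]
   (compose (carrier X$n) (cd Y (n-1)) (h n) +[lin_mod K X$n Y$n]
   compose (carrier X$n) (h (n+1)) (cd X n))" using h unfolding Kc.htp_def kmod_sel by blast
 obtain z where z: "z <: X$n" "cd X n z = 0[X$(n+1)]" "c = coh_class X n z" using c by (rule cohomologyE)
 have hz: "h n z <: Y$(n-1)" using lin_cl[OF h z(1)] .
 have "f n z = g n z +[Y$n] cd Y (n-1) (h n z)"
  unfolding e using z(1,2) ck_dcl[OF Y hz] lin_0[OF mX mY h[of "n + 1", simplified]]
  by (simp add: compose_def mod_0r[OF mY])
 thus ?thesis unfolding z(3) coh_map_class[OF X Y f z(1)] coh_map_class[OF X Y g z(1)]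
  by (rule coh_classI[OF Y ck_cl[OF g z(1)] hz])
qed

lemma htp_equiv_qis:
 assumes X: "X: Ob CK" and Y: "Y: Ob CK" and w: "w: Arr CK X Y" and v: "v: Arr CK Y X"
  and 1: "kl.htp (kmod K) Y Y (ide CK Y) (cmp CK Y X Y w v)"
  and 2: "kl.htp (kmod K) X X (ide CK X) (cmp CK X Y X v w)"
 shows "qis_mod X Y w"
 unfolding qis_mod_def
proof
 fix n
 note c = Ch_kmod_cat
 note sf = sf_simps[OF coh_set_fnc]
 show "bij_betw (coh_map Y w n) (cohomology X n) (cohomology Y n)"
 proof (rule bij_betw_byWitness[where f'="coh_map X v n"])
  show "ALL a:cohomology X n. coh_map X v n (coh_map Y w n a) = a"
   using htp_coh_map[OF X X cat_ide[OF c X] cat_cmp[OF c X Y X w v] 2] sf(1)[OF X] sf(3)[OF X Y X w v] by simp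
  show "ALL a:cohomology Y n. coh_map Y w n (coh_map X v n a) = a"
   using htp_coh_map[OF Y Y cat_ide[OF c Y] cat_cmp[OF c Y X Y v w] 1] sf(1)[OF Y] sf(3)[OF Y X Y v w] by simp
 qed (use sf(2)[OF X Y w] sf(2)[OF Y X v] in auto)
qed

subsection \<open>Extension of functionals\<close>

text \<open>The graph of a functional on a subspace. Single-valuedness is stated only over 0, which
  is the form in which well-definedness is checked when a functional is prescribed by a
  formula.\<close>

definition lin_rel :: "('k, 'v) module => ('v \<times> 'k) set => bool" where
 "lin_rel V R \<longleftrightarrow> R <= carrier V \<times> carrier K & (0[V], \<zero>): R \<and>
   (ALL v c w d. (v, c): R & (w, d): R \<longrightarrow> (v +[V] w, c \<oplus> d): R) \<and>
   (ALL v c k. (v, c): R & k <: K \<longrightarrow> (k *[V] v, k \<otimes> c): R) \<and>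
   (ALL c. (0[V], c): R \<longrightarrow> c = \<zero>)"

lemma lin_relD:
 assumes "lin_rel V R"
 shows "(v, c): R ==> v <: V & c <: K" "(0[V], \<zero>): R"
  "(v, c): R ==> (w, d): R ==> (v +[V] w, c \<oplus> d): R"
  "(v, c): R ==> k <: K ==> (k *[V] v, k \<otimes> c): R"
  "(0[V], c): R ==> c = \<zero>"
 using assms unfolding lin_rel_def by auto

lemma lin_rel_unique:
 assumes V: "module K V" and R: "lin_rel V R" and "(v, c): R" "(v, d): R" shows "c = d"
proof -
 have i: "v <: V" "c <: K" "d <: K" using assms unfolding lin_rel_def by auto
 have "(\<ominus> \<one> *[V] v, \<ominus> \<one> \<otimes> d): R" using assms unfolding lin_rel_def by auto
 hence "(v +[V] \<ominus> \<one> *[V] v, c \<oplus> \<ominus> \<one> \<otimes> d): R" using assms unfolding lin_rel_def by blast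
 hence "c \<oplus> \<ominus> \<one> \<otimes> d = \<zero>" using R i by (simp add: lin_rel_def mod_nr[OF V] flip: mod_neg_smult[OF V])
 thus ?thesis using i by (simp add: l_minus) (metis minus_equality minus_minus a_comm a_inv_closed)
qed

text \<open>The extended functional takes the value 0 at v.\<close>

lemma lin_rel_extend:
 assumes V: "module K V" and R: "lin_rel V R" and v: "v <: V" "!!c. (v, c) \<notin> R"
 shows "lin_rel V {(w +[V] a *[V] v, c) | w a c. (w, c): R & a <: K}" (is "lin_rel V ?S")
proof -
 have i: "!!w c. (w, c): R ==> w <: V & c <: K" and z: "(0[V], \<zero>): R" "!!c. (0[V], c): R ==> c = \<zero>"
  and a: "!!v c w d. (v, c): R ==> (w, d): R ==> (v +[V] w, c \<oplus> d): R"
  and s: "!!v c k. (v, c): R ==> k <: K ==> (k *[V] v, k \<otimes> c): R" using R unfolding lin_rel_def by auto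
 note [simp] = md_cl[OF V]
 show ?thesis unfolding lin_rel_def
 proof (intro conjI allI impI)
  show "?S <= carrier V \<times> carrier K" using i v by auto
  show "(0[V], \<zero>): ?S" using z(1) v by (force simp: mod_0s[OF V] mod_0l[OF V])
 next
  fix x c y d assume "(x, c): ?S & (y, d): ?S"
  then obtain w a' w' b where x: "x = w +[V] a' *[V] v" "y = w' +[V] b *[V] v" "(w, c): R" "(w', d): R" "a' <: K" "b <: K" by auto
  have "x +[V] y = (w +[V] w') +[V] (a' \<oplus> b) *[V] v" using x i v by (simp add: mod_adds[OF V] md_ac[OF V])
  thus "(x +[V] y, c \<oplus> d): ?S" using a[OF x(3,4)] x by blast
 next
  fix x c k assume "(x, c): ?S & k <: K"
  then obtain w a' where x: "x = w +[V] a' *[V] v" "(w, c): R" "a' <: K" and k: "k <: K" by auto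
  have "k *[V] x = (k *[V] w) +[V] (k \<otimes> a') *[V] v" using x i v k by (simp add: mod_sadd[OF V] mod_ss[OF V])
  thus "(k *[V] x, k \<otimes> c): ?S" using s[OF x(2) k] x k by blast
 next
  fix c assume "(0[V], c): ?S"
  then obtain w a' where x: "0[V] = w +[V] a' *[V] v" "(w, c): R" "a' <: K" by auto
  \<comment> \<open>Otherwise division by a' expresses v through w, and w lies in the domain of R,
    which contradicts the choice of v. Here nonzero scalars have to be invertible.\<close>
  have "a' = \<zero>"
  proof (rule ccontr)
   assume n: "a' \<noteq> \<zero>"
   hence u: "inv a' <: K" "inv a' \<otimes> a' = \<one>" using x(3) field_Units by auto
   have "a' *[V] v = -[V] w" using mod_neg_eq[OF V, of w "a' *[V] v"] x i v by simp
   hence "inv a' *[V] (a' *[V] v) = inv a' *[V] ((\<ominus> \<one>) *[V] w)" using i[OF x(2)] by (simp add: mod_neg_smult[OF V])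
   hence "v = (inv a' \<otimes> \<ominus> \<one>) *[V] w" using u x v i[OF x(2)] by (simp add: mod_ss[OF V] mod_1s[OF V])
   thus False using s[OF x(2), of "inv a' \<otimes> \<ominus> \<one>"] u v(2) by auto
  qed
  hence "w = 0[V]" using x i v by (simp add: mod_0s[OF V] mod_0r[OF V])
  thus "c = \<zero>" using z(2) x(2) by simp
 qed
qed

text \<open>A graph that is maximal under inclusion exists by Zorn's lemma, and
  \<open>lin_rel_extend\<close> forces its domain to be all of V. This is the injectivity of k
  behind the exactness of dualization. Prescribing a relation rather than a map on a subspace saves
  the choice of representatives.\<close>

lemma extend_functional:
 assumes V: "module K V" and R: "lin_rel V R"
 obtains ga where "ga: lin K V (ground K)" "!!v c. (v, c): R ==> ga v = c"
proof -
 let ?A = "{S. R <= S & lin_rel V S}"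
 have "EX M:?A. ALL X:?A. M <= X \<longrightarrow> X = M"
 proof (rule subset_Zorn_nonempty)
  show "?A \<noteq> {}" using R by auto
  fix \<C> assume ne: "\<C> \<noteq> {}" and ch: "subset.chain ?A \<C>"
  hence c: "!!S. S: \<C> ==> R <= S & lin_rel V S" and l: "!!S S'. S: \<C> ==> S': \<C> ==> S <= S' \<or> S' <= S"
   by (auto simp: subset.chain_def) blast
  have add: "(v +[V] w, c \<oplus> d): \<Union>\<C>" if vw: "(v, c): \<Union>\<C>" "(w, d): \<Union>\<C>" for v c w d
  proof -
   obtain S S' where "S: \<C>" "(v, c): S" "S': \<C>" "(w, d): S'" using vw by auto
   then obtain S'' where S: "S'': \<C>" "(v, c): S''" "(w, d): S''" using l[of S S'] by auto
   thus ?thesis using lin_relD(3)[of V S'' v c w d] c[OF S(1)] by blast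
  qed
  have "lin_rel V (\<Union>\<C>)" unfolding lin_rel_def
  proof (intro conjI allI impI)
   show "\<Union>\<C> <= carrier V \<times> carrier K" using c lin_relD(1)[of V] by fastforce
   show "(0[V], \<zero>): \<Union>\<C>" using c ne lin_relD(2)[of V] by blast
  next
   fix v c' k assume "(v, c'): \<Union>\<C> & k <: K" thus "(k *[V] v, k \<otimes> c'): \<Union>\<C>" using c lin_relD(4)[of V] by blast
  next
   fix c' assume "(0[V], c'): \<Union>\<C>" thus "c' = \<zero>" using c lin_relD(5)[of V] by blast
  qed (use add in blast)
  thus "\<Union>\<C>: ?A" using ne c by blast
 qed
 then obtain M where M0: "M: ?A" and mx0: "ALL X:?A. M <= X \<longrightarrow> X = M" by (rule bexE)
 have M: "R <= M" "lin_rel V M" using M0 by auto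
 have mx: "R <= X ==> lin_rel V X ==> M <= X ==> X = M" for X using mx0 by auto
 have tot: "EX c. (v, c): M" if v: "v <: V" for v
 proof (rule ccontr)
  assume n: "\<nexists>c. (v, c): M"
  let ?S = "{(w +[V] a *[V] v, c) | w a c. (w, c): M & a <: K}"
  have m: "!!w c. (w, c): M ==> w <: V" "(0[V], \<zero>): M" using M unfolding lin_rel_def by auto
  have "M <= ?S"
  proof
   fix p assume p: "p: M"
   hence "fst p = fst p +[V] \<zero> *[V] v" using m(1)[of "fst p" "snd p"] v by (simp add: mod_0s[OF V] mod_0r[OF V])
   thus "p: ?S" using p by (cases p) fastforce
  qed
  moreover have "lin_rel V ?S" using lin_rel_extend[OF V M(2) v] n by blast
  ultimately have "?S = M" using mx[of ?S] M(1) by blast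
  moreover have "(0[V] +[V] \<one> *[V] v, \<zero>): ?S" using m(2) by blast
  ultimately show False using n v by (simp add: mod_1s[OF V] mod_0l[OF V])
 qed
 define ga where "ga = (\<lambda>v\<in>carrier V. THE c. (v, c): M)"
 have g: "ga v = c" if "(v, c): M" for v c
 proof -
  have "v <: V" using that M(2) by (auto simp: lin_rel_def)
  thus ?thesis using that lin_rel_unique[OF V M(2)] by (auto simp: ga_def)
 qed
 have gM: "(v, ga v): M" if "v <: V" for v using tot[OF that] g by auto
 have "ga: lin K V (ground K)"
 proof (rule linI)
  fix x assume x: "x <: V"
  show "ga x <: (ground K)" using lin_relD(1)[OF M(2) gM[OF x]] by simp
  { fix y assume y: "y <: V"
   have "(x +[V] y, ga x \<oplus> ga y): M" by (rule lin_relD(3)[OF M(2) gM[OF x] gM[OF y]])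
   thus "ga (x +[V] y) = ga x +[ground K] ga y" using g by simp }
  fix c assume c: "c <: K"
  have "(c *[V] x, c \<otimes> ga x): M" by (rule lin_relD(4)[OF M(2) gM[OF x] c])
  thus "ga (c *[V] x) = c *[ground K] ga x" using g by simp
 qed (simp add: ga_def)
 thus thesis using g M(1) by (intro that) auto
qed

subsection \<open>Duality of complexes of modules\<close>

abbreviation (input) "KK == ground K"

lemma dual_sel: "carrier (dual K V) = lin K V KK" by (simp add: dual_def)

lemma module_dual: "module K V ==> module K (dual K V)"
 unfolding dual_def by (rule module_lin_mod[OF _ module_ground])

lemma dual_app: "al: lin K V KK ==> v <: V ==> al v <: K"
 using lin_cl[of al V KK v] by simp

lemma dual_add: "v <: V ==> (al +[dual K V] be) v = al v \<oplus> be v"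
 and dual_sm: "v <: V ==> (c *[dual K V] al) v = c \<otimes> al v"
 and dual_0: "v <: V ==> 0[dual K V] v = \<zero>"
 by (simp_all add: dual_def)

lemma dual_map_in:
 assumes V: "module K V" and W: "module K W" and g: "g: lin K V W"
 shows "dual_map K V W g: lin K (dual K W) (dual K V)"
proof (rule linI)
 note d = module_dual[OF W] and gc = lin_cl[OF g]
 have c: "dual_map K V W g al = (\<lambda>v\<in>carrier V. al (g v))" if "al <: (dual K W)" for al
  using that by (simp add: compose_def dual_map_def)
 fix al be k assume a: "al <: (dual K W)"
 show "dual_map K V W g al <: (dual K V)" using a V g by (simp add: dual_map_def dual_sel lin_comp)
 show "dual_map K V W g (k *[dual K W] al) = k *[dual K V] dual_map K V W g al" if k: "k <: K"
  unfolding c[OF a] c[OF mod_sm[OF d k a]] by (simp add: dual_def lin_mod_def gc fun_eq_iff)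
 show "dual_map K V W g (al +[dual K W] be) = dual_map K V W g al +[dual K V] dual_map K V W g be" if b: "be <: (dual K W)"
  unfolding c[OF a] c[OF b] c[OF mod_add[OF d a b]] by (simp add: dual_def lin_mod_def gc fun_eq_iff)
qed (simp add: dual_map_def)

lemma dual_map_app: "al: lin K W KK ==> v <: V ==> dual_map K V W g al v = al (g v)"
 by (simp add: dual_map_def dual_sel compose_def)

lemma lin_signed:
 assumes "module K V" "module K W" "g: lin K V W"
 shows "signed (lin_mod K V W) n g: lin K V W"
  "v <: V ==> signed (lin_mod K V W) n g v = signed W n (g v)"
 using assms mod_neg[OF module_lin_mod[OF assms(1,2)], of g] by (auto simp: signed_def lin_mod_neg)

lemma signed_dual:
 assumes "module K V" "al: lin K V KK"
 shows "signed (dual K V) n al: lin K V KK" "v <: V ==> signed (dual K V) n al v = signed KK n (al v)"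
 using lin_signed[OF assms(1) module_ground assms(2), where n=n] dual_app[OF assms(2)] by (auto simp: dual_def signed_def)

lemma signed_K[simp]: "c <: K ==> signed KK n c <: K" "c <: K ==> signed KK n (signed KK n c) = c"
 "signed KK n \<zero> = \<zero>" by (simp_all add: signed_def)

lemma dual_d:
 assumes X: "X: Ob CK"
 shows dual_d_lin: "cd (dual_cx K X) n: lin K (dual K X$(- n)) (dual K X$(- (n+1)))"
  and dual_d_app: "al: lin K X$(- n) KK ==> v <: X$(- (n+1)) ==>
   cd (dual_cx K X) n al v = signed KK (n+1) (al (cd X (- (n+1)) v))"
  and dual_d_in: "al: lin K X$(- n) KK ==> cd (dual_cx K X) n al: lin K X$(- (n+1)) KK"
proof -
 note m = ck_mod[OF X]
 have d: "cd X (- (n+1)): lin K X$(- (n+1)) X$(- n)" using ck_d[OF X, of "- (n+1)"] by simp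
 note l = lin_signed[OF module_dual[OF m] module_dual[OF m] dual_map_in[OF m m d], where n="n + 1"]
 show "cd (dual_cx K X) n: lin K (dual K X$(- n)) (dual K X$(- (n+1)))"
  using l(1) by (simp add: dual_cx_def)
 thus "al: lin K X$(- n) KK ==> cd (dual_cx K X) n al: lin K X$(- (n+1)) KK"
  using lin_cl[of "cd (dual_cx K X) n" "dual K X$(- n)" "dual K X$(- (n+1))" al] by (simp add: dual_sel)
 assume a: "al: lin K X$(- n) KK" and v: "v <: X$(- (n+1))"
 have in1: "dual_map K X$(- (n+1)) X$(- n) (cd X (- (n+1))) al: lin K X$(- (n+1)) KK"
  using lin_cl[OF dual_map_in[OF m m d], of al] a by (simp add: dual_sel)
 show "cd (dual_cx K X) n al v = signed KK (n+1) (al (cd X (- (n+1)) v))"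
  using l(2)[of al] a v signed_dual(2)[OF m in1 v] by (simp add: dual_cx_def dual_sel dual_map_app del: minus_add_distrib)
qed

lemma dual_cx_sel[simp]: "(dual_cx K X)$n = dual K X$(- n)" by (simp add: dual_cx_def)

lemma dual_cx_ob:
 assumes X: "X: Ob CK" shows "dual_cx K X: Ob CK"
proof (rule Ch_kmod_obI)
 note m = ck_mod[OF X]
 fix n
 show "module K (dual_cx K X)$n" by (simp add: module_dual m)
 show "cd (dual_cx K X) n: lin K (dual_cx K X)$n (dual_cx K X)$(n+1)" using dual_d_lin[OF X] by simp
 fix al assume "al <: (dual_cx K X)$n"
 hence a: "al: lin K X$(- n) KK" by (simp add: dual_sel)
 note b = dual_d_in[OF X a] and c = dual_d_in[OF X dual_d_in[OF X a]]
 have "cd (dual_cx K X) (n+1) (cd (dual_cx K X) n al) v = \<zero>" if v: "v <: X$(- (n+1+1))" for v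
 proof -
  have e: "- (n+1+1)+1 = - (n+1)" by simp
  have 1: "cd X (- (n+1+1)) v <: X$(- (n+1))" using ck_dcl[OF X v, unfolded e] .
  have "cd X (- (n+1)) (cd X (- (n+1+1)) v) = 0[X$(- n)]" using ck_dd[OF X v, unfolded e] by simp
  thus ?thesis using dual_d_app[OF X b v] dual_d_app[OF X a 1] lin_0[OF m module_ground a] by simp
 qed
 hence "cd (dual_cx K X) (n+1) (cd (dual_cx K X) n al) = 0[dual K X$(- (n+1+1))]"
  using mod_zero[OF module_dual[OF m]] by (intro lin_ext[OF c]) (auto simp: dual_sel dual_0)
 thus "cd (dual_cx K X) (n+1) (cd (dual_cx K X) n al) = 0[(dual_cx K X)$(n+1+1)]" by simp
qed

lemma dual_fnc_arr:
 assumes X: "X: Ob CK" and Y: "Y: Ob CK" and f: "f: Arr CK X Y"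
 shows "mm (dual_cx_fnc K) Y X f: Arr CK (dual_cx K Y) (dual_cx K X)"
proof (rule Ch_kmod_arrI)
 note mX = ck_mod[OF X] and mY = ck_mod[OF Y]
 fix n
 show l: "mm (dual_cx_fnc K) Y X f n: lin K (dual_cx K Y)$n (dual_cx K X)$n" for n
  by (simp add: dual_cx_fnc_def dual_map_in[OF mX mY ck_lin[OF f]])
 fix al assume "al <: (dual_cx K Y)$n"
 hence a: "al: lin K Y$(- n) KK" by (simp add: dual_sel)
 have fa: "mm (dual_cx_fnc K) Y X f n al: lin K X$(- n) KK" using lin_cl[OF l, of al] a by (simp add: dual_sel)
 have fda: "mm (dual_cx_fnc K) Y X f (n+1) (cd (dual_cx K Y) n al): lin K X$(- (n+1)) KK" using lin_cl[OF l, of "cd (dual_cx K Y) n al" "n + 1"] dual_d_in[OF Y a] by (simp add: dual_sel)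
 show "cd (dual_cx K X) n (mm (dual_cx_fnc K) Y X f n al) = mm (dual_cx_fnc K) Y X f (n+1) (cd (dual_cx K Y) n al)"
 proof (rule lin_ext[OF dual_d_in[OF X fa] fda])
  fix v assume v: "v <: X$(- (n+1))"
  have 1: "cd X (- (n+1)) v <: X$(- n)" using ck_dcl[OF X v] by simp
  have 2: "cd Y (- (n+1)) (f (- (n+1)) v) = f (- n) (cd X (- (n+1)) v)" using ck_comm[OF f v] by simp
  have 3: "mm (dual_cx_fnc K) Y X f (n+1) (cd (dual_cx K Y) n al) v = cd (dual_cx K Y) n al (f (- (n+1)) v)"
   unfolding dual_cx_fnc_def by (simp add: dual_map_app[OF dual_d_in[OF Y a] v] del: minus_add_distrib)
  have 4: "mm (dual_cx_fnc K) Y X f n al (cd X (- (n+1)) v) = al (f (- n) (cd X (- (n+1)) v))"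
   unfolding dual_cx_fnc_def by (simp add: dual_map_app[OF a 1] del: minus_add_distrib)
  show "cd (dual_cx K X) n (mm (dual_cx_fnc K) Y X f n al) v = mm (dual_cx_fnc K) Y X f (n+1) (cd (dual_cx K Y) n al) v"
   unfolding 3 dual_d_app[OF X fa v] dual_d_app[OF Y a ck_cl[OF f v]] 2 4 ..
 qed
qed

lemma dual_fnc_app: "al: lin K Y$(- n) KK ==> v <: X$(- n) ==> mm (dual_cx_fnc K) Y X f n al v = al (f (- n) v)"
 by (simp add: dual_cx_fnc_def dual_map_app)

lemma dual_functor: "is_functor (op_cat CK) CK (dual_cx_fnc K)"
proof -
 have om: "om (dual_cx_fnc K) = dual_cx K" by (simp add: dual_cx_fnc_def)
 note c = Ch_kmod_cat
 have ext: "f = g" if "f: Arr CK (dual_cx K Y) (dual_cx K X)" "g: Arr CK (dual_cx K Y) (dual_cx K X)"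
   "!!n al v. al: lin K Y$(- n) KK ==> v <: X$(- n) ==> f n al v = g n al v" for f g and X Y :: "(('k, 'v) module, 'v => 'v) cx"
 proof (rule Ch_kmod_ext[OF that(1,2)])
  fix n al assume a: "al <: (dual_cx K Y)$n"
  show "f n al = g n al" using ck_cl[OF that(1) a] ck_cl[OF that(2) a] that(3)[of al n] a by (intro lin_ext[of _ "X$(- n)" KK]) (simp_all add: dual_sel)
 qed
 show ?thesis unfolding is_functor_def om op_sel
 proof (intro conjI ballI)
  show "category (op_cat CK)" "category CK" using c by (auto intro: op_category)
  fix X assume X: "X: Ob CK"
  show "dual_cx K X: Ob CK" by (rule dual_cx_ob[OF X])
  show "mm (dual_cx_fnc K) X X (ide CK X) = ide CK (dual_cx K X)"
   by (rule ext[OF dual_fnc_arr[OF X X cat_ide[OF c X]] cat_ide[OF c dual_cx_ob[OF X]]]) (simp add: dual_fnc_app dual_sel)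
  fix Y f assume Y: "Y: Ob CK" and f: "f: Arr CK Y X"
  note f' = dual_fnc_arr[OF Y X f]
  show "mm (dual_cx_fnc K) X Y f: Arr CK (dual_cx K X) (dual_cx K Y)" by (rule f')
  fix Z g assume Z: "Z: Ob CK" and g: "g: Arr CK Z Y"
  note g' = dual_fnc_arr[OF Z Y g]
  show "mm (dual_cx_fnc K) X Z (cmp CK Z Y X f g) =
    cmp CK (dual_cx K X) (dual_cx K Y) (dual_cx K Z) (mm (dual_cx_fnc K) Y Z g) (mm (dual_cx_fnc K) X Y f)"
  proof (rule ext[OF dual_fnc_arr[OF Z X cat_cmp[OF c Z Y X g f]] cat_cmp[OF c dual_cx_ob[OF X] dual_cx_ob[OF Y] dual_cx_ob[OF Z] f' g']])
   fix n al v assume a: "al: lin K X$(- n) KK" and v: "v <: Z$(- n)"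
   have "mm (dual_cx_fnc K) X Y f n al: lin K Y$(- n) KK" using ck_cl[OF f', of al n] a by (simp add: dual_sel)
   thus "mm (dual_cx_fnc K) X Z (cmp CK Z Y X f g) n al v =
    cmp CK (dual_cx K X) (dual_cx K Y) (dual_cx K Z) (mm (dual_cx_fnc K) Y Z g) (mm (dual_cx_fnc K) X Y f) n al v"
    using a v ck_cl[OF g v] by (simp add: dual_fnc_app compose_def dual_sel)
  qed
 qed
qed

text \<open>The functional ga is prescribed on the subspace of all d y + f x with x a cocycle, by
  the value al y + be x; acyclicity of the cone makes this well defined. The rest be - ga f vanishes
  on cocycles, so it descends to the image of d, and de is an extension of it from there. This is
  acyclicity of the dual cone with all signs removed.\<close>

lemma dual_exact:
 assumes X: "X: Ob CK" and Y: "Y: Ob CK" and f: "f: Arr CK X Y"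
  and q: "cone_acyclic X Y f" and a: "al: lin K Y$m KK" and b: "be: lin K X$(m+1) KK"
  and ad: "!!y. y <: Y$(m-1) ==> al (cd Y (m-1) y) = \<zero>"
  and ab: "!!x. x <: X$m ==> al (f m x) = be (cd X m x)"
 obtains ga de where "ga: lin K Y$(m+1) KK" "de: lin K X$(m+1+1) KK"
  "!!y. y <: Y$m ==> ga (cd Y m y) = al y"
  "!!x. x <: X$(m+1) ==> be x = ga (f (m+1) x) \<oplus> de (cd X (m+1) x)"
proof -
 note mX = ck_mod[OF X] and mY = ck_mod[OF Y]
 note lX = ck_d[OF X] and lY = ck_d[OF Y] and lf = ck_lin[OF f]
 note cl = md_cl[OF mX] md_cl[OF mY] ck_dcl[OF X] ck_dcl[OF Y] ck_cl[OF f] dual_app[OF a] dual_app[OF b]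
 have dY1: "y <: Y$(m-1) ==> cd Y (m-1) y <: Y$m" for y using ck_dcl[OF Y, of y "m - 1"] by simp
 define R where "R = {(cd Y m y +[Y$(m+1)] f (m+1) x, al y \<oplus> be x) | x y. y <: Y$m & x <: X$(m+1) \<and>
   cd X (m+1) x = 0[X$(m+1+1)]}"
 have RI: "(cd Y m y +[Y$(m+1)] f (m+1) x, al y \<oplus> be x): R" if "y <: Y$m" "x <: X$(m+1)"
   "cd X (m+1) x = 0[X$(m+1+1)]" for x y using that unfolding R_def by blast
 have RE: "EX x y. y <: Y$m & x <: X$(m+1) & cd X (m+1) x = 0[X$(m+1+1)] \<and>
   v = cd Y m y +[Y$(m+1)] f (m+1) x & c = al y \<oplus> be x" if "(v, c): R" for v c using that unfolding R_def by blast
 have "lin_rel Y$(m+1) R" unfolding lin_rel_def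
 proof (intro conjI allI impI)
  show "R <= carrier Y$(m+1) \<times> carrier K" unfolding R_def by (auto simp: cl)
  show "(0[Y$(m+1)], \<zero>): R" using RI[of "0[Y$m]" "0[X$(m+1)]"]
   by (simp add: cl lin_0[OF mY mY lY] lin_0[OF mX mX lX] lin_0[OF mX mY lf] mod_0l[OF mY] lin_0[OF mY module_ground a] lin_0[OF mX module_ground b])
 next
  fix v c w d assume "(v, c): R & (w, d): R"
  then obtain x y x' y' where v: "y <: Y$m" "x <: X$(m+1)" "cd X (m+1) x = 0[X$(m+1+1)]"
   "v = cd Y m y +[Y$(m+1)] f (m+1) x" "c = al y \<oplus> be x" and w: "y' <: Y$m" "x' <: X$(m+1)" "cd X (m+1) x' = 0[X$(m+1+1)]"
   "w = cd Y m y' +[Y$(m+1)] f (m+1) x'" "d = al y' \<oplus> be x'" using RE by metis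
  show "(v +[Y$(m+1)] w, c \<oplus> d): R"
   using RI[of "y +[Y$m] y'" "x +[X$(m+1)] x'"] v w
   by (simp add: cl lin_add[OF lX] lin_add[OF lY] lin_add[OF lf] lin_add[OF a] lin_add[OF b] mod_0l[OF mX] md_ac[OF mY] a_ac)
 next
  fix v c k assume "(v, c): R & k <: K"
  then obtain x y where v: "y <: Y$m" "x <: X$(m+1)" "cd X (m+1) x = 0[X$(m+1+1)]"
   "v = cd Y m y +[Y$(m+1)] f (m+1) x" "c = al y \<oplus> be x" and k: "k <: K" using RE by metis
  show "(k *[Y$(m+1)] v, k \<otimes> c): R"
   using RI[of "k *[Y$m] y" "k *[X$(m+1)] x"] v k
   by (simp add: cl lin_sm[OF lX] lin_sm[OF lY] lin_sm[OF lf] lin_sm[OF a] lin_sm[OF b] mod_s0[OF mX] mod_sadd[OF mY] r_distr)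
 next
  fix c assume "(0[Y$(m+1)], c): R"
  then obtain x y where v: "y <: Y$m" "x <: X$(m+1)" "cd X (m+1) x = 0[X$(m+1+1)]"
   "0[Y$(m+1)] = cd Y m y +[Y$(m+1)] f (m+1) x" "c = al y \<oplus> be x" using RE by metis
  have "f (m+1) x = -[Y$(m+1)] cd Y m y" by (rule mod_neg_eq[OF mY]) (use v(1,2) in "auto simp: cl v(4)[symmetric]")
  hence "f (m+1) x = cd Y m (-[Y$m] y)" using v(1) by (simp add: lin_neg[OF mY mY lY])
  then obtain z z' where z: "z <: X$m" "z' <: Y$(m-1)" "cd X m z = x" "-[Y$m] y = f m z +[Y$m] cd Y (m-1) z'"
   using q[unfolded cone_acyclic_def, rule_format, OF v(2) mod_neg[OF mY v(1)] conjI[OF v(3)]] by blast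
  have "\<ominus> al y = al (-[Y$m] y)" using v(1) lin_neg[OF mY module_ground a] by (simp add: cl)
  also have "... = be x" unfolding z(4) using z(1-3) v(2) lin_add[OF a, of "f m z" "cd Y (m-1) z'"] dual_app[OF b v(2)] by (simp add: cl dY1 ab ad)
  finally show "c = \<zero>" unfolding v(5) using r_neg[OF dual_app[OF a v(1)]] by simp
 qed
 then obtain ga where g: "ga: lin K Y$(m+1) KK" "!!v c. (v, c): R ==> ga v = c" using extend_functional[OF mY] by metis
 have g1: "ga (cd Y m y) = al y" if "y <: Y$m" for y
  using g(2)[OF RI[OF that, of "0[X$(m+1)]"]] that
  by (simp add: cl lin_0[OF mX mX lX] lin_0[OF mX mY lf] mod_0r[OF mY] lin_0[OF mX module_ground b])
 have g2: "ga (f (m+1) x) = be x" if "x <: X$(m+1)" "cd X (m+1) x = 0[X$(m+1+1)]" for x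
  using g(2)[OF RI[OF _ that, of "0[Y$m]"]] that
  by (simp add: cl lin_0[OF mY mY lY] mod_0l[OF mY] lin_0[OF mY module_ground a])
 define \<epsilon> where "\<epsilon> x = be x \<oplus> \<ominus> ga (f (m+1) x)" for x
 have ga: "x <: X$(m+1) ==> ga (f (m+1) x) <: K" for x using dual_app[OF g(1)] cl by simp
 define S where "S = {(cd X (m+1) x, \<epsilon> x) | x. x <: X$(m+1)}"
 have "lin_rel X$(m+1+1) S" unfolding lin_rel_def
 proof (intro conjI allI impI)
  show "S <= carrier X$(m+1+1) \<times> carrier K" unfolding S_def \<epsilon>_def using ck_dcl[OF X, of _ "m + 1"] ga dual_app[OF b] by auto
  show "(0[X$(m+1+1)], \<zero>): S" unfolding S_def
   by (rule CollectI, rule exI[of _ "0[X$(m+1)]"])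
    (simp add: \<epsilon>_def cl lin_0[OF mX mX lX] lin_0[OF mX mY lf] lin_0[OF mX module_ground b] lin_0[OF mY module_ground g(1)])
 next
  fix v c w d assume "(v, c): S & (w, d): S"
  then obtain x y where x: "x <: X$(m+1)" "v = cd X (m+1) x" "c = \<epsilon> x" "y <: X$(m+1)" "w = cd X (m+1) y" "d = \<epsilon> y"
   unfolding S_def by blast
  show "(v +[X$(m+1+1)] w, c \<oplus> d): S" unfolding S_def
   by (rule CollectI, rule exI[of _ "x +[X$(m+1)] y"])
    (use x ga in "simp add: \<epsilon>_def cl lin_add[OF lX] lin_add[OF lf] lin_add[OF b] lin_add[OF g(1)] minus_add a_ac")
 next
  fix v c k assume "(v, c): S & k <: K"
  then obtain x where x: "x <: X$(m+1)" "v = cd X (m+1) x" "c = \<epsilon> x" "k <: K" unfolding S_def by blast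
  show "(k *[X$(m+1+1)] v, k \<otimes> c): S" unfolding S_def
   by (rule CollectI, rule exI[of _ "k *[X$(m+1)] x"])
    (use x ga in "simp add: \<epsilon>_def cl lin_sm[OF lX] lin_sm[OF lf] lin_sm[OF b] lin_sm[OF g(1)] r_distr r_minus")
 next
  fix c assume "(0[X$(m+1+1)], c): S"
  then obtain x where x: "x <: X$(m+1)" "cd X (m+1) x = 0[X$(m+1+1)]" "c = \<epsilon> x" unfolding S_def by auto
  thus "c = \<zero>" using g2[OF x(1,2)] by (simp add: \<epsilon>_def r_neg cl)
 qed
 then obtain de where d: "de: lin K X$(m+1+1) KK" "!!v c. (v, c): S ==> de v = c" using extend_functional[OF mX] by metis
 have "be x = ga (f (m+1) x) \<oplus> de (cd X (m+1) x)" if x: "x <: X$(m+1)" for x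
 proof -
  have "de (cd X (m+1) x) = \<epsilon> x" using d(2) x unfolding S_def by blast
  thus ?thesis using ga[OF x] x by (simp add: \<epsilon>_def cl a_comm[of "be x"] r_neg2)
 qed
 thus thesis using that[OF g(1) d(1) g1] by blast
qed

lemma dual_qis:
 assumes X: "X: Ob CK" and Y: "Y: Ob CK" and f: "f: Arr CK X Y" and q: "qis_mod X Y f"
 shows "qis_mod (dual_cx K Y) (dual_cx K X) (mm (dual_cx_fnc K) Y X f)"
 unfolding qis_iff[OF dual_cx_ob[OF Y] dual_cx_ob[OF X] dual_fnc_arr[OF X Y f]] cone_acyclic_def
proof (intro allI ballI impI)
 note mX = ck_mod[OF X] and mY = ck_mod[OF Y]
 let ?F = "mm (dual_cx_fnc K) Y X f"
 note F = dual_fnc_arr[OF X Y f]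
 fix n al be
 assume "al <: (dual_cx K Y)$(n+1)" "be <: (dual_cx K X)$n"
  and e: "cd (dual_cx K Y) (n+1) al = 0[(dual_cx K Y)$(n+1+1)] & ?F (n+1) al = cd (dual_cx K X) n be"
 hence a: "al: lin K Y$(- (n+1)) KK" and b: "be: lin K X$(- n) KK" by (simp_all add: dual_sel)
 define m where "m = - (n+1)"
 have n: "- n = m + 1" "- (n+1+1) = m - 1" "- (n+1) = m" "- (n-1) = m+1 + 1" by (auto simp: m_def)
 note a = a[unfolded n] and b = b[unfolded n]
 \<comment> \<open>Absorbing the sign (-1)^(n+1) into al removes it from the dual differentials, so
   that \<open>dual_exact\<close> applies; de is given its own sign in \<open>?d\<close>
   below.\<close>
 let ?a = "signed (dual K Y$m) (n+1) al"
 have aa: "?a: lin K Y$m KK" "v <: Y$m ==> ?a v = signed KK (n+1) (al v)" for v using signed_dual[OF mY a] by auto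
 have dY1: "y <: Y$(m-1) ==> cd Y (m-1) y <: Y$m" for y using ck_dcl[OF Y, of y "m - 1"] by simp
 have 1: "?a (cd Y (m-1) y) = \<zero>" if y: "y <: Y$(m-1)" for y
 proof -
  have "signed KK (n+1+1) (al (cd Y (m-1) y)) = \<zero>"
   using dual_d_app[OF Y, of al "n + 1" y] a y e dual_0[of y "Y$(m-1)"] unfolding n dual_cx_sel by simp
  thus ?thesis using dual_app[OF a dY1[OF y]] unfolding aa(2)[OF dY1[OF y]] by (auto simp: signed_def split: if_splits)
 qed
 have 2: "?a (f m x) = be (cd X m x)" if x: "x <: X$m" for x
 proof -
  have "al (f m x) = signed KK (n+1) (be (cd X m x))"
   using dual_d_app[OF X, of be n x] a b x e dual_fnc_app[of al Y "n + 1" x X f] unfolding n by simp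
  thus ?thesis using dual_app[OF b ck_dcl[OF X x]] by (simp add: aa ck_cl[OF f x])
 qed
 obtain ga de where g: "ga: lin K Y$(m+1) KK" "de: lin K X$(m+1+1) KK"
  "!!y. y <: Y$m ==> ga (cd Y m y) = ?a y"
  "!!x. x <: X$(m+1) ==> be x = ga (f (m+1) x) \<oplus> de (cd X (m+1) x)"
  using dual_exact[OF X Y f q[unfolded qis_iff[OF X Y f]] aa(1) b 1 2] by metis
 let ?d = "signed (dual K X$(m+1+1)) n de"
 note dd = signed_dual[OF mX g(2), where n=n]
 show "EX z:carrier (dual_cx K Y)$n. EX z':carrier (dual_cx K X)$(n-1).
   cd (dual_cx K Y) n z = al & be = ?F n z +[(dual_cx K X)$n] cd (dual_cx K X) (n-1) z'"
 proof (intro bexI conjI)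
  show "ga <: (dual_cx K Y)$n" "?d <: (dual_cx K X)$(n-1)"
   using g dd unfolding dual_cx_sel dual_sel n by auto
  show "cd (dual_cx K Y) n ga = al"
   by (rule lin_ext[of _ "Y$m" KK]) (use a g aa dual_app[OF a] dual_d_in[OF Y, of ga n] dual_d_app[OF Y, of ga n] in "auto simp: n")
  have i: "?F n ga: lin K X$(m+1) KK" "cd (dual_cx K X) (n-1) ?d: lin K X$(m+1) KK"
   using ck_cl[OF F, of ga n] g(1) dual_d_in[OF X, of ?d "n - 1"] dd(1) unfolding dual_cx_sel dual_sel n by (auto simp: n)
  have ar: "- n-1 = - (n+1)" for n :: int by simp
  show "be = ?F n ga +[(dual_cx K X)$n] cd (dual_cx K X) (n-1) ?d" unfolding dual_cx_sel n
  proof (rule lin_ext[OF b])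
   show "?F n ga +[dual K X$(m+1)] cd (dual_cx K X) (n-1) ?d: lin K X$(m+1) KK"
    using mod_add[OF module_dual[OF mX]] i by (simp add: dual_sel)
   fix x assume x: "x <: X$(m+1)"
   have "cd (dual_cx K X) (n-1) ?d x = de (cd X (m+1) x)"
   proof -
    have e: "- (n-1) = m+1 + 1" "n-1+1 = n" "- n = m + 1" by (auto simp: m_def)
    show ?thesis using dual_d_app[OF X, of ?d "n - 1" x, unfolded e] dd x ck_dcl[OF X x] dual_app[OF g(2)] by simp
   qed
   thus "be x = (?F n ga +[dual K X$(m+1)] cd (dual_cx K X) (n-1) ?d) x"
    using dual_fnc_app[of ga Y n x X f] g x by (simp add: dual_add n)
  qed
 qed
qed

subsection \<open>Change of universe\<close>

lemma emb_inj: "inj_on (e :: 'v => 'w) (carrier V) ==> inj_on (emb V :: 'v => 'w) (carrier V)"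
 unfolding emb_def by (rule someI[of "%e. inj_on e (carrier V)"])

context
 fixes V :: "('k, 'v) module" and ty :: "'w itself"
 assumes V: "module K V" and i: "inj_on (emb V :: 'v => 'w) (carrier V)"
begin

lemma unemb_emb: "x <: V ==> unemb V (emb V x :: 'w) = x"
 unfolding unemb_def by (rule the_inv_into_f_f[OF i])

lemma cpy_sel:
 "carrier (cpy V :: ('k, 'w) module) = emb V ` carrier V"
 "x <: V ==> y <: V ==> (emb V x :: 'w) +[cpy V] emb V y = emb V (x +[V] y)"
 "x <: V ==> c *[cpy V] (emb V x :: 'w) = emb V (c *[V] x)"
 "(0[cpy V] :: 'w) = emb V 0[V]"
 by (simp_all add: cpy_def unemb_emb)

lemma module_cpy: "module K (cpy V :: ('k, 'w) module)"
 by (rule mod_surj[OF V, where pj="emb V"]) (simp_all add: cpy_sel)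

lemma unemb_in: "y <: (cpy V :: ('k, 'w) module) ==> unemb V y <: V"
 and emb_unemb: "y <: (cpy V :: ('k, 'w) module) ==> emb V (unemb V y) = y"
 by (auto simp: cpy_sel unemb_emb)

lemma unemb_add: "x <: (cpy V :: ('k, 'w) module) ==> y <: (cpy V) ==> unemb V (x +[cpy V] y) = unemb V x +[V] unemb V y"
 and unemb_sm: "x <: (cpy V :: ('k, 'w) module) ==> c <: K ==> unemb V (c *[cpy V] x) = c *[V] unemb V x"
 by (auto simp: cpy_sel unemb_emb md_cl[OF V])

lemma emb_lin: "(\<lambda>x\<in>carrier V. emb V x :: 'w): lin K V (cpy V)"
 by (rule linI) (auto simp: cpy_sel md_cl[OF V])

end

lemma cpy_map_emb:
 assumes "inj_on (emb U :: 'v => 'w) (carrier U)" "x <: U"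
 shows "cpy_map U V f (emb U x :: 'w) = emb V (f x)"
 using assms by (simp add: cpy_map_def unemb_def the_inv_into_f_f)

lemma cpy_map_in:
 assumes U: "module K U" and V: "module K V" and iU: "inj_on (emb U :: 'v => 'w) (carrier U)"
  and iV: "inj_on (emb V :: 'v => 'w) (carrier V)" and f: "f: lin K U V"
 shows "(cpy_map U V f :: 'w => 'w): lin K (cpy U) (cpy V)"
proof (rule linI)
 note c = cpy_sel[OF U iU] cpy_sel[OF V iV] and e = cpy_map_emb[OF iU] and fc = lin_cl[OF f]
 fix x y :: 'w and k assume "x <: (cpy U)"
 then obtain a where a: "a <: U" "x = emb U a" by (auto simp: c)
 show "(cpy_map U V f :: 'w => 'w) x <: (cpy V)" using a by (simp add: e c fc)
 show "(cpy_map U V f :: 'w => 'w) (k *[cpy U] x) = k *[cpy V] cpy_map U V f x" if "k <: K"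
  using a that by (simp add: e c fc lin_sm[OF f] mod_sm[OF U])
 assume "y <: (cpy U)"
 then obtain b where b: "b <: U" "y = emb U b" by (auto simp: c)
 show "(cpy_map U V f :: 'w => 'w) (x +[cpy U] y) = cpy_map U V f x +[cpy V] cpy_map U V f y"
  using a b by (simp add: e c fc lin_add[OF f] mod_add[OF U])
qed (simp add: cpy_map_def cpy_def)

subsection \<open>Biproducts of modules\<close>

definition prod_mod :: "('k, 'v) module => ('k, 'v) module => ('k, 'v \<times> 'v) module" where
 "prod_mod V W = \<lparr>carrier = carrier V \<times> carrier W, mult = undefined, one = undefined,
   zero = (0[V], 0[W]), add = (%x y. (fst x +[V] fst y, snd x +[W] snd y)),
   smult = (%c x. (c *[V] fst x, c *[W] snd x))\<rparr>"

lemma prod_mod_sel[simp]: "carrier (prod_mod V W) = carrier V \<times> carrier W" "0[prod_mod V W] = (0[V], 0[W])"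
 "x +[prod_mod V W] y = (fst x +[V] fst y, snd x +[W] snd y)" "c *[prod_mod V W] x = (c *[V] fst x, c *[W] snd x)"
 by (simp_all add: prod_mod_def)

lemma module_prod_mod: assumes V: "module K V" and W: "module K W" shows "module K (prod_mod V W)"
proof (rule mod_inj[where I="UNIV :: bool set" and M="%b. if b then V else W" and ro="%b x. if b then fst x else snd x"])
 fix x y :: "'v \<times> 'v" assume "!!i :: bool. i: UNIV ==> (if i then fst x else snd x) = (if i then fst y else snd y)"
 from this[of True] this[of False] show "x = y" by (simp add: prod_eq_iff)
qed (use V W in "auto simp: md_cl split: if_splits")

text \<open>A biproduct in \<open>kmod\<close> must live on the type of its summands, so the product
  on pairs is moved back by a copy. This is why the type has to admit an injection of its
  square.\<close>

definition sum_mod :: "('k, 'v) module => ('k, 'v) module => ('k, 'v) module" where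
 "sum_mod V W = cpy (prod_mod V W)"

context
 fixes V W :: "('k, 'v) module" and pr :: "'v \<times> 'v => 'v"
 assumes V: "module K V" and W: "module K W" and pr: "inj pr"
begin

lemma prod_emb: "inj_on (emb (prod_mod V W) :: 'v \<times> 'v => 'v) (carrier (prod_mod V W))"
 by (rule emb_inj[OF inj_on_subset[OF pr]]) simp

lemmas sum_cpy = cpy_sel[OF module_prod_mod[OF V W] prod_emb] unemb_emb[OF module_prod_mod[OF V W] prod_emb]
 unemb_in[OF module_prod_mod[OF V W] prod_emb] emb_unemb[OF module_prod_mod[OF V W] prod_emb]
 unemb_add[OF module_prod_mod[OF V W] prod_emb] unemb_sm[OF module_prod_mod[OF V W] prod_emb]

lemma module_sum_mod: "module K (sum_mod V W)"
 unfolding sum_mod_def by (rule module_cpy[OF module_prod_mod[OF V W] prod_emb])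

abbreviation (input) "sum_in v w == emb (prod_mod V W) (v, w) :: 'v"
abbreviation (input) "sum_p1 x == fst (unemb (prod_mod V W) (x :: 'v))"
abbreviation (input) "sum_p2 x == snd (unemb (prod_mod V W) (x :: 'v))"

lemma sum_mod_facts:
 "v <: V ==> w <: W ==> sum_in v w <: (sum_mod V W)"
 "v <: V ==> w <: W ==> sum_p1 (sum_in v w) = v"
 "v <: V ==> w <: W ==> sum_p2 (sum_in v w) = w"
 "x <: (sum_mod V W) ==> sum_p1 x <: V" "x <: (sum_mod V W) ==> sum_p2 x <: W"
 "x <: (sum_mod V W) ==> sum_in (sum_p1 x) (sum_p2 x) = x"
 "x <: (sum_mod V W) ==> y <: (sum_mod V W) ==> sum_p1 (x +[sum_mod V W] y) = sum_p1 x +[V] sum_p1 y"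
 "x <: (sum_mod V W) ==> y <: (sum_mod V W) ==> sum_p2 (x +[sum_mod V W] y) = sum_p2 x +[W] sum_p2 y"
 "x <: (sum_mod V W) ==> c <: K ==> sum_p1 (c *[sum_mod V W] x) = c *[V] sum_p1 x"
 "x <: (sum_mod V W) ==> c <: K ==> sum_p2 (c *[sum_mod V W] x) = c *[W] sum_p2 x"
 "v <: V ==> w <: W ==> v' <: V ==> w' <: W ==>
   sum_in v w +[sum_mod V W] sum_in v' w' = sum_in (v +[V] v') (w +[W] w')"
 "v <: V ==> w <: W ==> c <: K ==> c *[sum_mod V W] sum_in v w = sum_in (c *[V] v) (c *[W] w)"
 using sum_cpy(6)[of x] unfolding sum_mod_def by (simp_all add: sum_cpy(1-5,7-9) mem_Times_iff)

end

lemma kmod_has_biprods: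
 fixes pr :: "'v \<times> 'v => 'v"
 assumes pr: "inj pr"
 shows "kl.has_biprods (kmod K :: ('k, ('k, 'v) module, 'v => 'v) kcat)"
proof -
 interpret Kc: kl K "kmod K :: ('k, ('k, 'v) module, 'v => 'v) kcat" by unfold_locales (rule kmod_klinear)
 show ?thesis unfolding Kc.has_biprods_def
 proof (intro ballI)
  fix V W :: "('k, 'v) module" assume "V: Ob (kmod K)" "W: Ob (kmod K)"
  hence V: "module K V" and W: "module K W" by auto
  note f = sum_mod_facts[OF V W pr] and m = md_cl[OF V] md_cl[OF W] md_eq[OF V] md_eq[OF W]
   and S = module_sum_mod[OF V W pr]
  let ?S = "sum_mod V W"
  let ?i1 = "\<lambda>v\<in>carrier V. emb (prod_mod V W) (v, 0[W]) :: 'v" and ?i2 = "\<lambda>w\<in>carrier W. emb (prod_mod V W) (0[V], w) :: 'v"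
  let ?p1 = "\<lambda>x\<in>carrier ?S. fst (unemb (prod_mod V W) x)" and ?p2 = "\<lambda>x\<in>carrier ?S. snd (unemb (prod_mod V W) x)"
  have l: "?i1: lin K V ?S" "?i2: lin K W ?S" "?p1: lin K ?S V" "?p2: lin K ?S W"
   by (rule linI; simp add: f m md_cl[OF S])+
  have "biprod_like": "compose (carrier V) ?p1 ?i1 = (\<lambda>x\<in>carrier V. x)" "compose (carrier W) ?p2 ?i2 = (\<lambda>x\<in>carrier W. x)"
   "compose (carrier W) ?p1 ?i2 = 0[lin_mod K W V]" "compose (carrier V) ?p2 ?i1 = 0[lin_mod K V W]"
   "compose (carrier ?S) ?i1 ?p1 +[lin_mod K ?S ?S] compose (carrier ?S) ?i2 ?p2 = (\<lambda>x\<in>carrier ?S. x)"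
   by (auto simp: compose_def lin_mod_def fun_eq_iff f m f(6)[simplified])
  thus "EX s i1 i2 p1 p2. Kc.biprod V W s i1 i2 p1 p2" unfolding Kc.biprod_def
   using l S by (intro exI[of _ ?S] exI[of _ ?i1] exI[of _ ?i2] exI[of _ ?p1] exI[of _ ?p2]) simp
 qed
qed

text \<open>Lifts to resolutions are determined only up to homotopy; they act functorially on Hom
  complexes because homotopic maps agree in the derived category of modules. The injection
  \<open>pr\<close> gives the biproducts that \<open>loc_htp\<close> asks for.\<close>

lemma kmod_loc_htp:
 fixes pr :: "'v \<times> 'v => 'v" and X Y :: "(('k, 'v) module, 'v => 'v) cx"
 assumes pr: "inj pr" and XY: "X: Ob CK" "Y: Ob CK" "f: Arr CK X Y" "g: Arr CK X Y"
  and h: "kl.htp (kmod K) X Y f g"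
 shows "loc_arr CK qis_mod X Y f = loc_arr CK qis_mod X Y g"
proof -
 interpret Kc: kl K "kmod K :: ('k, ('k, 'v) module, 'v => 'v) kcat" by unfold_locales (rule kmod_klinear)
 show ?thesis by (rule Kc.loc_htp[OF kmod_has_biprods[OF pr] XY h htp_equiv_qis])
qed

subsection \<open>Copies of complexes of modules\<close>

definition cpy_cx :: "(('k, 'v) module, 'v => 'v) cx => (('k, 'w) module, 'w => 'w) cx" where
 "cpy_cx X = \<lparr>cob = (%n. cpy X$n), cd = (%n. cpy_map X$n X$(n+1) (cd X n))\<rparr>"

lemma cpy_fnc_sel: "om cpy_cx_fnc X = cpy_cx X" "mm cpy_cx_fnc X Y f n = cpy_map X$n Y$n (f n)"
 by (simp_all add: cpy_cx_fnc_def cpy_cx_def)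

lemma cpy_cx_sel[simp]: "(cpy_cx X)$n = cpy X$n" "cd (cpy_cx X) n = cpy_map X$n X$(n+1) (cd X n)"
 by (simp_all add: cpy_cx_def)

context
 fixes j :: "'v => 'w"
 assumes j: "inj j"
begin

lemma emb_all: "inj_on (emb V :: 'v => 'w) (carrier V)"
 by (rule emb_inj[OF inj_on_subset[OF j]]) simp

lemma cpy_cx_ob:
 fixes X :: "(('k, 'v) module, 'v => 'v) cx"
 assumes X: "X: Ob CK"
 shows "(cpy_cx X :: (('k, 'w) module, 'w => 'w) cx): Ob CK"
proof (rule Ch_kmod_obI)
 note m = ck_mod[OF X]
 fix n
 show "module K ((cpy_cx X)$n :: ('k, 'w) module)" by (simp add: module_cpy[OF m emb_all])
 show "(cd (cpy_cx X) n :: 'w => 'w): lin K (cpy_cx X)$n (cpy_cx X)$(n+1)"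
  unfolding cpy_cx_sel by (rule cpy_map_in[OF m m emb_all emb_all ck_d[OF X]])
 fix x :: 'w assume "x <: (cpy_cx X)$n"
 then obtain a where a: "a <: X$n" "x = emb X$n a" by (auto simp: cpy_sel[OF m emb_all])
 show "cd (cpy_cx X) (n+1) (cd (cpy_cx X) n x) = 0[(cpy_cx X)$(n+1+1)]"
  unfolding cpy_cx_sel cpy_sel(4)[OF m emb_all] a(2) cpy_map_emb[OF emb_all a(1)] cpy_map_emb[OF emb_all ck_dcl[OF X a(1)]] ck_dd[OF X a(1)] ..
qed

lemma cpy_cx_arr:
 fixes X Y :: "(('k, 'v) module, 'v => 'v) cx"
 assumes X: "X: Ob CK" and Y: "Y: Ob CK" and f: "f: Arr CK X Y"
 shows "(mm cpy_cx_fnc X Y f :: int => 'w => 'w): Arr CK (cpy_cx X) (cpy_cx Y)"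
proof (rule Ch_kmod_arrI)
 note mX = ck_mod[OF X] and mY = ck_mod[OF Y]
 fix n
 show "(mm cpy_cx_fnc X Y f n :: 'w => 'w): lin K (cpy_cx X)$n (cpy_cx Y)$n"
  unfolding cpy_cx_sel cpy_fnc_sel by (rule cpy_map_in[OF mX mY emb_all emb_all ck_lin[OF f]])
 fix x :: 'w assume "x <: (cpy_cx X)$n"
 then obtain a where a: "a <: X$n" "x = emb X$n a" by (auto simp: cpy_sel[OF mX emb_all])
 thus "cd (cpy_cx Y) n (mm cpy_cx_fnc X Y f n x) = mm cpy_cx_fnc X Y f (n+1) (cd (cpy_cx X) n x)"
  by (simp add: cpy_fnc_sel cpy_map_emb[OF emb_all] ck_cl[OF f] ck_dcl[OF X] ck_comm[OF f])
qed

lemma cpy_functor: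
 shows "is_functor (Ch (kmod K :: ('k, ('k, 'v) module, 'v => 'v) kcat)) (Ch (kmod K :: ('k, ('k, 'w) module, 'w => 'w) kcat)) cpy_cx_fnc"
 unfolding is_functor_def cpy_fnc_sel(1)
proof (intro conjI ballI)
 note c = Ch_kmod_cat
 show "category (Ch (kmod K :: ('k, ('k, 'v) module, 'v => 'v) kcat))" "category (Ch (kmod K :: ('k, ('k, 'w) module, 'w => 'w) kcat))" by (rule c)+
 fix X :: "(('k, 'v) module, 'v => 'v) cx" assume X: "X: Ob CK"
 show "(cpy_cx X :: (('k, 'w) module, 'w => 'w) cx): Ob CK" by (rule cpy_cx_ob[OF X])
 have E: "EX a:carrier X$n. x = emb X$n a" if "x <: (cpy_cx X)$n" for x :: 'w and n
  using that by (auto simp: cpy_sel[OF ck_mod[OF X] emb_all])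
 note e = cpy_map_emb[OF emb_all]
 show "(mm cpy_cx_fnc X X (ide CK X) :: int => 'w => 'w) = ide CK (cpy_cx X)"
  by (rule Ch_kmod_ext[OF cpy_cx_arr[OF X X cat_ide[OF c X]] cat_ide[OF c cpy_cx_ob[OF X]]], drule E) (auto simp: cpy_fnc_sel e cpy_sel(1)[OF ck_mod[OF X] emb_all])
 fix Y :: "(('k, 'v) module, 'v => 'v) cx" and f assume Y: "Y: Ob CK" and f: "f: Arr CK X Y"
 show f': "(mm cpy_cx_fnc X Y f :: int => 'w => 'w): Arr CK (cpy_cx X) (cpy_cx Y)" by (rule cpy_cx_arr[OF X Y f])
 fix Z :: "(('k, 'v) module, 'v => 'v) cx" and g assume Z: "Z: Ob CK" and g: "g: Arr CK Y Z"
 show "(mm cpy_cx_fnc X Z (cmp CK X Y Z g f) :: int => 'w => 'w) =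
   cmp CK (cpy_cx X) (cpy_cx Y) (cpy_cx Z) (mm cpy_cx_fnc Y Z g) (mm cpy_cx_fnc X Y f)"
  by (rule Ch_kmod_ext[OF cpy_cx_arr[OF X Z cat_cmp[OF c X Y Z f g]] cat_cmp[OF c cpy_cx_ob[OF X] cpy_cx_ob[OF Y] cpy_cx_ob[OF Z] f' cpy_cx_arr[OF Y Z g]]], drule E)
    (auto simp: cpy_fnc_sel e compose_def ck_cl[OF f] cpy_sel(1)[OF ck_mod[OF X] emb_all])
qed

lemma cpy_qis:
 fixes X Y :: "(('k, 'v) module, 'v => 'v) cx"
 assumes X: "X: Ob CK" and Y: "Y: Ob CK" and f: "f: Arr CK X Y" and q: "qis_mod X Y f"
 shows "qis_mod (cpy_cx X) (cpy_cx Y) (mm cpy_cx_fnc X Y f :: int => 'w => 'w)"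
 unfolding qis_iff[OF cpy_cx_ob[OF X] cpy_cx_ob[OF Y] cpy_cx_arr[OF X Y f]] cone_acyclic_def
proof (intro allI ballI impI)
 note mX = ck_mod[OF X] and mY = ck_mod[OF Y]
 note cX = cpy_sel[OF mX emb_all] and cY = cpy_sel[OF mY emb_all]
 note e = cpy_map_emb[OF emb_all]
 let ?F = "mm cpy_cx_fnc X Y f :: int => 'w => 'w"
 fix n and y y' :: 'w assume "y <: (cpy_cx X)$(n+1)" "y' <: (cpy_cx Y)$n"
  and h: "cd (cpy_cx X) (n+1) y = 0[(cpy_cx X)$(n+1+1)] & ?F (n+1) y = cd (cpy_cx Y) n y'"
 then obtain a a' where a: "a <: X$(n+1)" "y = emb X$(n+1) a" and a': "a' <: Y$n" "y' = emb Y$n a'"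
  by (auto simp: cX cY)
 have "(emb X$(n+1+1) (cd X (n+1) a) :: 'w) = emb X$(n+1+1) 0[X$(n+1+1)]"
  using conjunct1[OF h] unfolding cpy_cx_sel cX a(2) e[OF a(1)] .
 hence 1: "cd X (n+1) a = 0[X$(n+1+1)]" using inj_onD[OF emb_all] ck_dcl[OF X a(1)] mod_zero[OF mX] by blast
 have "(emb Y$(n+1) (f (n+1) a) :: 'w) = emb Y$(n+1) (cd Y n a')"
  using conjunct2[OF h] unfolding cpy_cx_sel cpy_fnc_sel a(2) a'(2) e[OF a(1)] e[OF a'(1)] .
 hence 2: "f (n+1) a = cd Y n a'" using inj_onD[OF emb_all] ck_cl[OF f a(1)] ck_dcl[OF Y a'(1)] by blast
 obtain z z' where z: "z <: X$n" "z' <: Y$(n-1)" "cd X n z = a" "a' = f n z +[Y$n] cd Y (n-1) z'"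
  using q[unfolded qis_iff[OF X Y f] cone_acyclic_def, rule_format, OF a(1) a'(1) conjI[OF 1 2]] by blast
 have d: "cd Y (n-1) z' <: Y$n" using ck_dcl[OF Y z(2)] by simp
 show "EX z:carrier (cpy_cx X)$n. EX z':carrier (cpy_cx Y)$(n-1).
   cd (cpy_cx X) n z = y & y' = ?F n z +[(cpy_cx Y)$n] cd (cpy_cx Y) (n-1) z'"
  by (rule bexI[of _ "emb X$n z"], rule bexI[of _ "emb Y$(n-1) z'"])
   (use z d a a' ck_cl[OF f z(1)] in "simp_all add: cpy_fnc_sel e cX cY")
qed

end

end

subsection \<open>Yoneda bifunctors\<close>

text \<open>Induction on the support. Through the surjection \<mu>, claims about elements of T(a, b)
  reduce in this way to claims about arrows a -> b.\<close>

lemma (in gf) free_span: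
 assumes fi: "fi <: (free_mod K S)"
  and z: "P (%s. \<zero>)" and b: "!!s. s: S ==> P (free_basis K s)"
  and a: "!!fi sy. fi <: (free_mod K S) ==> sy <: (free_mod K S) ==> P fi ==> P sy ==> P (fi +[free_mod K S] sy)"
  and s: "!!c fi. c <: K ==> fi <: (free_mod K S) ==> P fi ==> P (c *[free_mod K S] fi)"
 shows "P fi"
proof -
 have "finite {s. fi s \<noteq> \<zero>}" using fi by (simp add: free_mod_def)
 thus ?thesis using fi
 proof (induction "{s. fi s \<noteq> \<zero>}" arbitrary: fi rule: finite_induct)
  case empty
  hence "fi = (%s. \<zero>)" by auto
  thus ?case using z by simp
 next
  case (insert t A)
  have t: "t: S" using insert by (auto simp: free_mod_def)
  let ?sy = "fi(t := \<zero>)"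
  have A: "A = {s. ?sy s \<noteq> \<zero>}" using insert by auto
  have fin: "finite {s. ?sy s \<noteq> \<zero>}" unfolding A[symmetric] by (rule insert(1))
  have sy: "?sy <: (free_mod K S)" using insert fin by (auto simp: free_mod_def)
  have ft: "fi t <: K" using insert t by (auto simp: free_mod_def)
  have bt: "free_basis K t <: (free_mod K S)" using t by (auto simp: free_mod_def free_basis_def)
  have ct: "fi t *[free_mod K S] free_basis K t <: (free_mod K S)"
   using t ft by (auto simp: free_mod_def free_basis_def)
  have "fi = ?sy +[free_mod K S] fi t *[free_mod K S] free_basis K t"
  proof
   fix s show "fi s = (?sy +[free_mod K S] fi t *[free_mod K S] free_basis K t) s"
    using insert(5) ft by (cases "s: S") (auto simp: free_mod_def free_basis_def)
  qed
  thus ?case using a[OF sy ct insert(3)[OF A sy] s[OF ft bt b[OF t]]] by simp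
 qed
qed

locale yon = gf K for K :: "'k ring" (structure) +
 fixes C :: "('k, 'o, 'm) kcat" and T :: "('k, 'o \<times> 'o, 'm \<times> 'm, 'u) mfnc" and \<mu> :: "'o \<times> 'o => ('m => 'k) => 'u"
  and \<epsilon> :: "('k + 'o + 'm + nat) set => 'u"
 assumes klC: "klinear_category K C" and yb: "yoneda_bifunctor K C T \<mu>" and eps: "inj \<epsilon>"
begin

abbreviation "NM == nat_mod K C"

lemmas C_cat = kl_cat[OF klC]
lemmas C_eq = cat_ide[OF C_cat] cat_cmp[OF C_cat] cat_idl[OF C_cat] cat_idr[OF C_cat]

abbreviation "nt F H == nat_trans K C F H"
abbreviation "Th == std C T"
abbreviation "isf F == is_functor C (kmod K) F"
text \<open>The universal element of T_a, at which the Yoneda map evaluates a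
  transformation.\<close>

abbreviation "u a == \<mu> (a, a) (free_basis K (ide C a))"
abbreviation "cc F G H == cmp (cmod K C) F G H"

lemma TF: "is_functor (prod_cat (op_cat C) C) (kmod K) T"
 and Tmu: "\<mu>: nat_trans K (prod_cat (op_cat C) C) (free_hom K C) T"
 using yb unfolding yoneda_bifunctor_def by blast+

lemma free_map_basis:
 assumes "h: S" shows "free_map K S g (free_basis K h) = free_basis K (g h)"
proof -
 have b: "free_basis K h <: (free_mod K S)" using assms by (auto simp: free_mod_def free_basis_def)
 have "finsum K (free_basis K h) {s: S. free_basis K h s \<noteq> \<zero> & g s = t} = free_basis K (g h) t" for t
 proof -
  have "{s: S. free_basis K h s \<noteq> \<zero> & g s = t} = (if g h = t then {h} else {})" using assms by (auto simp: free_basis_def)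
  thus ?thesis by (simp add: free_basis_def)
 qed
 thus ?thesis using b by (simp add: free_map_def)
qed

definition "te a b h = \<mu> (a, b) (free_basis K h)"

lemma mu_lin: "a: Ob C ==> b: Ob C ==> \<mu> (a, b): lin K (free_mod K (Arr C a b)) (om T (a, b))"
 using nt_lin[OF Tmu, of "(a, b)"] by (simp add: free_hom_def)

lemma basis_in: "h: S ==> free_basis K h <: (free_mod K S)"
 by (auto simp: free_mod_def free_basis_def)

lemma te_in: "a: Ob C ==> b: Ob C ==> h: Arr C a b ==> te a b h <: (om T (a, b))"
 unfolding te_def by (rule lin_cl[OF mu_lin basis_in])

lemma te_nat:
 assumes "a: Ob C" "b: Ob C" "a': Ob C" "b': Ob C" "h: Arr C a b" "f: Arr C a' a" "g: Arr C b b'"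
 shows "mm T (a, b) (a', b') (f, g) (te a b h) = te a' b' (cmp C a' b b' g (cmp C a' a b h f))"
 using nt_nat[OF Tmu, of "(a, b)" "(a', b')" "(f, g)" "free_basis K h"] assms
 by (simp add: te_def free_hom_def basis_in free_map_basis)

lemma te_u: "te a a (ide C a) = u a" by (simp add: te_def)

lemma u_in: "a: Ob C ==> u a <: (om T (a, a))"
 using te_in[of a a "ide C a"] C_eq(1) by (simp add: te_def)

lemma std_sel[simp]: "om (Th a) x = om T (a, x)" "mm (Th a) x y g = mm T (a, x) (a, y) (ide C a, g)"
 by (simp_all add: std_def)

lemma std_isf: "a: Ob C ==> isf (Th a)"
proof (rule mfI)
 assume a: "a: Ob C"
 show "category C" by (rule C_cat)
 show "x: Ob C ==> y: Ob C ==> z: Ob C ==> f: Arr C x y ==> g: Arr C y z ==> v <: (om (Th a) x) ==>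
   mm (Th a) x z (cmp C x y z g f) v = mm (Th a) y z g (mm (Th a) x y f v)" for x y z f g v
  using mf_cmp[OF TF, of "(a, x)" "(a, y)" "(a, z)" "(ide C a, f)" "(ide C a, g)" v] a C_eq by simp
qed (use mf_mod[OF TF] mf_lin[OF TF] mf_ide[OF TF, of "(a, x)" for x] C_eq in auto)

lemma std_map_nt:
 assumes "x: Ob C" "y: Ob C" "f: Arr C y x"
 shows "std_map C T x y f: nt (Th x) (Th y)"
proof (rule ntI)
 show "z: Ob C ==> std_map C T x y f z: lin K (om (Th x) z) (om (Th y) z)" for z
  using mf_lin[OF TF, of "(x, z)" "(y, z)" "(f, ide C z)"] assms C_eq by (simp add: std_map_def)
 fix z w g v assume z: "z: Ob C" "w: Ob C" "g: Arr C z w" "v <: (om (Th x) z)"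
 show "std_map C T x y f w (mm (Th x) z w g v) = mm (Th y) z w g (std_map C T x y f z v)"
  using mf_cmp[OF TF, of "(x, z)" "(x, w)" "(y, w)" "(ide C x, g)" "(f, ide C w)" v]
   mf_cmp[OF TF, of "(x, z)" "(y, z)" "(y, w)" "(f, ide C z)" "(ide C y, g)" v] assms z C_eq by (simp add: std_map_def)
qed (simp add: std_map_def)

lemma std_u: "a: Ob C ==> b: Ob C ==> h: Arr C a b ==> mm (Th a) a b h (u a) = te a b h"
 using te_nat[of a a a b "ide C a" "ide C a" h] C_eq by (simp add: te_u)

lemma std_map_u: "x: Ob C ==> y: Ob C ==> f: Arr C y x ==> std_map C T x y f x (u x) = te y x f"
 using te_nat[of x x y x "ide C x" f "ide C x"] C_eq by (simp add: te_u std_map_def)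

text \<open>Since \<mu> is onto, T(a, b) is spanned by the elements T_a(h)(u a) with h: a -> b, and
  naturality determines a transformation on these from its value at \<open>u a\<close>.\<close>

lemma yon_uniq:
 assumes a: "a: Ob C" and F: "isf F" and th: "th: nt (Th a) F" "th': nt (Th a) F" and e: "th a (u a) = th' a (u a)"
 shows "th = th'"
proof (rule nt_ext[OF th])
 fix b t assume b: "b: Ob C" and "t <: (om (Th a) b)"
 then obtain fi where fi: "fi <: (free_mod K (Arr C a b))" "t = \<mu> (a, b) fi"
 proof -
  have "\<mu> (a, b) ` carrier (om (free_hom K C) (a, b)) = carrier (om T (a, b))"
   using yb a b unfolding yoneda_bifunctor_def by blast
  hence "\<mu> (a, b) ` carrier (free_mod K (Arr C a b)) = carrier (om T (a, b))" by (simp add: free_hom_def)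
  with \<open>t <: (om (Th a) b)\<close> that show thesis by (metis imageE std_sel(1))
 qed
 note l = mu_lin[OF a b] and F1 = mf_mod[OF F b]
 have z: "(%s. \<zero>) = \<zero> *[free_mod K (Arr C a b)] fi" "\<zero> <: K"
 proof -
  have "fi s <: K" for s using fi(1) by (cases "s: Arr C a b") (auto simp: free_mod_def)
  thus "(%s. \<zero>) = \<zero> *[free_mod K (Arr C a b)] fi" by (simp add: free_mod_def)
 qed simp
 have "th b (\<mu> (a, b) fi) = th' b (\<mu> (a, b) fi)"
 proof (rule free_span[OF fi(1)])
  show "th b (\<mu> (a, b) (%s. \<zero>)) = th' b (\<mu> (a, b) (%s. \<zero>))"
   unfolding z lin_sm[OF l z(2) fi(1)]
   using nt_sm[OF th(1) b, of "\<mu> (a, b) fi" \<zero>] nt_sm[OF th(2) b, of "\<mu> (a, b) fi" \<zero>] lin_cl[OF l fi(1)]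
    nt_cl[OF th(1) b] nt_cl[OF th(2) b] by (simp add: mod_0s[OF F1])
  fix h assume h: "h: Arr C a b"
  have "th b (te a b h) = th' b (te a b h)"
   using nt_nat[OF th(1) a b h, of "u a"] nt_nat[OF th(2) a b h, of "u a"] u_in[OF a] e std_u[OF a b h] by simp
  thus "th b (\<mu> (a, b) (free_basis K h)) = th' b (\<mu> (a, b) (free_basis K h))" by (simp add: te_def)
 qed (use nt_add[OF th(1) b] nt_add[OF th(2) b] nt_sm[OF th(1) b] nt_sm[OF th(2) b] lin_cl[OF l] in "auto simp: lin_add[OF l] lin_sm[OF l]")
 thus "th b t = th' b t" using fi by simp
qed

text \<open>Evaluation at \<open>u a\<close> from Hom(T_a, F) to F(a) is onto, hence bijective by
  \<open>yon_uniq\<close>. These functors turn out to be exactly the objects of C_T-mod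
  (\<open>tmod_ob\<close>), and membership is tested in this form from then on. The value type is
  arbitrary so that the notion does not depend on 'u.\<close>

definition good :: "('k, 'o, 'm, 'w) mfnc => bool" where
 "good F \<longleftrightarrow> isf F & (ALL a:Ob C. ALL v:carrier (om F a). EX th:nt (Th a) F. th a (u a) = v)"

definition yo :: "('k, 'o, 'm, 'w) mfnc => 'o => 'w => 'o => 'u => 'w" where
 "yo F a v = (SOME th. th: nt (Th a) F & th a (u a) = v)"

lemma yo:
 assumes "good F" "a: Ob C" "v <: (om F a)"
 shows yo_nt: "yo F a v: nt (Th a) F" and yo_u: "yo F a v a (u a) = v"
proof -
 have "EX th. th: nt (Th a) F & th a (u a) = v" using assms unfolding good_def by blast
 from someI_ex[OF this] show "yo F a v: nt (Th a) F" "yo F a v a (u a) = v" unfolding yo_def by auto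
qed

lemma good_isf: "good F ==> isf F" by (simp add: good_def)

lemma yo_eq: "good F ==> a: Ob C ==> th: nt (Th a) F ==> th a (u a) = v ==> yo F a v = th"
 using yon_uniq[of a F "yo F a v" th] yo[of F a v] nt_cl[of th C "Th a" F a "u a"] u_in[of a] by (auto simp: good_isf)

lemma cc_app: "x: Ob C ==> v <: (om F x) ==> cc F G H th et x v = th x (et x v)" by simp

lemma yo_comp:
 assumes F: "good F" and G: "good H" and a: "a: Ob C" and v: "v <: (om F a)" and e: "et: nt F H" and x: "x: Ob C" "t <: (om T (a, x))"
 shows "et x (yo F a v x t) = yo H a (et a v) x t"
proof -
 let ?c = "\<lambda>x\<in>Ob C. compose (carrier (om T (a, x))) (et x) (yo F a v x)"
 have "?c: nt (Th a) H"
  by (rule ntI) (use nt_lin[OF yo_nt[OF F a v]] nt_lin[OF e] mf_mod[OF std_isf[OF a]] nt_cl[OF yo_nt[OF F a v]]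
   nt_nat[OF e] nt_nat[OF yo_nt[OF F a v]] mf_cl[OF std_isf[OF a]] in \<open>auto intro: lin_comp simp: compose_def\<close>,
   use nt_lin[OF yo_nt[OF F a v]] nt_lin[OF e] mf_mod[OF std_isf[OF a]] lin_comp in "fastforce simp: compose_def")
 moreover have "?c a (u a) = et a v" using a u_in[OF a] by (simp add: compose_def yo_u[OF F a v])
 ultimately have "yo H a (et a v) = ?c" by (intro yo_eq[OF G a])
 thus ?thesis using x by (simp add: compose_def)
qed

text \<open>This is the surjectivity of Hom(T_b, T_a) -> T(a, b) in the last axiom of a Yoneda
  bifunctor.\<close>

lemma std_good: "a: Ob C ==> good (Th a)"
 unfolding good_def
proof (intro conjI ballI)
 assume a: "a: Ob C"
 show "isf (Th a)" by (rule std_isf[OF a])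
 fix b v assume b: "b: Ob C" and v: "v <: (om (Th a) b)"
 have "lin_iso K (homm (cmod K C) (Th b) (Th a)) (om T (a, b)) (\<lambda>F\<in>Arr (cmod K C) (Th b) (Th a). F b (u b))"
  using yb a b unfolding yoneda_bifunctor_def by blast
 hence "(\<lambda>F\<in>nt (Th b) (Th a). F b (u b)) ` nt (Th b) (Th a) = carrier (om T (a, b))"
  unfolding lin_iso_def bij_betw_def by simp
 thus "EX th:nt (Th b) (Th a). th b (u b) = v" using v by (metis (no_types, lifting) imageE restrict_apply' std_sel(1))
qed

section \<open>Subfunctors, and stability of the Yoneda property under limits and colimits\<close>

definition subf :: "('k, 'o, 'm, 'w) mfnc => ('o => 'w set) => ('k, 'o, 'm, 'w) mfnc" where
 "subf F N = \<lparr>om = (%x. (om F x)\<lparr>carrier := N x\<rparr>), mm = (%x y f. restrict (mm F x y f) (N x))\<rparr>"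

definition incl :: "('o => 'w set) => 'o => 'w => 'w" where
 "incl N = (\<lambda>x\<in>Ob C. \<lambda>v\<in>N x. v)"

lemma subf_sel[simp]: "carrier (om (subf F N) x) = N x" "0[om (subf F N) x] = 0[om F x]"
 "v +[om (subf F N) x] w = v +[om F x] w" "c *[om (subf F N) x] v = c *[om F x] v"
 "v: N x ==> mm (subf F N) x y f v = mm F x y f v" "v \<notin> N x ==> mm (subf F N) x y f v = undefined"
 by (simp_all add: subf_def)

lemma subf:
 assumes F: "isf F" and N: "!!x. x: Ob C ==> N x <= carrier (om F x)" "!!x. x: Ob C ==> 0[om F x]: N x"
  "!!x v w. x: Ob C ==> v: N x ==> w: N x ==> v +[om F x] w: N x"
  "!!x v c. x: Ob C ==> v: N x ==> c <: K ==> c *[om F x] v: N x"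
  "!!x y f v. x: Ob C ==> y: Ob C ==> f: Arr C x y ==> v: N x ==> mm F x y f v: N y"
 shows subf_isf: "isf (subf F N)" and incl_nt: "incl N: nt (subf F N) F"
proof -
 have s: "x: Ob C ==> v: N x ==> v <: (om F x)" for x v using N(1) by blast
 show "isf (subf F N)"
 proof (rule mfI)
  show "category C" by (rule C_cat)
  fix x assume x: "x: Ob C"
  note m = mf_mod[OF F x]
  show "module K (om (subf F N) x)"
   by (rule mod_inj[where I="UNIV :: unit set" and M="%_. om F x" and ro="%_ x. x"]) (use x m N s in auto)
  fix y f assume y: "y: Ob C" "f: Arr C x y"
  show "mm (subf F N) x y f: lin K (om (subf F N) x) (om (subf F N) y)"
   by (rule linI) (use x y N s in "auto simp: lin_add[OF mf_lin[OF F]] lin_sm[OF mf_lin[OF F]]")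
 qed (use N s C_eq in "auto simp: mf_ide[OF F] mf_cmp[OF F]")
 show "incl N: nt (subf F N) F"
  by (rule ntI) (use N s in "auto simp: incl_def intro!: linI")
qed

lemma cc_nt: "isf F ==> et: nt F G ==> th: nt G H ==> cc F G H th et: nt F H"
 by (rule cmod_cmp)

text \<open>The elements killed by all projections form a subfunctor N of L. Its inclusion into L
  and the zero map induce the same cone, so they coincide and N is zero. This avoids constructing
  the limit objectwise.\<close>

lemma limit_joint_mono:
 fixes L :: "('k, 'o, 'm, 'w) mfnc"
 assumes L: "is_limit (cmod K C) J G L pj" and a: "a: Ob C" and v: "v <: (om L a)" "w <: (om L a)"
  and G: "!!j. j: Ob J ==> isf (om G j)"
  and e: "!!j. j: Ob J ==> pj j a v = pj j a w"
 shows "v = w"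
proof -
 have c: "is_cone (cmod K C) J G L pj" using L by (simp add: is_limit_def)
 hence Lf: "isf L" and p: "!!j. j: Ob J ==> pj j: nt L (om G j)" by (auto simp: is_cone_def)
 have cn: "!!i j m. i: Ob J ==> j: Ob J ==> m: Arr J i j ==> cc L (om G i) (om G j) (mm G i j m) (pj i) = pj j"
  using c by (auto simp: is_cone_def)
 note m = mf_mod[OF Lf] and mG = mf_mod[OF G]
 note pl = lin_0[OF m mG nt_lin[OF p]] lin_neg[OF m mG nt_lin[OF p]]
 define N where "N x = {l: carrier (om L x). ALL j:Ob J. pj j x l = 0[om (om G j) x]}" for x
 have N: "isf (subf L N)" "incl N: nt (subf L N) L"
  by (rule subf[OF Lf]; auto simp: N_def md_cl[OF m] pl nt_add[OF p] nt_sm[OF p] md_eq[OF mG] md_cl[OF mG] mf_cl[OF Lf] nt_nat[OF p]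
    mod_s0[OF mG] lin_0[OF mf_mod[OF G] mf_mod[OF G] mf_lin[OF G]])+
 let ?z = "0[NM (subf L N) L]"
 have z: "?z: nt (subf L N) L" using mod_zero[OF module_nat_mod[OF N(1) Lf]] by simp
 let ?ro = "%j. cc (subf L N) L (om G j) (pj j) (incl N)"
 have r: "j: Ob J ==> ?ro j: nt (subf L N) (om G j)" for j by (rule cc_nt[OF N p])
 have "is_cone (cmod K C) J G (subf L N) ?ro" unfolding is_cone_def
 proof (intro conjI ballI)
  fix i j m assume o: "i: Ob J" "j: Ob J" "m: Arr J i j"
  show "cc (subf L N) (om G i) (om G j) (mm G i j m) (?ro i) = ?ro j"
  proof (rule ext, rule ext)
   fix x y show "cc (subf L N) (om G i) (om G j) (mm G i j m) (?ro i) x y = ?ro j x y"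
    using fun_cong[OF fun_cong[OF cn[OF o]], of x "incl N x y"] nt_cl[OF N(2), of x y]
    by (auto simp: cmod_def compose_def restrict_def)
  qed
 qed (use N r in auto)
 hence ex: "EX! h. h: nt (subf L N) L & (ALL j:Ob J. cc (subf L N) L (om G j) (pj j) h = ?ro j)"
  using L unfolding is_limit_def by simp
 have zz: "cc (subf L N) L (om G j) (pj j) ?z = ?ro j" if j: "j: Ob J" for j
  by (rule nt_ext[OF cc_nt[OF N(1) z p[OF j]] r[OF j]]) (use j in "auto simp: pl incl_def N_def")
 have eq: "incl N = ?z" by (rule ex1E[OF ex]) (metis N(2) z zz)
 let ?d = "v +[om L a] -[om L a] w"
 have "pj j a ?d = 0[om (om G j) a]" if j: "j: Ob J" for j
  using a v e[OF j] by (simp add: nt_add[OF p[OF j]] mod_neg[OF m] pl j mod_nr[OF mG[OF j]] nt_cl[OF p[OF j]])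
 hence "?d: N a" using a v by (simp add: N_def md_cl[OF m])
 hence "?d = 0[om L a]" using fun_cong[OF fun_cong[OF eq], of a ?d] a by (simp add: incl_def)
 thus "v = w" using v mod_move[OF m[OF a], of v "-[om L a] w" "0[om L a]"] by (simp add: md_cl[OF m[OF a]] md_eq[OF m[OF a]])
qed

text \<open>The Yoneda maps of the components of v form a cone on T_a by uniqueness. The induced T_a
  -> L sends \<open>u a\<close> to v because the projections are jointly injective.\<close>

lemma good_limit:
 fixes L :: "('k, 'o, 'm, 'u) mfnc"
 assumes L: "is_limit (cmod K C) J G L pj" and G: "is_functor J (cmod K C) G" "!!j. j: Ob J ==> good (om G j)"
 shows "good L"
proof -
 have c: "is_cone (cmod K C) J G L pj" using L by (simp add: is_limit_def)
 hence Lf: "isf L" and p: "!!j. j: Ob J ==> pj j: nt L (om G j)" by (auto simp: is_cone_def)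
 have cn: "!!i j m. i: Ob J ==> j: Ob J ==> m: Arr J i j ==> cc L (om G i) (om G j) (mm G i j m) (pj i) = pj j"
  using c by (auto simp: is_cone_def)
 have Gm: "i: Ob J ==> j: Ob J ==> m: Arr J i j ==> mm G i j m: nt (om G i) (om G j)" for i j m
  using fnc_arr[OF G(1)] by simp
 show ?thesis unfolding good_def
 proof (intro conjI ballI Lf)
  fix a v assume a: "a: Ob C" and v: "v <: (om L a)"
  let ?ro = "%j. yo (om G j) a (pj j a v)"
  have pv: "j: Ob J ==> pj j a v <: (om (om G j) a)" for j using nt_cl[OF p a v] .
  note y = yo_nt[OF G(2) a pv] and yu = yo_u[OF G(2) a pv]
  have "is_cone (cmod K C) J G (Th a) ?ro" unfolding is_cone_def
  proof (intro conjI ballI)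
   fix i j m assume o: "i: Ob J" "j: Ob J" "m: Arr J i j"
   have "cc L (om G i) (om G j) (mm G i j m) (pj i) a v = pj j a v" using cn[OF o] by simp
   thus "cc (Th a) (om G i) (om G j) (mm G i j m) (?ro i) = ?ro j"
    using o a v u_in[OF a] by (intro yo_eq[OF G(2) a, symmetric] cc_nt[OF std_isf[OF a] y Gm]) (auto simp: yu)
  qed (use a std_isf y in auto)
  then obtain h where h: "h: nt (Th a) L" "!!j. j: Ob J ==> cc (Th a) L (om G j) (pj j) h = ?ro j"
   using L unfolding is_limit_def by (auto dest!: spec)
  have "h a (u a) = v"
  proof (rule limit_joint_mono[OF L a nt_cl[OF h(1) a] v good_isf[OF G(2)]])
   fix j assume j: "j: Ob J"
   show "pj j a (h a (u a)) = pj j a v" using fun_cong[OF fun_cong[OF h(2)[OF j]], of a "u a"] yu[OF j] j a u_in[OF a] by simp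
  qed (use u_in[OF a] in auto)
  thus "EX th:nt (Th a) L. th a (u a) = v" using h by blast
 qed
qed

text \<open>Maps out of T_x can be added and multiplied by scalars, and for f: x -> y precomposition
  with \<open>std_map\<close>: T_y -> T_x turns a map that hits v into one that hits F(f) v. So the
  elements that are hit form a subfunctor.\<close>

lemma good_part_sub:
 fixes F :: "('k, 'o, 'm, 'u) mfnc"
 assumes F: "isf F"
 defines "N == %x. {v: carrier (om F x). EX th:nt (Th x) F. th x (u x) = v}"
 shows "isf (subf F N)" "incl N: nt (subf F N) F"
proof -
 note m = mf_mod[OF F]
 have *: "x: Ob C ==> N x <= carrier (om F x)" "x: Ob C ==> 0[om F x]: N x"
  "x: Ob C ==> v: N x ==> w: N x ==> v +[om F x] w: N x"
  "x: Ob C ==> v: N x ==> c <: K ==> c *[om F x] v: N x"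
  "x: Ob C ==> y: Ob C ==> f: Arr C x y ==> v: N x ==> mm F x y f v: N y" for x y f v w c
 proof -
  assume x: "x: Ob C"
  note M = module_nat_mod[OF std_isf[OF x] F] and ux = u_in[OF x] and mx = m[OF x]
  show "N x <= carrier (om F x)" by (auto simp: N_def)
  show "0[om F x]: N x" using mod_zero[OF M] mod_zero[OF mx] x ux by (auto simp: N_def intro!: bexI[of _ "0[NM (Th x) F]"])
  show "v +[om F x] w: N x" if vw: "v: N x" "w: N x"
  proof -
   obtain th th' where t: "th: nt (Th x) F" "th x (u x) = v" "th': nt (Th x) F" "th' x (u x) = w" using vw by (auto simp: N_def)
   show ?thesis using mod_add[OF M, of th th'] t x ux vw mod_add[OF mx] by (auto simp: N_def intro!: bexI[of _ "th +[NM (Th x) F] th'"])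
  qed
  show "c *[om F x] v: N x" if vw: "v: N x" "c <: K"
  proof -
   obtain th where t: "th: nt (Th x) F" "th x (u x) = v" using vw by (auto simp: N_def)
   show ?thesis using mod_sm[OF M vw(2), of th] t x ux vw mod_sm[OF mx] by (auto simp: N_def intro!: bexI[of _ "c *[NM (Th x) F] th"])
  qed
  assume y: "y: Ob C" and f: "f: Arr C x y" and v: "v: N x"
  obtain th where t: "th: nt (Th x) F" "th x (u x) = v" using v by (auto simp: N_def)
  have s: "std_map C T y x f: nt (Th y) (Th x)" by (rule std_map_nt[OF y x f])
  have "cc (Th y) (Th x) F th (std_map C T y x f) y (u y) = mm F x y f v"
   using std_map_u[OF y x f] std_u[OF x y f] nt_nat[OF t(1) x y f, of "u x"] t(2) ux u_in[OF y] y by simp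
  thus "mm F x y f v: N y" using cc_nt[OF std_isf[OF y] s t(1)] mf_cl[OF F x y f] v by (auto simp: N_def)
 qed
 show "isf (subf F N)" "incl N: nt (subf F N) F" by (rule subf[OF F *]; assumption)+
qed

text \<open>The cocone lands in the subfunctor of elements hit by some T_x, hence L maps to that
  subfunctor. Followed by the inclusion this is the identity of L by uniqueness, so every element is
  hit.\<close>

lemma good_colimit:
 fixes L :: "('k, 'o, 'm, 'u) mfnc"
 assumes L: "is_colimit (cmod K C) J G L it" and G: "is_functor J (cmod K C) G" "!!j. j: Ob J ==> good (om G j)"
 shows "good L"
proof -
 have c: "is_cone (op_cat (cmod K C)) (op_cat J) (op_fnc G) L it" using L by (simp add: is_limit_def is_colimit_def)
 hence F: "isf L" and p: "!!j. j: Ob J ==> it j: nt (om G j) L" by (auto simp: is_cone_def op_fnc_def)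
 have cn: "!!i j m. i: Ob J ==> j: Ob J ==> m: Arr J i j ==> cc (om G i) (om G j) L (it j) (mm G i j m) = it i"
  using c by (auto simp: is_cone_def op_fnc_def)
 have Gm: "i: Ob J ==> j: Ob J ==> m: Arr J i j ==> mm G i j m: nt (om G i) (om G j)" for i j m
  using fnc_arr[OF G(1)] by simp
 define N where "N x = {v: carrier (om L x). EX th:nt (Th x) L. th x (u x) = v}" for x
 have N: "isf (subf L N)" "incl N: nt (subf L N) L" using good_part_sub[OF F] unfolding N_def by auto
 have iN: "it j x v: N x" if "j: Ob J" "x: Ob C" "v <: (om (om G j) x)" for j x v
  using yo_u[OF G(2)[OF that(1)] that(2,3)] cc_nt[OF std_isf[OF that(2)] yo_nt[OF G(2)[OF that(1)] that(2,3)] p[OF that(1)]] that nt_cl[OF p] u_in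
  by (auto simp: N_def intro!: bexI[of _ "cc (Th x) (om G j) L (it j) (yo (om G j) x v)"])
 have i': "it j: nt (om G j) (subf L N)" if j: "j: Ob J" for j
 proof (rule ntI)
  show "x \<notin> Ob C ==> it j x = undefined" for x using nt_und[OF p[OF j]] .
  show "it j x: lin K (om (om G j) x) (om (subf L N) x)" if x: "x: Ob C" for x
   by (rule linI) (simp_all add: iN[OF j x] lin_add[OF nt_lin[OF p[OF j] x]] lin_sm[OF nt_lin[OF p[OF j] x]] lin_undef[OF nt_lin[OF p[OF j] x]])
 qed (simp add: iN[OF j] nt_nat[OF p[OF j]])
 have "is_cone (op_cat (cmod K C)) (op_cat J) (op_fnc G) (subf L N) it" unfolding is_cone_def
 proof (intro conjI ballI)
  fix i j m assume "i: Ob (op_cat J)" "j: Ob (op_cat J)" "m: Arr (op_cat J) i j"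
  hence o: "j: Ob J" "i: Ob J" "m: Arr J j i" by auto
  have "cc (om G j) (om G i) (subf L N) (it i) (mm G j i m) = cc (om G j) (om G i) L (it i) (mm G j i m)"
   by (simp add: cmod_def)
  thus "cmp (op_cat (cmod K C)) (subf L N) (om (op_fnc G) i) (om (op_fnc G) j) (mm (op_fnc G) i j m) (it i) = it j"
   using cn[OF o] by (simp add: op_fnc_def)
 qed (use N i' in "auto simp: op_fnc_def")
 then obtain h where h: "h: nt L (subf L N)" "!!j. j: Ob J ==> cc (om G j) L (subf L N) h (it j) = it j"
  using L unfolding is_colimit_def is_limit_def by (auto simp: op_fnc_def dest!: spec)
 have "EX! h. h: nt L L & (ALL j:Ob J. cc (om G j) L L h (it j) = it j)"
  using L unfolding is_colimit_def is_limit_def by (auto simp: op_fnc_def)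
 moreover have "ide (cmod K C) L: nt L L" by (rule cmod_ide[OF F])
 moreover have "cc (om G j) L L (ide (cmod K C) L) (it j) = it j" if j: "j: Ob J" for j
  using nt_ext[OF cc_nt[OF good_isf[OF G(2)[OF j]] p[OF j] cmod_ide[OF F]] p[OF j]] nt_cl[OF p[OF j]] by simp
 moreover have hi: "cc L (subf L N) L (incl N) h: nt L L" by (rule cc_nt[OF F h(1) N(2)])
 moreover have "cc (om G j) L L (cc L (subf L N) L (incl N) h) (it j) = it j" if j: "j: Ob J" for j
 proof (rule nt_ext[OF cc_nt[OF good_isf[OF G(2)[OF j]] p[OF j] hi] p[OF j]])
  fix x v assume x: "x: Ob C" "v <: (om (om G j) x)"
  have "h x (it j x v) = it j x v" using fun_cong[OF fun_cong[OF h(2)[OF j]], of x v] x by simp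
  thus "cc (om G j) L L (cc L (subf L N) L (incl N) h) (it j) x v = it j x v"
   using x nt_cl[OF p[OF j]] iN[OF j] by (simp add: incl_def)
 qed
 ultimately have eq: "cc L (subf L N) L (incl N) h = ide (cmod K C) L" by blast
 have "v: N x" if x: "x: Ob C" "v <: (om L x)" for x v
  using fun_cong[OF fun_cong[OF eq], of x v] x nt_cl[OF h(1) x] by (simp add: incl_def)
 thus ?thesis using F unfolding good_def N_def by blast
qed

lemma tmod_sub: "Ob (tmod K C T) <= {F. good F}"
proof -
 have "lim_colim_stable K C {F :: ('k, 'o, 'm, 'u) mfnc. good F}"
  unfolding lim_colim_stable_def using good_limit good_colimit by fastforce
 moreover have "{F. good F} <= Ob (cmod K C)" using good_isf by auto
 ultimately have "{F :: ('k, 'o, 'm, 'u) mfnc. good F}: {S. S <= Ob (cmod K C) & (ALL a:Ob C. Th a: S) & lim_colim_stable K C S}"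
  using std_good by blast
 thus ?thesis unfolding tmod_def by auto
qed

subsection \<open>Cardinality of the universe\<close>

text \<open>The sets named by \<epsilon> include one for every natural number, so 'u is infinite,
  and an infinite type has the cardinality of its square.\<close>

lemma inj_pr: "EX p :: 'u \<times> 'u => 'u. inj p"
proof -
 have "infinite (UNIV :: 'u set)"
 proof
  assume "finite (UNIV :: 'u set)"
  hence "finite (UNIV :: ('k + 'o + 'm + nat) set set)" using eps by (rule finite_imageD[OF finite_subset[OF subset_UNIV]])
  moreover have "inj (%n :: nat. {Inr (Inr (Inr n))} :: ('k + 'o + 'm + nat) set)" by (auto intro: injI)
  ultimately show False by (metis finite_UNIV_inj_surj infinite_UNIV_nat finite_imageD finite_subset subset_UNIV)
 qed
 hence "(card_of (UNIV \<times> UNIV :: ('u \<times> 'u) set), card_of (UNIV :: 'u set)): ordLeq"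
  by (rule ordIso_imp_ordLeq[OF card_of_Times_same_infinite])
 then obtain f :: "'u \<times> 'u => 'u" where "inj_on f (UNIV \<times> UNIV)" using card_of_ordLeq[of "UNIV \<times> UNIV" "UNIV :: 'u set"] by auto
 thus ?thesis by auto
qed

definition pr :: "'u \<times> 'u => 'u" where "pr = (SOME p. inj p)"

lemma pr: "inj pr" unfolding pr_def by (rule someI_ex[OF inj_pr])

lemma pr_eq[simp]: "pr x = pr y \<longleftrightarrow> x = y" using pr by (auto dest: injD)

definition ob_u :: "'o => 'u" where "ob_u x = \<epsilon> {Inr (Inl x)}"
definition bool_u :: "bool => 'u" where "bool_u b = \<epsilon> {Inr (Inr (Inr (if b then 1 else 0)))}"

lemma ob_u[simp]: "ob_u x = ob_u y \<longleftrightarrow> x = y" and bool_u[simp]: "bool_u b = bool_u c \<longleftrightarrow> b = c"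
 unfolding ob_u_def bool_u_def using inj_eq[OF eps] by auto

subsection \<open>Sums of functors\<close>

definition fsum :: "('k, 'o, 'm, 'u) mfnc => ('k, 'o, 'm, 'u) mfnc => ('k, 'o, 'm, 'u) mfnc" where
 "fsum F G = \<lparr>om = (%x. sum_mod (om F x) (om G x)), mm = (%x y f. \<lambda>z\<in>carrier (sum_mod (om F x) (om G x)).
   emb (prod_mod (om F y) (om G y)) (mm F x y f (fst (unemb (prod_mod (om F x) (om G x)) z)), mm G x y f (snd (unemb (prod_mod (om F x) (om G x)) z))))\<rparr>"

abbreviation "cbip == kl.biprod (cmod K C :: ('k, ('k, 'o, 'm, 'u) mfnc, 'o => 'u => 'u) kcat)"

lemma fsum:
 assumes F: "isf F" and G: "isf G"
 shows fsum_isf: "isf (fsum F G)" and fsum_biprod: "EX i1 i2 p1 p2. cbip F G (fsum F G) i1 i2 p1 p2"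
proof -
 interpret cm: kl K "cmod K C :: ('k, ('k, 'o, 'm, 'u) mfnc, 'o => 'u => 'u) kcat" by unfold_locales (rule cmod_klinear)
 have f: "x: Ob C ==> module K (om F x)" "x: Ob C ==> module K (om G x)" for x by (auto simp: mf_mod[OF F] mf_mod[OF G])
 note s = sum_mod_facts[OF f pr] and S = module_sum_mod[OF f pr]
 note s6 = s(6)[simplified]
 note m = md_cl[OF f(1)] md_cl[OF f(2)] md_cl[OF S] md_eq[OF f(1)] md_eq[OF f(2)]
 note l = mf_cl[OF F] mf_cl[OF G] lin_add[OF mf_lin[OF F]] lin_add[OF mf_lin[OF G]] lin_sm[OF mf_lin[OF F]] lin_sm[OF mf_lin[OF G]]
  lin_0[OF f(1) f(1) mf_lin[OF F]] lin_0[OF f(2) f(2) mf_lin[OF G]]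
 let ?S = "fsum F G"
 have o: "om ?S x = sum_mod (om F x) (om G x)" for x by (simp add: fsum_def)
 have mS: "z <: (sum_mod (om F x) (om G x)) ==> mm ?S x y g z =
   emb (prod_mod (om F y) (om G y)) (mm F x y g (fst (unemb (prod_mod (om F x) (om G x)) z)), mm G x y g (snd (unemb (prod_mod (om F x) (om G x)) z)))" for x y g z
  by (simp add: fsum_def)
 show S': "isf ?S"
 proof (rule mfI)
  show "category C" by (rule C_cat)
  fix x assume x: "x: Ob C"
  show "module K (om ?S x)" using S[OF x x] by (simp add: o)
  show "v <: (om ?S x) ==> mm ?S x x (ide C x) v = v" for v
   using x by (simp add: o mS s s6 mf_ide[OF F] mf_ide[OF G])
  fix y g assume y: "y: Ob C" "g: Arr C x y"
  show "mm ?S x y g: lin K (om ?S x) (om ?S y)"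
   by (rule linI; (simp add: o mS s l m x y)?) (simp add: fsum_def)
  show "z: Ob C ==> h: Arr C y z ==> v <: (om ?S x) ==> mm ?S x z (cmp C x y z h g) v = mm ?S y z h (mm ?S x y g v)" for z h v
   using x y by (simp add: o mS s l mf_cmp[OF F] mf_cmp[OF G])
 qed
 let ?i1 = "\<lambda>x\<in>Ob C. \<lambda>v\<in>carrier (om F x). emb (prod_mod (om F x) (om G x)) (v, 0[om G x]) :: 'u"
 let ?i2 = "\<lambda>x\<in>Ob C. \<lambda>v\<in>carrier (om G x). emb (prod_mod (om F x) (om G x)) (0[om F x], v) :: 'u"
 let ?p1 = "\<lambda>x\<in>Ob C. \<lambda>z\<in>carrier (sum_mod (om F x) (om G x)). fst (unemb (prod_mod (om F x) (om G x)) z)"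
 let ?p2 = "\<lambda>x\<in>Ob C. \<lambda>z\<in>carrier (sum_mod (om F x) (om G x)). snd (unemb (prod_mod (om F x) (om G x)) z)"
 have i: "?i1: nt F ?S" "?i2: nt G ?S" "?p1: nt ?S F" "?p2: nt ?S G"
  by (rule ntI; (simp add: o mS s l m)?; rule linI; simp add: o mS s l m)+
 note cmi = cm.A_cl cm.A_eq
 have "cbip F G ?S ?i1 ?i2 ?p1 ?p2" unfolding cm.biprod_def
 proof (intro conjI)
  show "cc F ?S F ?p1 ?i1 = ide (cmod K C) F" "cc G ?S G ?p2 ?i2 = ide (cmod K C) G"
   "cc G ?S F ?p1 ?i2 = 0[homm (cmod K C) G F]" "cc F ?S G ?p2 ?i1 = 0[homm (cmod K C) F G]"
   "cc ?S F ?S ?i1 ?p1 +[homm (cmod K C) ?S ?S] cc ?S G ?S ?i2 ?p2 = ide (cmod K C) ?S"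
   using S' mod_zero[OF module_nat_mod[OF G F]] mod_zero[OF module_nat_mod[OF F G]]
     mod_add[OF module_nat_mod[OF S' S'], of "cc ?S F ?S ?i1 ?p1" "cc ?S G ?S ?i2 ?p2"]
     cmod_cmp[OF S' i(3,1)] cmod_cmp[OF S' i(4,2)]
   by (auto intro!: nt_ext[OF cmod_cmp[OF F i(1,3)] cmod_ide[OF F]] nt_ext[OF cmod_cmp[OF G i(2,4)] cmod_ide[OF G]]
    nt_ext[OF cmod_cmp[OF G i(2,3)]] nt_ext[OF cmod_cmp[OF F i(1,4)]] nt_ext[OF _ cmod_ide[OF S']] simp: o s s6 m)
 qed (use F G S' i in auto)
 thus "EX i1 i2 p1 p2. cbip F G ?S i1 i2 p1 p2" by blast
qed

subsection \<open>Density of the standard projectives\<close>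

text \<open>Closedness speaks only of index categories whose objects and arrows are elements of 'u.
  An index category on any types can be used once its objects, and each of its Hom sets separately,
  are injected into 'u.\<close>

lemma colim_relabel:
 fixes J :: "('j, 'i) cat" and e1 :: "'j => 'u" and e2 :: "'j => 'j => 'i => 'u" and S :: "('k, 'o, 'm, 'u) mfnc set"
 assumes st: "lim_colim_stable K C S" and G: "is_functor J (cmod K C) G" and GS: "!!j. j: Ob J ==> om G j: S"
  and L: "is_colimit (cmod K C) J G L it" and e1: "inj_on e1 (Ob J)"
  and e2: "!!i j. i: Ob J ==> j: Ob J ==> inj_on (e2 i j) (Arr J i j)"
 shows "L: S"
proof -
 define d where "d = the_inv_into (Ob J) e1"
 define c where "c x y = the_inv_into (Arr J (d x) (d y)) (e2 (d x) (d y))" for x y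
 have d: "d (e1 j) = j" if "j: Ob J" for j unfolding d_def by (rule the_inv_into_f_f[OF e1 that])
 have c: "c (e1 i) (e1 j) (e2 i j m) = m" if "i: Ob J" "j: Ob J" "m: Arr J i j" for i j m
  unfolding c_def d[OF that(1)] d[OF that(2)] by (rule the_inv_into_f_f[OF e2[OF that(1,2)] that(3)])
 define J' :: "('u, 'u) cat" where "J' = \<lparr>Ob = e1 ` Ob J, Arr = (%x y. e2 (d x) (d y) ` Arr J (d x) (d y)),
   ide = (%x. e2 (d x) (d x) (ide J (d x))), cmp = (%x y z g f. e2 (d x) (d z) (cmp J (d x) (d y) (d z) (c y z g) (c x y f)))\<rparr>"
 define G' where "G' = \<lparr>om = (%x. om G (d x)), mm = (%x y m. mm G (d x) (d y) (c x y m))\<rparr>"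
 have Jc: "category J" using fnc_cat[OF G] by simp
 note [simp] = d c catD[OF Jc]
 have J': "category J'" by (rule catI) (auto simp: J'_def)
 have G': "is_functor J' (cmod K C) G'" unfolding is_functor_def
 proof (intro conjI ballI J' kl_cat[OF cmod_klinear])
 qed (use fnc_ob[OF G] fnc_arr[OF G] fnc_ide[OF G] fnc_cmp[OF G] in "auto simp: J'_def G'_def")
 have cone: "is_cone (op_cat (cmod K C)) (op_cat J') (op_fnc G') M ro \<longleftrightarrow> is_cone (op_cat (cmod K C)) (op_cat J) (op_fnc G) M (%j. ro (e1 j))" for M ro
  unfolding is_cone_def by (auto simp: J'_def G'_def op_fnc_def)
 have "is_colimit (cmod K C) J' G' L (%x. it (d x))" unfolding is_colimit_def is_limit_def
 proof (intro conjI allI impI)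
  show "is_cone (op_cat (cmod K C)) (op_cat J') (op_fnc G') L (%x. it (d x))"
   using L unfolding cone is_colimit_def is_limit_def by (simp add: is_cone_def)
  fix M ro assume "is_cone (op_cat (cmod K C)) (op_cat J') (op_fnc G') M ro"
  hence "EX! h. h: Arr (op_cat (cmod K C)) M L & (ALL j:Ob (op_cat J). cmp (op_cat (cmod K C)) M L (om (op_fnc G) j) (it j) h = ro (e1 j))"
   using L unfolding cone is_colimit_def is_limit_def by blast
  thus "EX! h. h: Arr (op_cat (cmod K C)) M L & (ALL j:Ob (op_cat J'). cmp (op_cat (cmod K C)) M L (om (op_fnc G') j) (it (d j)) h = ro j)"
   by (simp add: J'_def G'_def op_fnc_def)
 qed
 moreover have "!!j. j: Ob J' ==> om G' j: S" using GS by (auto simp: J'_def G'_def)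
 ultimately show ?thesis using st G' unfolding lim_colim_stable_def by blast
qed

text \<open>A biproduct is a colimit over the discrete category with two objects, for which
  \<open>bool\<close> serves.\<close>

lemma stable_biprod:
 assumes st: "lim_colim_stable K C S" and F: "F: S" "isf F" and G: "G: S" "isf G" and b: "cbip F G L i1 i2 p1 p2"
 shows "L: S"
proof -
 interpret cm: kl K "cmod K C :: ('k, ('k, 'o, 'm, 'u) mfnc, 'o => 'u => 'u) kcat" by unfold_locales (rule cmod_klinear)
 let ?J = "\<lparr>Ob = UNIV, Arr = (%i j. if i = j then {()} else {}), ide = (%i. ()), cmp = (%i j k g f. ())\<rparr> :: (bool, unit) cat"
 let ?G = "\<lparr>om = (%b. if b then F else G), mm = (%i j m. ide (cmod K C) (if i then F else G))\<rparr>"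
 note bd = cm.biprodD[OF b]
 have o[simp]: "F: Ob (cmod K C)" "G: Ob (cmod K C)" "L: Ob (cmod K C)" using F G bd by auto
 note [simp del] = cmod_sel(1-3)
 note [simp] = bd(2-9) cm.biprod_nest[OF b]
 show ?thesis
 proof (rule colim_relabel[OF st, of ?J ?G L "%b. if b then i1 else i2" bool_u "%_ _ _. bool_u True"])
  show "is_functor ?J (cmod K C) ?G" unfolding is_functor_def
   by (intro conjI ballI kl_cat[OF cmod_klinear] catI) (auto split: if_splits)
  show "is_colimit (cmod K C) ?J ?G L (%b. if b then i1 else i2)" unfolding is_colimit_def is_limit_def
  proof (intro conjI allI impI)
   show "is_cone (op_cat (cmod K C)) (op_cat ?J) (op_fnc ?G) L (%b. if b then i1 else i2)"
    unfolding is_cone_def by (auto simp: op_fnc_def split: if_splits)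
   fix M ro assume "is_cone (op_cat (cmod K C)) (op_cat ?J) (op_fnc ?G) M ro"
   hence M[simp]: "M: Ob (cmod K C)" and r[simp]: "ro True: Arr (cmod K C) F M" "ro False: Arr (cmod K C) G M"
    unfolding is_cone_def by (auto simp: op_fnc_def split: if_splits)
   let ?h = "cc L F M (ro True) p1 +[homm (cmod K C) L M] cc L G M (ro False) p2"
   show "EX! h. h: Arr (op_cat (cmod K C)) M L & (ALL j:Ob (op_cat ?J). cmp (op_cat (cmod K C)) M L (om (op_fnc ?G) j) (if j then i1 else i2) h = ro j)"
   proof (rule ex1I[of _ ?h])
    show "?h: Arr (op_cat (cmod K C)) M L & (ALL j:Ob (op_cat ?J). cmp (op_cat (cmod K C)) M L (om (op_fnc ?G) j) (if j then i1 else i2) ?h = ro j)"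
     by (auto simp: op_fnc_def md_eq)
    fix h assume h: "h: Arr (op_cat (cmod K C)) M L & (ALL j:Ob (op_cat ?J). cmp (op_cat (cmod K C)) M L (om (op_fnc ?G) j) (if j then i1 else i2) h = ro j)"
    hence "cc F L M h i1 = ro True" "cc G L M h i2 = ro False" using spec[of "%j. cc (if j then F else G) L M h (if j then i1 else i2) = ro j" True]
      spec[of "%j. cc (if j then F else G) L M h (if j then i1 else i2) = ro j" False] by (simp_all add: op_fnc_def)
    thus "h = ?h" using cm.biprod_sum(1)[OF b o(1,2) M, of h] h by simp
   qed
  qed
 qed (use F G in "auto simp: inj_on_def")
qed

text \<open>F is the colimit of the objects T_a and T_a + T_a over all maps from them to F. A cocone
  assigns to v in F(a) the value at \<open>u a\<close> of its component at the Yoneda map of v.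
  Naturality and homogeneity of this assignment come from arrows between the T_a; the sums T_a + T_a
  are in the index category to give additivity, by way of the diagonal.\<close>

lemma good_in_stable:
 assumes st: "lim_colim_stable K C S" and Th: "!!a. a: Ob C ==> Th a: S" and F: "good F"
 shows "F: S"
proof -
 interpret cm: kl K "cmod K C :: ('k, ('k, 'o, 'm, 'u) mfnc, 'o => 'u => 'u) kcat" by unfold_locales (rule cmod_klinear)
 note Ff = good_isf[OF F]
 define Q where "Q a = fsum (Th a) (Th a)" for a
 have "ALL a:Ob C. EX t. cbip (Th a) (Th a) (Q a) (fst t) (fst (snd t)) (fst (snd (snd t))) (snd (snd (snd t)))"
  using fsum_biprod[OF std_isf std_isf] unfolding Q_def by fastforce
 then obtain t where t: "!!a. a: Ob C ==> cbip (Th a) (Th a) (Q a) (fst (t a)) (fst (snd (t a))) (fst (snd (snd (t a)))) (snd (snd (snd (t a))))"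
  by metis
 define i1 i2 p1 p2 where "i1 a = fst (t a)" and "i2 a = fst (snd (t a))" and "p1 a = fst (snd (snd (t a)))" and "p2 a = snd (snd (snd (t a)))" for a
 have B: "a: Ob C ==> cbip (Th a) (Th a) (Q a) (i1 a) (i2 a) (p1 a) (p2 a)" for a using t unfolding i1_def i2_def p1_def p2_def .
 have Thf: "a: Ob C ==> Th a: Ob (cmod K C)" for a using std_isf by simp
 have Qf: "a: Ob C ==> isf (Q a)" for a unfolding Q_def by (rule fsum_isf[OF std_isf std_isf])
 have QS: "a: Ob C ==> Q a: S" for a by (rule stable_biprod[OF st Th std_isf Th std_isf B])
 define Gq where "Gq q = (if snd q then Q (fst q) else Th (fst q))" for q :: "'o \<times> bool"
 have Gf: "fst q: Ob C ==> isf (Gq q)" for q using Qf std_isf by (auto simp: Gq_def)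
 have i12: "i1 a: nt (Th a) (Q a)" "i2 a: nt (Th a) (Q a)" "p1 a: nt (Q a) (Th a)" "p2 a: nt (Q a) (Th a)" if "a: Ob C" for a
  using cm.biprodD[OF B[OF that]] by auto
 have Qext: "et = et'" if a: "a: Ob C" and M: "isf M" and e: "et: nt (Q a) M" "et': nt (Q a) M"
   and 1: "cc (Th a) (Q a) M et (i1 a) = cc (Th a) (Q a) M et' (i1 a)" and 2: "cc (Th a) (Q a) M et (i2 a) = cc (Th a) (Q a) M et' (i2 a)" for a M et et'
  using cm.biprod_sum(1)[OF B[OF a] Thf[OF a] Thf[OF a], of M et] cm.biprod_sum(1)[OF B[OF a] Thf[OF a] Thf[OF a], of M et'] M e 1 2 by simp
 \<comment> \<open>An arrow out of T_a or T_a + T_a is determined by its values at these one or two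
   elements (\<open>Gext\<close>); for T_a the two agree.\<close>
 define g1 g2 where "g1 q = (if snd q then i1 (fst q) (fst q) (u (fst q)) else u (fst q))"
   and "g2 q = (if snd q then i2 (fst q) (fst q) (u (fst q)) else u (fst q))" for q :: "'o \<times> bool"
 have Gext: "et = et'" if q: "fst q: Ob C" and M: "isf M" and e: "et: nt (Gq q) M" "et': nt (Gq q) M"
   and 1: "et (fst q) (g1 q) = et' (fst q) (g1 q)" "et (fst q) (g2 q) = et' (fst q) (g2 q)" for q et et' and M :: "('k, 'o, 'm, 'u) mfnc"
 proof (cases "snd q")
  case False thus ?thesis using yon_uniq[OF q M] e 1 by (simp add: Gq_def g1_def)
 next
  case True
  note n = cc_nt[OF std_isf[OF q] i12(1)[OF q]] cc_nt[OF std_isf[OF q] i12(2)[OF q]]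
  have e: "et: nt (Q (fst q)) M" "et': nt (Q (fst q)) M" using e True by (auto simp: Gq_def)
  show ?thesis
   by (rule Qext[OF q M e]; rule yon_uniq[OF q M n(1)[OF e(1)] n(1)[OF e(2)]] yon_uniq[OF q M n(2)[OF e(1)] n(2)[OF e(2)]])
    (use True 1 q u_in[OF q] in "simp_all add: g1_def g2_def")
 qed
 let ?J = "\<lparr>Ob = {(q, et). fst q: Ob C & et: nt (Gq q) F}, Arr = (%(q, et) (q', et'). {m: nt (Gq q) (Gq q'). cc (Gq q) (Gq q') F et' m = et}),
   ide = (%(q, et). ide (cmod K C) (Gq q)), cmp = (%(q, et) (q', et') (q'', et''). cc (Gq q) (Gq q') (Gq q''))\<rparr>"
 let ?G = "\<lparr>om = (%(q, et). Gq q), mm = (%_ _ m. m)\<rparr>"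
 \<comment> \<open>These values name the objects and the arrows of the index category by elements of
   'u, as \<open>colim_relabel\<close> requires.\<close>
 let ?e1 = "%(q, et). pr (ob_u (fst q), pr (bool_u (snd q), pr (et (fst q) (g1 q), et (fst q) (g2 q))))"
 let ?e2 = "%(q, et :: 'o => 'u => 'u) (q' :: 'o \<times> bool, et' :: 'o => 'u => 'u) m. pr (m (fst q) (g1 q), m (fst q) (g2 q))"
 have fO: "fst q: Ob C ==> Gq q: Ob (cmod K C)" for q using Gf by simp
 show ?thesis
 proof (rule colim_relabel[OF st, of ?J ?G F "%(q, et). et" ?e1 ?e2])
  have "category ?J"
   by (rule catI; clarsimp simp del: cmod_sel(1,2) simp: Ff cm.A_cl[simplified] cmod_sel(2)[symmetric])
    (use fO Ff in "simp_all del: cmod_sel(2)")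
  thus "is_functor ?J (cmod K C) ?G" unfolding is_functor_def using kl_cat[OF cmod_klinear] Gf by (auto)
  show "is_colimit (cmod K C) ?J ?G F (%(q, et). et)" unfolding is_colimit_def is_limit_def
  proof (intro conjI allI impI)
   show "is_cone (op_cat (cmod K C)) (op_cat ?J) (op_fnc ?G) F (%(q, et). et)"
    unfolding is_cone_def using Ff by (auto simp: op_fnc_def)
   fix M ro assume cone: "is_cone (op_cat (cmod K C)) (op_cat ?J) (op_fnc ?G) M ro"
   hence M: "isf M" and r: "!!q et. fst q: Ob C ==> et: nt (Gq q) F ==> ro (q, et): nt (Gq q) M"
    by (auto simp: is_cone_def op_fnc_def)
   have rc: "cc (Gq q) (Gq q') M (ro (q', et')) m = ro (q, cc (Gq q) (Gq q') F et' m)"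
    if "fst q: Ob C" "fst q': Ob C" "et': nt (Gq q') F" "m: nt (Gq q) (Gq q')" for q q' et' m
   proof -
    have "ALL i:Ob ?J. ALL j:Ob ?J. ALL m:Arr ?J j i. cc (om ?G j) (om ?G i) M (ro i) m = ro j"
     using cone unfolding is_cone_def by (simp add: op_fnc_def)
    from this[rule_format, of "(q', et')" "(q, cc (Gq q) (Gq q') F et' m)" m] show ?thesis
     using that cc_nt[OF Gf[OF that(1)] that(4,3)] by simp
   qed
   define R where "R a v = ro ((a, False), yo F a v)" for a v
   have y: "yo F a v: nt (Th a) F" if "a: Ob C" "v <: (om F a)" for a v by (rule yo_nt[OF F that])
   have R: "R a v: nt (Th a) M" if "a: Ob C" "v <: (om F a)" for a v
    using r[of "(a, False)" "yo F a v"] y[OF that] that by (simp add: R_def Gq_def)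
   have Rc: "cc (Th b) (Th a) M (R a v) m = R b w" if o: "a: Ob C" "b: Ob C" "v <: (om F a)" and m: "m: nt (Th b) (Th a)"
     and w: "yo F a v b (m b (u b)) = w" for a b v m w
   proof -
    have "yo F b w = cc (Th b) (Th a) F (yo F a v) m"
     by (rule yo_eq[OF F o(2) cc_nt[OF std_isf[OF o(2)] m y[OF o(1,3)]]]) (use o w u_in in simp)
    thus ?thesis using rc[of "(b, False)" "(a, False)" "yo F a v" m] o m y[OF o(1,3)] by (simp add: R_def Gq_def)
   qed
   define h where "h = (\<lambda>a\<in>Ob C. \<lambda>v\<in>carrier (om F a). R a v a (u a))"
   have h: "h: nt F M"
   proof (rule ntI)
    fix a assume a: "a: Ob C"
    note mF = mf_mod[OF Ff a] and mM = mf_mod[OF M a] and ua = u_in[OF a]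
    show "h a: lin K (om F a) (om M a)"
    proof (rule linI)
     fix v assume v: "v <: (om F a)"
     show "h a v <: (om M a)" using a v nt_cl[OF R[OF a v] a, of "u a"] ua by (simp add: h_def)
     fix k assume k: "k <: K"
     \<comment> \<open>Homogeneity: k times the identity of T_a is an arrow of the index category
       from the Yoneda map of k v to that of v.\<close>
     let ?m = "k *[NM (Th a) (Th a)] ide (cmod K C) (Th a)"
     have m: "?m: nt (Th a) (Th a)" using cm.A_cl(6)[OF Thf[OF a] Thf[OF a] _ k, of "ide (cmod K C) (Th a)"] cmod_ide[OF std_isf[OF a]] by simp
     have mu: "?m a (u a) = k *[om T (a, a)] u a" using a ua by simp
     have "cc (Th a) (Th a) M (R a v) ?m = R a (k *[om F a] v)"
      by (rule Rc[OF a a v m]) (use nt_sm[OF y[OF a v] a, of "u a" k] k ua yo_u[OF F a v] in "simp add: mu")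
     from fun_cong[OF fun_cong[OF this], of a "u a"] show "h a (k *[om F a] v) = k *[om M a] h a v"
      using a ua v k nt_sm[OF R[OF a v] a, of "u a" k] by (simp add: h_def md_cl[OF mF] mu del: nat_mod_sel)
    next
     fix v w assume v: "v <: (om F a)" and w: "w <: (om F a)"
     have vw: "v +[om F a] w <: (om F a)" using v w by (rule mod_add[OF mF])
     note bb = cm.biprodD(2-9)[OF B[OF a]] cm.biprod_nest[OF B[OF a] Thf[OF a] Thf[OF a]]
     \<comment> \<open>Additivity: the map T_a + T_a -> F with components given by v and w is an
       object of the index category, and along the diagonal \<open>?D\<close> it restricts to the
       Yoneda map of v + w.\<close>
     define H where "H = cc (Q a) (Th a) F (yo F a v) (p1 a) +[homm (cmod K C) (Q a) F] cc (Q a) (Th a) F (yo F a w) (p2 a)"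
     note [simp del] = cmod_sel(1-3) std_sel
     have O: "F: Ob (cmod K C)" "M: Ob (cmod K C)" "Q a: Ob (cmod K C)" "Th a: Ob (cmod K C)" using Ff M Qf[OF a] Thf[OF a] cmod_sel(1) by blast+
     note yv = y[OF a v, folded cmod_sel(2)] and yw = y[OF a w, folded cmod_sel(2)]
     have H: "H: Arr (cmod K C) (Q a) F" unfolding H_def using O yv yw bb by simp
     have H12: "cc (Th a) (Q a) F H (i1 a) = yo F a v" "cc (Th a) (Q a) F H (i2 a) = yo F a w"
      unfolding H_def using O yv yw bb by (simp_all add: md_eq)
     let ?D = "i1 a +[homm (cmod K C) (Th a) (Q a)] i2 a"
     have D: "?D: Arr (cmod K C) (Th a) (Q a)" using O bb by simp
     have HD: "cc (Th a) (Q a) F H ?D = yo F a (v +[om F a] w)"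
     proof (rule yo_eq[OF F a, symmetric])
      have e: "cc (Th a) (Q a) F H ?D = yo F a v +[homm (cmod K C) (Th a) F] yo F a w" using O H bb H12 by simp
      show "cc (Th a) (Q a) F H ?D: nt (Th a) F" using O H D cm.A_cl(2) cmod_sel(2) by metis
      show "cc (Th a) (Q a) F H ?D a (u a) = v +[om F a] w" unfolding e unfolding cmod_sel(3) using yo_u[OF F a v] yo_u[OF F a w] a ua std_sel(1)[of a a] by simp
     qed
     have q: "fst (a, True): Ob C" "fst (a, False): Ob C" using a by auto
     have Gs: "Gq (a, True) = Q a" "Gq (a, False) = Th a" by (auto simp: Gq_def)
     note rcc = rc[OF q(2,1), unfolded Gs]
     have HH: "H: nt (Q a) F" using H by (simp only: cmod_sel(2))
     have r1: "cc (Th a) (Q a) M (ro ((a, True), H)) (i1 a) = R a v" "cc (Th a) (Q a) M (ro ((a, True), H)) (i2 a) = R a w"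
      using rcc[OF HH i12(1)[OF a]] rcc[OF HH i12(2)[OF a]] unfolding R_def H12 by auto
     have "R a (v +[om F a] w) = cc (Th a) (Q a) M (ro ((a, True), H)) ?D"
      using rcc[OF HH, of ?D] D unfolding cmod_sel(2) HD R_def by simp
     also have "... = R a v +[homm (cmod K C) (Th a) M] R a w"
      using r[OF q(1), unfolded Gs, OF HH, folded cmod_sel(2)] O bb r1 by simp
     finally have "R a (v +[om F a] w) a (u a) = R a v a (u a) +[om M a] R a w a (u a)"
      using a ua std_sel(1)[of a a] unfolding cmod_sel(3) by simp
     thus "h a (v +[om F a] w) = h a v +[om M a] h a w" using a v w vw by (simp add: h_def)
    qed (use a in "simp add: h_def")
    fix b f v assume b: "b: Ob C" and f: "f: Arr C a b" and v: "v <: (om F a)"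
    have m: "std_map C T b a f: nt (Th b) (Th a)" by (rule std_map_nt[OF b a f])
    have fv: "mm F a b f v <: (om F b)" by (rule mf_cl[OF Ff a b f v])
    have "cc (Th b) (Th a) M (R a v) (std_map C T b a f) = R b (mm F a b f v)"
     by (rule Rc[OF a b v m]) (use std_map_u[OF b a f] std_u[OF a b f] nt_nat[OF y[OF a v] a b f, of "u a"] yo_u[OF F a v] ua in simp)
    from fun_cong[OF fun_cong[OF this], of b "u b"] show "h b (mm F a b f v) = mm M a b f (h a v)"
     using a b f v fv u_in[OF b] std_map_u[OF b a f] std_u[OF a b f] nt_nat[OF R[OF a v] a b f, of "u a"] ua by (simp add: h_def)
   qed (simp add: h_def)
   have R_eq: "cc (Th a) F M h et = ro ((a, False), et)" if a: "a: Ob C" and e: "et: nt (Th a) F" for a et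
   proof (rule yon_uniq[OF a M cc_nt[OF std_isf[OF a] e h]])
    have q: "fst (a, False): Ob C" using a by auto
    show "ro ((a, False), et): nt (Th a) M" using r[OF q, of et] e by (simp add: Gq_def)
    have ev: "et a (u a) <: (om F a)" using nt_cl[OF e a, of "u a"] u_in[OF a] by simp
    have "yo F a (et a (u a)) = et" by (rule yo_eq[OF F a e refl])
    thus "cc (Th a) F M h et a (u a) = ro ((a, False), et) a (u a)" using a ev u_in[OF a] by (simp add: h_def R_def)
   qed
   have hr: "cc (Gq q) F M h et = ro (q, et)" if q: "fst q: Ob C" and e: "et: nt (Gq q) F" for q et
   proof (cases "snd q")
    case False hence "q = (fst q, False)" by (cases q) auto
    thus ?thesis using R_eq[OF q, of et] e by (simp add: Gq_def False)
   next
    case True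
    let ?a = "fst q"
    have qq: "q = (?a, True)" "fst (?a, False): Ob C" using True q by (cases q, auto)
    have GQ: "Gq q = Q ?a" "Gq (?a, False) = Th ?a" using True by (auto simp: Gq_def)
    have e': "et: nt (Q ?a) F" and rq: "ro (q, et): nt (Q ?a) M" using e r[OF q e] by (auto simp: GQ)
    have "cc (Th ?a) (Q ?a) M (cc (Q ?a) F M h et) i = cc (Th ?a) (Q ?a) M (ro (q, et)) i" if i: "i: nt (Th ?a) (Q ?a)" for i
    proof -
     have "cc (Th ?a) (Q ?a) M (cc (Q ?a) F M h et) i = cc (Th ?a) F M h (cc (Th ?a) (Q ?a) F et i)"
      by (rule nt_ext[OF cc_nt[OF std_isf[OF q] i cc_nt[OF Qf[OF q] e' h]] cc_nt[OF std_isf[OF q] cc_nt[OF std_isf[OF q] i e'] h]]) (use nt_cl[OF i] in simp)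
     also have "... = ro ((?a, False), cc (Th ?a) (Q ?a) F et i)" by (rule R_eq[OF q cc_nt[OF std_isf[OF q] i e']])
     also have "... = cc (Th ?a) (Q ?a) M (ro (q, et)) i" using rc[OF qq(2) q e, of i] i by (simp add: GQ)
     finally show ?thesis .
    qed
    thus ?thesis using Qext[OF q M cc_nt[OF Qf[OF q] e' h] rq] i12[OF q] by (simp add: GQ)
   qed
   show "EX! h. h: Arr (op_cat (cmod K C)) M F & (ALL j:Ob (op_cat ?J). cmp (op_cat (cmod K C)) M F (om (op_fnc ?G) j) ((%(q, et). et) j) h = ro j)"
   proof (rule ex1I[of _ h])
    show "h: Arr (op_cat (cmod K C)) M F & (ALL j:Ob (op_cat ?J). cmp (op_cat (cmod K C)) M F (om (op_fnc ?G) j) ((%(q, et). et) j) h = ro j)"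
     using h hr by (auto simp: op_fnc_def)
    fix h' assume "h': Arr (op_cat (cmod K C)) M F & (ALL j:Ob (op_cat ?J). cmp (op_cat (cmod K C)) M F (om (op_fnc ?G) j) ((%(q, et). et) j) h' = ro j)"
    hence h': "h': nt F M" "!!q et. fst q: Ob C ==> et: nt (Gq q) F ==> cc (Gq q) F M h' et = ro (q, et)"
     by (auto simp: op_fnc_def)
    show "h' = h"
    proof (rule nt_ext[OF h'(1) h])
     fix a v assume a: "a: Ob C" and v: "v <: (om F a)"
     have "cc (Th a) F M h' (yo F a v) = R a v" using h'(2)[of "(a, False)" "yo F a v"] a y[OF a v] by (simp add: Gq_def R_def)
     from fun_cong[OF fun_cong[OF this], of a "u a"] show "h' a v = h a v" using a v u_in[OF a] yo_u[OF F a v] by (simp add: h_def)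
    qed
   qed
  qed
  show "inj_on ?e1 (Ob ?J)" by (auto simp: inj_on_def) (rule Gext[of "(a, b)" F for a b], auto intro: Ff)
  fix i j assume "i: Ob ?J" "j: Ob ?J"
  then obtain q et q' et' where "i = (q, et)" "j = (q', et')" "fst q: Ob C" "fst q': Ob C" by auto
  thus "inj_on (?e2 i j) (Arr ?J i j)" using Gext[of q "Gq q'"] Gf[of q'] by (auto simp: inj_on_def)
 qed (use QS Th in "auto simp: Gq_def")
qed

lemma tmod_ob: "Ob (tmod K C T) = {F. good F}"
proof
 show "Ob (tmod K C T) <= {F. good F}" by (rule tmod_sub)
 show "{F. good F} <= Ob (tmod K C T)"
  unfolding tmod_def using good_in_stable good_isf by auto
qed

subsection \<open>Projectives of finite type\<close>

abbreviation "TM == tmod K C T"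

lemma TM_sel[simp]: "Arr TM = nat_trans K C" "ide TM = ide (cmod K C)" "cmp TM = cmp (cmod K C)" "homm TM = NM"
 by (simp_all add: tmod_def)

lemma TM_klinear: "klinear_category K TM"
 unfolding tmod_def by (rule sub_klinear[OF cmod_klinear])

end

sublocale yon \<subseteq> tm: kl K "tmod K C T" by unfold_locales (rule TM_klinear)

context yon
begin

lemma TM_ob[simp]: "F: Ob TM \<longleftrightarrow> good F" by (simp add: tmod_ob)

text \<open>Yoneda maps of the two components of v add up to one for v, so the sum of two functors
  keeps the Yoneda property. The biproducts are what \<open>loc_htp\<close> builds its cones
  from.\<close>

lemma TM_has_biprods: "tm.has_biprods"
 unfolding tm.has_biprods_def
proof (intro ballI)
 interpret cm: kl K "cmod K C :: ('k, ('k, 'o, 'm, 'u) mfnc, 'o => 'u => 'u) kcat" by unfold_locales (rule cmod_klinear)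
 fix F G assume "F: Ob TM" "G: Ob TM"
 hence F: "good F" and G: "good G" by auto
 note f = good_isf[OF F] good_isf[OF G]
 obtain i1 i2 p1 p2 where b: "cbip F G (fsum F G) i1 i2 p1 p2" using fsum_biprod[OF f] by blast
 note bd = cm.biprodD[OF b, simplified]
 have S: "isf (fsum F G)" by (rule fsum_isf[OF f])
 have "good (fsum F G)" unfolding good_def
 proof (intro conjI ballI S)
  fix a v assume a: "a: Ob C" and v: "v <: (om (fsum F G) a)"
  have pv: "p1 a v <: (om F a)" "p2 a v <: (om G a)" using nt_cl[OF bd(4) a v] nt_cl[OF bd(5) a v] .
  let ?th = "cc (Th a) F (fsum F G) i1 (yo F a (p1 a v)) +[NM (Th a) (fsum F G)] cc (Th a) G (fsum F G) i2 (yo G a (p2 a v))"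
  have "?th: nt (Th a) (fsum F G)"
   using mod_add[OF module_nat_mod[OF std_isf[OF a] S]] cc_nt[OF std_isf[OF a] yo_nt[OF F a pv(1)] bd(2)] cc_nt[OF std_isf[OF a] yo_nt[OF G a pv(2)] bd(3)]
   by simp
  moreover have "?th a (u a) = v"
   using fun_cong[OF fun_cong[OF bd(10)], of a v] a v u_in[OF a] yo_u[OF F a pv(1)] yo_u[OF G a pv(2)] by simp
  ultimately show "EX th:nt (Th a) (fsum F G). th a (u a) = v" by blast
 qed
 hence "tm.biprod F G (fsum F G) i1 i2 p1 p2" using b unfolding tm.biprod_def cm.biprod_def by simp
 thus "EX s i1 i2 p1 p2. tm.biprod F G s i1 i2 p1 p2" by blast
qed

text \<open>This is the identity of P written as a finite sum of composites P -> T_(a i) -> P, the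
  second map being named by the element \<open>p i\<close> through the Yoneda bijection.\<close>

definition dual_basis where
 "dual_basis P N a p xi \<longleftrightarrow> (ALL i<N. a i: Ob C & p i <: (om P (a i)) & xi i: nt P (Th (a i))) \<and>
   (ALL x:Ob C. ALL v:carrier (om P x). v = finsum (om P x) (%i. yo P (a i) (p i) x (xi i x v)) {..<N :: nat})"

lemma dual_basisD:
 assumes "dual_basis P N a p xi"
 shows "i < N ==> a i: Ob C" "i < N ==> p i <: (om P (a i))" "i < N ==> xi i: nt P (Th (a i))"
  and dual_basis_eq: "x: Ob C ==> v <: (om P x) ==> v = finsum (om P x) (%i. yo P (a i) (p i) x (xi i x v)) {..<N}"
 using conjunct1[OF assms[unfolded dual_basis_def]] conjunct2[OF assms[unfolded dual_basis_def]] by blast+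

lemma eval_lin:
 assumes F: "isf F" and G: "isf G" and x: "x: Ob C" "v <: (om F x)"
 shows "(\<lambda>et\<in>nt F G. et x v): lin K (NM F G) (om G x)"
 by (rule linI) (use x mod_add[OF module_nat_mod[OF F G]] mod_sm[OF module_nat_mod[OF F G]] in "auto simp: nt_cl")

lemma eval_finsum:
 assumes F: "isf F" and G: "isf G" and x: "x: Ob C" "v <: (om F x)" and I: "finite I" "!!i. i: I ==> et i: nt F G"
 shows "finsum (NM F G) et I x v = finsum (om G x) (%i. et i x v) I"
proof -
 have "finsum (NM F G) et I: nt F G" using mod_finsum_cl[OF module_nat_mod[OF F G], of I et] I by simp
 moreover have "finsum (om G x) (%i. (\<lambda>et\<in>nt F G. et x v) (et i)) I = finsum (om G x) (%i. et i x v) I"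
  by (rule abelian_monoid.finsum_cong') (use I x mf_mod[OF G x(1)] mod_ag abelian_group.axioms(1) nt_cl in "fastforce+")
 ultimately show ?thesis
  using lin_finsum[OF module_nat_mod[OF F G] mf_mod[OF G x(1)] eval_lin[OF F G x] I(1), of et] I(2) by simp
qed

text \<open>By projectivity the epimorphism e from a finite sum S of standard projectives onto P has
  a section s. Placing the decomposition of the identity of S between s and e decomposes the
  identity of P.\<close>

lemma dual_basis_exists:
 assumes ft: "finite_type K C T P" and pj: "projective_ob TM P"
 obtains N a p xi where "dual_basis P N a p xi"
proof -
 obtain as S it e where as: "set as <= Ob C" and fs: "is_finite_sum TM (map Th as) S it" and e: "is_epi TM S P e" and P: "good P"
  using ft unfolding finite_type_def by auto
 note Pf = good_isf[OF P]
 define N where "N = length as"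
 have S: "good S" and i: "!!i. i < N ==> it i: nt (Th (as ! i)) S"
  and un: "!!z g. good z ==> (!!i. i < N ==> g i: nt (Th (as ! i)) z) ==> EX! h. h: nt S z & (ALL i<N. cc (Th (as ! i)) S z h (it i) = g i)"
  using fs unfolding is_finite_sum_def N_def by auto
 note Sf = good_isf[OF S]
 have o: "i < N ==> as ! i: Ob C" for i using as unfolding N_def by (meson nth_mem subsetD)
 have en: "e: nt S P" using e unfolding is_epi_def by simp
 obtain s where s: "s: nt P S" "cc P S P e s = ide (cmod K C) P"
 proof -
  have "EX g:Arr TM P S. cmp TM P S P e g = ide TM P"
   using pj P S e tm.A_cl(1)[of P] unfolding projective_ob_def by (metis TM_ob)
  thus thesis using that by auto
 qed
 \<comment> \<open>\<open>is_finite_sum\<close> provides injections only. Projections are the maps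
   induced by identities and zeros; uniqueness then shows that the injections after the projections
   add up to the identity of S.\<close>
 have "EX h. h: nt S (Th (as ! i)) & (ALL j<N. cc (Th (as ! j)) S (Th (as ! i)) h (it j) = (if j = i then ide (cmod K C) (Th (as ! i)) else 0[NM (Th (as ! j)) (Th (as ! i))]))"
  if "i < N" for i
 proof (rule ex1_implies_ex, rule un[OF std_good[OF o[OF that]]])
  fix j assume j: "j < N"
  show "(if j = i then ide (cmod K C) (Th (as ! i)) else 0[NM (Th (as ! j)) (Th (as ! i))]): nt (Th (as ! j)) (Th (as ! i))"
   using cmod_ide[OF std_isf[OF o[OF that]]] mod_zero[OF module_nat_mod[OF std_isf[OF o[OF j]] std_isf[OF o[OF that]]]] by simp
 qed
 then obtain pj where pj: "!!i. i < N ==> pj i: nt S (Th (as ! i))"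
  "!!i j. i < N ==> j < N ==> cc (Th (as ! j)) S (Th (as ! i)) (pj i) (it j) = (if j = i then ide (cmod K C) (Th (as ! i)) else 0[NM (Th (as ! j)) (Th (as ! i))])"
  by metis
 let ?t = "%i. cc S (Th (as ! i)) S (it i) (pj i)"
 have t: "i < N ==> ?t i: nt S S" for i by (rule cc_nt[OF Sf pj(1) i])
 let ?s = "finsum (NM S S) ?t {..<N}"
 have sS: "?s: nt S S" using mod_finsum_cl[OF module_nat_mod[OF Sf Sf], of "{..<N}" ?t] t by simp
 have "?s = ide (cmod K C) S"
 proof -
  have "cc (Th (as ! j)) S S ?s (it j) = it j" if j: "j < N" for j
  proof (rule nt_ext[OF cc_nt[OF std_isf[OF o[OF j]] i[OF j] sS] i[OF j]])
   fix x v assume x: "x: Ob C" and v: "v <: (om (Th (as ! j)) x)"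
   interpret ab: abelian_group "om S x" by (rule mod_ag[OF mf_mod[OF Sf x]])
   have iv: "it j x v <: (om S x)" by (rule nt_cl[OF i[OF j] x v])
   have "?t k x (it j x v) = (if j = k then it j x v else 0[om S x])" if k: "k < N" for k
    using fun_cong[OF fun_cong[OF pj(2)[OF k j]], of x v] x v iv lin_0[OF mf_mod[OF std_isf[OF o[OF k]] x] mf_mod[OF Sf x] nt_lin[OF i[OF k] x]]
    by (auto split: if_splits)
   hence "finsum (om S x) (%k. ?t k x (it j x v)) {..<N} = finsum (om S x) (%k. if j = k then it j x v else 0[om S x]) {..<N}"
    by (intro ab.finsum_cong') (auto simp: iv)
   also have "... = it j x v" using ab.finsum_singleton[of j "{..<N}" "%_. it j x v"] j iv by simp
   finally show "cc (Th (as ! j)) S S ?s (it j) x v = it j x v" using x v eval_finsum[OF Sf Sf x iv, of "{..<N}" ?t] t by simp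
  qed
  moreover have "cc (Th (as ! j)) S S (ide (cmod K C) S) (it j) = it j" if j: "j < N" for j
   using tm.A_eq(2)[of "Th (as ! j)" S "it j"] i[OF j] S std_good[OF o[OF j]] by simp
  ultimately show ?thesis using un[OF S, of it] i sS cmod_ide[OF Sf] by blast
 qed
 note sid = this
 define p where "p i = e (as ! i) (it i (as ! i) (u (as ! i)))" for i
 have ei: "i < N ==> cc (Th (as ! i)) S P e (it i): nt (Th (as ! i)) P" for i by (rule cc_nt[OF std_isf[OF o] i en])
 have p: "i < N ==> p i <: (om P (as ! i))" for i unfolding p_def using nt_cl[OF en o nt_cl[OF i o]] u_in[OF o] by simp
 have yp: "i < N ==> yo P (as ! i) (p i) = cc (Th (as ! i)) S P e (it i)" for i
  by (rule yo_eq[OF P o ei]) (use o u_in[OF o] in "simp_all add: p_def")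
 have "dual_basis P N (%i. as ! i) p (%i. cc P S (Th (as ! i)) (pj i) s)" unfolding dual_basis_def
 proof (intro conjI allI ballI impI)
  fix x v assume x: "x: Ob C" and v: "v <: (om P x)"
  have sv: "s x v <: (om S x)" by (rule nt_cl[OF s(1) x v])
  have tv: "i < N ==> ?t i x (s x v) <: (om S x)" for i by (rule nt_cl[OF t x sv])
  interpret ab: abelian_group "om P x" by (rule mod_ag[OF mf_mod[OF Pf x]])
  have "v = e x (s x v)" using fun_cong[OF fun_cong[OF s(2)], of x v] x v by simp
  also have "s x v = ?s x (s x v)" unfolding sid using x sv by simp
  also have "... = finsum (om S x) (%i. ?t i x (s x v)) {..<N}" using eval_finsum[OF Sf Sf x sv, of "{..<N}" ?t] t by simp
  also have "e x ... = finsum (om P x) (%i. e x (?t i x (s x v))) {..<N}"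
   by (rule lin_finsum[OF mf_mod[OF Sf x] mf_mod[OF Pf x] nt_lin[OF en x]]) (use tv in auto)
  also have "... = finsum (om P x) (%i. yo P (as ! i) (p i) x (cc P S (Th (as ! i)) (pj i) s x v)) {..<N}"
   by (rule ab.finsum_cong') (use x v sv yp nt_cl[OF yo_nt[OF P o p] x] nt_cl[OF pj(1) x] in auto)
  finally show "v = finsum (om P x) (%i. yo P (as ! i) (p i) x (cc P S (Th (as ! i)) (pj i) s x v)) {..<N}" .
 qed (use o p cc_nt[OF Pf s(1) pj(1)] in auto)
 thus thesis by (rule that)
qed

text \<open>The transformation \<open>P \<rightarrow> F\<close> that factors as \<open>xi\<close> followed by the Yoneda map of \<open>v: F(a)\<close>; these
 elementary maps span \<open>Hom(P, F)\<close> when \<open>P\<close> has a dual basis.\<close>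

definition el where "el P F a v xi = cc P (Th a) F (yo F a v) xi"

lemma el_nt: "isf P ==> good F ==> a: Ob C ==> v <: (om F a) ==> xi: nt P (Th a) ==> el P F a v xi: nt P F"
 unfolding el_def by (rule cc_nt[OF _ _ yo_nt])

lemma el_app: "x: Ob C ==> w <: (om P x) ==> el P F a v xi x w = yo F a v x (xi x w)"
 unfolding el_def by simp

lemma yo_add:
 assumes F: "good F" and a: "a: Ob C" and v: "v <: (om F a)" "w <: (om F a)" and x: "x: Ob C" "t <: (om T (a, x))"
 shows "yo F a (v +[om F a] w) x t = yo F a v x t +[om F x] yo F a w x t"
proof -
 let ?s = "yo F a v +[NM (Th a) F] yo F a w"
 have "yo F a (v +[om F a] w) = ?s"
  by (rule yo_eq[OF F a]) (use mod_add[OF module_nat_mod[OF std_isf[OF a] good_isf[OF F]]] yo_nt[OF F a] yo_u[OF F a] v a u_in[OF a] in auto)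
 thus ?thesis using x by simp
qed

lemma yo_sm:
 assumes F: "good F" and a: "a: Ob C" and v: "v <: (om F a)" and k: "k <: K" and x: "x: Ob C" "t <: (om T (a, x))"
 shows "yo F a (k *[om F a] v) x t = k *[om F x] yo F a v x t"
proof -
 let ?s = "k *[NM (Th a) F] yo F a v"
 have "yo F a (k *[om F a] v) = ?s"
  by (rule yo_eq[OF F a]) (use mod_sm[OF module_nat_mod[OF std_isf[OF a] good_isf[OF F]] k] yo_nt[OF F a] yo_u[OF F a] v a u_in[OF a] in auto)
 thus ?thesis using x by simp
qed

lemma yo_mm:
 fixes F :: "('k, 'o, 'm, 'u) mfnc"
 assumes F: "good F" and o: "a: Ob C" "b: Ob C" and f: "f: Arr C a b" and v: "v <: (om F a)" and x: "x: Ob C" "t <: (om T (b, x))"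
 shows "yo F b (mm F a b f v) x t = yo F a v x (std_map C T b a f x t)"
proof -
 note s = std_map_nt[OF o(2,1) f]
 have "yo F b (mm F a b f v) = cc (Th b) (Th a) F (yo F a v) (std_map C T b a f)"
  by (rule yo_eq[OF F o(2) cc_nt[OF std_isf[OF o(2)] s yo_nt[OF F o(1) v]]])
   (use o u_in std_map_u[OF o(2,1) f] std_u[OF o f] nt_nat[OF yo_nt[OF F o(1) v] o f, of "u a"] yo_u[OF F o(1) v] in simp)
 thus ?thesis using x by simp
qed

context
 fixes P F :: "('k, 'o, 'm, 'u) mfnc" assumes P: "good P" and F: "good F"
begin

lemma el_in: "a: Ob C ==> v <: (om F a) ==> xi: nt P (Th a) ==> el P F a v xi: nt P F"
 by (rule el_nt[OF good_isf[OF P] F])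

lemma nat_mod_PF: "module K (NM P F)" by (rule module_nat_mod[OF good_isf[OF P] good_isf[OF F]])

context
 fixes a v xi assumes a: "a: Ob C" and v: "v <: (om F a)" and x: "xi: nt P (Th a)"
begin

lemma el_add:
 assumes w: "w <: (om F a)"
 shows "el P F a (v +[om F a] w) xi = el P F a v xi +[NM P F] el P F a w xi"
 by (rule nt_ext[OF el_in[OF a mod_add[OF mf_mod[OF good_isf[OF F] a] v w] x] mod_add[OF nat_mod_PF, simplified, OF el_in[OF a v x] el_in[OF a w x]]])
  (simp add: el_app yo_add[OF F a v w] nt_cl[OF x, simplified])

lemma el_sm:
 assumes k: "k <: K"
 shows "el P F a (k *[om F a] v) xi = k *[NM P F] el P F a v xi"
 by (rule nt_ext[OF el_in[OF a mod_sm[OF mf_mod[OF good_isf[OF F] a] k v] x] mod_sm[OF nat_mod_PF k, simplified, OF el_in[OF a v x]]])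
  (simp add: el_app yo_sm[OF F a v k] nt_cl[OF x, simplified])

lemma el_add2: "ze: nt P (Th a) ==>
  el P F a v (xi +[NM P (Th a)] ze) = el P F a v xi +[NM P F] el P F a v ze"
 unfolding el_def using tm.A_bil(1)[of P "Th a" F xi ze "yo F a v"] P F a x std_good[OF a] yo_nt[OF F a v] by simp

lemma el_sm2: "k <: K ==>
  el P F a v (k *[NM P (Th a)] xi) = k *[NM P F] el P F a v xi"
 unfolding el_def using tm.A_bil(3)[of P "Th a" F xi k "yo F a v"] P F a x std_good[OF a] yo_nt[OF F a v] by simp

lemma el_post:
 assumes H: "good H" and e: "et: nt F H"
 shows "cc P F H et (el P F a v xi) = el P H a (et a v) xi"
 by (rule nt_ext[OF cc_nt[OF good_isf[OF P] el_in[OF a v x] e] el_nt[OF good_isf[OF P] H a nt_cl[OF e a v] x]])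
  (simp add: el_app yo_comp[OF F H a v e] nt_cl[OF x, simplified])

lemma el_pre: "good Q ==> et: nt Q P ==> cc Q P F (el P F a v xi) et = el Q F a v (cc Q P (Th a) xi et)"
 unfolding el_def using tm.A_eq(3)[of Q P "Th a" F et xi "yo F a v"] P F a x std_good[OF a] yo_nt[OF F a v] by simp

end

text \<open>Moving f: a -> b from the element of F to the map out of P is the relation of a tensor
  product over C. With linearity in both arguments it makes \<open>el\<close> a pairing of F with DP
  that is balanced over C.\<close>

lemma el_mm:
 assumes o: "a: Ob C" "b: Ob C" and f: "f: Arr C a b" and v: "v <: (om F a)" and x: "xi: nt P (Th b)"
 shows "el P F b (mm F a b f v) xi = el P F a v (cc P (Th b) (Th a) (std_map C T b a f) xi)"
 by (rule nt_ext[OF el_in[OF o(2) mf_cl[OF good_isf[OF F] o f v] x] el_in[OF o(1) v cc_nt[OF good_isf[OF P] x std_map_nt[OF o(2,1) f]]]])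
  (simp add: el_app yo_mm[OF F o f v] nt_cl[OF x, simplified])

text \<open>The dual basis is inserted into the argument of f, and f moves past the Yoneda maps by
  \<open>yo_comp\<close>.\<close>

lemma el_expand:
 assumes B: "dual_basis P N a p xi" and f: "f: nt P F"
 shows "f = finsum (NM P F) (%i. el P F (a i) (f (a i) (p i)) (xi i)) {..<N}"
proof -
 note Pf = good_isf[OF P] and Ff = good_isf[OF F]
 note b = dual_basisD(1-3)[OF B]
 have e: "i < N ==> el P F (a i) (f (a i) (p i)) (xi i): nt P F" for i by (rule el_nt[OF Pf F b(1) nt_cl[OF f b(1,2)] b(3)])
 show ?thesis
 proof (rule nt_ext[OF f])
  show "finsum (NM P F) (%i. el P F (a i) (f (a i) (p i)) (xi i)) {..<N}: nt P F"
   using mod_finsum_cl[OF module_nat_mod[OF Pf Ff], of "{..<N}" "%i. el P F (a i) (f (a i) (p i)) (xi i)"] e by simp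
  fix x v assume x: "x: Ob C" and v: "v <: (om P x)"
  interpret ab: abelian_group "om F x" by (rule mod_ag[OF mf_mod[OF Ff x]])
  have y: "i < N ==> yo P (a i) (p i) x (xi i x v) <: (om P x)" for i
   using nt_cl[OF yo_nt[OF P b(1,2)] x] nt_cl[OF b(3) x v] by simp
  have "f x v = f x (finsum (om P x) (%i. yo P (a i) (p i) x (xi i x v)) {..<N})" using dual_basis_eq[OF B x v] by simp
  also have "... = finsum (om F x) (%i. f x (yo P (a i) (p i) x (xi i x v))) {..<N}"
   by (rule lin_finsum[OF mf_mod[OF Pf x] mf_mod[OF Ff x] nt_lin[OF f x]]) (use y in auto)
  also have "... = finsum (om F x) (%i. el P F (a i) (f (a i) (p i)) (xi i) x v) {..<N}"
   by (rule ab.finsum_cong') (use x v b nt_cl[OF b(3) x v] yo_comp[OF P F _ _ f x] nt_cl[OF e x v] in "auto simp: el_app")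
  finally show "f x v = finsum (NM P F) (%i. el P F (a i) (f (a i) (p i)) (xi i)) {..<N} x v"
   using eval_finsum[OF Pf Ff x v, of "{..<N}" "%i. el P F (a i) (f (a i) (p i)) (xi i)"] e by simp
 qed
qed

end

context
 fixes P F :: "('k, 'o, 'm, 'u) mfnc" assumes P: "good P" and F: "good F"
begin

text \<open>By \<open>el_expand\<close> the elementary maps at the dual basis span Hom(P,
  F).\<close>

lemma functional_eqI:
 assumes B: "dual_basis P N a p xi" and al: "al: lin K (NM P F) M" "be: lin K (NM P F) M" and M: "module K M"
  and e: "!!i v. i < N ==> v <: (om F (a i)) ==> al (el P F (a i) v (xi i)) = be (el P F (a i) v (xi i))"
 shows "al = be"
proof (rule lin_ext[OF al])
 note Pf = good_isf[OF P] and Ff = good_isf[OF F]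
 interpret ab: abelian_group M by (rule mod_ag[OF M])
 fix f assume "f <: (NM P F)"
 hence f: "f: nt P F" by simp
 note b = dual_basisD(1-3)[OF B]
 have t: "i < N ==> el P F (a i) (f (a i) (p i)) (xi i) <: (NM P F)" for i using el_nt[OF Pf F b(1) nt_cl[OF f b(1,2)] b(3)] by simp
 have "al f = finsum M (%i. al (el P F (a i) (f (a i) (p i)) (xi i))) {..<N}"
  using lin_finsum[OF module_nat_mod[OF Pf Ff] M al(1), of "{..<N}"] t by (subst el_expand[OF P F B f]) simp
 also have "... = finsum M (%i. be (el P F (a i) (f (a i) (p i)) (xi i))) {..<N}"
  by (rule ab.finsum_cong') (use e b nt_cl[OF f] t lin_cl[OF al(2)] in auto)
 also have "... = be f"
  using lin_finsum[OF module_nat_mod[OF Pf Ff] M al(2), of "{..<N}" "%i. el P F (a i) (f (a i) (p i)) (xi i)"] t el_expand[OF P F B f] by simp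
 finally show "al f = be f" .
qed

text \<open>On a map f the functional has to be the sum of ta at the pairs f(p i), xi i. That it has
  the prescribed value at every elementary map is seen by expanding ze in the dual basis and
  applying \<open>bal\<close> to the Yoneda map of each ze(p i). The balance is therefore required
  along all maps T_y -> T_x and not only those induced by arrows of C.\<close>

lemma functional_exists:
 assumes B: "dual_basis P N a p xi"
  and c: "!!x v ze. x: Ob C ==> v <: (om F x) ==> ze: nt P (Th x) ==> ta x v ze <: K"
  and a1: "!!x v w ze. x: Ob C ==> v <: (om F x) ==> w <: (om F x) ==> ze: nt P (Th x) ==> ta x (v +[om F x] w) ze = ta x v ze \<oplus> ta x w ze"
  and s1: "!!x v k ze. x: Ob C ==> v <: (om F x) ==> k <: K ==> ze: nt P (Th x) ==> ta x (k *[om F x] v) ze = k \<otimes> ta x v ze"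
  and l2: "!!x v. x: Ob C ==> v <: (om F x) ==> (\<lambda>ze\<in>nt P (Th x). ta x v ze): lin K (NM P (Th x)) (ground K)"
  and bal: "!!x y t v ze. x: Ob C ==> y: Ob C ==> v <: (om F x) ==> t: nt (Th y) (Th x) ==> ze: nt P (Th y) ==>
    ta y (yo F x v y (t y (u y))) ze = ta x v (cc P (Th y) (Th x) t ze)"
 shows "EX al:lin K (NM P F) (ground K). ALL x:Ob C. ALL v:carrier (om F x). ALL ze:nt P (Th x). al (el P F x v ze) = ta x v ze"
proof -
 note Pf = good_isf[OF P] and Ff = good_isf[OF F]
 note b = dual_basisD(1-3)[OF B]
 note M = module_nat_mod[OF Pf Ff]
 define al where "al = (\<lambda>f\<in>nt P F. finsum K (%i. ta (a i) (f (a i) (p i)) (xi i)) {..<N})"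
 have ti: "f: nt P F ==> i < N ==> ta (a i) (f (a i) (p i)) (xi i) <: K" for f i using c b nt_cl by metis
 have "al: lin K (NM P F) (ground K)"
 proof (rule linI)
  fix f assume "f <: (NM P F)"
  hence f: "f: nt P F" by simp
  show "al f <: (ground K)" using ti[OF f] f by (auto simp: al_def)
  { fix k assume k: "k <: K"
   have kf: "k *[NM P F] f: nt P F" using mod_sm[OF M k, of f] f by simp
   have "finsum K (%i. ta (a i) ((k *[NM P F] f) (a i) (p i)) (xi i)) {..<N} = finsum K (%i. k \<otimes> ta (a i) (f (a i) (p i)) (xi i)) {..<N}"
    by (rule finsum_cong') (use b ti[OF f] k s1 nt_cl[OF f] in auto)
   thus "al (k *[NM P F] f) = k *[ground K] al f" using f kf ti[OF f] k by (simp add: al_def finsum_rdistr Pi_iff) }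
  fix g assume "g <: (NM P F)"
  hence g: "g: nt P F" by simp
  have fg: "f +[NM P F] g: nt P F" using mod_add[OF M, of f g] f g by simp
  have "finsum K (%i. ta (a i) ((f +[NM P F] g) (a i) (p i)) (xi i)) {..<N} = finsum K (%i. ta (a i) (f (a i) (p i)) (xi i) \<oplus> ta (a i) (g (a i) (p i)) (xi i)) {..<N}"
   by (rule finsum_cong') (use b ti[OF f] ti[OF g] a1 nt_cl[OF f] nt_cl[OF g] in auto)
  thus "al (f +[NM P F] g) = al f +[ground K] al g" using f g fg ti[OF f] ti[OF g] by (simp add: al_def finsum_addf Pi_iff)
 qed (simp add: al_def)
 moreover have "al (el P F x v ze) = ta x v ze" if x: "x: Ob C" and v: "v <: (om F x)" and z: "ze: nt P (Th x)" for x v ze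
 proof -
  let ?e = "%i. el P (Th x) (a i) (ze (a i) (p i)) (xi i)"
  have zp: "i < N ==> ze (a i) (p i) <: (om (Th x) (a i))" for i using nt_cl[OF z b(1,2)] .
  have en: "i < N ==> ?e i: nt P (Th x)" for i by (rule el_nt[OF Pf std_good[OF x] b(1) zp b(3)])
  note z2 = el_expand[OF P std_good[OF x] B z]
  have "ta x v ze = (\<lambda>ze\<in>nt P (Th x). ta x v ze) (finsum (NM P (Th x)) ?e {..<N})" using z2 z by simp
  also have "... = finsum (ground K) (%i. (\<lambda>ze\<in>nt P (Th x). ta x v ze) (?e i)) {..<N}"
   by (rule lin_finsum[OF module_nat_mod[OF Pf std_isf[OF x]] module_ground l2[OF x v]]) (use en in auto)
  also have "... = finsum (ground K) (%i. ta x v (?e i)) {..<N}"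
   by (rule abelian_monoid.finsum_cong'[OF abelian_group.axioms(1)[OF mod_ag[OF module_ground]]]) (use en c[OF x v] in auto)
  also have "... = finsum K (%i. ta x v (?e i)) {..<N}" by (simp add: finsum_def finprod_def ground_def)
  also have "... = finsum K (%i. ta (a i) (el P F x v ze (a i) (p i)) (xi i)) {..<N}"
  proof (rule finsum_cong')
   show "{..<N} = {..<N}" ..
   fix i assume "i: {..<N}"
   hence i: "i < N" by simp
   have "ta x v (?e i) = ta (a i) (yo F x v (a i) (yo (Th x) (a i) (ze (a i) (p i)) (a i) (u (a i)))) (xi i)"
    unfolding el_def by (rule bal[OF x b(1)[OF i] v yo_nt[OF std_good[OF x] b(1) zp] b(3), symmetric]) (use i in auto)
   thus "ta x v (?e i) = ta (a i) (el P F x v ze (a i) (p i)) (xi i)"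
    using yo_u[OF std_good[OF x] b(1)[OF i] zp[OF i]] b[OF i] by (simp add: el_app)
  qed (use ti[OF el_nt[OF Pf F x v z]] in auto)
  finally show ?thesis using el_nt[OF Pf F x v z] by (simp add: al_def)
 qed
 ultimately show ?thesis by blast
qed

end

end

section \<open>Duals and copies of module-valued functors\<close>

context gf
begin

lemma dual_fnc_isf:
 assumes C: "category C" and F: "is_functor (op_cat C) (kmod K) F"
 shows "is_functor C (kmod K) (dual_fnc K F)"
proof -
 note l = mf_lin[OF F, simplified]
 have d: "x: Ob C ==> module K (om F x)" for x using mf_mod[OF F] by simp
 have m: "x: Ob C ==> y: Ob C ==> f: Arr C x y ==> mm (dual_fnc K F) x y f: lin K (om (dual_fnc K F) x) (om (dual_fnc K F) y)" for x y f
  unfolding dual_fnc_def using dual_map_in[OF d d l] by simp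
 note c = lin_cl[OF m, simplified dual_fnc_def fnc.simps dual_sel]
 show ?thesis
 proof (rule mfI[OF C _ m])
  show "x: Ob C ==> module K (om (dual_fnc K F) x)" for x using module_dual[OF d] by (simp add: dual_fnc_def)
  fix x al assume x: "x: Ob C" and a: "al <: (om (dual_fnc K F) x)"
  hence al: "al: lin K (om F x) KK" by (simp add: dual_fnc_def dual_sel)
  note i = cat_ide[OF C x]
  show "mm (dual_fnc K F) x x (ide C x) al = al"
   unfolding dual_fnc_def fnc.simps by (rule lin_ext[OF c[OF x x i al] al]) (use x mf_ide[OF F, of x] in "simp add: dual_map_app[OF al]")
  fix y z f g assume y: "y: Ob C" and z: "z: Ob C" and f: "f: Arr C x y" and g: "g: Arr C y z"
  show "mm (dual_fnc K F) x z (cmp C x y z g f) al = mm (dual_fnc K F) y z g (mm (dual_fnc K F) x y f al)"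
   unfolding dual_fnc_def fnc.simps
   by (rule lin_ext[OF c[OF x z cat_cmp[OF C x y z f g] al] c[OF y z g c[OF x y f al]]])
    (use mf_cmp[OF F, of z y x g f] mf_cl[OF F, of z y g] x y z f g in "simp add: dual_map_app[OF al] dual_map_app[OF c[OF x y f al]]")
 qed
qed

lemma dual_nat_nt:
 assumes F: "is_functor (op_cat C) (kmod K) F" and G: "is_functor (op_cat C) (kmod K) G" and p: "fi: nat_trans K (op_cat C) G F"
 shows "dual_nat K C G F fi: nat_trans K C (dual_fnc K F) (dual_fnc K G)"
proof (rule ntI)
 have m: "x: Ob C ==> module K (om F x)" "x: Ob C ==> module K (om G x)" for x using mf_mod[OF F] mf_mod[OF G] by simp_all
 have d: "dual_map K (om G x) (om F x) (fi x): lin K (dual K (om F x)) (dual K (om G x))" if "x: Ob C" for x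
  using dual_map_in[OF m(2,1) nt_lin[OF p]] that by simp
 thus "dual_nat K C G F fi x: lin K (om (dual_fnc K F) x) (om (dual_fnc K G) x)" if "x: Ob C" for x
  using that by (simp add: dual_nat_def dual_fnc_def)
 fix x y f al assume x: "x: Ob C" and y: "y: Ob C" and f: "f: Arr C x y" and a: "al <: (om (dual_fnc K F) x)"
 hence al: "al: lin K (om F x) KK" by (simp add: dual_fnc_def dual_sel)
 have e: "dual_map K (om F y) (om F x) (mm F y x f): lin K (dual K (om F x)) (dual K (om F y))"
   "dual_map K (om G y) (om G x) (mm G y x f): lin K (dual K (om G x)) (dual K (om G y))"
  using dual_map_in[OF m(1)[OF y] m(1)[OF x] mf_lin[OF F, of y x f]] dual_map_in[OF m(2)[OF y] m(2)[OF x] mf_lin[OF G, of y x f]] x y f by simp_all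
 note c = lin_cl[OF e(1), simplified dual_sel, OF al] lin_cl[OF d[OF x], simplified dual_sel, OF al]
 show "dual_nat K C G F fi y (mm (dual_fnc K F) x y f al) = mm (dual_fnc K G) x y f (dual_nat K C G F fi x al)"
  unfolding dual_nat_def dual_fnc_def fnc.simps restrict_apply'[OF x] restrict_apply'[OF y]
  by (rule lin_ext[OF lin_cl[OF d[OF y], simplified dual_sel, OF c(1)] lin_cl[OF e(2), simplified dual_sel, OF c(2)]])
   (use x y f nt_nat[OF p, of y x f] nt_cl[OF p, of y] mf_cl[OF G, of y x f] in "simp add: dual_map_app[OF al] dual_map_app[OF c(1)] dual_map_app[OF c(2)]")
qed (simp add: dual_nat_def)

lemma cpy_isf:
 fixes F :: "('k, 'o, 'm, 'v) mfnc"
 assumes C: "category C" and F: "is_functor C (kmod K) F" and i: "!!x. x: Ob C ==> inj_on (emb (om F x) :: 'v => 'w) (carrier (om F x))"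
 shows "is_functor C (kmod K) (cpy_fnc F :: ('k, 'o, 'm, 'w) mfnc)"
proof (rule mfI[OF C], unfold cpy_fnc_def fnc.simps)
 note m = mf_mod[OF F] and l = mf_lin[OF F]
 show "x: Ob C ==> module K (cpy (om F x) :: ('k, 'w) module)" for x by (rule module_cpy[OF m i])
 show "x: Ob C ==> y: Ob C ==> f: Arr C x y ==> cpy_map (om F x) (om F y) (mm F x y f): lin K (cpy (om F x) :: ('k, 'w) module) (cpy (om F y))" for x y f
  by (intro cpy_map_in m i l)
 fix x and v :: 'w assume x: "x: Ob C" and "v <: (cpy (om F x))"
 then obtain w where w: "w <: (om F x)" "v = emb (om F x) w" using cpy_sel(1)[OF m i, OF x x] by auto
 note e = cpy_map_emb[OF i[OF x] w(1)]
 show "cpy_map (om F x) (om F x) (mm F x x (ide C x)) v = v" unfolding w e using mf_ide[OF F x w(1)] by simp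
 fix y z f g assume y: "y: Ob C" and z: "z: Ob C" and f: "f: Arr C x y" and g: "g: Arr C y z"
 show "cpy_map (om F x) (om F z) (mm F x z (cmp C x y z g f)) v = cpy_map (om F y) (om F z) (mm F y z g) (cpy_map (om F x) (om F y) (mm F x y f) v)"
  unfolding w e cpy_map_emb[OF i[OF y] mf_cl[OF F x y f w(1)]] using mf_cmp[OF F x y z f g w(1)] by simp
qed

end

context yon
begin

subsection \<open>Biduality of functors of finite type\<close>

text \<open>Triples of an index, an arrow and a scalar are coded in the type whose subsets
  \<epsilon> names; a set of triples then has a name in 'u.\<close>

lemma code_exists: "EX g :: nat \<times> 'm \<times> 'k => 'k + 'o + 'm + nat. inj g"
proof -
 have "infinite (UNIV :: ('k + 'o + 'm + nat) set)"
  using finite_imageD[of "%n. Inr (Inr (Inr n)) :: 'k + 'o + 'm + nat" UNIV] finite_subset[OF subset_UNIV] infinite_UNIV_nat by (auto simp: inj_def)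
 hence "(card_of (UNIV \<times> UNIV :: (('k + 'o + 'm + nat) \<times> ('k + 'o + 'm + nat)) set), card_of (UNIV :: ('k + 'o + 'm + nat) set)): ordLeq"
  by (rule ordIso_imp_ordLeq[OF card_of_Times_same_infinite])
 then obtain q :: "('k + 'o + 'm + nat) \<times> ('k + 'o + 'm + nat) => 'k + 'o + 'm + nat" where "inj_on q (UNIV \<times> UNIV)"
  using card_of_ordLeq[of "UNIV \<times> UNIV" "UNIV :: ('k + 'o + 'm + nat) set"] by auto
 hence [simp]: "q x = q y \<longleftrightarrow> x = y" for x y by (simp add: inj_on_eq_iff)
 have "inj (%(n, h, c). q (Inr (Inr (Inr n)), q (Inr (Inr (Inl h)), Inl c)))" by (rule injI) (auto split: prod.splits)
 thus ?thesis by blast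
qed

text \<open>\<open>nd F x\<close> is the value of (DF)' at x. A functional is packed by
  \<open>mk\<close> into the element of 'u that names it, and \<open>pa\<close> unpacks it.\<close>

abbreviation "nd F x == dual K (NM F (Th x))"
abbreviation "mk F x al == emb (nd F x) al :: 'u"
abbreviation "pa F x == unemb (nd F x) :: 'u => ('o => 'u => 'u) => 'k"

text \<open>The functor (DF)' moved to the type 'u; \<open>ea\<close> is its action on maps. Both
  are free of signs, which enter only with complexes.\<close>

definition eo :: "('k, 'o, 'm, 'u) mfnc => ('k, 'o, 'm, 'u) mfnc" where
 "eo F = cpy_fnc (dual_fnc K (D_ob K C T F))"

definition ea :: "('k, 'o, 'm, 'u) mfnc => ('k, 'o, 'm, 'u) mfnc => ('o => 'u => 'u) => 'o => 'u => 'u" where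
 "ea F G fi = cpy_nat C (dual_fnc K (D_ob K C T F)) (dual_fnc K (D_ob K C T G)) (dual_nat K C (D_ob K C T G) (D_ob K C T F) (D_arr K C T F G fi))"

text \<open>The functors \<open>F\<close> for which the values of \<open>(DF)'\<close> fit into the type \<open>'u\<close>.\<close>

definition small :: "('k, 'o, 'm, 'u) mfnc => bool" where
 "small F \<longleftrightarrow> good F & (ALL x:Ob C. inj_on (emb (nd F x) :: _ => 'u) (carrier (nd F x)))"

text \<open>A functional on Hom(P, T_x) is determined by its values at the elementary maps
  \<open>?e i h\<close> with i < N and h: x -> a i, since these span. Its graph on these maps is a
  set of triples (i, h, scalar), and \<epsilon> turns the set into an element of 'u.\<close>

lemma dual_basis_small:
 assumes B: "dual_basis P N a p xi" and P: "good P"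
 shows "small P" unfolding small_def
proof (intro conjI P ballI)
 fix x assume x: "x: Ob C"
 note b = dual_basisD(1-3)[OF B]
 note M = module_nat_mod[OF good_isf[OF P] std_isf[OF x]]
 obtain g :: "nat \<times> 'm \<times> 'k => 'k + 'o + 'm + nat" where g: "inj g" using code_exists by blast
 let ?e = "%i h. el P (Th x) (a i) (te x (a i) h) (xi i)"
 let ?E = "%al. \<epsilon> {g (i, h, al (?e i h)) | i h. i < N & h: Arr C x (a i)}"
 have "inj_on ?E (carrier (nd P x))"
 proof (rule inj_onI)
  fix al be assume al: "al <: (nd P x)" "be <: (nd P x)" and e: "?E al = ?E be"
  note al = al[unfolded dual_sel]
  have ih: "al (?e i h) = be (?e i h)" if "i < N" "h: Arr C x (a i)" for i h
  proof -
   have "g (i, h, al (?e i h)): {g (i, h, be (?e i h)) | i h. i < N & h: Arr C x (a i)}"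
    unfolding injD[OF eps e, symmetric] using that by blast
   then obtain i' h' where "g (i, h, al (?e i h)) = g (i', h', be (?e i' h'))" by blast
   from injD[OF g this] show ?thesis by (metis prod.inject)
  qed
  show "al = be"
  proof (rule functional_eqI[OF P std_good[OF x] B al module_ground])
   fix i v assume i: "i < N" and v: "v <: (om (Th x) (a i))"
   let ?S = "Arr C x (a i)"
   note ml = mu_lin[OF x b(1)[OF i]]
   obtain fi where p: "fi <: (free_mod K ?S)" "v = \<mu> (x, a i) fi"
    using yb v x b(1)[OF i] unfolding yoneda_bifunctor_def free_hom_def by fastforce
   have mc: "sy <: (free_mod K ?S) ==> \<mu> (x, a i) sy <: (om (Th x) (a i))" for sy using lin_cl[OF ml] by simp
   note E = el_in[OF P std_good[OF x] b(1)[OF i] _ b(3)[OF i]]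
   note l = el_add[OF P std_good[OF x] b(1)[OF i] _ b(3)[OF i]] el_sm[OF P std_good[OF x] b(1)[OF i] _ b(3)[OF i]]
   let ?P = "%sy. al (el P (Th x) (a i) (\<mu> (x, a i) sy) (xi i)) = be (el P (Th x) (a i) (\<mu> (x, a i) sy) (xi i))"
   have sm: "?P (c *[free_mod K ?S] sy)" if "c <: K" "sy <: (free_mod K ?S)" "?P sy" for c sy
    using that lin_sm[OF ml] l(2)[OF mc] lin_sm[OF al(1)] lin_sm[OF al(2)] E[OF mc] by simp
   have zc: "(%s. \<zero>) <: (free_mod K ?S)" and z0: "\<zero> *[free_mod K ?S] (%s. \<zero>) = (%s. \<zero>)" by (auto simp: free_mod_def)
   have "?P (%s. \<zero>)"
   proof -
    have "\<mu> (x, a i) (%s. \<zero>) = \<zero> *[om (Th x) (a i)] \<mu> (x, a i) (%s. \<zero>)" using lin_sm[OF ml _ zc, of \<zero>] z0 by simp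
    hence "el P (Th x) (a i) (\<mu> (x, a i) (%s. \<zero>)) (xi i) = \<zero> *[NM P (Th x)] el P (Th x) (a i) (\<mu> (x, a i) (%s. \<zero>)) (xi i)"
     using l(2)[OF mc[OF zc], of \<zero>] by simp
    thus ?thesis using lin_0[OF M module_ground al(1)] lin_0[OF M module_ground al(2)] mod_0s[OF M] E[OF mc[OF zc]] by simp
   qed
   hence "?P fi"
   proof (rule free_span[OF p(1)])
    show "?P (free_basis K h)" if "h: ?S" for h using ih[OF i that] by (simp add: te_def)
    show "?P (fi +[free_mod K ?S] sy)" if "fi <: (free_mod K ?S)" "sy <: (free_mod K ?S)" "?P fi" "?P sy" for fi sy
     using that lin_add[OF ml] l(1)[OF mc mc] lin_add[OF al(1)] lin_add[OF al(2)] E[OF mc] by simp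
   qed (rule sm)
   thus "al (el P (Th x) (a i) v (xi i)) = be (el P (Th x) (a i) v (xi i))" using p by simp
  qed
 qed
 thus "inj_on (emb (nd P x) :: _ => 'u) (carrier (nd P x))" by (rule emb_inj)
qed

lemma eo_sel: "om (eo F) x = cpy (nd F x)" by (simp add: eo_def cpy_fnc_def dual_fnc_def D_ob_def)

context
 fixes F :: "('k, 'o, 'm, 'u) mfnc" assumes F: "small F"
begin

lemma small_good: "good F" using F by (simp add: small_def)

lemma nd_mod: "x: Ob C ==> module K (NM F (Th x))" "x: Ob C ==> module K (nd F x)"
 using module_nat_mod[OF good_isf[OF small_good] std_isf] module_dual by blast+

lemma nd_inj: "x: Ob C ==> inj_on (emb (nd F x) :: _ => 'u) (carrier (nd F x))" using F by (simp add: small_def)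

lemma eo_mod: "x: Ob C ==> module K (om (eo F) x)"
 unfolding eo_sel by (rule module_cpy[OF nd_mod(2) nd_inj])

lemma mk_in: "x: Ob C ==> al: lin K (NM F (Th x)) KK ==> mk F x al <: (om (eo F) x)"
 unfolding eo_sel using cpy_sel(1)[OF nd_mod(2) nd_inj] by (simp add: dual_sel)

lemma pa_in: "x: Ob C ==> v <: (om (eo F) x) ==> pa F x v: lin K (NM F (Th x)) KK"
 unfolding eo_sel using unemb_in[OF nd_mod(2) nd_inj] by (simp add: dual_sel)

lemma pa_mk: "x: Ob C ==> al: lin K (NM F (Th x)) KK ==> pa F x (mk F x al) = al"
 using unemb_emb[OF nd_mod(2) nd_inj] by (simp add: dual_sel)

lemma mk_pa: "x: Ob C ==> v <: (om (eo F) x) ==> mk F x (pa F x v) = v"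
 unfolding eo_sel using emb_unemb[OF nd_mod(2) nd_inj] by simp

lemma pa_add: "x: Ob C ==> v <: (om (eo F) x) ==> w <: (om (eo F) x) ==> xi: nt F (Th x) ==>
  pa F x (v +[om (eo F) x] w) xi = pa F x v xi \<oplus> pa F x w xi"
 and pa_sm: "x: Ob C ==> v <: (om (eo F) x) ==> c <: K ==> xi: nt F (Th x) ==>
  pa F x (c *[om (eo F) x] v) xi = c \<otimes> pa F x v xi"
 unfolding eo_sel using unemb_add[OF nd_mod(2) nd_inj] unemb_sm[OF nd_mod(2) nd_inj] by (simp_all add: dual_add dual_sm)

lemma pa_cl: "x: Ob C ==> v <: (om (eo F) x) ==> xi: nt F (Th x) ==> pa F x v xi <: K"
 using dual_app[OF pa_in] by simp

lemma eo_ext: "x: Ob C ==> v <: (om (eo F) x) ==> w <: (om (eo F) x) ==>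
  (!!xi. xi: nt F (Th x) ==> pa F x v xi = pa F x w xi) ==> v = w"
 by (rule box_equals[OF arg_cong[where f = "emb (nd F x)", OF lin_ext[OF pa_in pa_in]] mk_pa mk_pa]) simp_all

lemma D_mm:
 assumes "x: Ob C" "y: Ob C" "f: Arr C x y"
 shows "mm (D_ob K C T F) y x f: lin K (NM F (Th y)) (NM F (Th x))"
  and "xi: nt F (Th y) ==> mm (D_ob K C T F) y x f xi = cc F (Th y) (Th x) (std_map C T y x f) xi"
 using kl_r[OF TM_klinear, of F "Th y" "Th x" "std_map C T y x f"] std_map_nt[OF assms(2,1,3)] small_good std_good[OF assms(1)] std_good[OF assms(2)]
 by (simp_all add: D_ob_def)

lemma eo_mm_eq: "mm (eo F) x y f = cpy_map (nd F x) (nd F y) (dual_map K (NM F (Th y)) (NM F (Th x)) (mm (D_ob K C T F) y x f))"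
 by (simp add: eo_def cpy_fnc_def dual_fnc_def, simp add: D_ob_def)

lemma D_isf: "is_functor (op_cat C) (kmod K) (D_ob K C T F)"
proof (rule mfI[OF op_category[OF C_cat]], unfold op_sel)
 note g = good_isf[OF small_good]
 have o: "om (D_ob K C T F) x = NM F (Th x)" for x by (simp add: D_ob_def)
 show "x: Ob C ==> module K (om (D_ob K C T F) x)" for x using nd_mod(1) by (simp add: o)
 show "x: Ob C ==> y: Ob C ==> f: Arr C y x ==> mm (D_ob K C T F) x y f: lin K (om (D_ob K C T F) x) (om (D_ob K C T F) y)" for x y f
  unfolding o by (rule D_mm(1))
 fix x xi assume x: "x: Ob C" and "xi <: (om (D_ob K C T F) x)"
 hence xi: "xi: nt F (Th x)" by (simp add: o)
 have i: "ide C x: Arr C x x" using C_eq(1) x by blast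
 show "mm (D_ob K C T F) x x (ide C x) xi = xi" unfolding D_mm(2)[OF x x i xi]
  by (rule nt_ext[OF cc_nt[OF g xi std_map_nt[OF x x i]] xi])
   (use fnc_ide[OF TF] x nt_cl[OF xi] C_eq(1) in "auto simp: std_map_def kmod_def")
 fix y z f h assume y: "y: Ob C" and z: "z: Ob C" and f: "f: Arr C y x" and h: "h: Arr C z y"
 note s = std_map_nt[OF x y f] std_map_nt[OF y z h] std_map_nt[OF x z C_eq(2)[OF z y x h f]]
 show "mm (D_ob K C T F) x z (cmp C z y x f h) xi = mm (D_ob K C T F) y z h (mm (D_ob K C T F) x y f xi)"
  unfolding D_mm(2)[OF z x C_eq(2)[OF z y x h f] xi] D_mm(2)[OF y x f xi] D_mm(2)[OF z y h cc_nt[OF g xi s(1)]]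
 proof (rule nt_ext[OF cc_nt[OF g xi s(3)] cc_nt[OF g cc_nt[OF g xi s(1)] s(2)]])
  fix w t assume w: "w: Ob C" and t: "t <: (om F w)"
  show "cc F (Th x) (Th z) (std_map C T x z (cmp C z y x f h)) xi w t = cc F (Th y) (Th z) (std_map C T y z h) (cc F (Th x) (Th y) (std_map C T x y f) xi) w t"
   using fnc_cmp[OF TF, of "(x, w)" "(y, w)" "(z, w)" "(f, ide C w)" "(h, ide C w)"] w t x y z f h nt_cl[OF xi w t] C_eq
   by (simp add: std_map_def kmod_def compose_def)
 qed
qed

lemma dual_D_isf: "is_functor C (kmod K) (dual_fnc K (D_ob K C T F))"
 by (rule dual_fnc_isf[OF C_cat D_isf])

lemma dual_D_sel: "om (dual_fnc K (D_ob K C T F)) x = nd F x" by (simp add: dual_fnc_def D_ob_def)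

lemma eo_isf: "isf (eo F)" unfolding eo_def
 by (rule cpy_isf[OF C_cat dual_D_isf]) (simp add: dual_D_sel nd_inj)

lemmas eo_lin = mf_lin[OF eo_isf]

lemma eo_mm:
 assumes "x: Ob C" "y: Ob C" "f: Arr C x y" "v <: (om (eo F) x)" "xi: nt F (Th y)"
 shows "pa F y (mm (eo F) x y f v) xi = pa F x v (cc F (Th y) (Th x) (std_map C T y x f) xi)"
proof -
 let ?d = "dual_map K (NM F (Th y)) (NM F (Th x)) (mm (D_ob K C T F) y x f)"
 have "mm (eo F) x y f v = mk F y (?d (pa F x v))" unfolding eo_mm_eq
  using cpy_map_emb[OF nd_inj[OF assms(1)], of "pa F x v"] mk_pa[OF assms(1,4)] pa_in[OF assms(1,4)] by (simp add: dual_sel)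
 moreover have "?d (pa F x v): lin K (NM F (Th y)) KK"
  using lin_cl[OF dual_map_in[OF nd_mod(1)[OF assms(2)] nd_mod(1)[OF assms(1)] D_mm(1)[OF assms(1-3)]]] pa_in[OF assms(1,4)] by (simp add: dual_sel)
 ultimately show ?thesis using pa_mk[OF assms(2)] dual_map_app[OF pa_in[OF assms(1,4)], of xi] D_mm(2)[OF assms(1-3,5)] assms(5) by simp
qed

text \<open>An element v of (DF)'(a) is a functional on Hom(F, T_a). For t in T_a(x) and xi: F ->
  T_x the elementary map of t and xi goes from F to T_a, and v can be evaluated there; as xi varies
  this is the image of t under the Yoneda map of v. Naturality is the balance \<open>el_mm\<close>,
  and at t = \<open>u a\<close> the elementary map is xi itself. This puts (DF)' into
  C_T-mod.\<close>

lemma eo_yo_exists: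
 assumes a: "a: Ob C" and v: "v <: (om (eo F) a)"
 shows "EX th:nt (Th a) (eo F). th a (u a) = v & (ALL x:Ob C. ALL t:carrier (om (Th a) x). ALL xi:nt F (Th x). pa F x (th x t) xi = pa F a v (el F (Th a) x t xi))"
proof -
 note sg = small_good std_good[OF a]
 note pl = pa_in[OF a v]
 let ?b = "%x t. \<lambda>xi\<in>nt F (Th x). pa F a v (el F (Th a) x t xi)"
 have E: "x: Ob C ==> t <: (om (Th a) x) ==> xi: nt F (Th x) ==> el F (Th a) x t xi <: (NM F (Th a))" for x t xi
  using el_in[OF sg, of x t xi] by simp
 have bl: "x: Ob C ==> t <: (om (Th a) x) ==> ?b x t: lin K (NM F (Th x)) KK" for x t
  using mod_add[OF nd_mod(1), of x] mod_sm[OF nd_mod(1), of x] dual_app[OF pl E, of x t] lin_add[OF pl E E, of x t] lin_sm[OF pl _ E, of _ x t]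
  by (intro linI) (simp_all add: el_add2[OF sg] el_sm2[OF sg])
 define th where "th = (\<lambda>x\<in>Ob C. \<lambda>t\<in>carrier (om (Th a) x). mk F x (?b x t))"
 have tc: "x: Ob C ==> t <: (om (Th a) x) ==> th x t <: (om (eo F) x)" for x t unfolding th_def using mk_in[OF _ bl] by simp
 have tp: "x: Ob C ==> t <: (om (Th a) x) ==> xi: nt F (Th x) ==> pa F x (th x t) xi = pa F a v (el F (Th a) x t xi)" for x t xi
  unfolding th_def using pa_mk[OF _ bl, of x t] by simp
 have "th: nt (Th a) (eo F)"
 proof (rule ntI)
  fix x assume x: "x: Ob C"
  note mt = mf_mod[OF std_isf[OF a] x]
  show "th x: lin K (om (Th a) x) (om (eo F) x)"
  proof (rule linI)
   show "th x (t +[om (Th a) x] s) = th x t +[om (eo F) x] th x s" if t: "t <: (om (Th a) x)" "s <: (om (Th a) x)" for t s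
    by (rule eo_ext[OF x tc[OF x mod_add[OF mt t]] mod_add[OF eo_mod[OF x] tc[OF x t(1)] tc[OF x t(2)]]])
     (simp add: tp[OF x mod_add[OF mt t]] pa_add[OF x tc[OF x t(1)] tc[OF x t(2)]] tp[OF x t(1)] tp[OF x t(2)] el_add[OF sg x t(1) _ t(2)] lin_add[OF pl E[OF x t(1)] E[OF x t(2)], simplified] del: std_sel)
   show "th x (c *[om (Th a) x] t) = c *[om (eo F) x] th x t" if c: "c <: K" and t: "t <: (om (Th a) x)" for c t
    by (rule eo_ext[OF x tc[OF x mod_sm[OF mt c t]] mod_sm[OF eo_mod[OF x] c tc[OF x t]]])
     (simp add: tp[OF x mod_sm[OF mt c t]] pa_sm[OF x tc[OF x t] c] tp[OF x t] el_sm[OF sg x t _ c] lin_sm[OF pl c E[OF x t], simplified] del: std_sel)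
  qed (use tc[OF x] x in "simp_all add: th_def")
  fix y f t assume y: "y: Ob C" and f: "f: Arr C x y" and t: "t <: (om (Th a) x)"
  note ft = mf_cl[OF std_isf[OF a] x y f t]
  show "th y (mm (Th a) x y f t) = mm (eo F) x y f (th x t)"
   by (rule eo_ext[OF y tc[OF y ft] lin_cl[OF eo_lin[OF x y f] tc[OF x t]]])
    (simp add: tp[OF y ft] eo_mm[OF x y f tc[OF x t]] tp[OF x t cc_nt[OF good_isf[OF small_good] _ std_map_nt[OF y x f]]] el_mm[OF sg x y f t] del: std_sel)
 qed (simp add: th_def)
 moreover have "th a (u a) = v"
 proof (rule eo_ext[OF a tc[OF a] v])
  show ua: "u a <: (om (Th a) a)" using u_in[OF a] by simp
  fix xi assume xi: "xi: nt F (Th a)"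
  have "yo (Th a) a (u a) = ide (cmod K C) (Th a)" by (rule yo_eq[OF sg(2) a cmod_ide[OF std_isf[OF a]]]) (use a ua in simp)
  hence "el F (Th a) a (u a) xi = xi" unfolding el_def using tm.A_eq(2)[of F "Th a" xi] sg xi by simp
  thus "pa F a (th a (u a)) xi = pa F a v xi" using tp[OF a ua xi] by simp
 qed
 ultimately show ?thesis using tp by blast
qed

lemma eo_good: "good (eo F)" unfolding good_def using eo_isf eo_yo_exists by blast

lemma eo_yo:
 assumes "a: Ob C" "v <: (om (eo F) a)" "x: Ob C" "t <: (om (Th a) x)" "xi: nt F (Th x)"
 shows "pa F x (yo (eo F) a v x t) xi = pa F a v (el F (Th a) x t xi)"
 using eo_yo_exists[OF assms(1,2)] yo_eq[OF eo_good assms(1)] assms(3-5) by (metis (no_types))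

end

context
 fixes F G :: "('k, 'o, 'm, 'u) mfnc" assumes F: "small F" and G: "small G"
begin

context
 fixes fi assumes p: "fi: nt F G"
begin

lemma D_arr_lin: "x: Ob C ==> D_arr K C T F G fi x: lin K (NM G (Th x)) (NM F (Th x))"
 using kl_l[OF TM_klinear, of F G "Th x" fi] p small_good[OF F] small_good[OF G] std_good[of x] by (simp add: D_arr_def)

lemma D_arr_nt: "D_arr K C T F G fi: nat_trans K (op_cat C) (D_ob K C T G) (D_ob K C T F)"
proof (rule ntI, unfold op_sel)
 have o: "om (D_ob K C T H) x = NM H (Th x)" for x and H :: "('k, 'o, 'm, 'u) mfnc" by (simp add: D_ob_def)
 show "x: Ob C ==> D_arr K C T F G fi x: lin K (om (D_ob K C T G) x) (om (D_ob K C T F) x)" for x unfolding o by (rule D_arr_lin)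
 fix x y f xi assume x: "x: Ob C" and y: "y: Ob C" and f: "f: Arr C y x" and "xi <: (om (D_ob K C T G) x)"
 hence xi: "xi: nt G (Th x)" by (simp add: o)
 note g = small_good[OF F] small_good[OF G]
 note s = std_map_nt[OF x y f]
 show "D_arr K C T F G fi y (mm (D_ob K C T G) x y f xi) = mm (D_ob K C T F) x y f (D_arr K C T F G fi x xi)"
  using D_mm(2)[OF G y x f xi] D_mm(2)[OF F y x f cc_nt[OF good_isf[OF g(1)] p xi]] cc_nt[OF good_isf[OF g(2)] xi s] x y xi
   tm.A_eq(3)[of F G "Th x" "Th y" fi xi "std_map C T x y f"] g std_good p s by (simp add: D_arr_def)
qed (simp add: D_arr_def)

lemma ea_eq: "x: Ob C ==> ea F G fi x = cpy_map (nd F x) (nd G x) (dual_map K (NM G (Th x)) (NM F (Th x)) (D_arr K C T F G fi x))"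
 by (simp add: ea_def cpy_nat_def dual_fnc_def D_ob_def dual_nat_def)

lemma ea_lin1: "x: Ob C ==> ea F G fi x: lin K (om (eo F) x) (om (eo G) x)"
 unfolding eo_sel ea_eq by (intro cpy_map_in nd_mod[OF F] nd_inj[OF F] nd_mod[OF G] nd_inj[OF G] dual_map_in D_arr_lin)

lemma ea_app:
 assumes x: "x: Ob C" "v <: (om (eo F) x)" "xi: nt G (Th x)"
 shows "pa G x (ea F G fi x v) xi = pa F x v (cc F G (Th x) xi fi)"
proof -
 let ?d = "dual_map K (NM G (Th x)) (NM F (Th x)) (D_arr K C T F G fi x)"
 have "ea F G fi x v = mk G x (?d (pa F x v))" unfolding ea_eq[OF x(1)]
  using cpy_map_emb[OF nd_inj[OF F x(1)], of "pa F x v"] mk_pa[OF F x(1,2)] pa_in[OF F x(1,2)] by (simp add: dual_sel)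
 moreover have "?d (pa F x v): lin K (NM G (Th x)) KK"
  using lin_cl[OF dual_map_in[OF nd_mod(1)[OF G x(1)] nd_mod(1)[OF F x(1)] D_arr_lin[OF x(1)]]] pa_in[OF F x(1,2)] by (simp add: dual_sel)
 ultimately show ?thesis using pa_mk[OF G x(1)] dual_map_app[OF pa_in[OF F x(1,2)], of xi] x by (simp add: D_arr_def)
qed

lemma ea_nt: "ea F G fi: nt (eo F) (eo G)"
proof (rule ntI[OF _ ea_lin1])
 fix x y f v assume x: "x: Ob C" and y: "y: Ob C" and f: "f: Arr C x y" and v: "v <: (om (eo F) x)"
 note g = small_good[OF F] small_good[OF G] std_good
 note fv = lin_cl[OF eo_lin[OF F x y f] v]
 show "ea F G fi y (mm (eo F) x y f v) = mm (eo G) x y f (ea F G fi x v)"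
 proof (rule eo_ext[OF G y lin_cl[OF ea_lin1[OF y] fv] lin_cl[OF eo_lin[OF G x y f] lin_cl[OF ea_lin1[OF x] v]]])
  fix xi assume xi: "xi: nt G (Th y)"
  note s = std_map_nt[OF y x f]
  show "pa G y (ea F G fi y (mm (eo F) x y f v)) xi = pa G y (mm (eo G) x y f (ea F G fi x v)) xi"
   using ea_app[OF y fv xi] eo_mm[OF F x y f v cc_nt[OF good_isf[OF g(1)] p xi]] eo_mm[OF G x y f lin_cl[OF ea_lin1[OF x] v] xi]
    ea_app[OF x v cc_nt[OF good_isf[OF g(2)] xi s]] tm.A_eq(3)[of F G "Th y" "Th x" fi xi "std_map C T y x f"] g x y p xi s by simp
 qed
qed (simp add: ea_def cpy_nat_def)

end

lemma ea_ext: "et: nt H (eo G) ==> th: nt H (eo G) ==>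
 (!!x v xi. x: Ob C ==> v <: (om H x) ==> xi: nt G (Th x) ==> pa G x (et x v) xi = pa G x (th x v) xi) ==> et = th"
 by (rule nt_ext, assumption+, rule eo_ext[OF G]) (auto intro: nt_cl)

lemma ea_lin: "(\<lambda>fi\<in>nt F G. ea F G fi): lin K (NM F G) (NM (eo F) (eo G))"
proof (rule linI)
 note g = small_good[OF F] small_good[OF G]
 note M = module_nat_mod[OF good_isf[OF g(1)] good_isf[OF g(2)]] and M' = module_nat_mod[OF eo_isf[OF F] eo_isf[OF G]]
 fix fi assume "fi <: (NM F G)"
 hence p: "fi: nt F G" by simp
 thus "(\<lambda>fi\<in>nt F G. ea F G fi) fi <: (NM (eo F) (eo G))" using ea_nt by simp
 note cF = cc_nt[OF good_isf[OF g(1)]]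
 { fix c assume c: "c <: K"
  have cp: "c *[NM F G] fi: nt F G" using mod_sm[OF M c, of fi] p by simp
  have "ea F G (c *[NM F G] fi) = c *[NM (eo F) (eo G)] ea F G fi"
  proof (rule ea_ext[OF ea_nt[OF cp] mod_sm[OF M' c, of "ea F G fi", simplified, OF ea_nt[OF p]]])
   fix x v xi assume x: "x: Ob C" and v: "v <: (om (eo F) x)" and xi: "xi: nt G (Th x)"
   show "pa G x (ea F G (c *[NM F G] fi) x v) xi = pa G x ((c *[NM (eo F) (eo G)] ea F G fi) x v) xi"
    using ea_app[OF cp x v xi] ea_app[OF p x v xi] pa_sm[OF G x nt_cl[OF ea_nt[OF p] x v] c xi] tm.A_bil(3)[of F G "Th x" fi c xi]
     lin_sm[OF pa_in[OF F x v] c, of "cc F G (Th x) xi fi"] cF[OF p xi] g std_good[OF x] p c xi x v by simp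
  qed
  thus "(\<lambda>fi\<in>nt F G. ea F G fi) (c *[NM F G] fi) = c *[NM (eo F) (eo G)] (\<lambda>fi\<in>nt F G. ea F G fi) fi" using p cp by simp }
 fix sy assume "sy <: (NM F G)"
 hence q: "sy: nt F G" by simp
 have pq: "fi +[NM F G] sy: nt F G" using mod_add[OF M, of fi sy] p q by simp
 have "ea F G (fi +[NM F G] sy) = ea F G fi +[NM (eo F) (eo G)] ea F G sy"
 proof (rule ea_ext[OF ea_nt[OF pq] mod_add[OF M', of "ea F G fi" "ea F G sy", simplified, OF ea_nt[OF p] ea_nt[OF q]]])
  fix x v xi assume x: "x: Ob C" and v: "v <: (om (eo F) x)" and xi: "xi: nt G (Th x)"
  show "pa G x (ea F G (fi +[NM F G] sy) x v) xi = pa G x ((ea F G fi +[NM (eo F) (eo G)] ea F G sy) x v) xi"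
   using ea_app[OF pq x v xi] ea_app[OF p x v xi] ea_app[OF q x v xi] pa_add[OF G x nt_cl[OF ea_nt[OF p] x v] nt_cl[OF ea_nt[OF q] x v] xi] tm.A_bil(1)[of F G "Th x" fi sy xi]
    lin_add[OF pa_in[OF F x v], of "cc F G (Th x) xi fi" "cc F G (Th x) xi sy"] cF[OF p xi] cF[OF q xi] g std_good[OF x] p q xi x v by simp
 qed
 thus "(\<lambda>fi\<in>nt F G. ea F G fi) (fi +[NM F G] sy) = (\<lambda>fi\<in>nt F G. ea F G fi) fi +[NM (eo F) (eo G)] (\<lambda>fi\<in>nt F G. ea F G fi) sy" using p q pq by simp
qed simp

end

lemma ea_cmp:
 assumes F: "small F" and G: "small G" and H: "small H" and p: "fi: nt F G" and q: "sy: nt G H"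
 shows "ea F H (cc F G H sy fi) = cc (eo F) (eo G) (eo H) (ea G H sy) (ea F G fi)"
proof -
 note g = small_good[OF F] small_good[OF G] small_good[OF H]
 note pq = cc_nt[OF good_isf[OF g(1)] p q]
 show ?thesis
 proof (rule ea_ext[OF F H ea_nt[OF F H pq] cc_nt[OF eo_isf[OF F] ea_nt[OF F G p] ea_nt[OF G H q]]])
  fix x v xi assume x: "x: Ob C" and v: "v <: (om (eo F) x)" and xi: "xi: nt H (Th x)"
  show "pa H x (ea F H (cc F G H sy fi) x v) xi = pa H x (cc (eo F) (eo G) (eo H) (ea G H sy) (ea F G fi) x v) xi"
   using ea_app[OF F H pq x v xi] ea_app[OF G H q x nt_cl[OF ea_nt[OF F G p] x v] xi] ea_app[OF F G p x v cc_nt[OF good_isf[OF g(2)] q xi]]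
    tm.A_eq(3)[of F G H "Th x" fi sy xi] g std_good[OF x] p q xi x v by simp
 qed
qed

lemma ea_ide:
 assumes F: "small F" shows "ea F F (ide (cmod K C) F) = ide (cmod K C) (eo F)"
proof (rule ea_ext[OF F F])
 note i = cmod_ide[OF good_isf[OF small_good[OF F]]]
 show "ea F F (ide (cmod K C) F): nt (eo F) (eo F)" by (rule ea_nt[OF F F i])
 show "ide (cmod K C) (eo F): nt (eo F) (eo F)" by (rule cmod_ide[OF eo_isf[OF F]])
 fix x v xi assume x: "x: Ob C" and v: "v <: (om (eo F) x)" and xi: "xi: nt F (Th x)"
 show "pa F x (ea F F (ide (cmod K C) F) x v) xi = pa F x (ide (cmod K C) (eo F) x v) xi"
  using ea_app[OF F F i x v xi] tm.A_eq(1)[of F "Th x" xi] small_good[OF F] std_good[OF x] xi x v by simp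
qed

end

lemma (in gf) lin_sgn: "module K V ==> module K W ==> f: lin K V W ==> x <: V ==> f (signed V n x) = signed W n (f x)"
 by (simp add: signed_def lin_neg)

lemma (in gf) mod_sgn: "module K V ==> x <: V ==> signed V n x <: V"
 by (simp add: signed_def mod_neg)

context kl
begin

subsection \<open>Families concentrated in one degree\<close>

definition io where "io X Y n i f = (%k. if k = i then f else 0[homm A X$k Y$(k + n)])"

context
 fixes X Y assumes X: "X: Ob (Ch A)" and Y: "Y: Ob (Ch A)"
begin

lemma io_in: "f: Arr A X$i Y$j ==> j = i + n ==> io X Y n i f <: (hom_mod A X Y n)"
 using ch_ob[OF X] ch_ob[OF Y] by (simp add: io_def)

lemma io_lin:
 assumes j: "j = i + n"
 shows "(\<lambda>f\<in>Arr A X$i Y$j. io X Y n i f): lin K (homm A X$i Y$j) (hom_mod A X Y n)"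
proof (rule linI)
 note o[simp] = ch_ob[OF X] ch_ob[OF Y]
 fix f assume "f <: (homm A X$i Y$j)"
 hence f: "f: Arr A X$i Y$j" by simp
 show "(\<lambda>f\<in>Arr A X$i Y$j. io X Y n i f) f <: (hom_mod A X Y n)" using f io_in[OF _ j] by simp
 show "(\<lambda>f\<in>Arr A X$i Y$j. io X Y n i f) (f +[homm A X$i Y$j] g) =
   (\<lambda>f\<in>Arr A X$i Y$j. io X Y n i f) f +[hom_mod A X Y n] (\<lambda>f\<in>Arr A X$i Y$j. io X Y n i f) g" if "g <: (homm A X$i Y$j)" for g
  using f that j mod_0l[OF A_mod(1) mod_zero[OF A_mod(1)]] by (auto simp: io_def)
 show "(\<lambda>f\<in>Arr A X$i Y$j. io X Y n i f) (c *[homm A X$i Y$j] f) =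
   c *[hom_mod A X Y n] (\<lambda>f\<in>Arr A X$i Y$j. io X Y n i f) f" if "c <: K" for c
  using f that j mod_s0[OF A_mod(1)] by (auto simp: io_def)
qed (use ch_ob[OF X] ch_ob[OF Y] in simp)

lemma zero_arr: "zero_ob A a ==> b: Ob A ==> f: Arr A a b ==> f = 0[homm A a b]"
 using A_eq(1)[of a b f] A_bil(7)[of a a b f] unfolding zero_ob_def by simp

text \<open>Outside I the components start at zero objects and vanish, so a family on a bounded
  complex is a finite sum of families with a single component.\<close>

lemma io_sum:
 assumes I: "finite I" "!!i. i \<notin> I ==> zero_ob A X$i" and f: "f <: (hom_mod A X Y n)"
 shows "f = finsum (hom_mod A X Y n) (%i. io X Y n i (f i)) I"
proof
 note o[simp] = ch_ob[OF X] ch_ob[OF Y]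
 note M = module_hom_mod[OF X Y]
 fix k
 let ?e = "\<lambda>f\<in>carrier (hom_mod A X Y n). f k"
 have e: "?e: lin K (hom_mod A X Y n) (homm A X$k Y$(k + n))"
  by (rule linI) (use mod_add[OF M] mod_sm[OF M] in \<open>auto simp del: hom_mod_sel(1)\<close>, auto)
 have ii: "io X Y n i (f i) <: (hom_mod A X Y n)" for i using f by (intro io_in) auto
 interpret ab: abelian_group "homm A X$k Y$(k + n)" by (rule mod_ag) simp
 have "finsum (hom_mod A X Y n) (%i. io X Y n i (f i)) I k = finsum (homm A X$k Y$(k + n)) (%i. ?e (io X Y n i (f i))) I"
  using lin_finsum[OF M A_mod(1) e I(1), of "%i. io X Y n i (f i)"] ii mod_finsum_cl[OF M, of I "%i. io X Y n i (f i)"] by (simp del: hom_mod_sel)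
 also have "... = finsum (homm A X$k Y$(k + n)) (%i. if k = i then f k else 0[homm A X$k Y$(k + n)]) I"
  by (rule ab.finsum_cong') (use ii f in "auto simp: io_def")
 also have "... = f k"
 proof (cases "k: I")
  case True thus ?thesis using ab.finsum_singleton[of k I "%_. f k"] I f by simp
 next
  case False
  have "finsum (homm A X$k Y$(k + n)) (%i. if k = i then f k else 0[homm A X$k Y$(k + n)]) I = 0[homm A X$k Y$(k + n)]"
   by (rule ab.add.finprod_one_eqI) (use False in auto)
  thus ?thesis using zero_arr[OF I(2)[OF False], of "Y$(k + n)" "f k"] f by simp
 qed
 finally show "f k = finsum (hom_mod A X Y n) (%i. io X Y n i (f i)) I k" by simp
qed

text \<open>For a family with single component f: X^i -> Y^j only two components can survive, d f at
  i and f d at i - 1. This reduces \<open>Psi_comm\<close> to a comparison of two terms and their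
  signs.\<close>

lemma io_dh:
 assumes f: "f: Arr A X$i Y$j" and j: "j = i + m" and m': "m' = m + 1"
 shows "dh X Y m (io X Y m i f) = io X Y m' i (cmp A X$i Y$j Y$(j+1) (cd Y j) f) +[hom_mod A X Y m']
  -[hom_mod A X Y m'] signed (hom_mod A X Y m') m (io X Y m' (i-1) (cmp A X$(i-1) X$i Y$j f (cd X (i-1))))"
proof
 note o[simp] = ch_ob[OF X] ch_ob[OF Y]
 note z = mod_0l[OF A_mod(1)] mod_0r[OF A_mod(1)] mod_n0[OF A_mod(1)]
 fix k
 have d: "cmp A X$(i-1) X$i Y$j f (cd X (i-1)): Arr A X$(i-1) Y$j" using ch_d[OF X, of "i - 1" "i - 1" i] f by simp
 have d': "cmp A X$i Y$j Y$(j+1) (cd Y j) f: Arr A X$i Y$(j+1)" using ch_d[OF Y, of j j "j + 1"] f by simp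
 note i1 = io_in[OF d, of m']
 have i1: "io X Y m' (i-1) (cmp A X$(i-1) X$i Y$j f (cd X (i-1))) <: (hom_mod A X Y m')" using io_in[OF d, of m'] j m' by simp
 have n: "(-[hom_mod A X Y m'] signed (hom_mod A X Y m') m g) k = -[homm A X$k Y$(k + m')] signed (homm A X$k Y$(k + m')) m (g k)"
  if "g <: (hom_mod A X Y m')" for g
  using hom_mod_neg[OF X Y that] hom_mod_neg[OF X Y mod_neg[OF module_hom_mod[OF X Y] that]] by (simp add: signed_def)
 show "dh X Y m (io X Y m i f) k = (io X Y m' i (cmp A X$i Y$j Y$(j+1) (cd Y j) f) +[hom_mod A X Y m']
  -[hom_mod A X Y m'] signed (hom_mod A X Y m') m (io X Y m' (i-1) (cmp A X$(i-1) X$i Y$j f (cd X (i-1))))) k"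
  (is "?L = _")
 proof -
  have L: "?L = cmp A X$k Y$(k + m) Y$(k + m+1) (cd Y (k + m)) (io X Y m i f k) +[homm A X$k Y$(k + m+1)]
   -[homm A X$k Y$(k + m+1)] signed (homm A X$k Y$(k + m+1)) m (cmp A X$k X$(k+1) Y$(k + m+1) (io X Y m i f (k+1)) (cd X k))"
   by (simp add: dh_def mod_minus add.assoc)
  have e: "k + m' = k + m + 1" "k+1 + m = k + m + 1" using m' by simp_all
  note dx = ch_d[OF X, of k k "k + 1", OF refl refl] and dy = ch_d[OF Y, of "k + m" "k + m" "k + m + 1", OF refl refl]
  consider "k = i" | "k = i - 1" | "k \<noteq> i" "k \<noteq> i - 1" by blast
  thus ?thesis
  proof cases
   case 1
   show ?thesis unfolding L hom_mod_sel(3) n[OF i1] unfolding io_def e using dx dy d' f 1 by (simp add: signed_def z j)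
  next
   case 2
   have e2: "i-1 + m+1 = i + m" by simp
   show ?thesis unfolding L hom_mod_sel(3) n[OF i1] unfolding io_def e using dx dy d f mod_sgn[OF A_mod(1), of "X$(i-1)" "Y$(i + m)"] unfolding 2 e2 by (simp add: z j)
  next
   case 3
   show ?thesis unfolding L hom_mod_sel(3) n[OF i1] unfolding io_def e using dx dy 3 by (simp add: signed_def z)
  qed
 qed
qed

end

end

context yon
begin

subsection \<open>The adjunction between \<open>Hom(P, -)'\<close> and \<open>Hom(-, (DP)')\<close>\<close>

lemma pa_lin:
 assumes G: "small G" and x: "x: Ob C" and xi: "xi: nt G (Th x)"
 shows "(\<lambda>v\<in>carrier (om (eo G) x). pa G x v xi): lin K (om (eo G) x) KK"
 by (rule linI) (use mod_add[OF eo_mod[OF G x]] mod_sm[OF eo_mod[OF G x]] pa_cl[OF G x _ xi] pa_add[OF G x _ _ xi] pa_sm[OF G x _ _ xi] in "auto simp: ground_sel")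

definition ad :: "('k, 'o, 'm, 'u) mfnc => ('k, 'o, 'm, 'u) mfnc => (('o => 'u => 'u) => 'k) => 'o => 'u => 'u" where
 "ad P F be = (\<lambda>x\<in>Ob C. \<lambda>v\<in>carrier (om F x). mk P x (\<lambda>xi\<in>nt P (Th x). be (el P F x v xi)))"

context
 fixes P F :: "('k, 'o, 'm, 'u) mfnc" assumes P: "small P" and F: "good F"
begin

lemma ad_core:
 assumes b: "be: lin K (NM P F) KK" and x: "x: Ob C" and v: "v <: (om F x)"
 shows "(\<lambda>xi\<in>nt P (Th x). be (el P F x v xi)): lin K (NM P (Th x)) KK"
proof -
 note E = el_in[OF small_good[OF P] F x v]
 show ?thesis
  by (rule linI) (use mod_add[OF nd_mod(1)[OF P x]] mod_sm[OF nd_mod(1)[OF P x]] E el_add2[OF small_good[OF P] F x v] el_sm2[OF small_good[OF P] F x v]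
    lin_add[OF b, simplified] lin_sm[OF b, simplified] dual_app[OF b, simplified] in "auto simp: ground_sel")
qed

lemma ad_app: "be: lin K (NM P F) KK ==> x: Ob C ==> v <: (om F x) ==> xi: nt P (Th x) ==>
  pa P x (ad P F be x v) xi = be (el P F x v xi)"
 unfolding ad_def using pa_mk[OF P _ ad_core] by simp

lemma ad_cl: "be: lin K (NM P F) KK ==> x: Ob C ==> v <: (om F x) ==> ad P F be x v <: (om (eo P) x)"
 unfolding ad_def using mk_in[OF P _ ad_core] by simp

lemma ad_nt:
 assumes b: "be: lin K (NM P F) KK"
 shows "ad P F be: nt F (eo P)"
proof (rule ntI)
 note g = small_good[OF P] and c = ad_cl[OF b] and a = ad_app[OF b]
 fix x assume x: "x: Ob C"
 note m = mf_mod[OF good_isf[OF F] x] and me = eo_mod[OF P x]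
 note E = el_in[OF g F x]
 show "ad P F be x: lin K (om F x) (om (eo P) x)"
 proof (rule linI)
  fix v assume v: "v <: (om F x)"
  show "ad P F be x v <: (om (eo P) x)" by (rule c[OF x v])
  show "ad P F be x (v +[om F x] w) = ad P F be x v +[om (eo P) x] ad P F be x w" if w: "w <: (om F x)" for w
   by (rule eo_ext[OF P x c[OF x mod_add[OF m v w]] mod_add[OF me c[OF x v] c[OF x w]]])
    (simp add: a[OF x] v w mod_add[OF m] pa_add[OF P x] c[OF x] el_add[OF g F x v _ w] lin_add[OF b, simplified] E)
  show "ad P F be x (k *[om F x] v) = k *[om (eo P) x] ad P F be x v" if k: "k <: K" for k
   by (rule eo_ext[OF P x c[OF x mod_sm[OF m k v]] mod_sm[OF me k c[OF x v]]])
    (simp add: a[OF x] v k mod_sm[OF m] pa_sm[OF P x] c[OF x] el_sm[OF g F x v _ k] lin_sm[OF b, simplified] E)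
 qed (simp add: ad_def x)
 fix y f v assume y: "y: Ob C" and f: "f: Arr C x y" and v: "v <: (om F x)"
 show "ad P F be y (mm F x y f v) = mm (eo P) x y f (ad P F be x v)"
  by (rule eo_ext[OF P y c[OF y mf_cl[OF good_isf[OF F] x y f v]] mf_cl[OF eo_isf[OF P] x y f c[OF x v]]])
   (simp add: a mf_cl[OF good_isf[OF F] x y f v] y eo_mm[OF P x y f c[OF x v]] a[OF x v cc_nt[OF good_isf[OF g] _ std_map_nt[OF y x f]]] el_mm[OF g F x y f v])
qed (simp add: ad_def)

lemma ad_ext: "be: lin K (NM P F) KK ==> et: nt F (eo P) ==>
 (!!x v xi. x: Ob C ==> v <: (om F x) ==> xi: nt P (Th x) ==> be (el P F x v xi) = pa P x (et x v) xi) ==> ad P F be = et"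
 by (rule ea_ext[OF P P ad_nt]) (auto simp: ad_app)

text \<open>Injectivity holds because elementary maps span. For surjectivity, et: F -> (DP)' assigns
  to v and ze the scalar et(v)(ze). Since et commutes with Yoneda maps, and those of (DP)' are known
  from \<open>eo_yo\<close>, this assignment is balanced, and \<open>functional_exists\<close> makes
  it a functional.\<close>

lemma ad_bij:
 assumes B: "dual_basis P N a p xi"
 shows "bij_betw (ad P F) (lin K (NM P F) KK) (nt F (eo P))"
proof (intro bij_betwI' ballI)
 note g = small_good[OF P]
 fix be be' assume b: "be: lin K (NM P F) KK" "be': lin K (NM P F) KK"
 show "ad P F be = ad P F be' \<longleftrightarrow> be = be'"
 proof
  assume e: "ad P F be = ad P F be'"
  show "be = be'"
  proof (rule functional_eqI[OF g F B b module_ground])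
   fix i v assume "i < N" "v <: (om F (a i))"
   thus "be (el P F (a i) v (xi i)) = be' (el P F (a i) v (xi i))"
    using ad_app[OF b(1), of "a i" v "xi i"] ad_app[OF b(2), of "a i" v "xi i"] dual_basisD(1,3)[OF B] e by simp
  qed
 qed simp
next
 fix be assume "be: lin K (NM P F) KK" thus "ad P F be: nt F (eo P)" by (rule ad_nt)
next
 note g = small_good[OF P]
 fix et assume n: "et: nt F (eo P)"
 have "EX be:lin K (NM P F) KK. ALL x:Ob C. ALL v:carrier (om F x). ALL ze:nt P (Th x). be (el P F x v ze) = pa P x (et x v) ze"
 proof (rule functional_exists[OF g F B])
  fix x v ze assume x: "x: Ob C" and v: "v <: (om F x)"
  note nv = nt_cl[OF n x v]
  show "(\<lambda>ze\<in>nt P (Th x). pa P x (et x v) ze): lin K (NM P (Th x)) (ground K)"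
   by (rule linI) (use dual_app[OF pa_in[OF P x nv]] lin_add[OF pa_in[OF P x nv]] lin_sm[OF pa_in[OF P x nv]] mod_add[OF nd_mod(1)[OF P x]] mod_sm[OF nd_mod(1)[OF P x]] in auto)
  { assume z: "ze: nt P (Th x)"
   show "pa P x (et x v) ze <: K" by (rule pa_cl[OF P x nv z])
   show "pa P x (et x (v +[om F x] w)) ze = pa P x (et x v) ze \<oplus> pa P x (et x w) ze" if w: "w <: (om F x)" for w
    using nt_add[OF n x v w] pa_add[OF P x nv nt_cl[OF n x w] z] by simp
   show "pa P x (et x (k *[om F x] v)) ze = k \<otimes> pa P x (et x v) ze" if k: "k <: K" for k
    using nt_sm[OF n x v k] pa_sm[OF P x nv k z] by simp }
  fix y t assume y: "y: Ob C" and t: "t: nt (Th y) (Th x)" and z: "ze: nt P (Th y)"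
  have tu: "t y (u y) <: (om (Th x) y)" using nt_cl[OF t y] u_in[OF y] by simp
  hence "yo (Th x) y (t y (u y)) = t" by (intro yo_eq[OF std_good[OF x] y t]) simp
  thus "pa P y (et y (yo F x v y (t y (u y)))) ze = pa P x (et x v) (cc P (Th y) (Th x) t ze)"
   using yo_comp[OF F eo_good[OF P] x v n y, of "t y (u y)"] eo_yo[OF P x nv y tu z] tu by (simp add: el_def)
 qed
 then obtain be where "be: lin K (NM P F) KK" "ALL x:Ob C. ALL v:carrier (om F x). ALL ze:nt P (Th x). be (el P F x v ze) = pa P x (et x v) ze" by blast
 thus "EX be:lin K (NM P F) KK. et = ad P F be" using ad_ext[OF _ n] by (metis (no_types, lifting))
qed

lemma ad_lin: "(\<lambda>be\<in>lin K (NM P F) KK. ad P F be): lin K (dual K (NM P F)) (NM F (eo P))"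
proof (rule linI; unfold dual_sel nat_mod_sel(1))
 note g = small_good[OF P]
 note M = module_dual[OF nat_mod_PF[OF g F]] and M' = module_nat_mod[OF good_isf[OF F] eo_isf[OF P]]
 note E = el_in[OF g F]
 fix be assume b: "be: lin K (NM P F) KK"
 thus "(\<lambda>be\<in>lin K (NM P F) KK. ad P F be) be: nt F (eo P)" by (simp add: ad_nt)
 { fix ga assume c: "ga: lin K (NM P F) KK"
  have bc: "be +[dual K (NM P F)] ga: lin K (NM P F) KK" using mod_add[OF M] b c by (simp add: dual_sel)
  have "ad P F (be +[dual K (NM P F)] ga) = ad P F be +[NM F (eo P)] ad P F ga"
   by (rule ad_ext[OF bc mod_add[OF M', simplified, OF ad_nt[OF b] ad_nt[OF c]]])
    (simp add: dual_add E pa_add[OF P] ad_cl[OF b] ad_cl[OF c] ad_app[OF b] ad_app[OF c])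
  thus "(\<lambda>be\<in>lin K (NM P F) KK. ad P F be) (be +[dual K (NM P F)] ga) =
   (\<lambda>be\<in>lin K (NM P F) KK. ad P F be) be +[NM F (eo P)] (\<lambda>be\<in>lin K (NM P F) KK. ad P F be) ga" using b c bc by simp }
 fix k assume k: "k <: K"
 have bk: "k *[dual K (NM P F)] be: lin K (NM P F) KK" using mod_sm[OF M k] b by (simp add: dual_sel)
 have "ad P F (k *[dual K (NM P F)] be) = k *[NM F (eo P)] ad P F be"
  by (rule ad_ext[OF bk mod_sm[OF M' k, simplified, OF ad_nt[OF b]]])
   (simp add: dual_sm E pa_sm[OF P] ad_cl[OF b] ad_app[OF b] k)
 thus "(\<lambda>be\<in>lin K (NM P F) KK. ad P F be) (k *[dual K (NM P F)] be) =
   k *[NM F (eo P)] (\<lambda>be\<in>lin K (NM P F) KK. ad P F be) be" using b bk by simp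
qed simp

end

text \<open>The functional \<open>ga\<close> is characterised by an equation rather than written as
  a transpose, because in \<open>Psi_pre\<close> it arises as one component of a transposed family.
  \<open>ad_post\<close> is arranged in the same way for the first variable.\<close>

lemma ad_pre:
 assumes P: "small P" and F: "good F" and H: "good H" and e: "et: nt H F" and b: "be: lin K (NM P F) KK" and c: "ga: lin K (NM P H) KK"
  and eq: "!!f. f: nt P H ==> ga f = be (cc P H F et f)"
 shows "ad P H ga = cc H F (eo P) (ad P F be) et"
proof (rule ad_ext[OF P H c cc_nt[OF good_isf[OF H] e ad_nt[OF P F b]]])
 fix x v xi assume x: "x: Ob C" and v: "v <: (om H x)" and xi: "xi: nt P (Th x)"
 show "ga (el P H x v xi) = pa P x (cc H F (eo P) (ad P F be) et x v) xi"
  using eq[OF el_in[OF small_good[OF P] H x v xi]] el_post[OF small_good[OF P] H x v xi F e] ad_app[OF P F b x nt_cl[OF e x v] xi] x v by simp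
qed

lemma ad_post:
 assumes P: "small P" and Q: "small Q" and F: "good F" and p: "fi: nt P Q" and b: "be: lin K (NM P F) KK" and c: "ga: lin K (NM Q F) KK"
  and eq: "!!f. f: nt Q F ==> ga f = be (cc P Q F f fi)"
 shows "ad Q F ga = cc F (eo P) (eo Q) (ea P Q fi) (ad P F be)"
proof (rule ad_ext[OF Q F c cc_nt[OF good_isf[OF F] ad_nt[OF P F b] ea_nt[OF P Q p]]])
 note g = small_good[OF P] small_good[OF Q]
 fix x v xi assume x: "x: Ob C" and v: "v <: (om F x)" and xi: "xi: nt Q (Th x)"
 show "ga (el Q F x v xi) = pa Q x (cc F (eo P) (eo Q) (ea P Q fi) (ad P F be) x v) xi"
  using eq[OF el_in[OF g(2) F x v xi]] el_pre[OF g(2) F x v xi g(1) p] ea_app[OF P Q p x ad_cl[OF P F b x v] xi] ad_app[OF P F b x v cc_nt[OF good_isf[OF g(1)] p xi]] x v by simp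
qed

text \<open>The complex underlying \<open>RD(X)'\<close>, where \<open>P\<close> is the resolution of \<open>X\<close>. The signs of the two dualities
 combine to \<open>-1\<close> in every degree.\<close>

definition E :: "('k, 'o, 'm, 'u) fcx => ('k, 'o, 'm, 'u) fcx" where
 "E P = cpy_fcx C (dual_fcx K C (D_cx K C T P))"

definition Ea :: "('k, 'o, 'm, 'u) fcx => ('k, 'o, 'm, 'u) fcx => (int => 'o => 'u => 'u) => int => 'o => 'u => 'u" where
 "Ea P Q g = (%n. ea P$n Q$n (g n))"

lemma E_sel[simp]: "(E P)$n = eo P$n" by (simp add: E_def cpy_fcx_def dual_fcx_def D_cx_def eo_def)

lemma Ea_eq: "cpy_fcx_arr C (dual_fcx K C (D_cx K C T P)) (dual_fcx K C (D_cx K C T Q))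
  (dual_fcx_arr K C (D_cx K C T Q) (D_cx K C T P) (D_cx_arr K C T P Q g)) = Ea P Q g"
 by (simp add: Ea_def cpy_fcx_arr_def dual_fcx_arr_def D_cx_arr_def dual_fcx_def D_cx_def ea_def)

lemma E_d:
 assumes F: "small P$n" and G: "small P$(n+1)" and d: "cd P n: nt P$n P$(n+1)"
 shows "cd (E P) n = -[NM (eo P$n) (eo P$(n+1))] ea P$n P$(n+1) (cd P n)"
proof -
 let ?F = "P$n" and ?G = "P$(n+1)"
 let ?DF = "D_ob K C T ?F" and ?DG = "D_ob K C T ?G" and ?Dd = "D_arr K C T ?F ?G (cd P n)"
 \<comment> \<open>The inner sign belongs to the differential of D(P) in degree -(n+1), whence the
   exponent -n; the outer dual contributes n + 1. Exactly one of the two exponents is odd.\<close>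
 let ?S' = "signed (nat_mod K (op_cat C) ?DG ?DF) (- n) ?Dd"
 let ?S = "signed (NM (dual_fnc K ?DF) (dual_fnc K ?DG)) (n+1) (dual_nat K C ?DG ?DF ?S')"
 have eq: "cd (E P) n = cpy_nat C (dual_fnc K ?DF) (dual_fnc K ?DG) ?S"
  by (simp add: E_def cpy_fcx_def dual_fcx_def D_cx_def add.commute[of 1 n])
 note Df = D_isf[OF F] D_isf[OF G] and dn = D_arr_nt[OF F G d]
 note M' = module_nat_mod[OF Df(2,1)] and M = module_nat_mod[OF dual_D_isf[OF F] dual_D_isf[OF G]] and N = module_nat_mod[OF eo_isf[OF F] eo_isf[OF G]]
 have S': "?S': nat_trans K (op_cat C) ?DG ?DF" using mod_sgn[OF M', of ?Dd] dn by simp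
 have S: "?S: nt (dual_fnc K ?DF) (dual_fnc K ?DG)" using mod_sgn[OF M] dual_nat_nt[OF Df S'] by simp
 have o: "om ?DF x = NM ?F (Th x)" "om ?DG x = NM ?G (Th x)" for x by (simp_all add: D_ob_def)
 have core: "?S x al xi = \<ominus> al (cc ?F ?G (Th x) xi (cd P n))" and Sl: "?S x al: lin K (NM ?G (Th x)) KK"
  if x: "x: Ob C" and al: "al: lin K (NM ?F (Th x)) KK" and xi: "xi: nt ?G (Th x)" for x al xi
 proof -
  have ac: "al <: (om (dual_fnc K ?DF) x)" using al by (simp add: dual_D_sel[OF F] dual_D_sel[OF G] dual_sel)
  show Sl: "?S x al: lin K (NM ?G (Th x)) KK" using nt_cl[OF S x ac] by (simp add: dual_D_sel[OF F] dual_D_sel[OF G] dual_sel)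
  have aK: "al (?Dd x xi) <: K" using dual_app[OF al, of "?Dd x xi"] nt_cl[OF dn, of x xi] x xi by (simp add: o)
  note gn = ground_neg[OF aK]
  have z: "dual_nat K C ?DG ?DF sy x al xi = al (sy x xi)" for sy unfolding dual_nat_def o using x al xi by (simp add: dual_map_app)
  have zn: "(-[NM (dual_fnc K ?DF) (dual_fnc K ?DG)] dual_nat K C ?DG ?DF ?Dd) x al xi = \<ominus> al (?Dd x xi)"
  proof -
   have q: "dual_nat K C ?DG ?DF ?Dd x al: lin K (NM ?G (Th x)) KK" using nt_cl[OF dual_nat_nt[OF Df dn] x ac] by (simp add: dual_D_sel[OF F] dual_D_sel[OF G] dual_sel)
   show ?thesis using nat_mod_neg[OF dual_D_isf[OF F] dual_D_isf[OF G] dual_nat_nt[OF Df dn] x ac] lin_mod_neg[OF nd_mod(1)[OF G x] module_ground q, of xi] xi z gn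
    by (simp add: dual_D_sel[OF F] dual_D_sel[OF G] dual_def)
  qed
  have xi': "xi <: (om ?DG x)" using xi by (simp add: o)
  have "al ((-[nat_mod K (op_cat C) ?DG ?DF] ?Dd) x xi) = \<ominus> al (?Dd x xi)"
   using nat_mod_neg[OF Df(2,1) dn _ xi'] lin_neg[OF nd_mod(1)[OF F x] module_ground al, of "?Dd x xi"] nt_cl[OF dn, of x xi] x xi gn by (simp add: o)
  thus "?S x al xi = \<ominus> al (cc ?F ?G (Th x) xi (cd P n))" using z[of ?Dd] z[of "-[nat_mod K (op_cat C) ?DG ?DF] ?Dd"] zn x xi
   by (cases "even n") (simp_all add: signed_def D_arr_def)
 qed
 show ?thesis unfolding eq
 proof (rule ext, rule ext)
  fix x v
  note en = ea_nt[OF F G d]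
  have nn: "-[NM (eo ?F) (eo ?G)] ea ?F ?G (cd P n): nt (eo ?F) (eo ?G)" using mod_neg[OF N] en by simp
  consider "x \<notin> Ob C" | "x: Ob C" "v \<notin> carrier (om (eo ?F) x)" | "x: Ob C" "v <: (om (eo ?F) x)" by blast
  thus "cpy_nat C (dual_fnc K ?DF) (dual_fnc K ?DG) ?S x v = (-[NM (eo ?F) (eo ?G)] ea ?F ?G (cd P n)) x v"
  proof cases
   case 1 thus ?thesis using nt_und[OF nn] by (simp add: cpy_nat_def)
  next
   case 2
   thus ?thesis using lin_undef[OF nt_lin[OF nn]] cpy_sel(1)[OF nd_mod(2)[OF F] nd_inj[OF F]] by (simp add: cpy_nat_def cpy_map_def dual_D_sel[OF F] dual_D_sel[OF G] eo_sel)
  next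
   case 3
   note x = 3(1) and v = 3(2)
   note pv = pa_in[OF F x v]
   have l: "cpy_nat C (dual_fnc K ?DF) (dual_fnc K ?DG) ?S x v = mk ?G x (?S x (pa ?F x v))"
    using cpy_map_emb[OF nd_inj[OF F x], of "pa ?F x v"] pv x mk_pa[OF F x v] by (simp add: cpy_nat_def dual_D_sel[OF F] dual_D_sel[OF G] dual_sel)
   have Sx: "?S x (pa ?F x v): lin K (NM ?G (Th x)) KK" using Sl[OF x pv mod_zero[OF nd_mod(1)[OF G x], simplified]] .
   show ?thesis unfolding l
   proof (rule eo_ext[OF G x mk_in[OF G x Sx] nt_cl[OF nn x v]])
    fix xi assume xi: "xi: nt ?G (Th x)"
    have "pa ?G x ((-[NM (eo ?F) (eo ?G)] ea ?F ?G (cd P n)) x v) xi = \<ominus> pa ?G x (ea ?F ?G (cd P n) x v) xi"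
     using nat_mod_neg[OF eo_isf[OF F] eo_isf[OF G] en x v] lin_neg[OF eo_mod[OF G x] module_ground pa_lin[OF G x xi] nt_cl[OF en x v]]
      nt_cl[OF en x v] mod_neg[OF eo_mod[OF G x]] ground_neg[OF pa_cl[OF G x nt_cl[OF en x v] xi]] by simp
    thus "pa ?G x (mk ?G x (?S x (pa ?F x v))) xi = pa ?G x ((-[NM (eo ?F) (eo ?G)] ea ?F ?G (cd P n)) x v) xi"
     using pa_mk[OF G x Sx] core[OF x pv xi] ea_app[OF F G d x v xi] by simp
   qed
  qed
 qed
qed

subsection \<open>Strictly perfect complexes\<close>

abbreviation "CT == Ch TM"
abbreviation "sp P == strictly_perfect K C T P"
abbreviation "hm P Y n == hom_mod TM P Y n"

lemma sp_ob: "sp P ==> P: Ob CT" by (simp add: strictly_perfect_def)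

lemma sp_basis:
 assumes "sp P" obtains N a p xi where "dual_basis P$n N a p xi"
 using dual_basis_exists[of "P$n"] assms unfolding strictly_perfect_def by blast

lemma ct_good: "X: Ob CT ==> good X$n" using tm.ch_ob[of X n] by simp

lemma sp_small: "sp P ==> small P$n"
 using sp_basis[of P n] dual_basis_small ct_good[OF sp_ob] by metis

lemma sp_bounded:
 assumes "sp P" obtains N where "0 \<le> N" "!!n. \<bar>n\<bar> > N ==> zero_ob TM P$n"
proof -
 obtain N where "!!n. \<bar>n\<bar> > N ==> zero_ob TM P$n" using assms unfolding strictly_perfect_def bounded_cx_def by blast
 thus thesis by (intro that[of "max N 0"]) auto
qed

lemma ct_d: "X: Ob CT ==> b = n+1 ==> cd X n: nt X$n X$b" using tm.ch_d[of X n n b] by simp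

lemma ct_in: "f: Arr CT X Y ==> f n: nt X$n Y$n" using tm.ch_in[of f X Y n n n] by simp

lemma E_ob:
 assumes P: "sp P" shows "E P: Ob CT"
proof (rule tm.Ch_obI)
 note s = sp_small[OF P] and o = sp_ob[OF P]
 note M = module_nat_mod[OF eo_isf[OF s] eo_isf[OF s]]
 note G[simp] = eo_good[OF s] ct_good[OF o]
 show "(E P)$n: Ob TM" for n by simp
 have e: "ea P$n P$(n+1) (cd P n): nt (eo P$n) (eo P$(n+1))" for n by (rule ea_nt[OF s s ct_d[OF o refl]])
 note E_d = E_d[OF s s ct_d[OF o refl]]
 show "cd (E P) n: Arr TM (E P)$n (E P)$(n+1)" for n unfolding E_d using mod_neg[OF M] e by simp
 fix n
 let ?a = "P$n" and ?b = "P$(n+1)" and ?c = "P$(n+1+1)"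
 have "cc (eo ?a) (eo ?b) (eo ?c) (ea ?b ?c (cd P (n+1))) (ea ?a ?b (cd P n)) = ea ?a ?c (cc ?a ?b ?c (cd P (n+1)) (cd P n))"
  by (rule ea_cmp[OF s s s ct_d[OF o refl] ct_d[OF o refl], symmetric])
 also have "cc ?a ?b ?c (cd P (n+1)) (cd P n) = 0[NM ?a ?c]" using tm.ch_dd[OF o, of n n "n + 1" "n + 1" "n+1 + 1"] by simp
 also have "ea ?a ?c ... = 0[NM (eo ?a) (eo ?c)]"
  using lin_0[OF nat_mod_PF[of ?a ?c] M ea_lin[OF s s]] mod_zero[OF nat_mod_PF[of ?a ?c]] by simp
 finally show "cmp TM (E P)$n (E P)$(n+1) (E P)$(n+1+1) (cd (E P) (n+1)) (cd (E P) n) = 0[homm TM (E P)$n (E P)$(n+1+1)]"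
  unfolding E_d using tm.A_bil(5,6)[of "eo ?a" "eo ?b" "eo ?c"] e[of n] e[of "n + 1"] mod_neg[OF M] tm.A_bil(5)[of "eo ?a" "eo ?b" "eo ?c"]
   mod_nn[OF M mod_zero[OF M]] mod_n0[OF M] by simp
qed

lemma Ea_arr:
 assumes P: "sp P" and Q: "sp Q" and g: "g: Arr CT P Q"
 shows "Ea P Q g: Arr CT (E P) (E Q)"
proof (rule tm.Ch_arrI)
 note s = sp_small[OF P] sp_small[OF Q] and o = sp_ob[OF P] sp_ob[OF Q] and gn = ct_in[OF g]
 have G[simp]: "good (eo P$n)" "good P$n" "good (eo Q$n)" "good Q$n" for n using eo_good[OF s(1)] ct_good[OF o(1)] eo_good[OF s(2)] ct_good[OF o(2)] by simp_all
 note e = ea_nt[OF s(1) s(1) ct_d[OF o(1) refl]] ea_nt[OF s(2) s(2) ct_d[OF o(2) refl]] ea_nt[OF s gn]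
 show "Ea P Q g n: Arr TM (E P)$n (E Q)$n" for n using e(3) by (simp add: Ea_def)
 fix n
 note E_d = E_d[OF s(1) s(1) ct_d[OF o(1) refl]] E_d[OF s(2) s(2) ct_d[OF o(2) refl]]
 show "cmp TM (E P)$n (E Q)$n (E Q)$(n+1) (cd (E Q) n) (Ea P Q g n) = cmp TM (E P)$n (E P)$(n+1) (E Q)$(n+1) (Ea P Q g (n+1)) (cd (E P) n)"
  unfolding E_d Ea_def using e ea_cmp[OF s(1) s(1) s(2) ct_d[OF o(1) refl] gn, of n] ea_cmp[OF s(1) s(2) s(2) gn ct_d[OF o(2) refl], of n]
   tm.ch_comm[OF g, of n n n "n + 1" "n + 1"] tm.A_bil(6)[of "eo P$n" "eo Q$n" "eo Q$(n+1)"] tm.A_bil(5)[of "eo P$n" "eo P$(n+1)" "eo Q$(n+1)"] by simp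
qed

lemma Ea_ide: "sp P ==> Ea P P (ide CT P) = ide CT (E P)"
 unfolding Ea_def using ea_ide[OF sp_small] by simp

lemma Ea_cmp: "sp P ==> sp Q ==> sp R ==> g: Arr CT P Q ==> h: Arr CT Q R ==>
  Ea P R (cmp CT P Q R h g) = cmp CT (E P) (E Q) (E R) (Ea Q R h) (Ea P Q g)"
 unfolding Ea_def using ea_cmp[OF sp_small sp_small sp_small ct_in ct_in] by simp

lemma Ea_htp:
 assumes P: "sp P" and Q: "sp Q" and f: "f: Arr CT P Q" and g: "g: Arr CT P Q" and h: "tm.htp P Q f g"
 shows "tm.htp (E P) (E Q) (Ea P Q f) (Ea P Q g)"
proof -
 note s = sp_small[OF P] sp_small[OF Q] and o = sp_ob[OF P] sp_ob[OF Q]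
 have G[simp]: "good (eo P$n)" "good P$n" "good (eo Q$n)" "good Q$n" for n using eo_good[OF s(1)] ct_good[OF o(1)] eo_good[OF s(2)] ct_good[OF o(2)] by simp_all
 obtain k where k: "!!n. k n: nt P$n Q$(n-1)" and eq: "!!n. f n = g n +[NM P$n Q$n]
   (cc P$n Q$(n-1) Q$n (cd Q (n-1)) (k n) +[NM P$n Q$n] cc P$n P$(n+1) Q$n (k (n+1)) (cd P n))"
  using h unfolding tm.htp_def by auto
 have k1: "k (n+1): nt P$(n+1) Q$n" for n using k[of "n + 1"] by simp
 have dQ: "cd Q (n-1): nt Q$(n-1) Q$n" for n by (rule ct_d[OF o(2)]) simp
 note dP = ct_d[OF o(1) refl]
 note e = ea_nt[OF s k] ea_nt[OF s(2) s(2) dQ] ea_nt[OF s(1) s(1) dP] ea_nt[OF s k1]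
 have E_d: "cd (E Q) (n-1) = -[NM (eo Q$(n-1)) (eo Q$n)] ea Q$(n-1) Q$n (cd Q (n-1))"
  "cd (E P) n = -[NM (eo P$n) (eo P$(n+1))] ea P$n P$(n+1) (cd P n)" for n
  using E_d[OF s(2) s(2) ct_d[OF o(2) refl], of "n - 1"] E_d[OF s(1) s(1) dP] by simp_all
 have add: "ea P$n Q$n (fi +[NM P$n Q$n] sy) = ea P$n Q$n fi +[NM (eo P$n) (eo Q$n)] ea P$n Q$n sy"
  if "fi: nt P$n Q$n" "sy: nt P$n Q$n" for n fi sy
  using lin_add[OF ea_lin[OF s], of fi n n sy] that mod_add[OF nat_mod_PF[of "P$n" "Q$n"], of fi sy] by simp
 \<comment> \<open>Both differentials of E carry the sign -1, so the homotopy has to be negated as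
   well.\<close>
 let ?h = "%n. -[NM (eo P$n) (eo Q$(n-1))] ea P$n Q$(n-1) (k n)"
 show ?thesis unfolding tm.htp_def
 proof (intro exI[of _ ?h] conjI allI)
  fix n
  show "?h n: Arr TM (E P)$n (E Q)$(n-1)" using tm.A_cl(5)[of "eo P$n" "eo Q$(n-1)"] e(1) by simp
  have c: "cc P$n Q$(n-1) Q$n (cd Q (n-1)) (k n): nt P$n Q$n" "cc P$n P$(n+1) Q$n (k (n+1)) (cd P n): nt P$n Q$n"
   using cc_nt[OF good_isf k dQ] cc_nt[OF good_isf dP k1] by simp_all
  show "Ea P Q f n = Ea P Q g n +[homm TM (E P)$n (E Q)$n]
    (cmp TM (E P)$n (E Q)$(n-1) (E Q)$n (cd (E Q) (n-1)) (?h n) +[homm TM (E P)$n (E Q)$n]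
    cmp TM (E P)$n (E P)$(n+1) (E Q)$n (?h (n+1)) (cd (E P) n))"
   unfolding Ea_def E_d eq[of n] E_sel using add ct_in[OF g, of n] c mod_add[OF nat_mod_PF[of "P$n" "Q$n"]]
    ea_cmp[OF s(1) s(2) s(2) k dQ, of n] ea_cmp[OF s(1) s(1) s(2) dP k1, of n] e tm.A_cl(5)[of "eo P$n" "eo Q$(n-1)"] tm.A_cl(5)[of "eo P$(n+1)" "eo Q$n"]
    tm.A_bil(5,6)[of "eo P$n" "eo Q$(n-1)" "eo Q$n"] tm.A_bil(5,6)[of "eo P$n" "eo P$(n+1)" "eo Q$n"] tm.A_cl(2)
    mod_nn[OF nat_mod_PF[of "eo P$n" "eo Q$n"]] by simp
 qed
qed

subsection \<open>The duality isomorphism on the level of complexes\<close>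

text \<open>A functional on Hom^(-n)(P, Y) is restricted to families with the single component
  P^(j+n) -> Y^j; \<open>ad\<close> turns this restriction into the component Y^j -> E(P)^(j+n) of
  an element of Hom^n(Y, E(P)).\<close>

definition bt where "bt P Y n al j = (\<lambda>f\<in>nt P$(j + n) Y$j. al (tm.io P Y (- n) (j + n) f))"

definition Psi where "Psi P Y n al = (%j. ad P$(j + n) Y$j (bt P Y n al j))"

context
 fixes P Y :: "('k, 'o, 'm, 'u) fcx" assumes P: "sp P" and Y: "Y: Ob CT"
begin

lemma hm_mod: "module K (hm P Y n)" by (rule tm.module_hom_mod[OF sp_ob[OF P] Y])

lemma bt_io: "f: nt P$(j + n) Y$j ==> tm.io P Y (- n) (j + n) f <: (hm P Y (- n))"
 by (rule tm.io_in[OF sp_ob[OF P] Y]) simp_all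

lemma bt_in:
 assumes a: "al: lin K (hm P Y (- n)) KK"
 shows "bt P Y n al j: lin K (NM P$(j + n) Y$j) KK"
proof -
 have l: "(\<lambda>f\<in>nt P$(j + n) Y$j. tm.io P Y (- n) (j + n) f): lin K (NM P$(j + n) Y$j) (hm P Y (- n))"
  using tm.io_lin[OF sp_ob[OF P] Y, of j "j + n" "- n"] by simp
 have "bt P Y n al j = compose (carrier (NM P$(j + n) Y$j)) al (\<lambda>f\<in>nt P$(j + n) Y$j. tm.io P Y (- n) (j + n) f)"
  by (auto simp: bt_def compose_def)
 thus ?thesis using lin_comp[OF nat_mod_PF l a] ct_good[OF Y] ct_good[OF sp_ob[OF P]] by simp
qed

lemma Psi_in: "al: lin K (hm P Y (- n)) KK ==> Psi P Y n al <: (hm Y (E P) n)"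
 unfolding Psi_def using ad_nt[OF sp_small[OF P] ct_good[OF Y] bt_in] by simp

text \<open>As P is bounded, Hom^(-n)(P, Y) is the finite sum of its components in a window -N..N,
  so a functional on it is the same as an arbitrary family of functionals on the components.
  Bijectivity is then that of \<open>ad\<close> in each degree.\<close>

lemma Psi_bij: "bij_betw (Psi P Y n) (lin K (hm P Y (- n)) KK) (carrier (hm Y (E P) n))"
proof (intro bij_betwI' Psi_in)
 note g = ct_good[OF Y] ct_good[OF sp_ob[OF P]]
 note s = sp_small[OF P]
 have bj: "bij_betw (ad P$(j + n) Y$j) (lin K (NM P$(j + n) Y$j) KK) (nt Y$j (eo P$(j + n)))" for j
  using sp_basis[OF P, of "j + n"] ad_bij[OF s g(1)] by metis
 obtain N where N: "!!n. \<bar>n\<bar> > N ==> zero_ob TM P$n" using sp_bounded[OF P] by blast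
 have Nz: "i \<notin> {- N..N} ==> zero_ob TM P$i" for i using N[of i] by auto
 have sum: "f = finsum (hm P Y (- n)) (%i. tm.io P Y (- n) i (f i)) {- N..N}" if "f <: (hm P Y (- n))" for f
  by (rule tm.io_sum[OF sp_ob[OF P] Y _ Nz that]) simp_all
 have fi: "f i: nt P$i Y$(i - n)" if "f <: (hm P Y (- n))" for f i using that by simp
 have ioc: "f <: (hm P Y (- n)) ==> tm.io P Y (- n) i (f i) <: (hm P Y (- n))" for f i
  by (rule tm.io_in[OF sp_ob[OF P] Y]) simp_all
 fix al assume a: "al: lin K (hm P Y (- n)) KK"
 { fix be assume b: "be: lin K (hm P Y (- n)) KK"
  show "Psi P Y n al = Psi P Y n be \<longleftrightarrow> al = be"
  proof
   assume e: "Psi P Y n al = Psi P Y n be"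
   have be: "bt P Y n al j = bt P Y n be j" for j
    using inj_onD[OF bij_betw_imp_inj_on[OF bj] _ bt_in[OF a] bt_in[OF b]] fun_cong[OF e, of j] unfolding Psi_def by blast
   have io: "al (tm.io P Y (- n) i (f i)) = be (tm.io P Y (- n) i (f i))" if "f <: (hm P Y (- n))" for f i
    using fun_cong[OF be[of "i - n"], of "f i"] fi[OF that] by (simp add: bt_def)
   show "al = be"
   proof (rule lin_ext[OF a b])
    fix f assume f: "f <: (hm P Y (- n))"
    have A: "ga f = finsum KK (%i. ga (tm.io P Y (- n) i (f i))) {- N..N}" if "ga: lin K (hm P Y (- n)) KK" for ga
     using arg_cong[where f = ga, OF sum[OF f]] lin_finsum[OF hm_mod module_ground that, of "{- N..N}" "%i. tm.io P Y (- n) i (f i)"] ioc[OF f] by (simp del: tm.hom_mod_sel)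
    show "al f = be f" unfolding A[OF a] A[OF b] io[OF f] ..
   qed
  qed simp }
next
 note g = ct_good[OF Y] ct_good[OF sp_ob[OF P]]
 note s = sp_small[OF P]
 have bj: "bij_betw (ad P$(j + n) Y$j) (lin K (NM P$(j + n) Y$j) KK) (nt Y$j (eo P$(j + n)))" for j
  using sp_basis[OF P, of "j + n"] ad_bij[OF s g(1)] by metis
 obtain N where N: "!!n. \<bar>n\<bar> > N ==> zero_ob TM P$n" using sp_bounded[OF P] by blast
 fix ta assume t: "ta <: (hm Y (E P) n)"
 have "EX be. be: lin K (NM P$(j + n) Y$j) KK & ad P$(j + n) Y$j be = ta j" for j
 proof -
  have "ta j: nt Y$j (eo P$(j + n))" using t by simp
  thus ?thesis using bij_betw_imp_surj_on[OF bj[of j]] by (metis (no_types, lifting) imageE)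
 qed
 then obtain be where b: "!!j. be j: lin K (NM P$(j + n) Y$j) KK" "!!j. ad P$(j + n) Y$j (be j) = ta j" by metis
 define al where "al = (\<lambda>f\<in>carrier (hm P Y (- n)). finsum K (%i. be (i - n) (f i)) {- N..N})"
 have bl: "be (i - n): lin K (NM P$i Y$(i - n)) KK" for i using b(1)[of "i - n"] by simp
 have fi: "f i <: (NM P$i Y$(i - n))" if "f <: (hm P Y (- n))" for f i using that by simp
 note bK = dual_app[OF bl fi] and badd = lin_add[OF bl fi fi] and bsm = lin_sm[OF bl _ fi]
 have a: "al: lin K (hm P Y (- n)) KK"
 proof (rule linI)
  fix f assume f: "f <: (hm P Y (- n))"
  show "al f <: KK" using f bK by (simp add: al_def Pi_iff del: tm.hom_mod_sel(1))
  { fix g assume h: "g <: (hm P Y (- n))"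
   have "finsum K (%i. be (i - n) ((f +[hm P Y (- n)] g) i)) {- N..N} = finsum K (%i. be (i - n) (f i) \<oplus> be (i - n) (g i)) {- N..N}"
    by (rule finsum_cong') (use badd[OF f h] bK[OF f] bK[OF h] in auto)
   thus "al (f +[hm P Y (- n)] g) = al f +[KK] al g" using f h bK mod_add[OF hm_mod f h]
    by (simp add: al_def Pi_iff finsum_addf del: tm.hom_mod_sel) }
  fix c assume c: "c <: K"
  have "finsum K (%i. be (i - n) ((c *[hm P Y (- n)] f) i)) {- N..N} = finsum K (%i. c \<otimes> be (i - n) (f i)) {- N..N}"
   by (rule finsum_cong') (use bsm[OF c f] bK[OF f] c in auto)
  thus "al (c *[hm P Y (- n)] f) = c *[KK] al f" using f bK c mod_sm[OF hm_mod c f]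
   by (simp add: al_def Pi_iff finsum_rdistr del: tm.hom_mod_sel)
 qed (simp add: al_def del: tm.hom_mod_sel(1))
 have "bt P Y n al j = be j" for j
 proof (rule lin_ext[OF bt_in[OF a] b(1)])
  fix f assume "f <: (NM P$(j + n) Y$j)"
  hence f: "f: nt P$(j + n) Y$j" by simp
  let ?M = "%i. NM P$i Y$(i - n)"
  have b0: "be (i - n) 0[?M i] = \<zero>" for i using lin_0[OF nat_mod_PF module_ground bl] g by simp
  have bf: "be j f <: K" using dual_app[OF b(1)[of j], of f] f by simp
  have "al (tm.io P Y (- n) (j + n) f) = finsum K (%i. if j + n = i then be j f else \<zero>) {- N..N}"
   unfolding al_def using bt_io[OF f] by (simp del: tm.hom_mod_sel(1), intro finsum_cong') (use bf b0 in "auto simp: tm.io_def")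
  also have "... = be j f"
  proof (cases "j + n: {- N..N}")
   case True thus ?thesis using finsum_singleton[OF True, of "%_. be j f"] bf by simp
  next
   case False
   hence z: "zero_ob TM P$(j + n)" using N[of "j + n"] by auto
   have "f = 0[NM P$(j + n) Y$j]" using tm.zero_arr[OF sp_ob[OF P] Y z, of "Y$j" f] g f by simp
   hence "be j f = \<zero>" using lin_0[OF nat_mod_PF module_ground b(1)] g by simp
   moreover have "finsum K (%i. if j + n = i then be j f else \<zero>) {- N..N} = \<zero>" by (rule add.finprod_one_eqI) (use False in auto)
   ultimately show ?thesis by simp
  qed
  finally show "bt P Y n al j f = be j f" using f by (simp add: bt_def)
 qed
 hence "ta = Psi P Y n al" unfolding Psi_def using b(2) by auto
 thus "EX al:lin K (hm P Y (- n)) KK. ta = Psi P Y n al" using a by blast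
qed

lemma Psi_lin: "(\<lambda>al\<in>lin K (hm P Y (- n)) KK. Psi P Y n al): lin K (dual K (hm P Y (- n))) (hm Y (E P) n)"
proof (rule linI; unfold dual_sel)
 note g = ct_good[OF Y] ct_good[OF sp_ob[OF P]]
 note s = sp_small[OF P]
 note D = module_dual[OF hm_mod[of "- n"]]
 note al = ad_lin[OF s g(1)]
 fix al assume a: "al: lin K (hm P Y (- n)) KK"
 show "(\<lambda>al\<in>lin K (hm P Y (- n)) KK. Psi P Y n al) al <: (hm Y (E P) n)" using Psi_in[OF a] a by simp
 { fix be assume b: "be: lin K (hm P Y (- n)) KK"
  have ab: "al +[dual K (hm P Y (- n))] be: lin K (hm P Y (- n)) KK" using mod_add[OF D] a b by (simp add: dual_sel)
  have "bt P Y n (al +[dual K (hm P Y (- n))] be) j = bt P Y n al j +[dual K (NM P$(j + n) Y$j)] bt P Y n be j" for j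
   by (rule lin_ext[OF bt_in[OF ab] mod_add[OF module_dual[OF nat_mod_PF[OF g(2,1)]], unfolded dual_sel, OF bt_in[OF a] bt_in[OF b]]])
    (simp add: dual_add bt_io bt_def del: tm.hom_mod_sel)
  thus "(\<lambda>al\<in>lin K (hm P Y (- n)) KK. Psi P Y n al) (al +[dual K (hm P Y (- n))] be) =
   (\<lambda>al\<in>lin K (hm P Y (- n)) KK. Psi P Y n al) al +[hm Y (E P) n] (\<lambda>al\<in>lin K (hm P Y (- n)) KK. Psi P Y n al) be"
   using a b ab lin_add[OF al, unfolded dual_sel, OF bt_in[OF a] bt_in[OF b]] mod_add[OF module_dual[OF nat_mod_PF[OF g(2,1)]], unfolded dual_sel, OF bt_in[OF a] bt_in[OF b]]
   by (simp add: Psi_def bt_in) }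
 fix c assume c: "c <: K"
 have ca: "c *[dual K (hm P Y (- n))] al: lin K (hm P Y (- n)) KK" using mod_sm[OF D c] a by (simp add: dual_sel)
 have "bt P Y n (c *[dual K (hm P Y (- n))] al) j = c *[dual K (NM P$(j + n) Y$j)] bt P Y n al j" for j
  by (rule lin_ext[OF bt_in[OF ca] mod_sm[OF module_dual[OF nat_mod_PF[OF g(2,1)]] c, unfolded dual_sel, OF bt_in[OF a]]])
   (simp add: dual_sm bt_io bt_def del: tm.hom_mod_sel)
 thus "(\<lambda>al\<in>lin K (hm P Y (- n)) KK. Psi P Y n al) (c *[dual K (hm P Y (- n))] al) =
   c *[hm Y (E P) n] (\<lambda>al\<in>lin K (hm P Y (- n)) KK. Psi P Y n al) al"
  using a ca lin_sm[OF al c, unfolded dual_sel, OF bt_in[OF a]] mod_sm[OF module_dual[OF nat_mod_PF[OF g(2,1)]] c, unfolded dual_sel, OF bt_in[OF a]]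
  by (simp add: Psi_def bt_in)
qed simp

end

end

context kl
begin

lemma io_post:
 assumes "X: Ob (Ch A)" "Y: Ob (Ch A)" "Z: Ob (Ch A)" and g: "g: Arr (Ch A) Y Z" and f: "f: Arr A X$i Y$j" and j: "j = i + n"
 shows "mm (hom_cx_fnc A X) Y Z g n (io X Y n i f) = io X Z n i (cmp A X$i Y$j Z$j (g j) f)"
 unfolding hom_fnc_sel(2)[OF io_in[OF assms(1,2) f j]] using j f ch_ob[OF assms(1)] ch_ob[OF assms(2)] ch_ob[OF assms(3)] ch_in[OF g]
 by (auto simp: io_def)

lemma io_pre:
 assumes "X: Ob (Ch A)" "Y: Ob (Ch A)" "Z: Ob (Ch A)" and h: "h: Arr (Ch A) Z X" and f: "f: Arr A X$i Y$j" and j: "j = i + n"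
 shows "hom_cx_precomp A Z X Y h n (io X Y n i f) = io Z Y n i (cmp A Z$i X$i Y$j f (h i))"
 unfolding precomp_sel[OF io_in[OF assms(1,2) f j]] using j f ch_ob[OF assms(1)] ch_ob[OF assms(2)] ch_ob[OF assms(3)] ch_in[OF h]
 by (auto simp: io_def)

end

lemma (in gf) bij_qis:
 assumes X: "X: Ob CK" and Y: "Y: Ob CK" and f: "f: Arr CK X Y" and b: "!!n. bij_betw (f n) (carrier X$n) (carrier Y$n)"
 shows "qis_mod X Y f"
 unfolding qis_iff[OF X Y f] cone_acyclic_def
proof (intro allI ballI impI)
 fix n y y' assume y: "y <: X$(n+1)" "y' <: Y$n" and e: "cd X (n+1) y = 0[X$(n+1+1)] & f (n+1) y = cd Y n y'"
 obtain z where z: "z <: X$n" "f n z = y'" using bij_betw_imp_surj_on[OF b] y(2) by (metis imageE)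
 have "cd X n z = y" using inj_onD[OF bij_betw_imp_inj_on[OF b] _ ck_dcl[OF X z(1)] y(1)] ck_comm[OF f z(1)] z(2) e by simp
 moreover have "y' = f n z +[Y$n] cd Y (n-1) 0[Y$(n-1)]"
  using z lin_0[OF ck_mod[OF Y] ck_mod[OF Y] ck_d[OF Y, of "n - 1"]] mod_0r[OF ck_mod[OF Y] y(2)] by simp
 ultimately show "EX z:carrier X$n. EX z':carrier Y$(n-1). cd X n z = y & y' = f n z +[Y$n] cd Y (n-1) z'"
  using z mod_zero[OF ck_mod[OF Y, of "n - 1"]] by blast
qed

context yon
begin

abbreviation "HC P Y == hom_cx TM P Y"
abbreviation "LA == loc_arr CK qis_mod"
abbreviation "DM == mm (dual_cx_fnc K)"

lemma HC_ob: "X: Ob CT ==> Y: Ob CT ==> HC X Y: Ob CK" by (rule tm.hom_cx_ob)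

text \<open>Both sides are maps to (DP)', so they are compared at v and xi. Two scalars arise: U
  from the differential of Y and W from that of P. One side is -W - (-1)^n U and the other
  (-1)^(n+1) (U - (-1)^(n+1) W). These agree because the differential of E(P) carries the sign -1 in
  every degree.\<close>

lemma Psi_comm:
 assumes P: "sp P" and Y: "Y: Ob CT" and a: "al: lin K (hm P Y (- n)) KK"
 shows "tm.dh Y (E P) n (Psi P Y n al) = Psi P Y (n+1) (cd (dual_cx K (HC P Y)) n al)"
proof
 fix j
 let ?G = "P$(j + (n+1))" and ?F = "P$(j + n)" and ?ga = "cd (dual_cx K (HC P Y)) n al" and ?Y = "Y$j"
 let ?M = "NM ?Y (eo ?G)"
 note s = sp_small[OF P] and o = sp_ob[OF P] and g = ct_good[OF Y] and gP = ct_good[OF sp_ob[OF P]]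
 note hc = HC_ob[OF o Y]
 have gl: "?ga: lin K (hm P Y (- (n+1))) KK" using dual_d_in[OF hc, of al n] a by simp
 have i[simp]: "j+1 + n = j + (n+1)" "j + n+1 = j + (n+1)" by simp_all
 have dP: "cd P (j + n): nt ?F ?G" by (rule ct_d[OF o]) simp
 note dY = ct_d[OF Y refl, of j]
 let ?A = "cc ?Y (eo ?F) (eo ?G) (ea ?F ?G (cd P (j + n))) (Psi P Y n al j)" and ?B = "cc ?Y Y$(j+1) (eo ?G) (Psi P Y n al (j+1)) (cd Y j)"
 have ps: "Psi P Y n al j: nt ?Y (eo ?F)" "Psi P Y n al (j+1): nt Y$(j+1) (eo ?G)"
  using Psi_in[OF P Y a] spec[of _ "j + 1"] by (auto dest: spec[of _ "j + 1"])
 have en: "ea ?F ?G (cd P (j + n)): nt (eo ?F) (eo ?G)" by (rule ea_nt[OF s s dP])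
 have A: "?A: nt ?Y (eo ?G)" and B: "?B: nt ?Y (eo ?G)" using cc_nt[OF good_isf[OF g] ps(1) en] cc_nt[OF good_isf[OF g] dY ps(2)] .
 have Ed: "cd (E P) (j + n) = -[NM (eo ?F) (eo ?G)] ea ?F ?G (cd P (j + n))"
  using E_d[of P "j + n"] s dP by simp
 note M = nat_mod_PF[OF g eo_good[OF s]]
 have L: "tm.dh Y (E P) n (Psi P Y n al) j = -[?M] ?A +[?M] -[?M] signed ?M n ?B"
  unfolding tm.dh_def E_sel Ed using tm.A_bil(6)[of ?Y "eo ?F" "eo ?G"] g eo_good[OF s] ps(1) en by (simp add: mod_minus)
 have sB: "signed ?M n ?B: nt ?Y (eo ?G)" using mod_sgn[OF M] B by simp
 have Ln: "-[?M] ?A +[?M] -[?M] signed ?M n ?B: nt ?Y (eo ?G)" using mod_add[OF M mod_neg[OF M] mod_neg[OF M]] A sB by simp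
 show "tm.dh Y (E P) n (Psi P Y n al) j = Psi P Y (n+1) ?ga j" unfolding L Psi_def[of P Y "n + 1"]
 proof (rule ad_ext[OF s g bt_in[OF P Y gl] Ln, symmetric])
  fix x v xi assume x: "x: Ob C" and v: "v <: (om ?Y x)" and xi: "xi: nt ?G (Th x)"
  let ?f = "el ?G ?Y x v xi"
  have i1: "j + (n+1)-1 = j + n" by simp
  have f: "?f: nt ?G ?Y" by (rule el_in[OF gP g x v xi])
  \<comment> \<open>Evaluation at v and xi is treated as one linear functional, so that sums and
    signs pass through it in a single step.\<close>
  define L where "L = compose (carrier ?M) (\<lambda>w\<in>carrier (om (eo ?G) x). pa ?G x w xi) (\<lambda>et\<in>nt ?Y (eo ?G). et x v)"
  have Ll: "L: lin K ?M KK" unfolding L_def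
   by (rule lin_comp[OF M eval_lin[OF good_isf[OF g] eo_isf[OF s] x v] pa_lin[OF s x xi]])
  have La: "et: nt ?Y (eo ?G) ==> L et = pa ?G x (et x v) xi" for et using nt_cl[of et C ?Y "eo ?G", OF _ x v] by (simp add: L_def compose_def)
  let ?U = "al (tm.io P Y (- n) (j + (n+1)) (cc ?G ?Y Y$(j+1) (cd Y j) ?f))" and ?W = "al (tm.io P Y (- n) (j + n) (cc ?F ?G ?Y ?f (cd P (j + n))))"
  have c1: "cc ?G ?Y Y$(j+1) (cd Y j) ?f: nt ?G Y$(j+1)" and c2: "cc ?F ?G ?Y ?f (cd P (j + n)): nt ?F ?Y"
   using cc_nt[OF good_isf[OF gP] f dY] cc_nt[OF good_isf[OF gP] dP f] .
  have io1: "tm.io P Y (- n) (j + (n+1)) (cc ?G ?Y Y$(j+1) (cd Y j) ?f) <: (hm P Y (- n))"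
   by (rule tm.io_in[OF o Y, of _ _ "j + 1"]) (use c1 in simp_all)
  note io2 = bt_io[OF P Y c2]
  have U: "?U <: K" and W: "?W <: K" using dual_app[OF a io1] dual_app[OF a io2] .
  have LA: "L ?A = ?W"
  proof -
   have "L ?A = pa ?F x (ad ?F ?Y (bt P Y n al j) x v) (cc ?F ?G (Th x) xi (cd P (j + n)))"
    using La[OF A] ea_app[OF s s dP x nt_cl[OF ps(1) x v] xi] cc_app[OF x v] by (simp add: Psi_def)
   also have "... = bt P Y n al j (el ?F ?Y x v (cc ?F ?G (Th x) xi (cd P (j + n))))"
    by (rule ad_app[OF s g bt_in[OF P Y a] x v cc_nt[OF good_isf[OF gP] dP xi]])
   also have "el ?F ?Y x v (cc ?F ?G (Th x) xi (cd P (j + n))) = cc ?F ?G ?Y ?f (cd P (j + n))" by (rule el_pre[OF gP g x v xi gP dP, symmetric])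
   finally show ?thesis using c2 by (simp add: bt_def)
  qed
  have LB: "L ?B = ?U"
  proof -
   have "L ?B = pa ?G x (ad P$(j+1 + n) Y$(j+1) (bt P Y n al (j+1)) x (cd Y j x v)) xi" using La[OF B] x v by (simp add: Psi_def)
   also have "... = bt P Y n al (j+1) (el ?G Y$(j+1) x (cd Y j x v) xi)"
    using ad_app[OF s g bt_in[OF P Y a, of "j + 1"] x nt_cl[OF dY x v], of xi] xi by simp
   also have "el ?G Y$(j+1) x (cd Y j x v) xi = cc ?G ?Y Y$(j+1) (cd Y j) ?f" using el_post[OF gP g x v xi g dY] by simp
   finally show ?thesis using c1 by (simp add: bt_def)
  qed
  have "bt P Y (n+1) ?ga j ?f = signed KK (n+1) (al (tm.dh P Y (- (n+1)) (tm.io P Y (- (n+1)) (j + (n+1)) ?f)))"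
   using f dual_d_app[OF hc, of al n] a bt_io[OF P Y, of ?f j "n + 1"] tm.hom_cx_sel(2)[of _ P Y "- (n+1)"] by (simp add: bt_def del: tm.hom_mod_sel)
  also have "tm.dh P Y (- (n+1)) (tm.io P Y (- (n+1)) (j + (n+1)) ?f) = tm.io P Y (- n) (j + (n+1)) (cc ?G ?Y Y$(j+1) (cd Y j) ?f) +[hm P Y (- n)]
    -[hm P Y (- n)] signed (hm P Y (- n)) (- (n+1)) (tm.io P Y (- n) (j + n) (cc ?F ?G ?Y ?f (cd P (j + n))))"
   by (rule tm.io_dh[OF o Y, of ?f "j + (n+1)" j "- (n+1)" "- n", unfolded TM_sel i1, OF f]) simp_all
  also have "al ... = ?U \<oplus> \<ominus> signed KK (- (n+1)) ?W"
   using hm_mod[OF P Y] mod_sgn[OF hm_mod[OF P Y] io2, of "- (n+1)"] io1 io2 lin_add[OF a io1 mod_neg[OF hm_mod[OF P Y] mod_sgn[OF hm_mod[OF P Y] io2]]]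
    lin_neg[OF hm_mod[OF P Y] module_ground a] lin_sgn[OF hm_mod[OF P Y] module_ground a io2] W by (simp del: tm.hom_mod_sel)
  finally have R: "bt P Y (n+1) ?ga j ?f = signed KK (n+1) (?U \<oplus> \<ominus> signed KK (- (n+1)) ?W)" .
  have "pa ?G x ((-[?M] ?A +[?M] -[?M] signed ?M n ?B) x v) xi = L (-[?M] ?A +[?M] -[?M] signed ?M n ?B)" using La[OF Ln] by simp
  also have "... = \<ominus> ?W \<oplus> \<ominus> signed KK n ?U"
   using lin_add[OF Ll, of "-[?M] ?A" "-[?M] signed ?M n ?B"] mod_neg[OF M] A B sB lin_neg[OF M module_ground Ll] lin_sgn[OF M module_ground Ll, of ?B n] LA LB U W by simp
  also have "... = signed KK (n+1) (?U \<oplus> \<ominus> signed KK (- (n+1)) ?W)" using U W by (cases "even n") (simp_all add: signed_def minus_add a_comm)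
  finally show "bt P Y (n+1) ?ga j ?f = pa ?G x ((-[?M] ?A +[?M] -[?M] signed ?M n ?B) x v) xi" using R by simp
 qed
qed

lemma Psi_pre:
 assumes P: "sp P" and Y: "Y: Ob CT" and Z: "Z: Ob CT" and g: "g: Arr CT Y Z" and a: "al: lin K (hm P Z (- n)) KK"
 shows "Psi P Y n (DM (HC P Z) (HC P Y) (mm (hom_cx_fnc TM P) Y Z g) n al) = hom_cx_precomp TM Y Z (E P) g n (Psi P Z n al)"
proof -
 note o = sp_ob[OF P] and hf = tm.hom_fnc_arr[OF sp_ob[OF P] Y Z g]
 let ?ga = "DM (HC P Z) (HC P Y) (mm (hom_cx_fnc TM P) Y Z g) n al"
 have gl: "?ga: lin K (hm P Y (- n)) KK" using ck_cl[OF dual_fnc_arr[OF HC_ob[OF o Y] HC_ob[OF o Z] hf], of al n] a by (simp add: dual_sel)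
 have "Psi P Y n ?ga j = cc Y$j Z$j (eo P$(j + n)) (Psi P Z n al j) (g j)" for j unfolding Psi_def
 proof (rule ad_pre[OF sp_small[OF P] ct_good[OF Z] ct_good[OF Y] ct_in[OF g] bt_in[OF P Z a] bt_in[OF P Y gl]])
  fix f assume f: "f: nt P$(j + n) Y$j"
  thus "bt P Y n ?ga j f = bt P Z n al j (cc P$(j + n) Y$j Z$j (g j) f)"
   using dual_fnc_app[of al "HC P Z" n _ "HC P Y" "mm (hom_cx_fnc TM P) Y Z g"] a bt_io[OF P Y f] tm.io_post[OF o Y Z g, of f "j + n" j "- n"]
    cc_nt[OF good_isf[OF ct_good[OF o]] f ct_in[OF g]] by (simp add: bt_def del: tm.hom_mod_sel tm.hom_fnc_sel(2))
 qed
 thus ?thesis unfolding tm.precomp_sel[OF Psi_in[OF P Z a]] by auto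
qed

lemma Psi_post:
 assumes P: "sp P" and Q: "sp Q" and Y: "Y: Ob CT" and h: "h: Arr CT P Q" and a: "al: lin K (hm P Y (- n)) KK"
 shows "Psi Q Y n (DM (HC P Y) (HC Q Y) (hom_cx_precomp TM P Q Y h) n al) = mm (hom_cx_fnc TM Y) (E P) (E Q) (Ea P Q h) n (Psi P Y n al)"
proof -
 note o = sp_ob[OF P] sp_ob[OF Q] and hf = tm.precomp_arr[OF sp_ob[OF Q] sp_ob[OF P] Y h]
 let ?ga = "DM (HC P Y) (HC Q Y) (hom_cx_precomp TM P Q Y h) n al"
 have gl: "?ga: lin K (hm Q Y (- n)) KK" using ck_cl[OF dual_fnc_arr[OF HC_ob[OF o(2) Y] HC_ob[OF o(1) Y] hf], of al n] a by (simp add: dual_sel)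
 have "Psi Q Y n ?ga j = cc Y$j (eo P$(j + n)) (eo Q$(j + n)) (Ea P Q h (j + n)) (Psi P Y n al j)" for j unfolding Psi_def Ea_def
 proof (rule ad_post[OF sp_small[OF P] sp_small[OF Q] ct_good[OF Y] ct_in[OF h] bt_in[OF P Y a] bt_in[OF Q Y gl]])
  fix f assume f: "f: nt Q$(j + n) Y$j"
  thus "bt Q Y n ?ga j f = bt P Y n al j (cc P$(j + n) Q$(j + n) Y$j f (h (j + n)))"
   using dual_fnc_app[of al "HC P Y" n _ "HC Q Y" "hom_cx_precomp TM P Q Y h"] a bt_io[OF Q Y f] tm.io_pre[OF o(2) Y o(1) h, of f "j + n" j "- n"]
    cc_nt[OF good_isf[OF ct_good[OF o(1)]] ct_in[OF h] f] by (simp add: bt_def del: tm.hom_mod_sel)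
 qed
 thus ?thesis unfolding tm.hom_fnc_sel(2)[OF Psi_in[OF P Y a]] by auto
qed

text \<open>The copy brings the target onto the type of functionals, so that both complexes are
  objects of one category and the isomorphism can be an arrow there.\<close>

definition PsiC :: "('k, 'o, 'm, 'u) fcx => ('k, 'o, 'm, 'u) fcx => int => ((int => 'o => 'u => 'u) => 'k) => (int => 'o => 'u => 'u) => 'k" where
 "PsiC P Y n = (\<lambda>al\<in>lin K (hm P Y (- n)) KK. emb (hm Y (E P) n) (Psi P Y n al))"

text \<open>A set embeds into its functions to k by delta functions, which are distinct because 1
  and 0 are. Copies onto the type of functionals therefore always make sense.\<close>

lemma inj_delta: "inj (%(h :: 'h) h'. if h = h' then \<one> else \<zero>)"
proof (rule injI)
 fix x y :: 'h assume "(%h'. if x = h' then \<one> else \<zero>) = (%h'. if y = h' then \<one> else \<zero>)"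
 from fun_cong[OF this, of x] show "x = y" using one_not_zero by (simp split: if_splits)
qed

lemma emb_h: "inj_on (emb V :: 'h => 'h => 'k) (carrier V)" by (rule emb_all[OF inj_delta])

text \<open>Pairs of Hom families combine pointwise through \<open>pr\<close>. This gives biproducts
  of modules on the type of Hom complexes, hence \<open>kmod_loc_htp\<close> there.\<close>

lemma inj_h: "inj (%(f, g) (i :: int) (x :: 'o) v. pr (f i x v, g i x v) :: 'u)"
 by (rule injI) (auto simp: fun_eq_iff)

context
 fixes P Y :: "('k, 'o, 'm, 'u) fcx" assumes P: "sp P" and Y: "Y: Ob CT"
begin

lemma PsiC_arr: "PsiC P Y: Arr CK (dual_cx K (HC P Y)) (cpy_cx (HC Y (E P)))"
proof (rule Ch_kmod_arrI)
 note M = hm_mod[OF P Y] and N = tm.module_hom_mod[OF Y E_ob[OF P]]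
 fix n
 have "PsiC P Y n = compose (carrier (dual K (hm P Y (- n)))) (\<lambda>x\<in>carrier (hm Y (E P) n). emb (hm Y (E P) n) x) (\<lambda>al\<in>lin K (hm P Y (- n)) KK. Psi P Y n al)"
  using Psi_in[OF P Y] by (auto simp: PsiC_def compose_def dual_sel simp del: tm.hom_mod_sel)
 thus "PsiC P Y n: lin K (dual_cx K (HC P Y))$n (cpy_cx (HC Y (E P)))$n"
  using lin_comp[OF module_dual[OF M] Psi_lin[OF P Y] emb_lin[OF N emb_h]] by simp
 fix al assume "al <: (dual_cx K (HC P Y))$n"
 hence a: "al: lin K (hm P Y (- n)) KK" by (simp add: dual_sel)
 have d: "cd (dual_cx K (HC P Y)) n al: lin K (hm P Y (- (n+1))) KK" using dual_d_in[OF HC_ob[OF sp_ob[OF P] Y], of al n] a by simp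
 show "cd (cpy_cx (HC Y (E P))) n (PsiC P Y n al) = PsiC P Y (n+1) (cd (dual_cx K (HC P Y)) n al)"
  using cpy_map_emb[OF emb_h Psi_in[OF P Y a]] tm.hom_cx_sel(2)[OF Psi_in[OF P Y a]] a d Psi_comm[OF P Y a] by (simp add: PsiC_def del: tm.hom_mod_sel)
qed

lemma PsiC_qis: "qis_mod (dual_cx K (HC P Y)) (cpy_cx (HC Y (E P))) (PsiC P Y)"
proof (rule bij_qis[OF dual_cx_ob[OF HC_ob[OF sp_ob[OF P] Y]] cpy_cx_ob[OF inj_delta HC_ob[OF Y E_ob[OF P]]] PsiC_arr])
 fix n
 have "bij_betw (emb (hm Y (E P) n) :: _ => (int => 'o => 'u => 'u) => 'k) (carrier (hm Y (E P) n)) (carrier (cpy (hm Y (E P) n)))"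
  using cpy_sel(1)[OF tm.module_hom_mod[OF Y E_ob[OF P]] emb_h] emb_h unfolding bij_betw_def by (simp del: tm.hom_mod_sel)
 from bij_betw_trans[OF Psi_bij[OF P Y] this]
 have "bij_betw (PsiC P Y n) (lin K (hm P Y (- n)) KK) (carrier (cpy (hm Y (E P) n)))"
  by (rule bij_betw_cong[THEN iffD1, rotated]) (simp add: PsiC_def)
 thus "bij_betw (PsiC P Y n) (carrier (dual_cx K (HC P Y))$n) (carrier (cpy_cx (HC Y (E P)))$n)" by (simp add: dual_sel)
qed

end

lemma PsiC_pre:
 assumes P: "sp P" and Y: "Y: Ob CT" and Z: "Z: Ob CT" and g: "g: Arr CT Y Z"
 shows "cmp CK (dual_cx K (HC P Z)) (dual_cx K (HC P Y)) (cpy_cx (HC Y (E P))) (PsiC P Y) (DM (HC P Z) (HC P Y) (mm (hom_cx_fnc TM P) Y Z g)) =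
  cmp CK (dual_cx K (HC P Z)) (cpy_cx (HC Z (E P))) (cpy_cx (HC Y (E P))) (mm cpy_cx_fnc (HC Z (E P)) (HC Y (E P)) (hom_cx_precomp TM Y Z (E P) g)) (PsiC P Z)" (is "?l = ?r")
proof (rule ext, rule ext)
 fix n al
 note o = sp_ob[OF P]
 have gl: "DM (HC P Z) (HC P Y) (mm (hom_cx_fnc TM P) Y Z g) n al: lin K (hm P Y (- n)) KK" if "al: lin K (hm P Z (- n)) KK"
  using ck_cl[OF dual_fnc_arr[OF HC_ob[OF o Y] HC_ob[OF o Z] tm.hom_fnc_arr[OF o Y Z g]], of al n] that by (simp add: dual_sel)
 show "?l n al = ?r n al" using gl Psi_pre[OF P Y Z g] cpy_map_emb[OF emb_h Psi_in[OF P Z]]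
  by (cases "al: lin K (hm P Z (- n)) KK") (simp_all add: compose_def dual_sel cpy_fnc_sel PsiC_def del: tm.hom_mod_sel)
qed

lemma PsiC_post:
 assumes P: "sp P" and Q: "sp Q" and Y: "Y: Ob CT" and h: "h: Arr CT P Q"
 shows "cmp CK (dual_cx K (HC P Y)) (dual_cx K (HC Q Y)) (cpy_cx (HC Y (E Q))) (PsiC Q Y) (DM (HC P Y) (HC Q Y) (hom_cx_precomp TM P Q Y h)) =
  cmp CK (dual_cx K (HC P Y)) (cpy_cx (HC Y (E P))) (cpy_cx (HC Y (E Q))) (mm cpy_cx_fnc (HC Y (E P)) (HC Y (E Q)) (mm (hom_cx_fnc TM Y) (E P) (E Q) (Ea P Q h))) (PsiC P Y)" (is "?l = ?r")
proof (rule ext, rule ext)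
 fix n al
 note o = sp_ob[OF P] sp_ob[OF Q]
 have gl: "DM (HC P Y) (HC Q Y) (hom_cx_precomp TM P Q Y h) n al: lin K (hm Q Y (- n)) KK" if "al: lin K (hm P Y (- n)) KK"
  using ck_cl[OF dual_fnc_arr[OF HC_ob[OF o(2) Y] HC_ob[OF o(1) Y] tm.precomp_arr[OF o(2,1) Y h]], of al n] that by (simp add: dual_sel)
 show "?l n al = ?r n al" using gl Psi_post[OF P Q Y h] cpy_map_emb[OF emb_h Psi_in[OF P Y]]
  by (cases "al: lin K (hm P Y (- n)) KK") (simp_all add: compose_def dual_sel cpy_fnc_sel PsiC_def del: tm.hom_mod_sel tm.hom_fnc_sel(2))
qed

end

lemma set_fnc_pull:
 assumes F: "is_functor A B F" and s: "sends A W W' F" and S: "set_fnc B W' S M"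
 shows "set_fnc A W (%a. S (om F a)) (%a b f. M (om F a) (om F b) (mm F a b f))"
 unfolding set_fnc_def using fncD[OF F] sf_simps[OF S] s[unfolded sends_def] by auto

context yon
begin

subsection \<open>Quasi-isomorphisms of complexes of functors\<close>

definition evf :: "'o => (('k, 'o, 'm, 'u) fcx, int => 'o => 'u => 'u, (('k, 'u) module, 'u => 'u) cx, int => 'u => 'u) fnc" where
 "evf x = \<lparr>om = ev_cx x, mm = (%X Y f n. f n x)\<rparr>"

lemma evf_sel[simp]: "om (evf x) = ev_cx x" "mm (evf x) X Y f = (%n. f n x)" "(ev_cx x X)$n = om X$n x" "cd (ev_cx x X) n = cd X n x"
 by (simp_all add: evf_def ev_cx_def)

lemma CT_cat: "category CT" by (rule kl_cat[OF tm.Ch_klinear])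

lemma evf_functor:
 assumes x: "x: Ob C" shows "is_functor CT CK (evf x)"
 unfolding is_functor_def
proof (intro conjI CT_cat Ch_kmod_cat ballI)
 fix X assume X: "X: Ob CT"
 note g = good_isf[OF ct_good[OF X]]
 show "om (evf x) X: Ob CK"
 proof (rule Ch_kmod_obI)
  fix n v assume "v <: (om (evf x) X)$n"
  hence v: "v <: (om X$n x)" by simp
  show "cd (om (evf x) X) (n+1) (cd (om (evf x) X) n v) = 0[(om (evf x) X)$(n+1+1)]"
   using fun_cong[OF fun_cong[OF tm.ch_dd[OF X, of n n "n + 1" "n + 1" "n+1 + 1"]], of x v] x v by simp
 qed (use mf_mod[OF g x] nt_lin[OF ct_d[OF X refl] x] in simp_all)
 show "mm (evf x) X X (ide CT X) = ide CK (om (evf x) X)" by (rule ext) (use x in "simp add: cmod_def kmod_sel restrict_def")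
 fix Y f assume Y: "Y: Ob CT" and f: "f: Arr CT X Y"
 show "mm (evf x) X Y f: Arr CK (om (evf x) X) (om (evf x) Y)"
 proof (rule Ch_kmod_arrI)
  fix n v assume "v <: (om (evf x) X)$n"
  hence v: "v <: (om X$n x)" by simp
  show "cd (om (evf x) Y) n (mm (evf x) X Y f n v) = mm (evf x) X Y f (n+1) (cd (om (evf x) X) n v)"
   using fun_cong[OF fun_cong[OF tm.ch_comm[OF f, of n n n "n + 1" "n + 1"]], of x v] x v by simp
 qed (use nt_lin[OF ct_in[OF f] x] in simp)
 fix Z g show "mm (evf x) X Z (cmp CT X Y Z g f) = cmp CK (om (evf x) X) (om (evf x) Y) (om (evf x) Z) (mm (evf x) Y Z g) (mm (evf x) X Y f)"
  by (rule ext) (use x in "simp add: cmod_def kmod_sel restrict_def")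
qed

lemma qis_sends: "x: Ob C ==> sends CT (qis_fnc C) qis_mod (evf x)"
 by (simp add: sends_def qis_fnc_def)

lemma qis_cone: "X: Ob CT ==> Y: Ob CT ==> f: Arr CT X Y ==> qis_fnc C X Y f ==> x: Ob C ==> cone_acyclic (ev_cx x X) (ev_cx x Y) (%n. f n x)"
 using qis_iff[OF fnc_ob[OF evf_functor] fnc_ob[OF evf_functor] fnc_arr[OF evf_functor], of x X Y f] by (simp add: qis_fnc_def)

abbreviation "LT == loc_arr CT (qis_fnc C)"
abbreviation "LI == loc_inv CT (qis_fnc C)"
abbreviation "DT == loc_cat CT (qis_fnc C)"

text \<open>Cohomology at each object of C is a functor to sets that inverts quasi-isomorphisms, so
  arrows invertible in the derived category act on it bijectively. In \<open>res\<close> this turns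
  an abstract isomorphism into an honest quasi-isomorphism.\<close>

lemma iso_qis:
 assumes i: "is_iso DT X Y (LT X Y f)" and o: "X: Ob CT" "Y: Ob CT" "f: Arr CT X Y"
 shows "qis_fnc C X Y f"
 unfolding qis_fnc_def qis_mod_def using loc_iso_bij[OF set_fnc_pull[OF evf_functor qis_sends coh_set_fnc] i o] by simp

text \<open>Evaluating homotopies at each object of C shows that homotopy equivalences are
  quasi-isomorphisms, which is the condition of \<open>loc_htp\<close> on the inverted
  class.\<close>

lemma LT_htp:
 assumes "X: Ob CT" "Y: Ob CT" "f: Arr CT X Y" "g: Arr CT X Y" "tm.htp X Y f g"
 shows "LT X Y f = LT X Y g"
proof (rule tm.loc_htp[OF TM_has_biprods assms])
 fix X Y w v
 assume X: "X: Ob CT" and Y: "Y: Ob CT" and w: "w: Arr CT X Y" and v: "v: Arr CT Y X"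
  and h: "tm.htp Y Y (ide CT Y) (cmp CT Y X Y w v)" "tm.htp X X (ide CT X) (cmp CT X Y X v w)"
 have ht: "kl.htp (kmod K) (ev_cx x X) (ev_cx x Y) (%n. f n x) (%n. g n x)"
  if x: "x: Ob C" and h: "tm.htp X Y f g" and X: "X: Ob CT" and Y: "Y: Ob CT" and f: "f: Arr CT X Y" and g: "g: Arr CT X Y" for x X Y f g
 proof -
  interpret km: kl K "kmod K :: ('k, ('k, 'u) module, 'u => 'u) kcat" by unfold_locales (rule kmod_klinear)
  obtain k where k: "!!n. k n: nt X$n Y$(n-1)" and eq: "!!n. f n = g n +[NM X$n Y$n]
    (cc X$n Y$(n-1) Y$n (cd Y (n-1)) (k n) +[NM X$n Y$n] cc X$n X$(n+1) Y$n (k (n+1)) (cd X n))"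
   using h unfolding tm.htp_def by auto
  note e = fnc_ob[OF evf_functor[OF x], simplified] fnc_arr[OF evf_functor[OF x], simplified]
  show ?thesis unfolding km.htp_def
  proof (intro exI[of _ "%n. k n x"] conjI allI)
   fix n
   show kn: "k n x: Arr (kmod K) (ev_cx x X)$n (ev_cx x Y)$(n-1)" for n using nt_lin[OF k x] by (simp add: kmod_sel)
   have k1: "k (n+1) x: Arr (kmod K) (ev_cx x X)$(n+1) (ev_cx x Y)$n" using kn[of "n + 1"] by simp
   have d: "cd (ev_cx x Y) (n-1): Arr (kmod K) (ev_cx x Y)$(n-1) (ev_cx x Y)$n" "cd (ev_cx x X) n: Arr (kmod K) (ev_cx x X)$n (ev_cx x X)$(n+1)"
    using km.ch_d[OF e(1)[OF Y], of "n - 1" "n - 1" n] km.ch_d[OF e(1)[OF X], of n n "n + 1"] by simp_all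
   let ?r = "g n x +[homm (kmod K) (ev_cx x X)$n (ev_cx x Y)$n] (cmp (kmod K) (ev_cx x X)$n (ev_cx x Y)$(n-1) (ev_cx x Y)$n (cd (ev_cx x Y) (n-1)) (k n x) +[homm (kmod K) (ev_cx x X)$n (ev_cx x Y)$n]
      cmp (kmod K) (ev_cx x X)$n (ev_cx x X)$(n+1) (ev_cx x Y)$n (k (n+1) x) (cd (ev_cx x X) n))"
   have "?r: Arr (kmod K) (ev_cx x X)$n (ev_cx x Y)$n"
    using km.ch_ob[OF e(1)[OF X]] km.ch_ob[OF e(1)[OF Y]] km.ch_in[OF e(2)[OF X Y g], of n n n] kn[of n] k1 d
    by (intro km.A_cl) simp_all
   hence r: "?r: lin K (om X$n x) (om Y$n x)" by (simp add: kmod_sel)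
   show "f n x = ?r"
    by (rule lin_ext[OF nt_lin[OF ct_in[OF f] x] r]) (use x in "simp add: eq[of n] kmod_sel compose_def")
  qed
 qed
 note c = cat_ide[OF CT_cat] cat_cmp[OF CT_cat]
 show "qis_fnc C X Y w" unfolding qis_fnc_def
 proof
  fix x assume x: "x: Ob C"
  note e = fnc_ob[OF evf_functor[OF x], simplified] fnc_arr[OF evf_functor[OF x], simplified] fnc_ide[OF evf_functor[OF x], simplified evf_sel] fnc_cmp[OF evf_functor[OF x], simplified evf_sel]
  show "qis_mod (ev_cx x X) (ev_cx x Y) (%n. w n x)"
   using htp_equiv_qis[OF e(1)[OF X] e(1)[OF Y] e(2)[OF X Y w] e(2)[OF Y X v]] ht[OF x h(1) Y Y c(1)[OF Y] c(2)[OF Y X Y v w]] ht[OF x h(2) X X c(1)[OF X] c(2)[OF X Y X w v]]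
   unfolding e(3)[OF X] e(3)[OF Y] e(4)[OF Y X Y v w] e(4)[OF X Y X w v] by blast
 qed
qed

subsection \<open>\<open>Hom(P, -)\<close> preserves quasi-isomorphisms\<close>

text \<open>A map from P to a good functor F is recovered from its values at the \<open>p i\<close>.
  The assignment S from families v_i in F(a i) to the sum of the elementary maps of v_i and xi i is
  additive and natural in F, and it is a left inverse of taking these values. So the problem is
  solved elementwise at each a i, by acyclicity of the cone there, and S reassembles the solutions.
  This is how projectivity of P enters.\<close>

lemma lift_dual_basis:
 assumes B: "dual_basis P N a p xi" and P: "good P" and o: "Y: Ob CT" "Z: Ob CT" and f: "f: Arr CT Y Z" and q: "qis_fnc C Y Z f"
  and w: "w: nt P Y$(m+1)" and w': "w': nt P Z$m"
  and dw: "cc P Y$(m+1) Y$(m+1+1) (cd Y (m+1)) w = 0[NM P Y$(m+1+1)]"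
  and fw: "cc P Y$(m+1) Z$(m+1) (f (m+1)) w = cc P Z$m Z$(m+1) (cd Z m) w'"
 shows "EX ze:nt P Y$m. EX ze':nt P Z$(m-1). cc P Y$m Y$(m+1) (cd Y m) ze = w \<and>
  w' = cc P Y$m Z$m (f m) ze +[NM P Z$m] cc P Z$(m-1) Z$m (cd Z (m-1)) ze'"
proof -
 note b = dual_basisD(1-3)[OF B]
 note g = ct_good[OF o(1)] ct_good[OF o(2)]
 define S where "S F v = finsum (NM P F) (%i. el P F (a i) (v i) (xi i)) {..<N}" for F :: "('k, 'o, 'm, 'u) mfnc" and v
 have en: "good F ==> i < N ==> y <: (om F (a i)) ==> el P F (a i) y (xi i): nt P F" for F i y using el_in[OF P _ b(1) _ b(3)] by blast
 have Sn: "good F ==> (!!i. i < N ==> v i <: (om F (a i))) ==> S F v: nt P F" for F v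
  unfolding S_def using mod_finsum_cl[OF nat_mod_PF[OF P], of F "{..<N}" "%i. el P F (a i) (v i) (xi i)"] en by simp
 have Sc: "S F v = S F v'" if F: "good F" and v: "!!i. i < N ==> v' i <: (om F (a i))" "!!i. i < N ==> v i = v' i" for F v v'
  unfolding S_def by (rule abelian_monoid.finsum_cong'[OF abelian_group.axioms(1)[OF mod_ag[OF nat_mod_PF[OF P F]]]]) (use v en[OF F] in auto)
 have Sp: "cc P F H et (S F v) = S H (%i. et (a i) (v i))" if F: "good F" and H: "good H" and e: "et: nt F H" and v: "!!i. i < N ==> v i <: (om F (a i))" for F H et v
 proof -
  have l: "(\<lambda>f\<in>nt P F. cc P F H et f): lin K (NM P F) (NM P H)" using kl_r[OF TM_klinear, of P F H et] P F H e by simp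
  have "cc P F H et (S F v) = finsum (NM P H) (%i. (\<lambda>f\<in>nt P F. cc P F H et f) (el P F (a i) (v i) (xi i))) {..<N}"
   using lin_finsum[OF nat_mod_PF[OF P F] nat_mod_PF[OF P H] l, of "{..<N}" "%i. el P F (a i) (v i) (xi i)"] en[OF F _ v] Sn[OF F v] by (simp add: S_def)
  also have "... = S H (%i. et (a i) (v i))" unfolding S_def
   by (rule abelian_monoid.finsum_cong'[OF abelian_group.axioms(1)[OF mod_ag[OF nat_mod_PF[OF P H]]]])
    (use en[OF F _ v] el_post[OF P F b(1) v b(3) H e] en[OF H] nt_cl[OF e b(1) v] in auto)
  finally show ?thesis .
 qed
 have Sa: "S F (%i. v i +[om F (a i)] v' i) = S F v +[NM P F] S F v'" if F: "good F" and v: "!!i. i < N ==> v i <: (om F (a i))" "!!i. i < N ==> v' i <: (om F (a i))" for F v v'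
 proof -
  interpret ab: abelian_group "NM P F" by (rule mod_ag[OF nat_mod_PF[OF P F]])
  have "S F (%i. v i +[om F (a i)] v' i) = finsum (NM P F) (%i. el P F (a i) (v i) (xi i) +[NM P F] el P F (a i) (v' i) (xi i)) {..<N}"
   unfolding S_def by (rule ab.finsum_cong') (use el_add[OF P F b(1) v(1) b(3) v(2)] ab.add.m_closed en[OF F _ v(1)] en[OF F _ v(2)] in auto)
  thus ?thesis unfolding S_def using en[OF F _ v(1)] en[OF F _ v(2)] by (subst ab.finsum_addf[symmetric]) auto
 qed
 have Se: "good F ==> fi: nt P F ==> S F (%i. fi (a i) (p i)) = fi" for F fi unfolding S_def using el_expand[OF P _ B, of F fi] by simp
 have "EX z z'. i < N \<longrightarrow> z <: (om Y$m (a i)) & z' <: (om Z$(m-1) (a i)) & cd Y m (a i) z = w (a i) (p i) \<and>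
   w' (a i) (p i) = f m (a i) z +[om Z$m (a i)] cd Z (m-1) (a i) z'" for i
 proof (cases "i < N")
  case True
  have "cd Y (m+1) (a i) (w (a i) (p i)) = 0[om Y$(m+1+1) (a i)]" "f (m+1) (a i) (w (a i) (p i)) = cd Z m (a i) (w' (a i) (p i))"
   using fun_cong[OF fun_cong[OF dw], of "a i" "p i"] fun_cong[OF fun_cong[OF fw], of "a i" "p i"] b[OF True] by simp_all
  thus ?thesis using qis_cone[OF o f q b(1)[OF True]] nt_cl[OF w b(1,2)[OF True]] nt_cl[OF w' b(1,2)[OF True]] unfolding cone_acyclic_def evf_sel by blast
 qed auto
 then obtain z z' where z: "!!i. i < N ==> z i <: (om Y$m (a i))" "!!i. i < N ==> z' i <: (om Z$(m-1) (a i))"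
  "!!i. i < N ==> cd Y m (a i) (z i) = w (a i) (p i)" "!!i. i < N ==> w' (a i) (p i) = f m (a i) (z i) +[om Z$m (a i)] cd Z (m-1) (a i) (z' i)"
  by metis
 have dZ: "cd Z (m-1): nt Z$(m-1) Z$m" by (rule ct_d[OF o(2)]) simp
 have "cc P Y$m Y$(m+1) (cd Y m) (S Y$m z) = w"
  unfolding Sp[of "Y$m" "Y$(m+1)" "cd Y m" z, OF g(1) g(1) ct_d[OF o(1) refl] z(1), simplified] using Sc[OF g(1) nt_cl[OF w b(1,2)] z(3)] Se[OF g(1) w] by simp
 moreover have "w' = cc P Y$m Z$m (f m) (S Y$m z) +[NM P Z$m] cc P Z$(m-1) Z$m (cd Z (m-1)) (S Z$(m-1) z')"
  unfolding Sp[of "Y$m" "Z$m" "f m" z, OF g(1) g(2) ct_in[OF f] z(1), simplified] Sp[of "Z$(m-1)" "Z$m" "cd Z (m-1)" z', OF g(2) g(2) dZ z(2), simplified]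
   Sa[of "Z$m" "%i. f m (a i) (z i)" "%i. cd Z (m-1) (a i) (z' i)", OF g(2) nt_cl[OF ct_in[OF f] b(1) z(1)] nt_cl[OF dZ b(1) z(2)], simplified, symmetric]
  using Sc[OF g(2) nt_cl[OF w' b(1,2)] z(4)[symmetric]] Se[OF g(2) w'] by simp
 ultimately show ?thesis using Sn[OF g(1) z(1)] Sn[OF g(2) z(2)] by blast
qed

text \<open>P is bounded, which allows an induction on a bound M from which on all components of r
  and r' vanish. In the highest remaining degree the term of the differential coming from the next
  component of the family vanishes, so \<open>lift_dual_basis\<close> solves the problem in that
  degree alone; subtracting the solution, as a family concentrated there, lowers the bound. The
  induction is entered at M = N + 1.\<close>

lemma hom_cone:
 assumes P: "sp P" and Y: "Y: Ob CT" and Z: "Z: Ob CT" and f: "f: Arr CT Y Z" and q: "qis_fnc C Y Z f"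
 shows "cone_acyclic (HC P Y) (HC P Z) (mm (hom_cx_fnc TM P) Y Z f)"
proof -
 note o = sp_ob[OF P]
 let ?F = "mm (hom_cx_fnc TM P) Y Z f" and ?d = "cd (HC P Y)" and ?e = "cd (HC P Z)"
 note hY = HC_ob[OF o Y] and hZ = HC_ob[OF o Z] and hF = tm.hom_fnc_arr[OF o Y Z f]
 note MY = ck_mod[OF hY] and MZ = ck_mod[OF hZ]
 note d = ck_dcl[OF hY] ck_dcl[OF hZ]
 obtain N where N: "0 \<le> N" "!!n. \<bar>n\<bar> > N ==> zero_ob TM P$n" using sp_bounded[OF P] by blast
 have gz: "good P$n" "good Y$n" "good Z$n" for n using ct_good o Y Z by blast+
 have zero: "fi = 0[NM P$i G]" if "\<bar>i\<bar> > N" "good G" "fi: nt P$i G" for i fi and G :: "('k, 'o, 'm, 'u) mfnc"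
  using tm.zero_arr[OF o Y N(2)[OF that(1)], of G fi] that by simp
 have main: "EX z:carrier (hm P Y n). EX z':carrier (hm P Z (n-1)). ?d n z = r & r' = ?F n z +[hm P Z n] ?e (n-1) z'"
  if "M \<ge> - N" and "r <: (hm P Y (n+1))" "r' <: (hm P Z n)" "?d (n+1) r = 0[hm P Y (n+1+1)]" "?F (n+1) r = ?e n r'"
   "\<forall>i\<ge>M. r i = 0[NM P$i Y$(i + (n+1))]" "\<forall>i\<ge>M. r' i = 0[NM P$i Z$(i + n)]" for M n r r'
  using that
 proof (induction M arbitrary: r r' rule: int_ge_induct)
  \<comment> \<open>Below -N the components start at zero objects, and from -N on they vanish by
    assumption, so nothing is left.\<close>
  case base
  have "r i = 0[NM P$i Y$(i + (n+1))]" for i using base(5) zero[of i "Y$(i + (n+1))" "r i"] base(1) gz by (cases "i \<ge> - N") auto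
  moreover have "r' i = 0[NM P$i Z$(i + n)]" for i using base(6) zero[of i "Z$(i + n)" "r' i"] base(2) gz by (cases "i \<ge> - N") auto
  ultimately have "r = 0[hm P Y (n+1)]" "r' = 0[hm P Z n]" by auto
  thus ?case using lin_0[OF MY MY ck_d[OF hY, of n]] lin_0[OF MY MZ ck_lin[OF hF, of n]] lin_0[OF MZ MZ ck_d[OF hZ, of "n - 1"]]
    mod_zero[OF MY, of n] mod_zero[OF MZ, of "n - 1"] mod_0l[OF MZ mod_zero[OF MZ, of n]]
   by (intro bexI[of _ "0[hm P Y n]"] bexI[of _ "0[hm P Z (n-1)]"]) (simp_all del: tm.hom_mod_sel tm.hom_cx_sel(2) tm.hom_fnc_sel(2))
 next
  case (step M)
  let ?P = "P$M" and ?m = "M + n"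
  have ix: "M + (n+1) = ?m + 1" "M + (n+1+1) = ?m+1 + 1" "M+1 + (n+1) = ?m+1 + 1" "M+1 + n = ?m + 1" "M + (n-1) = ?m - 1" by simp_all
  obtain Nb a p xi where B: "dual_basis ?P Nb a p xi" using sp_basis[OF P] by blast
  have w: "r M: nt ?P Y$(?m+1)" "r' M: nt ?P Z$?m" using step.prems(1,2) spec[of _ M] by (auto simp: ix(1)[symmetric])
  have dP: "cd P M: nt ?P P$(M+1)" by (rule ct_d[OF o refl])
  have r1: "r (M+1) = 0[NM P$(M+1) Y$(?m+1+1)]" "r' (M+1) = 0[NM P$(M+1) Z$(?m+1)]"
   using step.prems(5,6) ix by (metis order_refl)+
  have z0: "good F ==> good G ==> signed (NM F G) n 0[NM F G] = 0[NM F G]" for n and F G :: "('k, 'o, 'm, 'u) mfnc"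
   using mod_n0[OF nat_mod_PF] by (simp add: signed_def)
  \<comment> \<open>At the top index M the component at M + 1 is zero, and only composition with the
    differential of the target remains.\<close>
  have dh: "X: Ob CT ==> s <: (hm P X k) ==> s (M+1) = 0[NM P$(M+1) X$(M + k+1)] ==>
    cd (HC P X) k s M = cc ?P X$(M + k) X$(M + k+1) (cd X (M + k)) (s M)" for X s k
  proof -
   assume X: "X: Ob CT" and s: "s <: (hm P X k)" and s1: "s (M+1) = 0[NM P$(M+1) X$(M + k+1)]"
   have e: "M + (k+1) = M + k + 1" by simp
   have c: "cc ?P X$(M + k) X$(M + k+1) (cd X (M + k)) (s M): nt ?P X$(M + k+1)" using cc_nt[OF good_isf[OF gz(1)] _ ct_d[OF X refl]] s by simp
   show "cd (HC P X) k s M = cc ?P X$(M + k) X$(M + k+1) (cd X (M + k)) (s M)"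
    unfolding tm.hom_cx_sel(2)[OF s] tm.dh_def e s1 using tm.A_bil(8)[of ?P "P$(M+1)" "X$(M + k+1)" "cd P M"] gz(1) ct_good[OF X] dP z0[OF gz(1) ct_good[OF X]]
     mod_n0[OF nat_mod_PF[OF gz(1) ct_good[OF X]]] mod_0r[OF nat_mod_PF[OF gz(1) ct_good[OF X]]] c by (simp add: mod_minus)
  qed
  have "cc ?P Y$(?m+1) Y$(?m+1+1) (cd Y (?m+1)) (r M) = 0[NM ?P Y$(?m+1+1)]"
   using dh[OF Y step.prems(1)] r1(1) fun_cong[OF step.prems(3), of M] by (simp add: ix add.left_commute[of M 2 n])
  moreover have "cc ?P Y$(?m+1) Z$(?m+1) (f (?m+1)) (r M) = cc ?P Z$?m Z$(?m+1) (cd Z ?m) (r' M)"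
   using dh[OF Z step.prems(2)] r1(2) fun_cong[OF step.prems(4), of M] tm.hom_fnc_sel(2)[OF step.prems(1), of Z f] by (simp add: ix)
  ultimately obtain ze ze' where zn: "ze: nt ?P Y$?m" "ze': nt ?P Z$(?m-1)" and ze: "cc ?P Y$?m Y$(?m+1) (cd Y ?m) ze = r M"
   "r' M = cc ?P Y$?m Z$?m (f ?m) ze +[NM ?P Z$?m] cc ?P Z$(?m-1) Z$?m (cd Z (?m-1)) ze'"
   using lift_dual_basis[OF B gz(1) Y Z f q w] by blast
  \<comment> \<open>The solution in degree M as families with a single component; \<open>?s\<close>
    and \<open>?s'\<close> below are what remains of r and r' once it is subtracted.\<close>
  let ?i = "tm.io P Y n M ze" and ?i' = "tm.io P Z (n-1) M ze'"
  have i: "?i <: (hm P Y n)" "?i' <: (hm P Z (n-1))"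
   by (rule tm.io_in[OF o Y, of ze M ?m n], simp_all only: zn TM_sel, rule tm.io_in[OF o Z, of ze' M "?m - 1" "n - 1"], simp_all only: zn TM_sel ix(5))
  have dd: "?d n ?i <: (hm P Y (n+1))" "?e (n-1) ?i' <: (hm P Z n)" "?F n ?i <: (hm P Z n)"
   using d(1)[of ?i n] d(2)[of ?i' "n - 1"] ck_cl[OF hF, of ?i n] i by (simp_all del: tm.hom_mod_sel tm.hom_cx_sel(2) tm.hom_fnc_sel(2))
  let ?s = "r +[hm P Y (n+1)] -[hm P Y (n+1)] ?d n ?i" and ?t = "?F n ?i +[hm P Z n] ?e (n-1) ?i'"
  let ?s' = "r' +[hm P Z n] -[hm P Z n] ?t"
  note MY' = MY[unfolded tm.hom_cx_sel(1)] and MZ' = MZ[unfolded tm.hom_cx_sel(1)]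
  have t: "?t <: (hm P Z n)" by (rule mod_add[OF MZ' dd(3,2)])
  have "EX z:carrier (hm P Y n). EX z':carrier (hm P Z (n-1)). ?d n z = ?s & ?s' = ?F n z +[hm P Z n] ?e (n-1) z'"
  proof (rule step.IH)
   note nn = mod_neg[OF MY' dd(1)] mod_neg[OF MZ' t]
   show "?s <: (hm P Y (n+1))" "?s' <: (hm P Z n)" using mod_add[OF MY' step.prems(1) nn(1)] mod_add[OF MZ' step.prems(2) nn(2)] .
   show "?d (n+1) ?s = 0[hm P Y (n+1+1)]"
    using lin_add[OF ck_d[OF hY], unfolded tm.hom_cx_sel(1), OF step.prems(1) nn(1)] lin_neg[OF MY MY ck_d[OF hY], unfolded tm.hom_cx_sel(1), OF dd(1)]
     ck_dd[OF hY, unfolded tm.hom_cx_sel(1), OF i(1)] step.prems(3) mod_n0[OF MY', of "n+1 + 1"] mod_0l[OF MY' mod_zero[OF MY', of "n+1 + 1"]] by metis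
   have "?F (n+1) ?s = ?F (n+1) r +[hm P Z (n+1)] -[hm P Z (n+1)] ?F (n+1) (?d n ?i)"
    using lin_add[OF ck_lin[OF hF], unfolded tm.hom_cx_sel(1), OF step.prems(1) nn(1)] lin_neg[OF MY MZ ck_lin[OF hF], unfolded tm.hom_cx_sel(1), OF dd(1)] by metis
   moreover have "?e n ?s' = ?e n r' +[hm P Z (n+1)] -[hm P Z (n+1)] ?e n ?t"
    using lin_add[OF ck_d[OF hZ], unfolded tm.hom_cx_sel(1), OF step.prems(2) nn(2)] lin_neg[OF MZ MZ ck_d[OF hZ], unfolded tm.hom_cx_sel(1), OF t] by metis
   moreover have "?e n ?t = ?F (n+1) (?d n ?i)"
    using lin_add[OF ck_d[OF hZ], unfolded tm.hom_cx_sel(1), OF dd(3,2)] ck_dd[OF hZ, unfolded tm.hom_cx_sel(1), OF i(2)] ck_comm[OF hF, unfolded tm.hom_cx_sel(1), OF i(1)]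
     mod_0r[OF MZ', of "?F (n+1) (?d n ?i)" "n + 1"] ck_cl[OF hF, unfolded tm.hom_cx_sel(1), OF dd(1)] by (simp del: tm.hom_mod_sel tm.hom_cx_sel(2) tm.hom_fnc_sel(2))
   ultimately show "?F (n+1) ?s = ?e n ?s'" using step.prems(4) by simp
   have ii: "i > M ==> ?d n ?i i = 0[NM P$i Y$(i + (n+1))]" "i > M ==> ?e (n-1) ?i' i = 0[NM P$i Z$(i + n)]"
    "i > M ==> ?F n ?i i = 0[NM P$i Z$(i + n)]" for i
   proof -
    assume iM: "i > M"
    have x0: "cd (HC P X) k (tm.io P X k M s) i = 0[NM P$i X$(i + (k+1))]" if X: "X: Ob CT" and s: "tm.io P X k M s <: (hm P X k)" for X k s
     unfolding tm.hom_cx_sel(2)[OF s] tm.dh_def using iM gz(1) ct_good[OF X] ct_d[OF o refl, of i] ct_d[OF X, of "i + (k+1)" "i + k"]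
      tm.A_bil(7)[of "P$i" "X$(i + k)" "X$(i + (k+1))" "cd X (i + k)"] tm.A_bil(8)[of "P$i" "P$(i+1)" "X$(i + (k+1))" "cd P i"] z0[OF gz(1) ct_good[OF X]]
      mod_n0[OF nat_mod_PF[OF gz(1) ct_good[OF X]]] mod_0r[OF nat_mod_PF[OF gz(1) ct_good[OF X]] mod_zero[OF nat_mod_PF[OF gz(1) ct_good[OF X]]]]
     by (simp add: tm.io_def mod_minus add.assoc[of i 1 k] add.commute[of 1 k])
    show "?d n ?i i = 0[NM P$i Y$(i + (n+1))]" by (rule x0[OF Y i(1)])
    show "?e (n-1) ?i' i = 0[NM P$i Z$(i + n)]" using x0[OF Z i(2)] by simp
    show "?F n ?i i = 0[NM P$i Z$(i + n)]" unfolding tm.hom_fnc_sel(2)[OF i(1)]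
     using iM tm.A_bil(7)[of "P$i" "Y$(i + n)" "Z$(i + n)" "f (i + n)"] gz ct_in[OF f] by (simp add: tm.io_def)
   qed
   have fi: "?F n ?i M = cc ?P Y$?m Z$?m (f ?m) ze" unfolding tm.hom_fnc_sel(2)[OF i(1)] by (simp add: tm.io_def)
   have iM: "?d n ?i M = r M" "?e (n-1) ?i' M = cc ?P Z$(?m-1) Z$?m (cd Z (?m-1)) ze'" "?F n ?i M = cc ?P Y$?m Z$?m (f ?m) ze"
    using dh[OF Y i(1)] dh[OF Z i(2)] ze(1) fi by (simp_all add: tm.io_def ix)
   show "\<forall>i\<ge>M. ?s i = 0[NM P$i Y$(i + (n+1))]"
   proof (intro allI impI)
    fix i assume "i \<ge> M"
    have neg: "(-[hm P Y (n+1)] ?d n ?i) i = -[NM P$i Y$(i + (n+1))] ?d n ?i i" using tm.hom_mod_neg[OF o Y dd(1)] by simp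
    show "?s i = 0[NM P$i Y$(i + (n+1))]"
    proof (cases "i = M")
     case True
     have "r M: nt ?P Y$(M + (n+1))" unfolding ix(1) by (rule w(1))
     thus ?thesis using neg iM(1) mod_nr[OF nat_mod_PF[OF gz(1,2)]] unfolding True by simp
    next
     case False
     hence "i > M" using \<open>i \<ge> M\<close> by simp
     thus ?thesis using neg ii(1) step.prems(5) mod_n0[OF nat_mod_PF[OF gz(1,2)]] mod_0r[OF nat_mod_PF[OF gz(1,2)] mod_zero[OF nat_mod_PF[OF gz(1,2)]]]
      by (simp del: tm.hom_cx_sel(2))
    qed
   qed
   show "\<forall>i\<ge>M. ?s' i = 0[NM P$i Z$(i + n)]"
   proof (intro allI impI)
    fix i assume "i \<ge> M"
    have neg: "(-[hm P Z n] ?t) i = -[NM P$i Z$(i + n)] ?t i" using tm.hom_mod_neg[OF o Z t] by simp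
    show "?s' i = 0[NM P$i Z$(i + n)]"
    proof (cases "i = M")
     case True
     thus ?thesis using neg iM(2,3) ze(2) w(2) mod_nr[OF nat_mod_PF[OF gz(1,3)]] unfolding True by (simp del: tm.hom_cx_sel(2) tm.hom_fnc_sel(2))
    next
     case False
     hence "i > M" using \<open>i \<ge> M\<close> by simp
     thus ?thesis using neg ii(2,3) step.prems(6) mod_n0[OF nat_mod_PF[OF gz(1,3)]] mod_0r[OF nat_mod_PF[OF gz(1,3)] mod_zero[OF nat_mod_PF[OF gz(1,3)]]]
      by (simp del: tm.hom_cx_sel(2) tm.hom_fnc_sel(2))
    qed
   qed
  qed
  then obtain z z' where z: "z <: (hm P Y n)" "z' <: (hm P Z (n-1))" "?d n z = ?s" "?s' = ?F n z +[hm P Z n] ?e (n-1) z'" by blast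
  show ?case
  proof (intro bexI conjI)
   show "z +[hm P Y n] ?i <: (hm P Y n)" "z' +[hm P Z (n-1)] ?i' <: (hm P Z (n-1))"
    using mod_add[OF MY' z(1) i(1)] mod_add[OF MZ' z(2) i(2)] .
   show "?d n (z +[hm P Y n] ?i) = r"
    using lin_add[OF ck_d[OF hY], unfolded tm.hom_cx_sel(1), OF z(1) i(1)] z(3) mod_assoc[OF MY' step.prems(1) mod_neg[OF MY' dd(1)] dd(1)]
     mod_nl[OF MY' dd(1)] mod_0r[OF MY' step.prems(1)] by metis
   have k: "?F n z <: (hm P Z n)" "?e (n-1) z' <: (hm P Z n)"
    using ck_cl[OF hF, unfolded tm.hom_cx_sel(1), OF z(1)] d(2)[unfolded tm.hom_cx_sel(1), OF z(2)] by (simp_all del: tm.hom_mod_sel tm.hom_cx_sel(2) tm.hom_fnc_sel(2))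
   have "?F n (z +[hm P Y n] ?i) +[hm P Z n] ?e (n-1) (z' +[hm P Z (n-1)] ?i') = (?F n z +[hm P Z n] ?F n ?i) +[hm P Z n] (?e (n-1) z' +[hm P Z n] ?e (n-1) ?i')"
    using lin_add[OF ck_lin[OF hF], unfolded tm.hom_cx_sel(1), OF z(1) i(1)] lin_add[OF ck_d[OF hZ], unfolded tm.hom_cx_sel(1), OF z(2) i(2)]
    by (simp del: tm.hom_mod_sel tm.hom_cx_sel(2) tm.hom_fnc_sel(2))
   also have "... = ?s' +[hm P Z n] ?t" unfolding z(4) using md_ac[OF MZ'] k dd mod_add[OF MZ'] by (simp del: tm.hom_mod_sel tm.hom_cx_sel(2) tm.hom_fnc_sel(2))
   also have "... = r'" using mod_assoc[OF MZ' step.prems(2) mod_neg[OF MZ' t] t] mod_nl[OF MZ' t] mod_0r[OF MZ' step.prems(2)] by metis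
   finally show "r' = ?F n (z +[hm P Y n] ?i) +[hm P Z n] ?e (n-1) (z' +[hm P Z (n-1)] ?i')" ..
  qed
 qed
 show ?thesis unfolding cone_acyclic_def tm.hom_cx_sel(1)
 proof (intro allI ballI impI, elim conjE)
  fix n y y' assume y: "y <: (hm P Y (n+1))" "y' <: (hm P Z n)" "?d (n+1) y = 0[hm P Y (n+1+1)]" "?F (n+1) y = ?e n y'"
  show "EX z:carrier (hm P Y n). EX z':carrier (hm P Z (n-1)). ?d n z = y & y' = ?F n z +[hm P Z n] ?e (n-1) z'"
   by (rule main[OF _ y, of "N + 1"]) (use N(1) y(1,2) gz in "auto intro!: zero")
 qed
qed

end

section \<open>Chain maps and homotopies as cocycles and boundaries of the Hom complex\<close>

lemma (in kl) chain_hom: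
 assumes X: "X: Ob (Ch A)" and Y: "Y: Ob (Ch A)"
 shows "f: Arr (Ch A) X Y \<longleftrightarrow> f <: (hom_mod A X Y 0) & dh X Y 0 f = 0[hom_mod A X Y 1]"
proof -
 have z: "a +[M] -[M] b = 0[M] \<longleftrightarrow> a = b" if "module K M" "a <: M" "b <: M" for a b and M :: "('k, 'm) module"
  using mod_move[OF that(1,2) mod_neg[OF that(1,3)] mod_zero[OF that(1)]] mod_nn[OF that(1,3)] mod_0l[OF that(1,3)] by simp
 have e: "dh X Y 0 f i = 0[homm A X$i Y$(i+1)] \<longleftrightarrow> cmp A X$i Y$i Y$(i+1) (cd Y i) (f i) = cmp A X$i X$(i+1) Y$(i+1) (f (i+1)) (cd X i)"
  if "!!i. f i: Arr A X$i Y$i" for i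
  using z[of "homm A X$i Y$(i+1)"] that ch_ob[OF X] ch_ob[OF Y] ch_d[OF Y, of i i "i + 1"] ch_d[OF X, of i i "i + 1"] by (simp add: dh_def signed_def mod_minus)
 show ?thesis
 proof
  assume f: "f: Arr (Ch A) X Y"
  thus "f <: (hom_mod A X Y 0) & dh X Y 0 f = 0[hom_mod A X Y 1]"
   using ch_in[OF f] ch_comm[OF f] by (auto simp: e)
 next
  assume f: "f <: (hom_mod A X Y 0) & dh X Y 0 f = 0[hom_mod A X Y 1]"
  hence i: "f i: Arr A X$i Y$i" for i by simp
  show "f: Arr (Ch A) X Y" by (rule Ch_arrI[OF i]) (use f e[OF i] in "simp add: fun_eq_iff")
 qed
qed

lemma (in kl) htp_hom:
 assumes X: "X: Ob (Ch A)" and Y: "Y: Ob (Ch A)"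
 shows "htp X Y f g \<longleftrightarrow> (EX k:carrier (hom_mod A X Y (- 1)). f = g +[hom_mod A X Y 0] dh X Y (- 1) k)"
proof -
 have e: "dh X Y (- 1) k i = cmp A X$i Y$(i-1) Y$i (cd Y (i-1)) (k i) +[homm A X$i Y$i] cmp A X$i X$(i+1) Y$i (k (i+1)) (cd X i)"
  if "!!i. k i: Arr A X$i Y$(i-1)" for k i
  using that[of "i + 1"] ch_ob[OF X] ch_ob[OF Y] ch_d[OF X, of i i "i + 1"] mod_nn[OF A_mod(1)[of "X$i" "Y$i"]] by (simp add: dh_def signed_def mod_minus)
 show ?thesis unfolding htp_def by (auto simp: e fun_eq_iff) (metis e)+
qed

context yon
begin

subsection \<open>Arrows out of strictly perfect complexes\<close>

lemma hom_sends: "sp P ==> sends CT (qis_fnc C) qis_mod (hom_cx_fnc TM P)"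
 unfolding sends_def using qis_iff[OF HC_ob HC_ob tm.hom_fnc_arr] hom_cone sp_ob by simp

lemma LT_in[simp]: "X: Ob CT ==> Y: Ob CT ==> f: Arr CT X Y ==> LT X Y f: Arr DT X Y" by (rule loc_arr_in)
lemma LI_in[simp]: "X: Ob CT ==> Y: Ob CT ==> f: Arr CT X Y ==> qis_fnc C X Y f ==> LI X Y f: Arr DT Y X" by (rule loc_inv_in)

lemmas DT_cat = loc_category[OF CT_cat, of "qis_fnc C"]

lemma DT_cl[simp]: "X: Ob CT ==> Y: Ob CT ==> Z: Ob CT ==> f: Arr DT X Y ==> g: Arr DT Y Z ==> cmp DT X Y Z g f: Arr DT X Z"
 using cat_cmp[OF DT_cat] by simp

lemma DT_eq[simp]: "X: Ob CT ==> Y: Ob CT ==> f: Arr DT X Y ==> cmp DT X X Y f (ide DT X) = f"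
 "X: Ob CT ==> Y: Ob CT ==> f: Arr DT X Y ==> cmp DT X Y Y (ide DT Y) f = f"
 "X: Ob CT ==> Y: Ob CT ==> Z: Ob CT ==> V: Ob CT ==> f: Arr DT X Y ==> g: Arr DT Y Z ==> h: Arr DT Z V ==>
  cmp DT X Y V (cmp DT Y Z V h g) f = cmp DT X Z V h (cmp DT X Y Z g f)"
 using cat_idr[OF DT_cat] cat_idl[OF DT_cat] cat_assoc[OF DT_cat] by simp_all

lemma LT_cmp: "X: Ob CT ==> Y: Ob CT ==> Z: Ob CT ==> f: Arr CT X Y ==> g: Arr CT Y Z ==>
  LT X Z (cmp CT X Y Z g f) = cmp DT X Y Z (LT Y Z g) (LT X Y f)"
 using loc_arr_cmp[OF CT_cat] by metis

lemma LI_eq[simp]: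
 assumes "X: Ob CT" "Y: Ob CT" "w: Arr CT X Y" "qis_fnc C X Y w"
 shows "cmp DT X Y X (LI X Y w) (LT X Y w) = ide DT X" "cmp DT Y X Y (LT X Y w) (LI X Y w) = ide DT Y"
  "V: Ob CT ==> f: Arr DT V X ==> cmp DT V Y X (LI X Y w) (cmp DT V X Y (LT X Y w) f) = f"
  "V: Ob CT ==> f: Arr DT V Y ==> cmp DT V X Y (LT X Y w) (cmp DT V Y X (LI X Y w) f) = f"
proof -
 show 1: "cmp DT X Y X (LI X Y w) (LT X Y w) = ide DT X" and 2: "cmp DT Y X Y (LT X Y w) (LI X Y w) = ide DT Y"
  using loc_inv1[where W = "qis_fnc C", OF CT_cat assms] loc_inv2[where W = "qis_fnc C", OF CT_cat assms] .
 show "V: Ob CT ==> f: Arr DT V X ==> cmp DT V Y X (LI X Y w) (cmp DT V X Y (LT X Y w) f) = f"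
  using DT_eq(3)[of V X Y X f "LT X Y w" "LI X Y w", symmetric] assms 1 by simp
 show "V: Ob CT ==> f: Arr DT V Y ==> cmp DT V X Y (LT X Y w) (cmp DT V Y X (LI X Y w) f) = f"
  using DT_eq(3)[of V Y X Y f "LI X Y w" "LT X Y w", symmetric] assms 2 by simp
qed

lemma ct_cmp: "X: Ob CT ==> Y: Ob CT ==> Z: Ob CT ==> f: Arr CT X Y ==> g: Arr CT Y Z ==> cmp CT X Y Z g f: Arr CT X Z"
 by (rule cat_cmp[OF CT_cat])

text \<open>This is surjectivity of Hom(P, w) on cohomology in degree 0. It takes the place of the
  calculus of fractions for arrows out of P.\<close>

lemma lift_htp:
 assumes P: "sp P" and Z: "Z: Ob CT" and Y: "Y: Ob CT" and w: "w: Arr CT Z Y" "qis_fnc C Z Y w" and f: "f: Arr CT P Y"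
 shows "EX g:Arr CT P Z. tm.htp P Y f (cmp CT P Z Y w g)"
proof -
 note o = sp_ob[OF P]
 note h = HC_ob[OF o Z] HC_ob[OF o Y] and F = tm.hom_fnc_arr[OF o Z Y w(1)]
 note f' = f[unfolded tm.chain_hom[OF o Y]]
 \<comment> \<open>The instance of acyclicity with y = 0 in degree 1 and y' = f: the resulting z is
   the lift and z' the homotopy.\<close>
 have "EX z:carrier (HC P Z)$0. EX z':carrier (HC P Y)$(0-1). cd (HC P Z) 0 z = 0[(HC P Z)$(0+1)] & f = mm (hom_cx_fnc TM P) Z Y w 0 z +[(HC P Y)$0] cd (HC P Y) (0-1) z'"
  by (rule hom_cone[OF P Z Y w, unfolded cone_acyclic_def, rule_format, of "0[(HC P Z)$(0+1)]" 0 f])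
   (use mod_zero[OF ck_mod[OF h(1)], of "0 + 1"] f' lin_0[OF ck_mod[OF h(1)] ck_mod[OF h(1)] ck_d[OF h(1)], of "0 + 1"] lin_0[OF ck_mod[OF h(1)] ck_mod[OF h(2)] ck_lin[OF F], of "0 + 1"] tm.hom_cx_sel(2)[of f P Y 0]
    in "simp_all del: tm.hom_mod_sel tm.hom_cx_sel(2) tm.hom_fnc_sel(2)")
 then obtain g k where g: "g <: (hm P Z 0)" "tm.dh P Z 0 g = 0[hm P Z 1]" and k: "k <: (hm P Y (- 1))" "f = mm (hom_cx_fnc TM P) Z Y w 0 g +[hm P Y 0] tm.dh P Y (- 1) k"
  by (auto simp del: tm.hom_mod_sel tm.hom_fnc_sel(2))
 have "g: Arr CT P Z" using g tm.chain_hom[OF o Z] by blast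
 moreover have "mm (hom_cx_fnc TM P) Z Y w 0 g = cmp CT P Z Y w g" using tm.hom_fnc_sel(2)[OF g(1), of Y w] by simp
 ultimately show ?thesis using k tm.htp_hom[OF o Y] by metis
qed

text \<open>The cohomology of Hom(P, -) is a functor on the derived category, so two chain maps with
  the same image there act alike on it. Applied to the class of the identity of P in degree 0, they
  yield their own classes, and equality of these is homotopy.\<close>

lemma LT_htp_iff:
 assumes P: "sp P" and Y: "Y: Ob CT" and f: "f: Arr CT P Y" and g: "g: Arr CT P Y"
 shows "LT P Y f = LT P Y g \<longleftrightarrow> tm.htp P Y f g"
proof
 note o = sp_ob[OF P]
 note h = HC_ob[OF o o] HC_ob[OF o Y]
 let ?H = "mm (hom_cx_fnc TM P) P Y"
 let ?i = "ide CT P"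
 assume e: "LT P Y f = LT P Y g"
 have i: "?i: Arr CT P P" by (rule cat_ide[OF CT_cat o])
 note i' = i[unfolded tm.chain_hom[OF o o]]
 have ci: "?i <: (HC P P)$0" using i' by simp
 have "coh_class (HC P P) 0 ?i: cohomology (HC P P) 0" using i' unfolding cohomology_def by simp
 hence "coh_map (HC P Y) (?H f) 0 (coh_class (HC P P) 0 ?i) = coh_map (HC P Y) (?H g) 0 (coh_class (HC P P) 0 ?i)"
  using loc_arr_act[OF set_fnc_pull[OF tm.hom_fnc_functor[OF o] hom_sends[OF P] coh_set_fnc] e o Y f g, of "coh_class (HC P P) 0 ?i" 0] by simp
 moreover have H: "?H f 0 ?i = f" if f: "f: Arr CT P Y" for f
 proof -
  have "?H f 0 ?i = cmp CT P P Y f ?i" unfolding tm.hom_fnc_sel(2)[OF conjunct1[OF i']] by simp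
  thus ?thesis using cat_idr[OF CT_cat o Y f] by simp
 qed
 have F: "?H f: Arr CK (HC P P) (HC P Y)" if "f: Arr CT P Y" for f by (rule tm.hom_fnc_arr[OF o o Y that])
 ultimately have "coh_class (HC P Y) 0 f = coh_class (HC P Y) 0 g"
  using coh_map_class[OF h F[OF f] ci] coh_map_class[OF h F[OF g] ci] H[OF f] H[OF g] by simp
 thus "tm.htp P Y f g" using coh_class_eq[OF h(2), of f 0 g] f g tm.chain_hom[OF o Y] tm.htp_hom[OF o Y] by auto
qed (rule LT_htp[OF sp_ob[OF P] Y f g])

text \<open>Induction along the zigzag. A step along a chain map is composition; a step against a
  quasi-isomorphism w is removed by lifting through w with \<open>lift_htp\<close>, the homotopy
  being invisible in the localization.\<close>

lemma LT_surj:
 assumes P: "sp P" and fi: "fi: Arr DT P Y" and Y: "Y: Ob CT"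
 shows "EX f:Arr CT P Y. fi = LT P Y f"
 using CT_cat fi sp_ob[OF P]
proof (rule loc_induct[where P = "%Y fi. EX f:Arr CT P Y. fi = LT P Y f"])
 note o[simp] = sp_ob[OF P]
 show "EX f:Arr CT P P. ide DT P = LT P P f" using loc_arr_ide[OF CT_cat o] cat_ide[OF CT_cat o] by metis
 fix Y Z fi assume Y: "Y: Ob CT" and Z: "Z: Ob CT" and f: "EX f:Arr CT P Y. fi = LT P Y f"
 then obtain f where f: "f: Arr CT P Y" "fi = LT P Y f" by blast
 show "EX h:Arr CT P Z. cmp DT P Y Z (LT Y Z g) fi = LT P Z h" if g: "g: Arr CT Y Z" for g
  using LT_cmp[OF o Y Z f(1) g] ct_cmp[OF o Y Z f(1) g] f(2) by metis
 show "EX h:Arr CT P Z. cmp DT P Y Z (LI Z Y w) fi = LT P Z h" if w: "w: Arr CT Z Y" "qis_fnc C Z Y w" for w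
 proof -
  obtain g where g: "g: Arr CT P Z" "tm.htp P Y f (cmp CT P Z Y w g)" using lift_htp[OF P Z Y w f(1)] by blast
  have "fi = cmp DT P Z Y (LT Z Y w) (LT P Z g)" using LT_htp[OF o Y f(1) ct_cmp[OF o Z Y g(1) w(1)] g(2)] LT_cmp[OF o Z Y g(1) w(1)] f(2) by simp
  thus ?thesis using g(1) w Y Z by auto
 qed
qed

subsection \<open>Perfect complexes\<close>

abbreviation "DP == Dperf K C T"
abbreviation "rP == res_ob K C T"
abbreviation "rq == res_qis K C T"

lemma DP_sel[simp]: "Arr DP = Arr DT" "ide DP = ide DT" "cmp DP = cmp DT" "homm DP = homm (Dtmod K C T)"
 "Arr (Dtmod K C T) = Arr DT" "ide (Dtmod K C T) = ide DT" "cmp (Dtmod K C T) = cmp DT" "Ob (Dtmod K C T) = Ob CT"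
 by (simp_all add: Dperf_def Dtmod_def)

lemma DP_ob: "X: Ob DP ==> X: Ob CT" by (simp add: Dperf_def Dtmod_def)

text \<open>Perfection only provides an isomorphism of the derived category from a strictly perfect
  P. By \<open>LT_surj\<close> it comes from a chain map, which is a quasi-isomorphism by
  \<open>iso_qis\<close>; hence the choice in \<open>res_ob\<close> and \<open>res_qis\<close> is
  from a nonempty set.\<close>

lemma res:
 assumes X: "X: Ob DP"
 shows rP: "sp (rP X)" and rq: "rq X: Arr CT (rP X) X" and rq_qis: "qis_fnc C (rP X) X (rq X)"
proof -
 obtain P f where P: "sp P" and f: "is_iso DT P X f" using X unfolding Dperf_def perfect_def by (auto simp: is_iso_def inverse_arrows_def)
 have "f: Arr DT P X" using f by (auto simp: is_iso_def inverse_arrows_def)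
 then obtain g where g: "g: Arr CT P X" "f = LT P X g" using LT_surj[OF P _ DP_ob[OF X]] by blast
 have "is_resolution K C T X (P, g)" unfolding is_resolution_def using P g iso_qis[OF f[unfolded g(2)] sp_ob[OF P] DP_ob[OF X] g(1)] by simp
 hence "is_resolution K C T X (SOME Pp. is_resolution K C T X Pp)" by (rule someI)
 thus "sp (rP X)" "rq X: Arr CT (rP X) X" "qis_fnc C (rP X) X (rq X)"
  unfolding is_resolution_def res_ob_def res_qis_def by (auto simp: case_prod_unfold)
qed

lemma rP_ob: "X: Ob DP ==> rP X: Ob CT" by (rule sp_ob[OF rP])

abbreviation "LQ X == LT (rP X) X (rq X)"
abbreviation "IQ X == LI (rP X) X (rq X)"

text \<open>Fractions with the fixed denominator \<open>rq X\<close>. Every arrow X -> Y of the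
  derived category has this form, and f is determined up to homotopy, so Hom(X, Y) is a quotient of
  the module of chain maps \<open>rP X\<close> -> Y.\<close>

definition pi where "pi X Y f = cmp DT X (rP X) Y (LT (rP X) Y f) (IQ X)"

context
 fixes X Y assumes X: "X: Ob DP" and Y: "Y: Ob CT"
begin

lemma pi_in: "f: Arr CT (rP X) Y ==> pi X Y f: Arr DT X Y"
 unfolding pi_def using rP_ob[OF X] DP_ob[OF X] Y rq[OF X] rq_qis[OF X] by simp

lemma pi_q: "f: Arr CT (rP X) Y ==> cmp DT (rP X) X Y (pi X Y f) (LQ X) = LT (rP X) Y f"
 unfolding pi_def using rP_ob[OF X] DP_ob[OF X] Y rq[OF X] rq_qis[OF X] by simp

lemma pi_eqI: "f: Arr CT (rP X) Y ==> fi: Arr DT X Y ==> cmp DT (rP X) X Y fi (LQ X) = LT (rP X) Y f ==> pi X Y f = fi"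
 unfolding pi_def using rP_ob[OF X] DP_ob[OF X] Y rq[OF X] rq_qis[OF X] DT_eq(3)[of X "rP X" X Y "IQ X" "LQ X" fi] by simp

lemma pi_surj:
 assumes p: "fi: Arr DT X Y" shows "EX f:Arr CT (rP X) Y. pi X Y f = fi"
proof -
 have "cmp DT (rP X) X Y fi (LQ X): Arr DT (rP X) Y" using rP_ob[OF X] DP_ob[OF X] Y rq[OF X] p by simp
 then obtain f where "f: Arr CT (rP X) Y" "cmp DT (rP X) X Y fi (LQ X) = LT (rP X) Y f" using LT_surj[OF rP[OF X] _ Y] by blast
 thus ?thesis using pi_eqI[OF _ p] by blast
qed

lemma pi_eq_iff: "f: Arr CT (rP X) Y ==> g: Arr CT (rP X) Y ==> pi X Y f = pi X Y g \<longleftrightarrow> tm.htp (rP X) Y f g"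
 using LT_htp_iff[OF rP[OF X] Y] pi_q[of f] pi_q[of g] by (metis pi_def)

text \<open>Addition is a definite description over all common denominators, so it has to be shown
  that any representation of the two arrows leads to the same sum. The resolution serves as the
  reference denominator.\<close>

lemma pi_add:
 assumes f: "f: Arr CT (rP X) Y" and g: "g: Arr CT (rP X) Y"
 shows "pi X Y f +[homm DP X Y] pi X Y g = pi X Y (f +[chain_mod TM (rP X) Y] g)"
proof -
 interpret ct: kl K CT by unfold_locales (rule tm.Ch_klinear)
 note o[simp] = rP_ob[OF X] DP_ob[OF X] Y and q = rq[OF X] rq_qis[OF X]
 have fr: "fraction CT (qis_fnc C) X z Y u s = cmp DT X z Y (LT z Y u) (LI z X s)" if "z: Ob CT" "s: Arr CT z X" "u: Arr CT z Y" "qis_fnc C z X s" for z s u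
  unfolding fraction_def loc_arr_def loc_inv_def using loc_cmp[OF CT_cat, of "qis_fnc C" X "[Bwd X z s]" z "[Fwd z Y u]" Y] that o by simp
 have fg: "f +[homm CT (rP X) Y] g: Arr CT (rP X) Y" using ct.A_cl(4) o f g by blast
 have "(THE ch. EX z:Ob CT. EX s:Arr CT z X. EX u:Arr CT z Y. EX v:Arr CT z Y. qis_fnc C z X s & pi X Y f = fraction CT (qis_fnc C) X z Y u s \<and>
   pi X Y g = fraction CT (qis_fnc C) X z Y v s & ch = fraction CT (qis_fnc C) X z Y (u +[homm CT z Y] v) s) = pi X Y (f +[homm CT (rP X) Y] g)"
 proof (rule the_equality)
  show "EX z:Ob CT. EX s:Arr CT z X. EX u:Arr CT z Y. EX v:Arr CT z Y. qis_fnc C z X s & pi X Y f = fraction CT (qis_fnc C) X z Y u s \<and>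
   pi X Y g = fraction CT (qis_fnc C) X z Y v s & pi X Y (f +[homm CT (rP X) Y] g) = fraction CT (qis_fnc C) X z Y (u +[homm CT z Y] v) s"
   using fr[OF o(1) q(1) f q(2)] fr[OF o(1) q(1) g q(2)] fr[OF o(1) q(1) fg q(2)] o(1) q f g unfolding pi_def by blast
  fix ch assume "EX z:Ob CT. EX s:Arr CT z X. EX u:Arr CT z Y. EX v:Arr CT z Y. qis_fnc C z X s & pi X Y f = fraction CT (qis_fnc C) X z Y u s \<and>
   pi X Y g = fraction CT (qis_fnc C) X z Y v s & ch = fraction CT (qis_fnc C) X z Y (u +[homm CT z Y] v) s"
  then obtain z s u v where z: "z: Ob CT" and s: "s: Arr CT z X" "qis_fnc C z X s" and u: "u: Arr CT z Y" and v: "v: Arr CT z Y"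
   and e: "pi X Y f = fraction CT (qis_fnc C) X z Y u s" "pi X Y g = fraction CT (qis_fnc C) X z Y v s" "ch = fraction CT (qis_fnc C) X z Y (u +[homm CT z Y] v) s" by blast
  have uv: "u +[homm CT z Y] v: Arr CT z Y" using ct.A_cl(4)[of z Y] z o u v by blast
  \<comment> \<open>Comparison of denominators: q is s t up to homotopy, so f and g are homotopic to
    u t and v t, and the sum f + g to (u + v) t.\<close>
  obtain t where t: "t: Arr CT (rP X) z" "tm.htp (rP X) X (rq X) (cmp CT (rP X) z X s t)" using lift_htp[OF rP[OF X] z o(2) s q(1)] by blast
  have L: "LQ X = cmp DT (rP X) z X (LT z X s) (LT (rP X) z t)"
   using LT_htp[OF o(1,2) q(1) ct_cmp[OF o(1) z o(2) t(1) s(1)] t(2)] LT_cmp[OF o(1) z o(2) t(1) s(1)] by simp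
  have c: "cmp DT (rP X) X Y (fraction CT (qis_fnc C) X z Y w s) (LQ X) = LT (rP X) Y (cmp CT (rP X) z Y w t)" if w: "w: Arr CT z Y" for w
   unfolding fr[OF z s(1) w s(2)] L using z s w t(1) LT_cmp[OF o(1) z o(3) t(1) w] by simp
  have h: "tm.htp (rP X) Y f (cmp CT (rP X) z Y u t)" "tm.htp (rP X) Y g (cmp CT (rP X) z Y v t)"
   by (rule iffD1[OF LT_htp_iff[OF rP[OF X] Y f ct_cmp[OF o(1) z o(3) t(1) u]]], metis c[OF u] pi_q[OF f] e(1),
     rule iffD1[OF LT_htp_iff[OF rP[OF X] Y g ct_cmp[OF o(1) z o(3) t(1) v]]], metis c[OF v] pi_q[OF g] e(2))
  have "tm.htp (rP X) Y (f +[homm CT (rP X) Y] g) (cmp CT (rP X) z Y (u +[homm CT z Y] v) t)"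
   using tm.htp_add[OF o(1,3) f ct_cmp[OF o(1) z o(3) t(1) u] g ct_cmp[OF o(1) z o(3) t(1) v] h] ct.A_bil(2)[OF o(1) z o(3) u v t(1)] by (simp del: tm.Ch_sel(2,4,5,6))
  hence "LT (rP X) Y (f +[homm CT (rP X) Y] g) = cmp DT (rP X) X Y ch (LQ X)" unfolding e(3) c[OF uv] by (rule LT_htp[OF o(1,3) fg ct_cmp[OF o(1) z o(3) t(1) uv]])
  moreover have "ch: Arr DT X Y" unfolding e(3) fr[OF z s(1) uv s(2)] using z s uv by simp
  ultimately show "ch = pi X Y (f +[homm CT (rP X) Y] g)" using pi_eqI[OF fg] by simp
 qed
 thus ?thesis by (simp add: Dtmod_def derived_cat_def del: tm.Ch_sel(5))
qed

lemma pi_zero: "0[homm DP X Y] = pi X Y 0[chain_mod TM (rP X) Y]"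
proof -
 interpret ct: kl K CT by unfold_locales (rule tm.Ch_klinear)
 note o[simp] = rP_ob[OF X] DP_ob[OF X] Y and q = rq[OF X]
 have "pi X Y 0[homm CT (rP X) Y] = LT X Y 0[homm CT X Y]"
  by (rule pi_eqI) (use LT_cmp[OF o(1-3) q, of "0[homm CT X Y]"] ct.A_bil(8)[OF o q] ct.A_cl(3)[OF o(2,3)] ct.A_cl(3)[OF o(1,3)] in "simp_all del: tm.Ch_sel")
 thus ?thesis by (simp add: Dtmod_def derived_cat_def del: tm.Ch_sel(4))
qed

lemma pi_sm:
 assumes f: "f: Arr CT (rP X) Y" and c: "c <: K"
 shows "c *[homm DP X Y] pi X Y f = pi X Y (c *[chain_mod TM (rP X) Y] f)"
proof -
 interpret ct: kl K CT by unfold_locales (rule tm.Ch_klinear)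
 note o[simp] = rP_ob[OF X] DP_ob[OF X] Y and q = rq[OF X]
 let ?c = "c *[homm CT X X] ide CT X" and ?r = "c *[homm CT (rP X) (rP X)] ide CT (rP X)"
 note cc = ct.A_cl(6)[OF o(2,2) ct.A_cl(1)[OF o(2)] c] ct.A_cl(6)[OF o(1,1) ct.A_cl(1)[OF o(1)] c]
 have e: "cmp CT (rP X) X X ?c (rq X) = cmp CT (rP X) (rP X) X (rq X) ?r" "cmp CT (rP X) (rP X) Y f ?r = c *[homm CT (rP X) Y] f"
  using ct.A_bil(4)[OF o(1,2,2) q c, of "ide CT X"] ct.A_bil(3)[OF o(1,1,2) _ c q, of "ide CT (rP X)"] ct.A_bil(3)[OF o(1,1,3) _ c f, of "ide CT (rP X)"] ct.A_cl(1) ct.A_eq(1,2) q f by (simp_all del: tm.Ch_sel)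
 have "pi X Y (c *[homm CT (rP X) Y] f) = cmp DT X X Y (pi X Y f) (LT X X ?c)"
 proof (rule pi_eqI)
  show "c *[homm CT (rP X) Y] f: Arr CT (rP X) Y" using ct.A_cl(6)[OF o(1,3) f c] .
  show "cmp DT X X Y (pi X Y f) (LT X X ?c): Arr DT X Y" using pi_in[OF f] cc by simp
  have "cmp DT (rP X) X Y (cmp DT X X Y (pi X Y f) (LT X X ?c)) (LQ X) = cmp DT (rP X) X Y (pi X Y f) (LT (rP X) X (cmp CT (rP X) X X ?c (rq X)))"
   using pi_in[OF f] cc q LT_cmp[OF o(1,2,2) q cc(1)] by (simp del: tm.Ch_sel)
  also have "... = cmp DT (rP X) (rP X) Y (cmp DT (rP X) X Y (pi X Y f) (LQ X)) (LT (rP X) (rP X) ?r)"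
   unfolding e(1) using pi_in[OF f] cc q LT_cmp[OF o(1,1,2) cc(2) q] by (simp del: tm.Ch_sel)
  finally show "cmp DT (rP X) X Y (cmp DT X X Y (pi X Y f) (LT X X ?c)) (LQ X) = LT (rP X) Y (c *[homm CT (rP X) Y] f)"
   unfolding pi_q[OF f] e(2)[symmetric] LT_cmp[OF o(1,1,3) cc(2) f] .
 qed
 thus ?thesis by (simp add: Dtmod_def derived_cat_def del: tm.Ch_sel(1,2,4,5,6))
qed

lemma homm_module: "module K (homm DP X Y)" and homm_carrier: "carrier (homm DP X Y) = Arr DT X Y"
proof -
 show c: "carrier (homm DP X Y) = Arr DT X Y" by (simp add: Dtmod_def derived_cat_def)
 have "pi X Y ` carrier (chain_mod TM (rP X) Y) = carrier (homm DP X Y)" unfolding c using pi_in pi_surj by auto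
 thus "module K (homm DP X Y)"
  by (rule mod_surj[OF tm.chain_module[OF rP_ob[OF X] Y]]) (use pi_add pi_sm pi_zero in "simp_all del: tm.Ch_sel(4-6)")
qed

end

lemma pi_lift:
 assumes X: "X: Ob DP" and Y: "Y: Ob DP" and a: "a: Arr CT (rP X) Y"
 obtains a' where "a': Arr CT (rP X) (rP Y)" "tm.htp (rP X) Y a (cmp CT (rP X) (rP Y) Y (rq Y) a')"
 using lift_htp[OF rP[OF X] rP_ob[OF Y] DP_ob[OF Y] rq[OF Y] rq_qis[OF Y] a] by blast

lemma pi_comp:
 assumes X: "X: Ob DP" and Y: "Y: Ob DP" and Z: "Z: Ob CT" and a: "a: Arr CT (rP X) Y" and a': "a': Arr CT (rP X) (rP Y)"
  and h: "tm.htp (rP X) Y a (cmp CT (rP X) (rP Y) Y (rq Y) a')" and b: "b: Arr CT (rP Y) Z"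
 shows "cmp DT X Y Z (pi Y Z b) (pi X Y a) = pi X Z (cmp CT (rP X) (rP Y) Z b a')"
proof -
 note o[simp] = rP_ob[OF X] DP_ob[OF X] rP_ob[OF Y] DP_ob[OF Y] Z and q = rq[OF X] rq_qis[OF X] rq[OF Y] rq_qis[OF Y]
 have L: "LT (rP X) Y a = cmp DT (rP X) (rP Y) Y (LQ Y) (LT (rP X) (rP Y) a')"
  using LT_htp[OF o(1,4) a ct_cmp[OF o(1,3,4) a' q(3)] h] LT_cmp[OF o(1,3,4) a' q(3)] by simp
 show ?thesis unfolding pi_def L LT_cmp[OF o(1,3,5) a' b] using q a' b by simp
qed

lemma Dt_cat: "category (Dtmod K C T)"
 by (rule catI) (use cat_ide[OF DT_cat] in simp_all)

text \<open>Through \<open>pi\<close> every arrow is a chain map out of a resolution, and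
  composition is composition with a lift to the next resolution (\<open>pi_comp\<close>). Sums and
  multiples of lifts lift the sums and multiples, so bilinearity is that of chain maps.\<close>

lemma DP_klinear: "klinear_category K DP"
proof (rule klI)
 interpret ct: kl K CT by unfold_locales (rule tm.Ch_klinear)
 note cs[simp] = tm.Ch_sel(3)
 show "category DP" unfolding Dperf_def by (rule sub_category[OF Dt_cat])
 show "module K (homm DP X Y)" if X: "X: Ob DP" and Y: "Y: Ob DP" for X Y by (rule homm_module[OF X DP_ob[OF Y]])
 show "carrier (homm DP X Y) = Arr DP X Y" if X: "X: Ob DP" and Y: "Y: Ob DP" for X Y using homm_carrier[OF X DP_ob[OF Y]] by simp
 have core: "EX a:Arr CT (rP X) Y. EX a':Arr CT (rP X) (rP Y). f = pi X Y a & tm.htp (rP X) Y a (cmp CT (rP X) (rP Y) Y (rq Y) a')"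
  if X: "X: Ob DP" and Y: "Y: Ob DP" and f: "f: Arr DP X Y" for X Y f
  using pi_surj[OF X DP_ob[OF Y], of f] pi_lift[OF X Y] f by (metis DP_sel(1))
 fix X Y Z f g k assume X: "X: Ob DP" and Y: "Y: Ob DP" and Z: "Z: Ob DP" and f: "f: Arr DP X Y" and g: "g: Arr DP Y Z"
 note o = rP_ob[OF X] DP_ob[OF X] rP_ob[OF Y] DP_ob[OF Y] DP_ob[OF Z] and q = rq[OF Y]
 obtain a a' where a: "a: Arr CT (rP X) Y" "a': Arr CT (rP X) (rP Y)" "f = pi X Y a" "tm.htp (rP X) Y a (cmp CT (rP X) (rP Y) Y (rq Y) a')" using core[OF X Y f] by blast
 obtain b where b: "b: Arr CT (rP Y) Z" "g = pi Y Z b" using pi_surj[OF Y o(5)] g by auto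
 note pc = pi_comp[OF X Y o(5)] and qa = ct_cmp[OF o(1,3,4) _ q] and ba = ct_cmp[OF o(1,3,5)]
 { fix f' assume f': "f': Arr DP X Y"
  obtain c c' where c: "c: Arr CT (rP X) Y" "c': Arr CT (rP X) (rP Y)" "f' = pi X Y c" "tm.htp (rP X) Y c (cmp CT (rP X) (rP Y) Y (rq Y) c')" using core[OF X Y f'] by blast
  have h: "tm.htp (rP X) Y (a +[homm CT (rP X) Y] c) (cmp CT (rP X) (rP Y) Y (rq Y) (a' +[homm CT (rP X) (rP Y)] c'))"
   using tm.htp_add[OF o(1,4) a(1) qa[OF a(2)] c(1) qa[OF c(2)] a(4) c(4)] ct.A_bil(1)[OF o(1,3,4) a(2) c(2) q] by (simp del: tm.Ch_sel(2,4,5,6))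
  have "cmp DT X Y Z (pi Y Z b) (pi X Y (a +[homm CT (rP X) Y] c)) = pi X Z (cmp CT (rP X) (rP Y) Z b a' +[homm CT (rP X) Z] cmp CT (rP X) (rP Y) Z b c')"
   unfolding pc[OF ct.A_cl(4)[OF o(1,4) a(1) c(1)] ct.A_cl(4)[OF o(1,3) a(2) c(2)] h b(1)] ct.A_bil(1)[OF o(1,3,5) a(2) c(2) b(1)] ..
  thus "cmp DP X Y Z g (f +[homm DP X Y] f') = cmp DP X Y Z g f +[homm DP X Z] cmp DP X Y Z g f'"
   using pi_add[OF X o(4) a(1) c(1)] pi_add[OF X o(5) ba[OF a(2) b(1)] ba[OF c(2) b(1)]] pc[OF a(1,2,4) b(1)] pc[OF c(1,2,4) b(1)] a(3) b(2) c(3) by (simp del: tm.Ch_sel(2,4,5,6) DP_sel(4)) }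
 { fix g' assume "g': Arr DP Y Z"
  then obtain c where c: "c: Arr CT (rP Y) Z" "g' = pi Y Z c" using pi_surj[OF Y o(5)] by auto
  show "cmp DP X Y Z (g +[homm DP Y Z] g') f = cmp DP X Y Z g f +[homm DP X Z] cmp DP X Y Z g' f"
   using pi_add[OF Y o(5) b(1) c(1)] pi_add[OF X o(5) ba[OF a(2) b(1)] ba[OF a(2) c(1)]] pc[OF a(1,2,4) b(1)] pc[OF a(1,2,4) c(1)] pc[OF a(1,2,4) ct.A_cl(4)[OF o(3,5) b(1) c(1)]]
    ct.A_bil(2)[OF o(1,3,5) b(1) c(1) a(2)] a(3) b(2) c(2) by (simp del: tm.Ch_sel(2,4,5,6) DP_sel(4)) }
 assume k: "k <: K"
 have h: "tm.htp (rP X) Y (k *[homm CT (rP X) Y] a) (cmp CT (rP X) (rP Y) Y (rq Y) (k *[homm CT (rP X) (rP Y)] a'))"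
  using tm.htp_sm[OF o(1,4) a(1) qa[OF a(2)] a(4) k] ct.A_bil(3)[OF o(1,3,4) a(2) k q] by (simp del: tm.Ch_sel(2,4,5,6))
 show "cmp DP X Y Z g (k *[homm DP X Y] f) = k *[homm DP X Z] cmp DP X Y Z g f"
  using pi_sm[OF X o(4) a(1) k] pi_sm[OF X o(5) ba[OF a(2) b(1)] k] pc[OF a(1,2,4) b(1)] pc[OF ct.A_cl(6)[OF o(1,4) a(1) k] ct.A_cl(6)[OF o(1,3) a(2) k] h b(1)]
   ct.A_bil(3)[OF o(1,3,5) a(2) k b(1)] a(3) b(2) by (simp del: tm.Ch_sel(2,4,5,6) DP_sel(4))
 show "cmp DP X Y Z (k *[homm DP Y Z] g) f = k *[homm DP X Z] cmp DP X Y Z g f"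
  using pi_sm[OF Y o(5) b(1) k] pi_sm[OF X o(5) ba[OF a(2) b(1)] k] pc[OF a(1,2,4) b(1)] pc[OF a(1,2,4) ct.A_cl(6)[OF o(3,5) b(1) k]]
   ct.A_bil(4)[OF o(1,3,5) a(2) k b(1)] a(3) b(2) by (simp del: tm.Ch_sel(2,4,5,6) DP_sel(4))
qed

end

text \<open>A functor on a product is assembled from functors \<open>H x\<close> in the second
  variable and natural transformations between them for the first. This suits RHom, where the second
  variable comes from a functor on the localization and the first from chosen lifts between
  resolutions.\<close>

lemma bifunctor:
 assumes A: "category A" and B: "category B" and D: "category D" and H: "!!x. x: Ob A ==> is_functor B D (H x)"
  and P: "!!x x' f y. x: Ob A ==> x': Ob A ==> f: Arr A x x' ==> y: Ob B ==> P x x' f y: Arr D (om (H x) y) (om (H x') y)"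
  and i: "!!x y. x: Ob A ==> y: Ob B ==> P x x (ide A x) y = ide D (om (H x) y)"
  and c: "!!x x' x'' f g y. x: Ob A ==> x': Ob A ==> x'': Ob A ==> f: Arr A x x' ==> g: Arr A x' x'' ==> y: Ob B ==>
    P x x'' (cmp A x x' x'' g f) y = cmp D (om (H x) y) (om (H x') y) (om (H x'') y) (P x' x'' g y) (P x x' f y)"
  and n: "!!x x' f y y' g. x: Ob A ==> x': Ob A ==> f: Arr A x x' ==> y: Ob B ==> y': Ob B ==> g: Arr B y y' ==>
    cmp D (om (H x) y) (om (H x) y') (om (H x') y') (P x x' f y') (mm (H x) y y' g) = cmp D (om (H x) y) (om (H x') y) (om (H x') y') (mm (H x') y y' g) (P x x' f y)"
  and F: "!!x y. om F (x, y) = om (H x) y" "!!x x' y y' f g. mm F (x, y) (x', y') (f, g) = cmp D (om (H x) y) (om (H x) y') (om (H x') y') (P x x' f y') (mm (H x) y y' g)"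
 shows "is_functor (prod_cat A B) D F"
proof -
 note h = fnc_ob[OF H] fnc_ide[OF H] fnc_arr[OF H]
 have 1: "om (H x) y: Ob D & cmp D (om (H x) y) (om (H x) y) (om (H x) y) (P x x (ide A x) y) (mm (H x) y y (ide B y)) = ide D (om (H x) y)"
  if x: "x: Ob A" and y: "y: Ob B" for x y
  using h(1)[OF x y] h(2)[OF x y] i[OF x y] cat_idl[OF D, of "om (H x) y" "om (H x) y"] cat_ide[OF D] by simp
 have 2: "cmp D (om (H x) y) (om (H x) y') (om (H x') y') (P x x' f y') (mm (H x) y y' g): Arr D (om (H x) y) (om (H x') y')"
  if "x: Ob A" "y: Ob B" "x': Ob A" "y': Ob B" "f: Arr A x x'" "g: Arr B y y'" for x y x' y' f g
  by (rule cat_cmp[OF D h(1)[OF that(1,2)] h(1)[OF that(1,4)] h(1)[OF that(3,4)] h(3)[OF that(1,2,4,6)] P[OF that(1,3,5,4)]])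
 have 3: "cmp D (om (H x) y) (om (H x) y'') (om (H x'') y'') (P x x'' (cmp A x x' x'' f' f) y'') (mm (H x) y y'' (cmp B y y' y'' g' g)) =
    cmp D (om (H x) y) (om (H x') y') (om (H x'') y'') (cmp D (om (H x') y') (om (H x') y'') (om (H x'') y'') (P x' x'' f' y'') (mm (H x') y' y'' g'))
     (cmp D (om (H x) y) (om (H x) y') (om (H x') y') (P x x' f y') (mm (H x) y y' g))"
  if x: "x: Ob A" and y: "y: Ob B" and x': "x': Ob A" and y': "y': Ob B" and f: "f: Arr A x x'" and g: "g: Arr B y y'"
   and x'': "x'': Ob A" and y'': "y'': Ob B" and f': "f': Arr A x' x''" and g': "g': Arr B y' y''" for x y x' y' f g x'' y'' f' g'
 proof -
  note o = h(1)[OF x y] h(1)[OF x y'] h(1)[OF x y''] h(1)[OF x' y'] h(1)[OF x' y''] h(1)[OF x'' y'']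
  note a = h(3)[OF x y y' g] h(3)[OF x y' y'' g'] P[OF x x' f y''] P[OF x' x'' f' y''] h(3)[OF x' y' y'' g'] P[OF x x' f y']
  show ?thesis unfolding c[OF x x' x'' f f' y''] fnc_cmp[OF H[OF x] y y' y'' g g']
   using cat_assoc[OF D] cat_cmp[OF D] n[OF x x' f y' y'' g'] o a by metis
 qed
 show ?thesis unfolding is_functor_def using D prod_category[OF A B] 1 2 3 by (auto simp: F)
qed

lemma derived_category: "category (loc_cat B W) ==> category (derived_cat B W)"
 unfolding category_def derived_sel loc_sel(1) .

lemma derived_functor: "is_functor A (loc_cat B W) F ==> is_functor A (derived_cat B W) F"
 unfolding is_functor_def derived_sel loc_sel(1) using derived_category by blast

lemma iso_comp:
 assumes A: "category A" and o: "a: Ob A" "b: Ob A" "c: Ob A" and f: "is_iso A a b f" and g: "is_iso A b c g"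
 shows "is_iso A a c (cmp A a b c g f)"
proof -
 obtain f' g' where f: "inverse_arrows A a b f f'" and g: "inverse_arrows A b c g g'" using f g unfolding is_iso_def by blast
 note fg = f[unfolded inverse_arrows_def] g[unfolded inverse_arrows_def]
 have "cmp A a c a (cmp A c b a f' g') (cmp A a b c g f) = cmp A a b a f' (cmp A a b b (cmp A b c b g' g) f)"
  "cmp A c a c (cmp A a b c g f) (cmp A c b a f' g') = cmp A c b c g (cmp A c b b (cmp A b a b f f') g')"
  using cat_assoc[OF A] cat_cmp[OF A] fg o by metis+
 hence "inverse_arrows A a c (cmp A a b c g f) (cmp A c b a f' g')" unfolding inverse_arrows_def using fg o cat_cmp[OF A] cat_idl[OF A] by simp
 thus ?thesis unfolding is_iso_def by blast
qed

context yon
begin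

subsection \<open>The derived functors\<close>

abbreviation "ra == res_arr K C T"
abbreviation "DK == loc_cat CK qis_mod"

lemma res_arr:
 assumes X: "X: Ob DP" and Y: "Y: Ob DP" and p: "fi: Arr DT X Y"
 shows ra_in: "ra X Y fi: Arr CT (rP X) (rP Y)" and ra_eq: "cmp DT (rP X) (rP Y) Y (LQ Y) (LT (rP X) (rP Y) (ra X Y fi)) = cmp DT (rP X) X Y fi (LQ X)"
proof -
 note o = rP_ob[OF X] rP_ob[OF Y] DP_ob[OF Y]
 obtain a where a: "a: Arr CT (rP X) Y" "pi X Y a = fi" using pi_surj[OF X o(3) p] by blast
 obtain a' where a': "a': Arr CT (rP X) (rP Y)" "tm.htp (rP X) Y a (cmp CT (rP X) (rP Y) Y (rq Y) a')" using pi_lift[OF X Y a(1)] by blast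
 have "cmp DT (rP X) (rP Y) Y (LQ Y) (LT (rP X) (rP Y) a') = cmp DT (rP X) X Y fi (LQ X)"
  using LT_htp[OF o(1,3) a(1) ct_cmp[OF o a'(1) rq[OF Y]] a'(2)] LT_cmp[OF o a'(1) rq[OF Y]] pi_q[OF X o(3) a(1)] a(2) by simp
 hence "EX g. g: Arr CT (rP X) (rP Y) & cmp (Dtmod K C T) (rP X) (rP Y) Y (Dloc K C T (rP Y) Y (rq Y)) (Dloc K C T (rP X) (rP Y) g) = cmp (Dtmod K C T) (rP X) X Y fi (Dloc K C T (rP X) X (rq X))"
  using a'(1) unfolding Dloc_def DP_sel by blast
 from someI_ex[OF this, folded res_arr_def]
 show "ra X Y fi: Arr CT (rP X) (rP Y)" "cmp DT (rP X) (rP Y) Y (LQ Y) (LT (rP X) (rP Y) (ra X Y fi)) = cmp DT (rP X) X Y fi (LQ X)"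
  unfolding Dloc_def DP_sel by simp_all
qed

text \<open>The resolution of Y is invertible in the derived category, so the defining equation of a
  lift determines its image there, and \<open>LT_htp_iff\<close> turns equality of images into
  homotopy. Identities and composites of chosen lifts are compared in this way.\<close>

lemma ra_htp:
 assumes X: "X: Ob DP" and Y: "Y: Ob DP" and p: "fi: Arr DT X Y" and g: "g: Arr CT (rP X) (rP Y)"
  and e: "cmp DT (rP X) (rP Y) Y (LQ Y) (LT (rP X) (rP Y) g) = cmp DT (rP X) X Y fi (LQ X)"
 shows "tm.htp (rP X) (rP Y) (ra X Y fi) g"
proof -
 note o = rP_ob[OF X] rP_ob[OF Y] DP_ob[OF Y]
 have "LT (rP X) (rP Y) h = cmp DT (rP X) Y (rP Y) (IQ Y) (cmp DT (rP X) (rP Y) Y (LQ Y) (LT (rP X) (rP Y) h))" if "h: Arr CT (rP X) (rP Y)" for h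
  using LI_eq(3)[OF o(2,3) rq[OF Y] rq_qis[OF Y] o(1)] LT_in[OF o(1,2) that] by simp
 from this[OF g] this[OF ra_in[OF X Y p]] have "LT (rP X) (rP Y) (ra X Y fi) = LT (rP X) (rP Y) g" unfolding e ra_eq[OF X Y p] by simp
 thus ?thesis using LT_htp_iff[OF rP[OF X] o(2) ra_in[OF X Y p] g] by simp
qed

lemma ra_pi: "X: Ob DP ==> Y: Ob DP ==> fi: Arr DT X Y ==> pi X Y (cmp CT (rP X) (rP Y) Y (rq Y) (ra X Y fi)) = fi"
 by (rule pi_eqI) (use DP_ob rP_ob rq ra_in ra_eq LT_cmp[of "rP X" "rP Y" Y "ra X Y fi" "rq Y"] ct_cmp[of "rP X" "rP Y" Y "ra X Y fi" "rq Y"] in "simp_all del: tm.Ch_sel")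

lemma ra_ide: "X: Ob DP ==> tm.htp (rP X) (rP X) (ra X X (ide DT X)) (ide CT (rP X))"
 by (rule ra_htp) (use DP_ob rP_ob rq cat_ide[OF DT_cat, of X] cat_ide[OF CT_cat, of "rP X"] loc_arr_ide[OF CT_cat, of "rP X" "qis_fnc C"] in "simp_all del: tm.Ch_sel")

lemma ra_cmp:
 assumes X: "X: Ob DP" and Y: "Y: Ob DP" and Z: "Z: Ob DP" and f: "f: Arr DT X Y" and g: "g: Arr DT Y Z"
 shows "tm.htp (rP X) (rP Z) (ra X Z (cmp DT X Y Z g f)) (cmp CT (rP X) (rP Y) (rP Z) (ra Y Z g) (ra X Y f))"
proof (rule ra_htp[OF X Z])
 note o[simp] = rP_ob[OF X] rP_ob[OF Y] rP_ob[OF Z] DP_ob[OF X] DP_ob[OF Y] DP_ob[OF Z] and q = rq[OF X] rq[OF Y] rq[OF Z]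
 note r = ra_in[OF X Y f] ra_in[OF Y Z g]
 show "cmp DT X Y Z g f: Arr DT X Z" using f g by simp
 show "cmp CT (rP X) (rP Y) (rP Z) (ra Y Z g) (ra X Y f): Arr CT (rP X) (rP Z)" by (rule ct_cmp[OF o(1-3) r])
 have "cmp DT (rP X) (rP Z) Z (LQ Z) (LT (rP X) (rP Z) (cmp CT (rP X) (rP Y) (rP Z) (ra Y Z g) (ra X Y f))) =
  cmp DT (rP X) (rP Y) Z (cmp DT (rP Y) (rP Z) Z (LQ Z) (LT (rP Y) (rP Z) (ra Y Z g))) (LT (rP X) (rP Y) (ra X Y f))"
  unfolding LT_cmp[OF o(1-3) r] using r q by simp
 also have "... = cmp DT (rP X) Y Z g (cmp DT (rP X) (rP Y) Y (LQ Y) (LT (rP X) (rP Y) (ra X Y f)))"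
  unfolding ra_eq[OF Y Z g] using r q g by simp
 also have "... = cmp DT (rP X) X Z (cmp DT X Y Z g f) (LQ X)" unfolding ra_eq[OF X Y f] using f g q by simp
 finally show "cmp DT (rP X) (rP Z) Z (LQ Z) (LT (rP X) (rP Z) (cmp CT (rP X) (rP Y) (rP Z) (ra Y Z g) (ra X Y f))) = cmp DT (rP X) X Z (cmp DT X Y Z g f) (LQ X)" .
qed

abbreviation "RD == RD_dual K C T"

lemma RD_sel: "om RD X = E (rP X)" "mm RD X Y fi = LT (E (rP X)) (E (rP Y)) (Ea (rP X) (rP Y) (ra X Y fi))"
 by (simp_all add: RD_dual_def Let_def E_def Dloc_def Ea_eq)

text \<open>Chosen lifts respect identities and composition only up to homotopy. \<open>Ea\<close>
  carries these homotopies over, and the localization identifies homotopic maps.\<close>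

lemma RD_functor: "is_functor DP (Dtmod K C T) RD"
 unfolding is_functor_def RD_sel DP_sel
proof (intro conjI Dt_cat kl_cat[OF DP_klinear] ballI)
 fix X assume X: "X: Ob DP"
 note s = rP[OF X]
 show "E (rP X): Ob CT" by (rule E_ob[OF s])
 have "ide DT X: Arr DT X X" using cat_ide[OF DT_cat, of X] DP_ob[OF X] by simp
 thus "LT (E (rP X)) (E (rP X)) (Ea (rP X) (rP X) (ra X X (ide DT X))) = ide DT (E (rP X))"
  using LT_htp[OF E_ob[OF s] E_ob[OF s] Ea_arr[OF s s] Ea_arr[OF s s] Ea_htp[OF s s _ _ ra_ide[OF X]]] ra_in[OF X X, of "ide DT X"] cat_ide[OF CT_cat sp_ob[OF s]]
   Ea_ide[OF s] loc_arr_ide[OF CT_cat E_ob[OF s], of "qis_fnc C"] by (simp del: tm.Ch_sel)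
 fix Y f assume Y: "Y: Ob DP" and f: "f: Arr DT X Y"
 note r = ra_in[OF X Y f]
 show "LT (E (rP X)) (E (rP Y)) (Ea (rP X) (rP Y) (ra X Y f)): Arr DT (E (rP X)) (E (rP Y))" by (rule LT_in[OF E_ob[OF s] E_ob[OF rP[OF Y]] Ea_arr[OF s rP[OF Y] r]])
 fix Z g assume Z: "Z: Ob DP" and g: "g: Arr DT Y Z"
 note t = rP[OF Y] rP[OF Z] and r' = ra_in[OF Y Z g]
 have gf: "cmp DT X Y Z g f: Arr DT X Z" using f g DP_ob X Y Z by simp
 note rr = ct_cmp[OF sp_ob[OF s] sp_ob[OF t(1)] sp_ob[OF t(2)] r r']
 show "LT (E (rP X)) (E (rP Z)) (Ea (rP X) (rP Z) (ra X Z (cmp DT X Y Z g f))) =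
   cmp DT (E (rP X)) (E (rP Y)) (E (rP Z)) (LT (E (rP Y)) (E (rP Z)) (Ea (rP Y) (rP Z) (ra Y Z g))) (LT (E (rP X)) (E (rP Y)) (Ea (rP X) (rP Y) (ra X Y f)))"
  unfolding LT_htp[OF E_ob[OF s] E_ob[OF t(2)] Ea_arr[OF s t(2) ra_in[OF X Z gf]] Ea_arr[OF s t(2) rr] Ea_htp[OF s t(2) ra_in[OF X Z gf] rr ra_cmp[OF X Y Z f g]]]
   Ea_cmp[OF s t r r'] by (rule LT_cmp[OF E_ob[OF s] E_ob[OF t(1)] E_ob[OF t(2)] Ea_arr[OF s t(1) r] Ea_arr[OF t r']])
qed

abbreviation "HF P == hom_cx_fnc TM P"
abbreviation "PC == hom_cx_precomp TM"
abbreviation "HL P == loc_fnc CK qis_mod (HF P)"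
abbreviation "RH == RHom K C T"

lemmas DK_cat = loc_category[OF Ch_kmod_cat, where W = qis_mod]

lemma HL_functor: "sp P ==> is_functor DT DK (HL P)"
 by (rule loc_fnc_functor[OF tm.hom_fnc_functor[OF sp_ob] hom_sends])

lemma HL_LT: "sp P ==> Y: Ob CT ==> Z: Ob CT ==> g: Arr CT Y Z ==> mm (HL P) Y Z (LT Y Z g) = LA (HC P Y) (HC P Z) (mm (HF P) Y Z g)"
 using loc_fnc_arr[OF tm.hom_fnc_functor[OF sp_ob] hom_sends] by simp

lemma HL_om[simp]: "om (HL P) Y = HC P Y" by (simp add: loc_fnc_def)

lemma LA_cmp: "X: Ob CK ==> Y: Ob CK ==> Z: Ob CK ==> f: Arr CK X Y ==> g: Arr CK Y Z ==>
  cmp DK X Y Z (LA Y Z g) (LA X Y f) = LA X Z (cmp CK X Y Z g f)"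
 by (rule loc_arr_cmp[OF Ch_kmod_cat])

text \<open>In the first variable the homotopies between lifts act on Hom complexes by homotopies,
  which disappear in the derived category of modules. Compatibility of the two variables needs to be
  checked for chain maps Y -> Y' only, by \<open>loc_natural\<close>.\<close>

lemma RH_functor: "is_functor (prod_cat (op_cat DP) (Dtmod K C T)) DK RH"
proof (rule bifunctor[where H = "%X. HL (rP X)" and P = "%X X' f Y. LA (HC (rP X) Y) (HC (rP X') Y) (PC (rP X') (rP X) Y (ra X' X f))"])
 show "category (op_cat DP)" by (rule op_category[OF kl_cat[OF DP_klinear]])
 show "category (Dtmod K C T)" by (rule Dt_cat)
 show "category DK" by (rule DK_cat)
 fix X assume X0: "X: Ob (op_cat DP)"
 hence X: "X: Ob DP" by simp
 note pX = rP_ob[OF X]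
 show "is_functor (Dtmod K C T) DK (HL (rP X))"
  using HL_functor[OF rP[OF X]] Dt_cat unfolding is_functor_def DP_sel loc_sel(1) by blast
 { fix Y assume "Y: Ob (Dtmod K C T)"
  hence Y: "Y: Ob CT" by simp
  have i: "ide DT X: Arr DT X X" using cat_ide[OF DT_cat, of X] DP_ob[OF X] by simp
  note h = tm.precomp_htp[OF pX pX Y ra_in[OF X X i] cat_ide[OF CT_cat pX] ra_ide[OF X]]
  show "LA (HC (rP X) Y) (HC (rP X) Y) (PC (rP X) (rP X) Y (ra X X (ide (op_cat DP) X))) = ide DK (om (HL (rP X)) Y)"
   unfolding op_sel DP_sel kmod_loc_htp[OF inj_h HC_ob[OF pX Y] HC_ob[OF pX Y] tm.precomp_arr[OF pX pX Y ra_in[OF X X i]] tm.precomp_arr[OF pX pX Y cat_ide[OF CT_cat pX]] h]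
    tm.precomp_ide[OF pX Y] HL_om by (rule loc_arr_ide[OF Ch_kmod_cat HC_ob[OF pX Y]]) }
 fix X' f assume "X': Ob (op_cat DP)" and "f: Arr (op_cat DP) X X'"
 hence X': "X': Ob DP" and f: "f: Arr DT X' X" by simp_all
 note pX' = rP_ob[OF X'] and r = ra_in[OF X' X f]
 fix Y assume "Y: Ob (Dtmod K C T)"
 hence Y: "Y: Ob CT" by simp
 show P: "LA (HC (rP X) Y) (HC (rP X') Y) (PC (rP X') (rP X) Y (ra X' X f)): Arr DK (om (HL (rP X)) Y) (om (HL (rP X')) Y)"
  unfolding HL_om by (rule loc_arr_in[OF HC_ob[OF pX Y] HC_ob[OF pX' Y] tm.precomp_arr[OF pX pX' Y r]])
 { fix X'' g assume "X'': Ob (op_cat DP)" and "g: Arr (op_cat DP) X' X''"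
  hence X'': "X'': Ob DP" and g: "g: Arr DT X'' X'" by simp_all
  note pX'' = rP_ob[OF X''] and r' = ra_in[OF X'' X' g]
  have fg: "cmp DT X'' X' X f g: Arr DT X'' X" using f g DP_ob X X' X'' by simp
  note rr = ct_cmp[OF pX'' pX' pX r' r]
  note h = tm.precomp_htp[OF pX pX'' Y ra_in[OF X'' X fg] rr ra_cmp[OF X'' X' X g f]]
  show "LA (HC (rP X) Y) (HC (rP X'') Y) (PC (rP X'') (rP X) Y (ra X'' X (cmp (op_cat DP) X X' X'' g f))) =
    cmp DK (om (HL (rP X)) Y) (om (HL (rP X')) Y) (om (HL (rP X'')) Y) (LA (HC (rP X') Y) (HC (rP X'') Y) (PC (rP X'') (rP X') Y (ra X'' X' g))) (LA (HC (rP X) Y) (HC (rP X') Y) (PC (rP X') (rP X) Y (ra X' X f)))"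
   unfolding op_sel DP_sel HL_om kmod_loc_htp[OF inj_h HC_ob[OF pX Y] HC_ob[OF pX'' Y] tm.precomp_arr[OF pX pX'' Y ra_in[OF X'' X fg]] tm.precomp_arr[OF pX pX'' Y rr] h]
    LA_cmp[OF HC_ob[OF pX Y] HC_ob[OF pX' Y] HC_ob[OF pX'' Y] tm.precomp_arr[OF pX pX' Y r] tm.precomp_arr[OF pX' pX'' Y r']] tm.precomp_cmp[OF pX pX' pX'' Y r r'] .. }
 fix Y' g assume g: "g: Arr (Dtmod K C T) Y Y'"
 show "cmp DK (om (HL (rP X)) Y) (om (HL (rP X)) Y') (om (HL (rP X')) Y') (LA (HC (rP X) Y') (HC (rP X') Y') (PC (rP X') (rP X) Y' (ra X' X f))) (mm (HL (rP X)) Y Y' g) =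
   cmp DK (om (HL (rP X)) Y) (om (HL (rP X')) Y) (om (HL (rP X')) Y') (mm (HL (rP X')) Y Y' g) (LA (HC (rP X) Y) (HC (rP X') Y) (PC (rP X') (rP X) Y (ra X' X f)))"
 proof (rule loc_natural[OF CT_cat HL_functor[OF rP[OF X]] HL_functor[OF rP[OF X']], where th = "%Y. LA (HC (rP X) Y) (HC (rP X') Y) (PC (rP X') (rP X) Y (ra X' X f))"])
  show "LA (HC (rP X) Y) (HC (rP X') Y) (PC (rP X') (rP X) Y (ra X' X f)): Arr DK (om (HL (rP X)) Y) (om (HL (rP X')) Y)" if Y: "Y: Ob CT" for Y
   unfolding HL_om by (rule loc_arr_in[OF HC_ob[OF pX Y] HC_ob[OF pX' Y] tm.precomp_arr[OF pX pX' Y r]])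
  fix Y Z k assume Y: "Y: Ob CT" and Z: "Z: Ob CT" and k: "k: Arr CT Y Z"
  note h = HC_ob[OF pX Y] HC_ob[OF pX Z] HC_ob[OF pX' Z] HC_ob[OF pX' Y]
  show "cmp DK (om (HL (rP X)) Y) (om (HL (rP X)) Z) (om (HL (rP X')) Z) (LA (HC (rP X) Z) (HC (rP X') Z) (PC (rP X') (rP X) Z (ra X' X f))) (mm (HL (rP X)) Y Z (LT Y Z k)) =
   cmp DK (om (HL (rP X)) Y) (om (HL (rP X')) Y) (om (HL (rP X')) Z) (mm (HL (rP X')) Y Z (LT Y Z k)) (LA (HC (rP X) Y) (HC (rP X') Y) (PC (rP X') (rP X) Y (ra X' X f)))"
   unfolding HL_om HL_LT[OF rP[OF X] Y Z k] HL_LT[OF rP[OF X'] Y Z k] LA_cmp[OF h(1,2,3) tm.hom_fnc_arr[OF pX Y Z k] tm.precomp_arr[OF pX pX' Z r]]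
    LA_cmp[OF h(1,4,3) tm.precomp_arr[OF pX pX' Y r] tm.hom_fnc_arr[OF pX' Y Z k]] tm.precomp_natural[OF pX pX' Y Z r k] ..
 qed (use Y g in simp_all)
qed (simp_all add: RHom_def Let_def Dkmod_def loc_fnc_def)

abbreviation "DL == loc_fnc_op CK qis_mod (dual_cx_fnc K)"
end

section \<open>Composites of functors and pasting of squares\<close>

lemma comp_functor:
 assumes F: "is_functor A B F" and G: "is_functor B D G"
 shows "is_functor A D \<lparr>om = (%x. om G (om F x)), mm = (%a b f. mm G (om F a) (om F b) (mm F a b f))\<rparr>"
 unfolding is_functor_def using fncD[OF F] fncD[OF G] by simp

lemma swap_functor:
 assumes S: "is_functor A B S" and A': "category A'"
 shows "is_functor (prod_cat A (op_cat A')) (prod_cat (op_cat A') B)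
  \<lparr>om = (%(x, y). (y, om S x)), mm = (%(x, y) (x', y') (f, g). (g, mm S x x' f))\<rparr>"
 unfolding is_functor_def using fncD[OF S] prod_category[OF fnc_cat(1)[OF S] op_category[OF A']] prod_category[OF op_category[OF A'] fnc_cat(2)[OF S]] by auto

text \<open>Read backwards, R goes to the opposite of D, where dualization starts. RHom(-, -)' thus
  becomes a composite of functors, and its functor laws need no computation.\<close>

lemma flip_functor:
 assumes R: "is_functor (prod_cat (op_cat A) B) D R" and A: "category A" and AB: "Ob A <= Ob B" "Arr A = Arr B" "ide A = ide B" "cmp A = cmp B"
 shows "is_functor (prod_cat A (op_cat A)) (op_cat D) \<lparr>om = om R, mm = (%a b f. mm R b a f)\<rparr>"
proof -
 have sub[simp]: "x: Ob A ==> x: Ob B" for x using AB(1) by blast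
 have "mm R (x'', y'') (x, y) (cmp A x x' x'' f' f, cmp A y'' y' y g g') = cmp D (om R (x'', y'')) (om R (x', y')) (om R (x, y)) (mm R (x', y') (x, y) (f, g)) (mm R (x'', y'') (x', y') (f', g'))"
  if "x: Ob A" "y: Ob A" "x': Ob A" "y': Ob A" "x'': Ob A" "y'': Ob A" "f: Arr A x x'" "g: Arr A y' y" "f': Arr A x' x''" "g': Arr A y'' y'" for x y x' y' x'' y'' f g f' g'
  using fnc_cmp[OF R, of "(x'', y'')" "(x', y')" "(x, y)" "(f', g')" "(f, g)"] that AB by auto
 thus ?thesis unfolding is_functor_def using fncD[OF R] prod_category[OF A op_category[OF A]] op_category AB by auto
qed

text \<open>Four commuting squares are combined. Stated with variables for all objects and arrows,
  so that the large terms of \<open>eta_natural\<close> are matched once instead of being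
  rewritten.\<close>

lemma pasting:
 assumes D: "category D" and o: "d1: Ob D" "d2: Ob D" "d3: Ob D" "d4: Ob D" "d5: Ob D" "e: Ob D" "h: Ob D" "k: Ob D" "l: Ob D"
  and a: "M: Arr D d1 d2" "G: Arr D d2 d3" "Q': Arr D d3 d4" "P': Arr D d4 d5" "Q: Arr D d2 e" "B: Arr D e d4" "QX: Arr D d1 h" "M2: Arr D h e"
   "P1: Arr D e k" "C1: Arr D k d5" "P0: Arr D h l" "C2: Arr D l k"
  and eq: "cmp D d2 d3 d4 Q' G = cmp D d2 e d4 B Q" "cmp D d1 d2 e Q M = cmp D d1 h e M2 QX" "cmp D e d4 d5 P' B = cmp D e k d5 C1 P1" "cmp D h e k P1 M2 = cmp D h l k C2 P0"
 shows "cmp D d1 d3 d5 (cmp D d3 d4 d5 P' Q') (cmp D d1 d2 d3 G M) = cmp D d1 l d5 (cmp D l k d5 C1 C2) (cmp D d1 h l P0 QX)"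
proof -
 note s = cat_assoc[OF D] and c = cat_cmp[OF D]
 have "cmp D d1 d3 d5 (cmp D d3 d4 d5 P' Q') (cmp D d1 d2 d3 G M) = cmp D d1 d4 d5 P' (cmp D d1 d2 d4 (cmp D d2 d3 d4 Q' G) M)" using s c o a by metis
 also have "... = cmp D d1 e d5 (cmp D e d4 d5 P' B) (cmp D d1 d2 e Q M)" unfolding eq(1) using s c o a by metis
 also have "... = cmp D d1 k d5 C1 (cmp D d1 h k (cmp D h e k P1 M2) QX)" unfolding eq(2,3) using s c o a by metis
 also have "... = cmp D d1 l d5 (cmp D l k d5 C1 C2) (cmp D d1 h l P0 QX)" unfolding eq(4) using s c o a by metis
 finally show ?thesis .
qed

context yon
begin

subsection \<open>The natural isomorphism\<close>

abbreviation "CF == cpy_cx_fnc :: (('k, int => 'o => 'u => 'u) mcx, int => (int => 'o => 'u => 'u) => int => 'o => 'u => 'u,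
  ('k, (int => 'o => 'u => 'u) => 'k) mcx, int => ((int => 'o => 'u => 'u) => 'k) => (int => 'o => 'u => 'u) => 'k) fnc"
abbreviation "UL == loc_fnc CK qis_mod CF"

lemma dual_om[simp]: "om (dual_cx_fnc K) = dual_cx K" by (simp add: dual_cx_fnc_def)

lemma dual_sends: "sends (op_cat CK) (%a b. qis_mod b a) qis_mod (dual_cx_fnc K)"
 unfolding sends_def op_sel dual_om by (blast intro: dual_qis)

lemmas DL_functor = loc_fnco_functor[OF dual_functor Ch_kmod_cat dual_sends]

lemma cpy_sends: "sends CK qis_mod qis_mod CF"
 unfolding sends_def cpy_fnc_sel(1) by (blast intro: cpy_qis[OF inj_delta])

lemmas UL_functor = loc_fnc_functor[OF cpy_functor[OF inj_delta] cpy_sends]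

lemma DL_LA: "X: Ob CK ==> Y: Ob CK ==> f: Arr CK X Y ==> mm DL Y X (LA X Y f) = LA (dual_cx K Y) (dual_cx K X) (DM Y X f)"
 using loc_fnco_arr[OF dual_functor dual_sends] by simp

lemma UL_LA: "X: Ob CK ==> Y: Ob CK ==> f: Arr CK X Y ==> mm UL X Y (LA X Y f) = LA (cpy_cx X) (cpy_cx Y) (mm CF X Y f)"
 using loc_fnc_arr[OF cpy_functor[OF inj_delta] cpy_sends] by (simp add: cpy_fnc_sel(1))

lemma L_om[simp]: "om DL X = dual_cx K X" "om UL Z = cpy_cx Z"
 by (simp_all add: loc_fnc_op_def loc_fnc_def cpy_fnc_sel(1))

lemma RH_sel: "om RH (X, Y) = HC (rP X) Y" "mm RH (X, Y) (X', Y') (f, g) = cmp DK (HC (rP X) Y) (HC (rP X) Y') (HC (rP X') Y')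
  (LA (HC (rP X) Y') (HC (rP X') Y') (PC (rP X') (rP X) Y' (ra X' X f))) (mm (HL (rP X)) Y Y' g)"
 by (simp_all add: RHom_def Let_def Dkmod_def)

lemma RHd_functor: "is_functor (prod_cat DP (op_cat DP)) (Dkmod K) (RHom_dual K C T)"
 unfolding Dkmod_def
proof (rule derived_functor, rule back_subst[where P = "is_functor (prod_cat DP (op_cat DP)) DK", OF comp_functor[OF flip_functor[OF RH_functor kl_cat[OF DP_klinear]] DL_functor]])
 show "Ob DP <= Ob (Dtmod K C T)" using DP_ob by auto
qed (simp_all add: RHom_dual_def Let_def case_prod_unfold)

lemma RHRD_functor: "is_functor (prod_cat DP (op_cat DP)) (Dkmod K) (RHom_RD_dual K C T)"
 unfolding Dkmod_def
 by (rule derived_functor, rule back_subst[where P = "is_functor (prod_cat DP (op_cat DP)) DK", OF comp_functor[OF comp_functor[OF swap_functor[OF RD_functor kl_cat[OF DP_klinear]] RH_functor] UL_functor]])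
  (simp add: RHom_RD_dual_def Let_def case_prod_unfold)

text \<open>RHom(X, Y) resolves only X, while RHom(Y, RD(X)') resolves Y as well. So Y is first
  replaced by its resolution through the dual of composition with \<open>rq Y\<close>, which is a
  quasi-isomorphism; then the isomorphism of complexes \<open>PsiC\<close> applies.\<close>

definition eta where
 "eta = (%(X, Y). cmp DK (dual_cx K (HC (rP X) Y)) (dual_cx K (HC (rP X) (rP Y))) (cpy_cx (HC (rP Y) (E (rP X))))
   (LA (dual_cx K (HC (rP X) (rP Y))) (cpy_cx (HC (rP Y) (E (rP X)))) (PsiC (rP X) (rP Y)))
   (LA (dual_cx K (HC (rP X) Y)) (dual_cx K (HC (rP X) (rP Y))) (DM (HC (rP X) Y) (HC (rP X) (rP Y)) (mm (HF (rP X)) (rP Y) Y (rq Y)))))"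

lemma eta_iso:
 assumes X: "X: Ob DP" and Y: "Y: Ob DP"
 shows "is_iso DK (dual_cx K (HC (rP X) Y)) (cpy_cx (HC (rP Y) (E (rP X)))) (eta (X, Y))"
proof -
 note p = rP_ob[OF X] rP_ob[OF Y] DP_ob[OF Y] E_ob[OF rP[OF X]]
 note h = HC_ob[OF p(1,2)] HC_ob[OF p(1,3)] and c = cpy_cx_ob[OF inj_delta HC_ob[OF p(2,4)]]
 note hq = tm.hom_fnc_arr[OF p(1-3) rq[OF Y]]
 have q: "qis_mod (HC (rP X) (rP Y)) (HC (rP X) Y) (mm (HF (rP X)) (rP Y) Y (rq Y))"
  using hom_sends[OF rP[OF X]] p rq[OF Y] rq_qis[OF Y] unfolding sends_def by simp
 show ?thesis unfolding eta_def prod.case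
  by (rule iso_comp[OF DK_cat, unfolded loc_sel(1), OF dual_cx_ob[OF h(2)] dual_cx_ob[OF h(1)] c loc_iso[where W = qis_mod, OF Ch_kmod_cat dual_cx_ob[OF h(2)] dual_cx_ob[OF h(1)] dual_fnc_arr[OF h hq] dual_qis[OF h hq q]]
     loc_iso[where W = qis_mod, OF Ch_kmod_cat dual_cx_ob[OF h(1)] c PsiC_arr[OF rP[OF X] p(2)] PsiC_qis[OF rP[OF X] p(2)]]])
qed

text \<open>The square splits into four: the lift of g against g itself, the interchange of
  composition on the two sides of Hom, and naturality of \<open>PsiC\<close> in its second and in
  its first variable. The last three commute on the level of complexes already.\<close>

lemma eta_natural:
 assumes X: "X: Ob DP" and Y: "Y: Ob DP" and X': "X': Ob DP" and Y': "Y': Ob DP" and f: "f: Arr DT X X'" and g: "g: Arr DT Y' Y"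
 shows "cmp DK (dual_cx K (HC (rP X) Y)) (dual_cx K (HC (rP X') Y')) (cpy_cx (HC (rP Y') (E (rP X')))) (eta (X', Y')) (mm (RHom_dual K C T) (X, Y) (X', Y') (f, g)) =
  cmp DK (dual_cx K (HC (rP X) Y)) (cpy_cx (HC (rP Y) (E (rP X)))) (cpy_cx (HC (rP Y') (E (rP X')))) (mm (RHom_RD_dual K C T) (X, Y) (X', Y') (f, g)) (eta (X, Y))"
proof -
 let ?P = "rP X" and ?P' = "rP X'" and ?Q = "rP Y" and ?Q' = "rP Y'" and ?d = "dual_cx K"
 let ?a = "ra X X' f" and ?b = "ra Y' Y g"
 note o = rP_ob[OF X] rP_ob[OF X'] rP_ob[OF Y] rP_ob[OF Y'] DP_ob[OF Y] DP_ob[OF Y'] E_ob[OF rP[OF X]] E_ob[OF rP[OF X']]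
 note s = rP[OF X] rP[OF X']
 note a = ra_in[OF X X' f] and b = ra_in[OF Y' Y g] and q = rq[OF Y] rq[OF Y']
 note h = HC_ob[OF o(1,5)] HC_ob[OF o(2,5)] HC_ob[OF o(2,6)] HC_ob[OF o(2,4)] HC_ob[OF o(2,3)] HC_ob[OF o(1,3)]
 note c = HC_ob[OF o(3,7)] HC_ob[OF o(4,8)] HC_ob[OF o(3,8)]
 note cc = cpy_cx_ob[OF inj_delta c(1)] cpy_cx_ob[OF inj_delta c(2)] cpy_cx_ob[OF inj_delta c(3)]
 note d = dual_cx_ob[OF h(1)] dual_cx_ob[OF h(2)] dual_cx_ob[OF h(3)] dual_cx_ob[OF h(4)] dual_cx_ob[OF h(5)] dual_cx_ob[OF h(6)]
 note pcY = tm.precomp_arr[OF o(2,1,5) a] and pcQ = tm.precomp_arr[OF o(2,1,3) a]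
 note H' = tm.hom_fnc_arr[OF o(2,4,6) q(2)] tm.hom_fnc_arr[OF o(2,3,5) q(1)] tm.hom_fnc_arr[OF o(2,4,3) b] tm.hom_fnc_arr[OF o(1,3,5) q(1)]
 note D = dual_fnc_arr[OF h(2,1) pcY] dual_fnc_arr[OF h(4,3) H'(1)] dual_fnc_arr[OF h(5,2) H'(2)] dual_fnc_arr[OF h(4,5) H'(3)] dual_fnc_arr[OF h(5,6) pcQ] dual_fnc_arr[OF h(6,1) H'(4)]
 note P = PsiC_arr[OF s(2) o(4)] PsiC_arr[OF s(2) o(3)] PsiC_arr[OF s(1) o(3)]
 note ea = Ea_arr[OF s a]
 note he = tm.hom_fnc_arr[OF o(3,7,8) ea] and pb = tm.precomp_arr[OF o(3,4,8) b]
 note C = cpy_cx_arr[OF inj_delta c(1,3) he] cpy_cx_arr[OF inj_delta c(3,2) pb]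
 note HL = fnc_arr[OF HL_functor[OF s(2)], simplified HL_om loc_sel(1), OF o(6,5) g]
 let ?G = "mm DL (HC ?P' Y) (HC ?P' Y') (mm (HL ?P') Y' Y g)"
 have DLc: "mm DL Z U (cmp DK U V Z k j) = cmp DK (?d Z) (?d V) (?d U) (mm DL V U j) (mm DL Z V k)"
  if "Z: Ob CK" "V: Ob CK" "U: Ob CK" "k: Arr DK V Z" "j: Arr DK U V" for Z V U k j
  using fnc_cmp[OF DL_functor, of Z V U k j] that by simp
 have G: "?G: Arr DK (?d (HC ?P' Y)) (?d (HC ?P' Y'))" using fnc_arr[OF DL_functor, of "HC ?P' Y" "HC ?P' Y'"] h HL by simp
 have l: "mm (RHom_dual K C T) (X, Y) (X', Y') (f, g) = cmp DK (?d (HC ?P Y)) (?d (HC ?P' Y)) (?d (HC ?P' Y')) ?G (LA (?d (HC ?P Y)) (?d (HC ?P' Y)) (DM (HC ?P Y) (HC ?P' Y) (PC ?P ?P' Y ?a)))"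
  unfolding DL_LA[OF h(2,1) pcY, symmetric] DLc[OF h(1,2,3) loc_arr_in[OF h(2,1) pcY] HL, symmetric] by (simp add: RHom_dual_def Let_def RH_sel)
 have r: "mm (RHom_RD_dual K C T) (X, Y) (X', Y') (f, g) = cmp DK (cpy_cx (HC ?Q (E ?P))) (cpy_cx (HC ?Q (E ?P'))) (cpy_cx (HC ?Q' (E ?P')))
   (LA (cpy_cx (HC ?Q (E ?P'))) (cpy_cx (HC ?Q' (E ?P'))) (mm CF (HC ?Q (E ?P')) (HC ?Q' (E ?P')) (PC ?Q' ?Q (E ?P') ?b)))
   (LA (cpy_cx (HC ?Q (E ?P))) (cpy_cx (HC ?Q (E ?P'))) (mm CF (HC ?Q (E ?P)) (HC ?Q (E ?P')) (mm (HF ?Q) (E ?P) (E ?P') (Ea ?P ?P' ?a))))"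
 proof -
  have "mm (RHom_RD_dual K C T) (X, Y) (X', Y') (f, g) = mm UL (HC ?Q (E ?P)) (HC ?Q' (E ?P')) (cmp DK (HC ?Q (E ?P)) (HC ?Q (E ?P')) (HC ?Q' (E ?P'))
    (LA (HC ?Q (E ?P')) (HC ?Q' (E ?P')) (PC ?Q' ?Q (E ?P') ?b)) (LA (HC ?Q (E ?P)) (HC ?Q (E ?P')) (mm (HF ?Q) (E ?P) (E ?P') (Ea ?P ?P' ?a))))"
   by (simp add: RHom_RD_dual_def Let_def RH_sel RD_sel HL_LT[OF rP[OF Y] o(7,8) ea])
  also have "... = cmp DK (om UL (HC ?Q (E ?P))) (om UL (HC ?Q (E ?P'))) (om UL (HC ?Q' (E ?P')))
    (mm UL (HC ?Q (E ?P')) (HC ?Q' (E ?P')) (LA (HC ?Q (E ?P')) (HC ?Q' (E ?P')) (PC ?Q' ?Q (E ?P') ?b))) (mm UL (HC ?Q (E ?P)) (HC ?Q (E ?P')) (LA (HC ?Q (E ?P)) (HC ?Q (E ?P')) (mm (HF ?Q) (E ?P) (E ?P') (Ea ?P ?P' ?a))))"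
   by (rule fnc_cmp[OF UL_functor]) (use c loc_arr_in[OF c(1,3) he] loc_arr_in[OF c(3,2) pb] in simp_all)
  finally show ?thesis unfolding UL_LA[OF c(3,2) pb] UL_LA[OF c(1,3) he] L_om .
 qed
 show ?thesis unfolding l r eta_def prod.case
 proof (rule pasting[OF DK_cat, unfolded loc_sel(1), OF d(1,2,3,4) cc(2) d(5,6) cc(3,1) loc_arr_in[OF d(1,2) D(1)] G loc_arr_in[OF d(3,4) D(2)] loc_arr_in[OF d(4) cc(2) P(1)]
   loc_arr_in[OF d(2,5) D(3)] loc_arr_in[OF d(5,4) D(4)] loc_arr_in[OF d(1,6) D(6)] loc_arr_in[OF d(6,5) D(5)] loc_arr_in[OF d(5) cc(3) P(2)] loc_arr_in[OF cc(3,2) C(2)]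
   loc_arr_in[OF d(6) cc(1) P(3)] loc_arr_in[OF cc(1,3) C(1)]])
  \<comment> \<open>This square commutes in the derived category only: it is the defining equation
    of the lift of g, which need not come from a chain map.\<close>
  have HLc: "cmp DK (HC ?P' ?Q') (HC ?P' Y') (HC ?P' Y) (mm (HL ?P') Y' Y g) (LA (HC ?P' ?Q') (HC ?P' Y') (mm (HF ?P') ?Q' Y' (rq Y'))) =
    cmp DK (HC ?P' ?Q') (HC ?P' ?Q) (HC ?P' Y) (LA (HC ?P' ?Q) (HC ?P' Y) (mm (HF ?P') ?Q Y (rq Y))) (LA (HC ?P' ?Q') (HC ?P' ?Q) (mm (HF ?P') ?Q' ?Q ?b))"
   unfolding HL_LT[OF s(2) o(4,6) q(2), symmetric] HL_LT[OF s(2) o(3,5) q(1), symmetric] HL_LT[OF s(2) o(4,3) b, symmetric]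
   using fnc_cmp[OF HL_functor[OF s(2)], of ?Q' Y' Y "LQ Y'" g] fnc_cmp[OF HL_functor[OF s(2)], of ?Q' ?Q Y "LT ?Q' ?Q ?b" "LQ Y"] o g LT_in[OF o(4,6) q(2)] LT_in[OF o(3,5) q(1)] LT_in[OF o(4,3) b] ra_eq[OF Y' Y g] by simp
  show "cmp DK (?d (HC ?P' Y)) (?d (HC ?P' Y')) (?d (HC ?P' ?Q')) (LA (?d (HC ?P' Y')) (?d (HC ?P' ?Q')) (DM (HC ?P' Y') (HC ?P' ?Q') (mm (HF ?P') ?Q' Y' (rq Y')))) ?G =
    cmp DK (?d (HC ?P' Y)) (?d (HC ?P' ?Q)) (?d (HC ?P' ?Q')) (LA (?d (HC ?P' ?Q)) (?d (HC ?P' ?Q')) (DM (HC ?P' ?Q) (HC ?P' ?Q') (mm (HF ?P') ?Q' ?Q ?b)))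
     (LA (?d (HC ?P' Y)) (?d (HC ?P' ?Q)) (DM (HC ?P' Y) (HC ?P' ?Q) (mm (HF ?P') ?Q Y (rq Y))))"
   unfolding DL_LA[OF h(4,3) H'(1), symmetric] DL_LA[OF h(4,5) H'(3), symmetric] DL_LA[OF h(5,2) H'(2), symmetric]
    DLc[OF h(2,3,4) HL loc_arr_in[OF h(4,3) H'(1)], symmetric] DLc[OF h(2,5,4) loc_arr_in[OF h(5,2) H'(2)] loc_arr_in[OF h(4,5) H'(3)], symmetric] HLc ..
  have Dc: "DM Z U (cmp CK U V Z k j) = cmp CK (?d Z) (?d V) (?d U) (DM V U j) (DM Z V k)"
   if "Z: Ob CK" "V: Ob CK" "U: Ob CK" "k: Arr CK V Z" "j: Arr CK U V" for Z V U k j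
   using fnc_cmp[OF dual_functor, of Z V U k j] that by simp
  show "cmp DK (?d (HC ?P Y)) (?d (HC ?P' Y)) (?d (HC ?P' ?Q)) (LA (?d (HC ?P' Y)) (?d (HC ?P' ?Q)) (DM (HC ?P' Y) (HC ?P' ?Q) (mm (HF ?P') ?Q Y (rq Y)))) (LA (?d (HC ?P Y)) (?d (HC ?P' Y)) (DM (HC ?P Y) (HC ?P' Y) (PC ?P ?P' Y ?a))) =
    cmp DK (?d (HC ?P Y)) (?d (HC ?P ?Q)) (?d (HC ?P' ?Q)) (LA (?d (HC ?P ?Q)) (?d (HC ?P' ?Q)) (DM (HC ?P ?Q) (HC ?P' ?Q) (PC ?P ?P' ?Q ?a))) (LA (?d (HC ?P Y)) (?d (HC ?P ?Q)) (DM (HC ?P Y) (HC ?P ?Q) (mm (HF ?P) ?Q Y (rq Y))))"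
   unfolding LA_cmp[OF d(1,2,5) D(1,3)] LA_cmp[OF d(1,6,5) D(6,5)] Dc[OF h(1,2,5) pcY H'(2), symmetric] Dc[OF h(1,6,5) H'(4) pcQ, symmetric] tm.precomp_natural[OF o(2,1,3,5) a q(1)] ..
  show "cmp DK (?d (HC ?P' ?Q)) (?d (HC ?P' ?Q')) (cpy_cx (HC ?Q' (E ?P'))) (LA (?d (HC ?P' ?Q')) (cpy_cx (HC ?Q' (E ?P'))) (PsiC ?P' ?Q')) (LA (?d (HC ?P' ?Q)) (?d (HC ?P' ?Q')) (DM (HC ?P' ?Q) (HC ?P' ?Q') (mm (HF ?P') ?Q' ?Q ?b))) =
    cmp DK (?d (HC ?P' ?Q)) (cpy_cx (HC ?Q (E ?P'))) (cpy_cx (HC ?Q' (E ?P'))) (LA (cpy_cx (HC ?Q (E ?P'))) (cpy_cx (HC ?Q' (E ?P'))) (mm CF (HC ?Q (E ?P')) (HC ?Q' (E ?P')) (PC ?Q' ?Q (E ?P') ?b))) (LA (?d (HC ?P' ?Q)) (cpy_cx (HC ?Q (E ?P'))) (PsiC ?P' ?Q))"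
   unfolding LA_cmp[OF d(5,4) cc(2) D(4) P(1)] LA_cmp[OF d(5) cc(3,2) P(2) C(2)] PsiC_pre[OF s(2) o(4,3) b] ..
  show "cmp DK (?d (HC ?P ?Q)) (?d (HC ?P' ?Q)) (cpy_cx (HC ?Q (E ?P'))) (LA (?d (HC ?P' ?Q)) (cpy_cx (HC ?Q (E ?P'))) (PsiC ?P' ?Q)) (LA (?d (HC ?P ?Q)) (?d (HC ?P' ?Q)) (DM (HC ?P ?Q) (HC ?P' ?Q) (PC ?P ?P' ?Q ?a))) =
    cmp DK (?d (HC ?P ?Q)) (cpy_cx (HC ?Q (E ?P))) (cpy_cx (HC ?Q (E ?P'))) (LA (cpy_cx (HC ?Q (E ?P))) (cpy_cx (HC ?Q (E ?P'))) (mm CF (HC ?Q (E ?P)) (HC ?Q (E ?P')) (mm (HF ?Q) (E ?P) (E ?P') (Ea ?P ?P' ?a)))) (LA (?d (HC ?P ?Q)) (cpy_cx (HC ?Q (E ?P))) (PsiC ?P ?Q))"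
   unfolding LA_cmp[OF d(6,5) cc(3) D(5) P(2)] LA_cmp[OF d(6) cc(1,3) P(3) C(1)] PsiC_post[OF s o(3) a] ..
 qed
qed

lemma eta_natural_iso: "natural_iso (prod_cat DP (op_cat DP)) (Dkmod K) (RHom_dual K C T) (RHom_RD_dual K C T) eta"
proof -
 have o: "om (RHom_dual K C T) (X, Y) = dual_cx K (HC (rP X) Y)" "om (RHom_RD_dual K C T) (X, Y) = cpy_cx (HC (rP Y) (E (rP X)))" for X Y
  by (simp_all add: RHom_dual_def RHom_RD_dual_def Let_def RH_sel RD_sel)
 show ?thesis unfolding natural_iso_def
  using RHd_functor RHRD_functor eta_iso eta_natural by (auto simp: o Dkmod_def is_iso_def inverse_arrows_def)
qed

subsection \<open>Serre duality\<close>

text \<open>The inverse of \<open>Psi\<close> in degree 0: a family Y -> E(P) is read as a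
  functional on the families P -> Y.\<close>

definition Al where "Al P Y = the_inv_into (lin K (hm P Y 0) KK) (Psi P Y 0)"

context
 fixes P Y :: "('k, 'o, 'm, 'u) fcx" assumes P: "sp P" and Y: "Y: Ob CT"
begin

lemma Psi_bij0: "bij_betw (Psi P Y 0) (lin K (hm P Y 0) KK) (carrier (hm Y (E P) 0))"
 using Psi_bij[OF P Y, of 0] by simp

lemma Al_in: "g <: (hm Y (E P) 0) ==> Al P Y g: lin K (hm P Y 0) KK"
 and Psi_Al: "g <: (hm Y (E P) 0) ==> Psi P Y 0 (Al P Y g) = g"
 and Al_Psi: "al: lin K (hm P Y 0) KK ==> Al P Y (Psi P Y 0 al) = al"
 unfolding Al_def using Psi_bij0 the_inv_into_into[OF bij_betw_imp_inj_on[OF Psi_bij0]] f_the_inv_into_f_bij_betw[OF Psi_bij0] the_inv_into_f_f[OF bij_betw_imp_inj_on[OF Psi_bij0]]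
 unfolding bij_betw_def by blast+

lemma hm_chain: "f: Arr CT P Y ==> f <: (hm P Y 0)" "g: Arr CT Y (E P) ==> g <: (hm Y (E P) 0)"
 using tm.chain_hom[OF sp_ob[OF P] Y] tm.chain_hom[OF Y E_ob[OF P]] by blast+

text \<open>\<open>Psi\<close> is an isomorphism of complexes, so chain maps correspond to cocycles
  of the dual complex, and a functional is a cocycle there when it vanishes on boundaries.\<close>

lemma Psi_chain:
 assumes a: "al: lin K (hm P Y 0) KK"
 shows "Psi P Y 0 al: Arr CT Y (E P) \<longleftrightarrow> (ALL k:carrier (hm P Y (- 1)). al (tm.dh P Y (- 1) k) = \<zero>)"
proof -
 let ?g = "cd (dual_cx K (HC P Y)) 0 al"
 note hc = HC_ob[OF sp_ob[OF P] Y] and M = hm_mod[OF P Y] and N = tm.module_hom_mod[OF Y E_ob[OF P]]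
 have g: "?g: lin K (hm P Y (- 1)) KK" using dual_d_in[OF hc, of al 0] a by simp
 have gk: "?g k = \<ominus> al (tm.dh P Y (- 1) k)" and ak: "al (tm.dh P Y (- 1) k) <: K" if k: "k <: (hm P Y (- 1))" for k
 proof -
  show ak: "al (tm.dh P Y (- 1) k) <: K" using dual_app[OF a, of "tm.dh P Y (- 1) k"] tm.dh_in[OF sp_ob[OF P] Y k] by simp
  show "?g k = \<ominus> al (tm.dh P Y (- 1) k)" using dual_d_app[OF hc, of al 0 k] a k ak tm.hom_cx_sel(2)[OF k] by (simp add: signed_def del: tm.hom_mod_sel)
 qed
 have z: "Psi P Y 1 0[dual K (hm P Y (- 1))] = 0[hm Y (E P) 1]" and zi: "0[dual K (hm P Y (- 1))]: lin K (hm P Y (- 1)) KK"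
  using lin_0[OF module_dual[OF M] N Psi_lin[OF P Y, of 1]] mod_zero[OF module_dual[OF M[of "- 1"]]] by (simp_all add: dual_sel del: tm.hom_mod_sel)
 have "Psi P Y 0 al: Arr CT Y (E P) \<longleftrightarrow> Psi P Y 1 ?g = 0[hm Y (E P) 1]"
  using tm.chain_hom[OF Y E_ob[OF P]] Psi_in[OF P Y, of al 0] Psi_comm[OF P Y, of al 0] a by (simp del: tm.hom_mod_sel)
 also have "... \<longleftrightarrow> ?g = 0[dual K (hm P Y (- 1))]" using inj_on_eq_iff[OF bij_betw_imp_inj_on[OF Psi_bij[OF P Y, of 1]] g zi] z by simp
 also have "... \<longleftrightarrow> (ALL k:carrier (hm P Y (- 1)). ?g k = \<zero>)" using lin_ext[OF g zi] by (auto simp: dual_0 simp del: tm.hom_mod_sel)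
 also have "... \<longleftrightarrow> (ALL k:carrier (hm P Y (- 1)). al (tm.dh P Y (- 1) k) = \<zero>)" using gk ak by (auto simp del: tm.hom_mod_sel)
 finally show ?thesis .
qed

text \<open>Homotopic chain maps correspond to functionals that differ by some de composed with the
  differential, and such composites vanish on cocycles. Together with \<open>Psi_chain\<close>,
  homotopy classes of chain maps Y -> E(P) become functionals on cocycles modulo boundaries.\<close>

lemma Psi_htp:
 assumes a: "al: lin K (hm P Y 0) KK" and b: "be: lin K (hm P Y 0) KK"
 shows "tm.htp Y (E P) (Psi P Y 0 al) (Psi P Y 0 be) \<longleftrightarrow> (ALL v:Arr CT P Y. al v = be v)"
proof -
 let ?c = "%de. cd (dual_cx K (HC P Y)) (- 1) de" and ?D = "dual K (hm P Y 0)"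
 note o = sp_ob[OF P]
 note hc = HC_ob[OF o Y] and M = hm_mod[OF P Y]
 have c: "?c de: lin K (hm P Y 0) KK" and cv: "!!v. v <: (hm P Y 0) ==> ?c de v = de (tm.dh P Y 0 v)"
  and cP: "tm.dh Y (E P) (- 1) (Psi P Y (- 1) de) = Psi P Y 0 (?c de)" if d: "de: lin K (hm P Y 1) KK" for de
  using dual_d_in[OF hc, of de "- 1"] dual_d_app[OF hc, of de "- 1"] tm.hom_cx_sel(2)[of _ P Y 0] Psi_comm[OF P Y, of de "- 1"] d by (simp_all add: signed_def del: tm.hom_mod_sel)
 have s: "Psi P Y 0 (ga +[?D] ga') = Psi P Y 0 ga +[hm Y (E P) 0] Psi P Y 0 ga'" "ga +[?D] ga': lin K (hm P Y 0) KK" if "ga: lin K (hm P Y 0) KK" "ga': lin K (hm P Y 0) KK" for ga ga'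
  using lin_add[OF Psi_lin[OF P Y, of 0], of ga ga'] mod_add[OF module_dual[OF M[of 0]], of ga ga'] that by (simp_all add: dual_sel del: tm.hom_mod_sel)
 note inj = bij_betw_imp_inj_on[OF Psi_bij0]
 show ?thesis
 proof
  assume "tm.htp Y (E P) (Psi P Y 0 al) (Psi P Y 0 be)"
  then obtain k where k: "k <: (hm Y (E P) (- 1))" "Psi P Y 0 al = Psi P Y 0 be +[hm Y (E P) 0] tm.dh Y (E P) (- 1) k" using tm.htp_hom[OF Y E_ob[OF P]] by blast
  obtain de where d: "de: lin K (hm P Y 1) KK" "k = Psi P Y (- 1) de" using Psi_bij[OF P Y, of "- 1"] k(1) unfolding bij_betw_def by (auto simp del: tm.hom_mod_sel)
  have "al = be +[?D] ?c de" by (rule inj_onD[OF inj _ a s(2)[OF b c[OF d(1)]]]) (use k(2) d cP s(1)[OF b c[OF d(1)]] in simp)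
  thus "ALL v:Arr CT P Y. al v = be v"
   using hm_chain(1) cv[OF d(1)] tm.chain_hom[OF o Y] lin_0[OF M module_ground d(1)] dual_app[OF b] by (simp add: dual_add del: tm.hom_mod_sel)
 next
  assume e: "ALL v:Arr CT P Y. al v = be v"
  note K = dual_app[OF a] dual_app[OF b]
  \<comment> \<open>Since al - be vanishes on cocycles it descends to the image of the differential;
    extending it to all of degree 1 gives the de that is needed.\<close>
  let ?R = "{(tm.dh P Y 0 v, al v \<ominus> be v) | v. v <: (hm P Y 0)}"
  note d = tm.dh_lin[OF o Y, of 0, simplified]
  have dv: "tm.dh P Y 0 v = cd (HC P Y) 0 v" if "v <: (hm P Y 0)" for v using tm.hom_cx_sel(2)[OF that] by simp
  have "lin_rel (hm P Y 1) ?R" unfolding lin_rel_def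
  proof (intro conjI allI impI)
   show "?R <= carrier (hm P Y 1) \<times> carrier K" using tm.dh_in[OF o Y, of _ 0] K by (auto simp del: tm.hom_mod_sel)
   show "(0[hm P Y 1], \<zero>): ?R" using mod_zero[OF M, of 0] dv lin_0[OF M M d] lin_0[OF M module_ground a] lin_0[OF M module_ground b]
    by (intro CollectI exI[of _ "0[hm P Y 0]"]) (simp add: minus_eq del: tm.hom_mod_sel tm.hom_cx_sel(2))
   fix v c w e assume "(v, c): ?R & (w, e): ?R"
   then obtain x y where x: "x <: (hm P Y 0)" "v = tm.dh P Y 0 x" "c = al x \<ominus> be x" and y: "y <: (hm P Y 0)" "w = tm.dh P Y 0 y" "e = al y \<ominus> be y" by blast
   show "(v +[hm P Y 1] w, c \<oplus> e): ?R" using mod_add[OF M x(1) y(1)] dv lin_add[OF d x(1) y(1)] lin_add[OF a x(1) y(1)] lin_add[OF b x(1) y(1)] K[OF x(1)] K[OF y(1)] x y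
    by (intro CollectI exI[of _ "x +[hm P Y 0] y"]) (simp add: minus_eq minus_add a_ac del: tm.hom_mod_sel tm.hom_cx_sel(2))
  next
   fix v c k assume "(v, c): ?R & k <: K"
   then obtain x where x: "x <: (hm P Y 0)" "v = tm.dh P Y 0 x" "c = al x \<ominus> be x" and k: "k <: K" by blast
   show "(k *[hm P Y 1] v, k \<otimes> c): ?R" using mod_sm[OF M k x(1)] dv lin_sm[OF d k x(1)] lin_sm[OF a k x(1)] lin_sm[OF b k x(1)] K[OF x(1)] x k
    by (intro CollectI exI[of _ "k *[hm P Y 0] x"]) (simp add: minus_eq r_distr r_minus del: tm.hom_mod_sel tm.hom_cx_sel(2))
  next
   fix c assume "(0[hm P Y 1], c): ?R"
   then obtain x where x: "x <: (hm P Y 0)" "tm.dh P Y 0 x = 0[hm P Y 1]" "c = al x \<ominus> be x" by (auto simp del: tm.hom_mod_sel)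
   hence "al x = be x" using e tm.chain_hom[OF o Y, of x] by blast
   thus "c = \<zero>" using x K[OF x(1)] by (simp add: minus_eq r_neg)
  qed
  then obtain de where dl: "de: lin K (hm P Y 1) KK" "!!v c. (v, c): ?R ==> de v = c" using extend_functional[OF M] by blast
  have "al = be +[?D] ?c de"
  proof (rule lin_ext[OF a s(2)[OF b c[OF dl(1)]]])
   fix v assume v: "v <: (hm P Y 0)"
   have "de (tm.dh P Y 0 v) = al v \<ominus> be v" using dl(2) v by blast
   thus "al v = (be +[?D] ?c de) v" using cv[OF dl(1) v] v K[OF v] by (simp add: dual_add minus_eq a_lcomm r_neg del: tm.hom_mod_sel)
  qed
  hence "Psi P Y 0 al = Psi P Y 0 be +[hm Y (E P) 0] tm.dh Y (E P) (- 1) (Psi P Y (- 1) de)" using s(1)[OF b c[OF dl(1)]] cP[OF dl(1)] by simp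
  moreover have "Psi P Y (- 1) de <: (hm Y (E P) (- 1))" by (rule Psi_in[OF P Y]) (use dl in simp)
  ultimately show "tm.htp Y (E P) (Psi P Y 0 al) (Psi P Y 0 be)" using tm.htp_hom[OF Y E_ob[OF P]] by blast
 qed
qed

end

text \<open>A chain map g representing h is read as a functional on families \<open>rP a\<close> ->
  \<open>rP b\<close> and evaluated at the chosen lift of t. The choices of g and of the lift are
  harmless by \<open>ph_val\<close>.\<close>

definition ph where
 "ph a b = (\<lambda>h\<in>Arr DT b (om RD a). \<lambda>t\<in>Arr DT a b. Al (rP a) (rP b) (SOME g. g: Arr CT (rP b) (E (rP a)) & pi b (om RD a) g = h) (ra a b t))"

context
 fixes a b assumes a: "a: Ob DP" and b: "b: Ob DP"
begin

lemmas ab = rP_ob[OF a] rP_ob[OF b] DP_ob[OF b] E_ob[OF rP[OF a]]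

abbreviation (input) "vt v == pi a b (cmp CT (rP a) (rP b) b (rq b) v)"

lemma qv: "v: Arr CT (rP a) (rP b) ==> cmp CT (rP a) (rP b) b (rq b) v: Arr CT (rP a) b" by (rule ct_cmp[OF ab(1-3) _ rq[OF b]])

lemma vt:
 shows vt_in: "v: Arr CT (rP a) (rP b) ==> vt v: Arr DT a b"
  and vt_add: "v: Arr CT (rP a) (rP b) ==> w: Arr CT (rP a) (rP b) ==> vt (v +[chain_mod TM (rP a) (rP b)] w) = vt v +[homm DP a b] vt w"
  and vt_sm: "v: Arr CT (rP a) (rP b) ==> c <: K ==> vt (c *[chain_mod TM (rP a) (rP b)] v) = c *[homm DP a b] vt v"
  and vt_0: "vt 0[chain_mod TM (rP a) (rP b)] = 0[homm DP a b]"
proof -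
 interpret ct: kl K CT by unfold_locales (rule tm.Ch_klinear)
 note q = rq[OF b]
 show "v: Arr CT (rP a) (rP b) ==> vt v: Arr DT a b" by (rule pi_in[OF a ab(3) qv])
 show "v: Arr CT (rP a) (rP b) ==> w: Arr CT (rP a) (rP b) ==> vt (v +[chain_mod TM (rP a) (rP b)] w) = vt v +[homm DP a b] vt w"
  unfolding tm.Ch_sel(3)[symmetric] ct.A_bil(1)[OF ab(1-3) _ _ q] unfolding tm.Ch_sel(3) by (rule pi_add[OF a ab(3) qv qv, symmetric])
 show "v: Arr CT (rP a) (rP b) ==> c <: K ==> vt (c *[chain_mod TM (rP a) (rP b)] v) = c *[homm DP a b] vt v"
  unfolding tm.Ch_sel(3)[symmetric] ct.A_bil(3)[OF ab(1-3) _ _ q] unfolding tm.Ch_sel(3) by (rule pi_sm[OF a ab(3) qv, symmetric])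
 show "vt 0[chain_mod TM (rP a) (rP b)] = 0[homm DP a b]"
  unfolding tm.Ch_sel(3)[symmetric] ct.A_bil(7)[OF ab(1-3) q] unfolding tm.Ch_sel(3) by (rule pi_zero[OF a ab(3), symmetric])
qed

lemma chain_zero_add: "f <: (hm X Z 0) ==> g <: (hm X Z 0) ==> f +[chain_mod TM X Z] g = f +[hm X Z 0] g"
 "c *[chain_mod TM X Z] f = c *[hm X Z 0] f" "0[chain_mod TM X Z] = 0[hm X Z 0]"
 by simp_all

text \<open>Replacing g by a homotopic map changes its functional by one that vanishes on chain maps
  (\<open>Psi_htp\<close>). Replacing v by a homotopic lift adds a boundary, and there the
  functional of a chain map is zero (\<open>Psi_chain\<close>).\<close>

lemma ph_val:
 assumes g: "g: Arr CT (rP b) (E (rP a))" and v: "v: Arr CT (rP a) (rP b)"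
 shows "ph a b (pi b (om RD a) g) (vt v) = Al (rP a) (rP b) g v"
proof -
 let ?g = "SOME g'. g': Arr CT (rP b) (E (rP a)) & pi b (om RD a) g' = pi b (om RD a) g"
 let ?A = "Al (rP a) (rP b)" and ?t = "vt v"
 have g': "?g: Arr CT (rP b) (E (rP a)) & pi b (om RD a) ?g = pi b (om RD a) g" by (rule someI[of _ g]) (use g in simp)
 note hc = hm_chain[OF rP[OF a] ab(2)]
 note A = Al_in[OF rP[OF a] ab(2) hc(2)] and PA = Psi_Al[OF rP[OF a] ab(2) hc(2)]
 note t = vt_in[OF v]
 note r = ra_in[OF a b t]
 have "tm.htp (rP b) (E (rP a)) ?g g" using pi_eq_iff[OF b ab(4), of ?g g] g' g by (simp add: RD_sel)
 hence "?A ?g (ra a b ?t) = ?A g (ra a b ?t)"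
  using Psi_htp[OF rP[OF a] ab(2) A A, of ?g g] PA[of ?g] PA[OF g] g' g r by simp
 moreover have "tm.htp (rP a) (rP b) (ra a b ?t) v"
  by (rule ra_htp[OF a b t v]) (use pi_q[OF a ab(3) qv[OF v]] LT_cmp[OF ab(1-3) v rq[OF b]] in simp)
 then obtain k where k: "k <: (hm (rP a) (rP b) (- 1))" "ra a b ?t = v +[hm (rP a) (rP b) 0] tm.dh (rP a) (rP b) (- 1) k" using tm.htp_hom[OF ab(1,2)] by blast
 have "?A g (ra a b ?t) = ?A g v"
 proof -
  have "?A g (tm.dh (rP a) (rP b) (- 1) k) = \<zero>" using Psi_chain[OF rP[OF a] ab(2) A[OF g]] PA[OF g] g k(1) by simp
  moreover have "tm.dh (rP a) (rP b) (- 1) k <: (hm (rP a) (rP b) 0)" using tm.dh_in[OF ab(1,2) k(1)] by simp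
  ultimately show ?thesis using lin_add[OF A[OF g] hc(1)[OF v]] k(2) dual_app[OF A[OF g] hc(1)[OF v]] by (simp del: tm.hom_mod_sel)
 qed
 ultimately show ?thesis using pi_in[OF b ab(4) g] t by (simp add: ph_def RD_sel)
qed

lemma Arr_vt: "t: Arr DT a b ==> EX v:Arr CT (rP a) (rP b). t = vt v"
 using ra_pi[OF a b] ra_in[OF a b] by metis

lemma Arr_pi: "h: Arr DT b (om RD a) ==> EX g:Arr CT (rP b) (E (rP a)). h = pi b (om RD a) g"
 using pi_surj[OF b ab(4)] unfolding RD_sel by metis

lemma ct_mod: "X: Ob CT ==> Z: Ob CT ==> f: Arr CT X Z ==> g: Arr CT X Z ==> f +[chain_mod TM X Z] g: Arr CT X Z"
 "X: Ob CT ==> Z: Ob CT ==> f: Arr CT X Z ==> c <: K ==> c *[chain_mod TM X Z] f: Arr CT X Z" "X: Ob CT ==> Z: Ob CT ==> 0[chain_mod TM X Z]: Arr CT X Z"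
 using mod_add[OF tm.chain_module] mod_sm[OF tm.chain_module] mod_zero[OF tm.chain_module] by (simp_all only: tm.Ch_sel(7))

text \<open>By \<open>Psi_chain\<close> and \<open>Psi_htp\<close> the arrows b -> RD(a)' are
  functionals that vanish on boundaries, modulo those that also vanish on cocycles. This is the dual
  of the cohomology of the Hom complex in degree 0, that is, of Hom(a, b). Surjectivity asks for an
  extension from cocycles to all families.\<close>

lemma ph_iso: "lin_iso K (homm (Dtmod K C T) b (om RD a)) (dual K (homm DP a b)) (ph a b)"
 unfolding lin_iso_def
proof
 note hc = hm_chain[OF rP[OF a] ab(2)]
 note A = Al_in[OF rP[OF a] ab(2) hc(2)] and PA = Psi_Al[OF rP[OF a] ab(2) hc(2)] and AP = Al_Psi[OF rP[OF a] ab(2)]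
 note m = homm_module[OF a ab(3)] homm_carrier[OF a ab(3)] homm_module[OF b ab(4)] homm_carrier[OF b ab(4)]
 note M = hm_mod[OF rP[OF a] ab(2)]
 let ?S = "E (rP a)"
 have phD: "ph a b h: lin K (homm DP a b) KK" if h: "h: Arr DT b (om RD a)" for h
 proof -
  obtain g where g: "g: Arr CT (rP b) ?S" "h = pi b (om RD a) g" using Arr_pi[OF h] by blast
  note V = ph_val[OF g(1)] and Al = A[OF g(1)]
  show ?thesis
  proof (rule linI; unfold m(2))
   show "ph a b h t = undefined" if "t \<notin> Arr DT a b" for t using h that by (simp add: ph_def)
   fix t assume t: "t: Arr DT a b"
   obtain v where v: "v: Arr CT (rP a) (rP b)" "t = vt v" using Arr_vt[OF t] by blast
   show "ph a b h t <: KK" unfolding g(2) v(2) V[OF v(1)] using dual_app[OF Al hc(1)[OF v(1)]] by simp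
   show "ph a b h (t +[homm DP a b] s) = ph a b h t +[KK] ph a b h s" if s: "s: Arr DT a b" for s
   proof -
    obtain w where w: "w: Arr CT (rP a) (rP b)" "s = vt w" using Arr_vt[OF s] by blast
    show ?thesis unfolding g(2) v(2) w(2) vt_add[OF v(1) w(1), symmetric] V[OF v(1)] V[OF w(1)] V[OF ct_mod(1)[OF ab(1,2) v(1) w(1)]]
     unfolding chain_zero_add(1)[OF hc(1)[OF v(1)] hc(1)[OF w(1)]] by (rule lin_add[OF Al hc(1)[OF v(1)] hc(1)[OF w(1)]])
   qed
   show "ph a b h (c *[homm DP a b] t) = c *[KK] ph a b h t" if c: "c <: K" for c
    unfolding g(2) v(2) vt_sm[OF v(1) c, symmetric] V[OF v(1)] V[OF ct_mod(2)[OF ab(1,2) v(1) c]] unfolding chain_zero_add(2) by (rule lin_sm[OF Al c hc(1)[OF v(1)]])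
  qed
 qed
 show "ph a b: lin K (homm (Dtmod K C T) b (om RD a)) (dual K (homm DP a b))"
 proof (rule linI; unfold DP_sel(4)[symmetric] RD_sel(1) m(4) dual_sel)
  note md = module_dual[OF m(1)]
  note phD' = phD[unfolded RD_sel]
  show "ph a b h = undefined" if "h \<notin> Arr DT b ?S" for h using that by (simp add: ph_def RD_sel)
  fix h assume h: "h: Arr DT b ?S"
  show "ph a b h: lin K (homm DP a b) KK" by (rule phD'[OF h])
  obtain g where g: "g: Arr CT (rP b) ?S" "h = pi b ?S g" using Arr_pi h by (auto simp: RD_sel)
  { fix h' assume h': "h': Arr DT b ?S"
   obtain g' where g': "g': Arr CT (rP b) ?S" "h' = pi b ?S g'" using Arr_pi h' by (auto simp: RD_sel)
   note gg = ct_mod(1)[OF ab(2,4) g(1) g'(1)]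
   have sum: "Al (rP a) (rP b) (g +[hm (rP b) ?S 0] g') = Al (rP a) (rP b) g +[dual K (hm (rP a) (rP b) 0)] Al (rP a) (rP b) g'"
    using AP[of "Al (rP a) (rP b) g +[dual K (hm (rP a) (rP b) 0)] Al (rP a) (rP b) g'"] lin_add[OF Psi_lin[OF rP[OF a] ab(2), of 0], of "Al (rP a) (rP b) g" "Al (rP a) (rP b) g'"]
     mod_add[OF module_dual[OF M[of 0]], of "Al (rP a) (rP b) g" "Al (rP a) (rP b) g'"] A[OF g(1)] A[OF g'(1)] PA[OF g(1)] PA[OF g'(1)] by (simp add: dual_sel del: tm.hom_mod_sel)
   have hh: "h +[homm DP b ?S] h' = pi b ?S (g +[chain_mod TM (rP b) ?S] g')" unfolding g(2) g'(2) by (rule pi_add[OF b ab(4) g(1) g'(1)])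
   show "ph a b (h +[homm DP b ?S] h') = ph a b h +[dual K (homm DP a b)] ph a b h'"
   proof (rule lin_ext[OF phD'])
    show "h +[homm DP b ?S] h': Arr DT b ?S" unfolding hh by (rule pi_in[OF b ab(4) gg])
    show "ph a b h +[dual K (homm DP a b)] ph a b h': lin K (homm DP a b) KK" using mod_add[OF md] phD'[OF h] phD'[OF h'] by (simp add: dual_sel)
    fix t assume "t <: (homm DP a b)"
    hence t: "t: Arr DT a b" using m(2) by simp
    obtain v where v: "v: Arr CT (rP a) (rP b)" "t = vt v" using Arr_vt[OF t] by blast
    have "ph a b (h +[homm DP b ?S] h') t = ph a b h t \<oplus> ph a b h' t"
     unfolding hh unfolding g(2) g'(2) v(2) ph_val[OF gg v(1), unfolded RD_sel] ph_val[OF g(1) v(1), unfolded RD_sel] ph_val[OF g'(1) v(1), unfolded RD_sel]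
      unfolding chain_zero_add(1)[OF hc(2)[OF g(1)] hc(2)[OF g'(1)]] sum by (rule dual_add[OF hc(1)[OF v(1)]])
    thus "ph a b (h +[homm DP b ?S] h') t = (ph a b h +[dual K (homm DP a b)] ph a b h') t" using dual_add[of t "homm DP a b"] t m(2) by simp
   qed }
  fix c assume c: "c <: K"
  note cg = ct_mod(2)[OF ab(2,4) g(1) c]
  have sum: "Al (rP a) (rP b) (c *[hm (rP b) ?S 0] g) = c *[dual K (hm (rP a) (rP b) 0)] Al (rP a) (rP b) g"
   using AP[of "c *[dual K (hm (rP a) (rP b) 0)] Al (rP a) (rP b) g"] lin_sm[OF Psi_lin[OF rP[OF a] ab(2), of 0] c, of "Al (rP a) (rP b) g"]
    mod_sm[OF module_dual[OF M[of 0]] c, of "Al (rP a) (rP b) g"] A[OF g(1)] PA[OF g(1)] by (simp add: dual_sel del: tm.hom_mod_sel)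
  have hh: "c *[homm DP b ?S] h = pi b ?S (c *[chain_mod TM (rP b) ?S] g)" unfolding g(2) by (rule pi_sm[OF b ab(4) g(1) c])
  show "ph a b (c *[homm DP b ?S] h) = c *[dual K (homm DP a b)] ph a b h"
  proof (rule lin_ext[OF phD'])
   show "c *[homm DP b ?S] h: Arr DT b ?S" unfolding hh by (rule pi_in[OF b ab(4) cg])
   show "c *[dual K (homm DP a b)] ph a b h: lin K (homm DP a b) KK" using mod_sm[OF md c] phD'[OF h] by (simp add: dual_sel)
   fix t assume "t <: (homm DP a b)"
   hence t: "t: Arr DT a b" using m(2) by simp
   obtain v where v: "v: Arr CT (rP a) (rP b)" "t = vt v" using Arr_vt[OF t] by blast
   have "ph a b (c *[homm DP b ?S] h) t = c \<otimes> ph a b h t"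
    unfolding hh unfolding g(2) v(2) ph_val[OF cg v(1), unfolded RD_sel] ph_val[OF g(1) v(1), unfolded RD_sel] unfolding chain_zero_add(2) sum by (rule dual_sm[OF hc(1)[OF v(1)]])
   thus "ph a b (c *[homm DP b ?S] h) t = (c *[dual K (homm DP a b)] ph a b h) t" using dual_sm[of t "homm DP a b"] t m(2) by simp
  qed
 qed
 show "bij_betw (ph a b) (carrier (homm (Dtmod K C T) b (om RD a))) (carrier (dual K (homm DP a b)))"
  unfolding DP_sel(4)[symmetric] RD_sel(1) m(4) dual_sel
 proof (intro bij_betwI' phD[unfolded RD_sel])
  fix h h' assume h: "h: Arr DT b ?S" and h': "h': Arr DT b ?S"
  obtain g where g: "g: Arr CT (rP b) ?S" "h = pi b ?S g" using Arr_pi h by (auto simp: RD_sel)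
  obtain g' where g': "g': Arr CT (rP b) ?S" "h' = pi b ?S g'" using Arr_pi h' by (auto simp: RD_sel)
  show "ph a b h = ph a b h' \<longleftrightarrow> h = h'"
  proof
   assume "ph a b h = ph a b h'"
   hence "ALL v:Arr CT (rP a) (rP b). Al (rP a) (rP b) g v = Al (rP a) (rP b) g' v" using ph_val[OF g(1), unfolded RD_sel] ph_val[OF g'(1), unfolded RD_sel] g(2) g'(2) by metis
   hence "tm.htp (rP b) ?S g g'" using Psi_htp[OF rP[OF a] ab(2) A[OF g(1)] A[OF g'(1)]] PA[OF g(1)] PA[OF g'(1)] by simp
   thus "h = h'" unfolding g(2) g'(2) using pi_eq_iff[OF b ab(4) g(1) g'(1)] by simp
  qed simp
 next
  fix ta assume t: "ta: lin K (homm DP a b) KK"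
  \<comment> \<open>The given functional on Hom(a, b) is pulled back to chain maps between the
    resolutions, and from this subspace it is extended to all families of degree 0.\<close>
  let ?R = "{(v, ta (vt v)) | v. v: Arr CT (rP a) (rP b)}"
  have vc: "v: Arr CT (rP a) (rP b) ==> vt v <: (homm DP a b)" for v using vt_in m(2) by simp
  have t0: "ta (vt 0[chain_mod TM (rP a) (rP b)]) = \<zero>" unfolding vt_0 using lin_0[OF m(1) module_ground t] by simp
  have "lin_rel (hm (rP a) (rP b) 0) ?R" unfolding lin_rel_def
  proof (intro conjI allI impI)
   show "?R <= carrier (hm (rP a) (rP b) 0) \<times> carrier K" using hc(1) dual_app[OF t vc] by blast
   show "(0[hm (rP a) (rP b) 0], \<zero>): ?R" using ct_mod(3)[OF ab(1,2)] t0 chain_zero_add(3)[of "rP a" "rP b"] by (metis (mono_tags, lifting) CollectI)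
   fix v c w d assume "(v, c): ?R & (w, d): ?R"
   hence v: "v: Arr CT (rP a) (rP b)" "c = ta (vt v)" and w: "w: Arr CT (rP a) (rP b)" "d = ta (vt w)" by blast+
   have "c \<oplus> d = ta (vt (v +[hm (rP a) (rP b) 0] w))" unfolding chain_zero_add(1)[OF hc(1)[OF v(1)] hc(1)[OF w(1)], symmetric] vt_add[OF v(1) w(1)] lin_add[OF t vc[OF v(1)] vc[OF w(1)]] using v w by simp
   moreover have "v +[hm (rP a) (rP b) 0] w: Arr CT (rP a) (rP b)" using ct_mod(1)[OF ab(1,2) v(1) w(1)] unfolding chain_zero_add(1)[OF hc(1)[OF v(1)] hc(1)[OF w(1)]] .
   ultimately show "(v +[hm (rP a) (rP b) 0] w, c \<oplus> d): ?R" by blast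
  next
   fix v c k assume "(v, c): ?R & k <: K"
   hence v: "v: Arr CT (rP a) (rP b)" "c = ta (vt v)" and k: "k <: K" by blast+
   have "k \<otimes> c = ta (vt (k *[hm (rP a) (rP b) 0] v))" unfolding chain_zero_add(2)[symmetric] vt_sm[OF v(1) k] lin_sm[OF t k vc[OF v(1)]] using v by simp
   moreover have "k *[hm (rP a) (rP b) 0] v: Arr CT (rP a) (rP b)" using ct_mod(2)[OF ab(1,2) v(1) k] unfolding chain_zero_add(2) .
   ultimately show "(k *[hm (rP a) (rP b) 0] v, k \<otimes> c): ?R" by blast
  next
   fix c assume "(0[hm (rP a) (rP b) 0], c): ?R"
   hence "c = ta (vt 0[hm (rP a) (rP b) 0])" by blast
   thus "c = \<zero>" using t0 unfolding chain_zero_add(3) by simp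
  qed
  then obtain al where al: "al: lin K (hm (rP a) (rP b) 0) KK" "!!v c. (v, c): ?R ==> al v = c" using extend_functional[OF M] by blast
  have av: "v: Arr CT (rP a) (rP b) ==> al v = ta (vt v)" for v using al(2) by blast
  \<comment> \<open>A boundary is a null-homotopic chain map, hence the zero arrow of the derived
    category.\<close>
  have "al (tm.dh (rP a) (rP b) (- 1) k) = \<zero>" if k: "k <: (hm (rP a) (rP b) (- 1))" for k
  proof -
   let ?k = "tm.dh (rP a) (rP b) (- 1) k"
   have k0: "?k <: (hm (rP a) (rP b) 0)" using tm.dh_in[OF ab(1,2) k] by simp
   have kc: "?k: Arr CT (rP a) (rP b)" using k0 tm.dh_dh[OF ab(1,2) k] tm.chain_hom[OF ab(1,2), of ?k] by simp
   have "tm.htp (rP a) (rP b) ?k 0[chain_mod TM (rP a) (rP b)]"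
    unfolding tm.htp_hom[OF ab(1,2)] chain_zero_add(3) using k mod_0l[OF M k0] by metis
   hence "vt ?k = vt 0[chain_mod TM (rP a) (rP b)]"
    using pi_eq_iff[OF a ab(3) qv[OF kc] qv[OF ct_mod(3)[OF ab(1,2)]]] tm.htp_post[OF ab(1-3) kc ct_mod(3)[OF ab(1,2)] _ rq[OF b]] by blast
   thus ?thesis using av[OF kc] t0 by simp
  qed
  hence g: "Psi (rP a) (rP b) 0 al: Arr CT (rP b) ?S" using Psi_chain[OF rP[OF a] ab(2) al(1)] by blast
  have "ta = ph a b (pi b ?S (Psi (rP a) (rP b) 0 al))"
  proof (rule lin_ext[OF t phD[unfolded RD_sel, OF pi_in[OF b ab(4) g]]])
   fix s assume "s <: (homm DP a b)"
   then obtain v where v: "v: Arr CT (rP a) (rP b)" "s = vt v" using Arr_vt m(2) by auto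
   show "ta s = ph a b (pi b ?S (Psi (rP a) (rP b) 0 al)) s" unfolding v(2) ph_val[OF g v(1), unfolded RD_sel] AP[OF al(1)] using av[OF v(1)] by simp
  qed
  thus "EX h:Arr DT b ?S. ta = ph a b h" using pi_in[OF b ab(4) g] by blast
 qed
qed

end

text \<open>Both composites are first expressed by chain maps between resolutions. Composition with
  g and f then corresponds to transposed maps on functionals by \<open>Psi_pre\<close> and
  \<open>Psi_post\<close>, so both sides evaluate the functional of h at the composite of the lifts
  of f, t and g.\<close>

lemma ph_natural:
 assumes o: "a: Ob DP" "a': Ob DP" "b: Ob DP" "b': Ob DP" and f: "f: Arr DT a a'" and g: "g: Arr DT b' b" and h: "h: Arr DT b (om RD a)" and t: "t: Arr DT a' b'"
 shows "ph a' b' (cmp DT b' (om RD a) (om RD a') (mm RD a a' f) (cmp DT b' b (om RD a) h g)) t = ph a b h (cmp DT a b' b g (cmp DT a a' b' t f))"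
proof -
 let ?A = "rP a" and ?A' = "rP a'" and ?B = "rP b" and ?B' = "rP b'"
 note p = rP_ob[OF o(1)] rP_ob[OF o(2)] rP_ob[OF o(3)] rP_ob[OF o(4)] and d = DP_ob[OF o(1)] DP_ob[OF o(2)] DP_ob[OF o(3)] DP_ob[OF o(4)] and s = rP[OF o(1)] rP[OF o(2)]
 note e = E_ob[OF s(1)] E_ob[OF s(2)]
 obtain k where k: "k: Arr CT ?B (E ?A)" "h = pi b (E ?A) k" using Arr_pi[OF o(1,3) h] unfolding RD_sel by blast
 let ?F = "ra a a' f" and ?G = "ra b' b g" and ?T = "ra a' b' t"
 note r = ra_in[OF o(1,2) f] ra_in[OF o(4,3) g] ra_in[OF o(2,4) t]
 note TF = ct_cmp[OF p(1,2,4) r(1,3)]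
 note GTF = ct_cmp[OF p(1,4,3) TF r(2)] and kG = ct_cmp[OF p(4,3) e(1) r(2) k(1)]
 note EF = Ea_arr[OF s r(1)]
 note EkG = ct_cmp[OF p(4) e kG EF]
 have 1: "cmp DT b' (E ?A) (E ?A') (LT (E ?A) (E ?A') (Ea ?A ?A' ?F)) (cmp DT b' b (E ?A) h g) = pi b' (E ?A') (cmp CT ?B' (E ?A) (E ?A') (Ea ?A ?A' ?F) (cmp CT ?B' ?B (E ?A) k ?G))"
 proof -
  have "cmp DT b' b (E ?A) h g = pi b' (E ?A) (cmp CT ?B' ?B (E ?A) k ?G)"
   using pi_comp[OF o(4,3) e(1) ct_cmp[OF p(4,3) d(3) r(2) rq[OF o(3)]] r(2) tm.htp_refl[OF p(4) d(3) ct_cmp[OF p(4,3) d(3) r(2) rq[OF o(3)]]] k(1)] ra_pi[OF o(4,3) g] k(2) by simp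
  thus ?thesis unfolding pi_def LT_cmp[OF p(4) e kG EF] using p d e LT_in[OF p(4) e(1) kG] LT_in[OF e EF] rq[OF o(4)] rq_qis[OF o(4)] by simp
 qed
 have 2: "cmp DT a b' b g (cmp DT a a' b' t f) = pi a b (cmp CT ?A ?B b (rq b) (cmp CT ?A ?B' ?B ?G (cmp CT ?A ?A' ?B' ?T ?F)))"
 proof (rule pi_eqI[OF o(1) d(3), symmetric])
  have tf: "cmp DT a a' b' t f: Arr DT a b'" using t f d by simp
  show "cmp CT ?A ?B b (rq b) (cmp CT ?A ?B' ?B ?G (cmp CT ?A ?A' ?B' ?T ?F)): Arr CT ?A b" by (rule ct_cmp[OF p(1,3) d(3) GTF rq[OF o(3)]])
  show "cmp DT a b' b g (cmp DT a a' b' t f): Arr DT a b" using tf g d by simp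
  note q = rq[OF o(1)] rq[OF o(2)] rq[OF o(3)] rq[OF o(4)]
  have "LT ?A b (cmp CT ?A ?B b (rq b) (cmp CT ?A ?B' ?B ?G (cmp CT ?A ?A' ?B' ?T ?F))) = cmp DT ?A ?B' b (cmp DT ?B' ?B b (LQ b) (LT ?B' ?B ?G)) (cmp DT ?A ?A' ?B' (LT ?A' ?B' ?T) (LT ?A ?A' ?F))"
   unfolding LT_cmp[OF p(1,3) d(3) GTF q(3)] LT_cmp[OF p(1,4,3) TF r(2)] LT_cmp[OF p(1,2,4) r(1,3)] using p d q r by simp
  also have "... = cmp DT ?A b' b g (cmp DT ?A ?A' b' (cmp DT ?A' ?B' b' (LQ b') (LT ?A' ?B' ?T)) (LT ?A ?A' ?F))" unfolding ra_eq[OF o(4,3) g] using p d q r g by simp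
  also have "... = cmp DT ?A b' b g (cmp DT ?A a' b' t (cmp DT ?A ?A' a' (LQ a') (LT ?A ?A' ?F)))" unfolding ra_eq[OF o(2,4) t] using p d q r g t by simp
  also have "... = cmp DT ?A a b (cmp DT a b' b g (cmp DT a a' b' t f)) (LQ a)" unfolding ra_eq[OF o(1,2) f] using p d q f g t tf by simp
  finally show "cmp DT ?A a b (cmp DT a b' b g (cmp DT a a' b' t f)) (LQ a) = LT ?A b (cmp CT ?A ?B b (rq b) (cmp CT ?A ?B' ?B ?G (cmp CT ?A ?A' ?B' ?T ?F)))" ..
 qed
 let ?al = "Al ?A ?B k"
 note hc = hm_chain[OF s(1) p(3)]
 have al: "?al: lin K (hm ?A ?B 0) KK" by (rule Al_in[OF s(1) p(3) hc(2)[OF k(1)]])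
 \<comment> \<open>The functional of h is carried to families \<open>?A\<close> ->
   \<open>?B'\<close> and then to families \<open>?A'\<close> -> \<open>?B'\<close>, by the
   transposes of composition with the lifts of g and f.\<close>
 let ?be = "DM (HC ?A ?B) (HC ?A ?B') (mm (HF ?A) ?B' ?B ?G) 0 ?al"
 let ?ga = "DM (HC ?A ?B') (HC ?A' ?B') (PC ?A ?A' ?B' ?F) 0 ?be"
 note hf = tm.hom_fnc_arr[OF p(1,4,3) r(2)] and pf = tm.precomp_arr[OF p(2,1,4) r(1)]
 note H = HC_ob[OF p(1,3)] HC_ob[OF p(1,4)] HC_ob[OF p(2,4)]
 have be: "?be: lin K (hm ?A ?B' 0) KK" using ck_cl[OF dual_fnc_arr[OF H(2,1) hf], of ?al 0] al by (simp add: dual_sel)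
 have ga: "?ga: lin K (hm ?A' ?B' 0) KK" using ck_cl[OF dual_fnc_arr[OF H(3,2) pf], of ?be 0] be by (simp add: dual_sel)
 have "Psi ?A ?B' 0 ?be = cmp CT ?B' ?B (E ?A) k ?G"
  using Psi_pre[OF s(1) p(4,3) r(2), of ?al 0] al Psi_Al[OF s(1) p(3) hc(2)[OF k(1)]] tm.precomp_sel[OF hc(2)[OF k(1)], of ?B' ?G] by simp
 hence "Psi ?A' ?B' 0 ?ga = cmp CT ?B' (E ?A) (E ?A') (Ea ?A ?A' ?F) (cmp CT ?B' ?B (E ?A) k ?G)"
  using Psi_post[OF s p(4) r(1), of ?be 0] be tm.hom_fnc_sel(2)[OF hm_chain(2)[OF s(1) p(4) kG], of "E ?A'" "Ea ?A ?A' ?F"] by simp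
 hence "Al ?A' ?B' (cmp CT ?B' (E ?A) (E ?A') (Ea ?A ?A' ?F) (cmp CT ?B' ?B (E ?A) k ?G)) = ?ga" using Al_Psi[OF s(2) p(4) ga] by simp
 moreover have "?ga ?T = ?al (cmp CT ?A ?B' ?B ?G (cmp CT ?A ?A' ?B' ?T ?F))"
 proof -
  note T = hm_chain(1)[OF s(2) p(4) r(3)] and T' = hm_chain(1)[OF s(1) p(4) TF]
  have "?ga ?T = ?be (PC ?A ?A' ?B' ?F 0 ?T)" using dual_fnc_app[of ?be "HC ?A ?B'" 0 ?T "HC ?A' ?B'"] be T by (simp del: tm.hom_mod_sel)
  also have "PC ?A ?A' ?B' ?F 0 ?T = cmp CT ?A ?A' ?B' ?T ?F" unfolding tm.precomp_sel[OF T] by simp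
  also have "?be ... = ?al (mm (HF ?A) ?B' ?B ?G 0 (cmp CT ?A ?A' ?B' ?T ?F))" using dual_fnc_app[of ?al "HC ?A ?B" 0 "cmp CT ?A ?A' ?B' ?T ?F" "HC ?A ?B'"] al T' by (simp del: tm.hom_mod_sel tm.hom_fnc_sel(2) tm.Ch_sel)
  also have "mm (HF ?A) ?B' ?B ?G 0 (cmp CT ?A ?A' ?B' ?T ?F) = cmp CT ?A ?B' ?B ?G (cmp CT ?A ?A' ?B' ?T ?F)" unfolding tm.hom_fnc_sel(2)[OF T'] by simp
  finally show ?thesis .
 qed
 ultimately show ?thesis
  using ph_val[OF o(2,4) EkG r(3)] ph_val[OF o(1,3) k(1) GTF] ra_pi[OF o(2,4) t] 1 2 k(2) by (simp add: RD_sel del: tm.Ch_sel)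
qed

lemma serre: "serre_iso K DP (Dtmod K C T) RD ph"
 unfolding serre_iso_def using DP_klinear RD_functor ph_iso ph_natural by simp

lemma serre_perfect: "(!!X. X: Ob DP ==> om RD X: Ob DP) ==> serre_duality K DP RD ph"
proof -
 assume o: "!!X. X: Ob DP ==> om RD X: Ob DP"
 have "is_functor DP DP RD" using RD_functor kl_cat[OF DP_klinear] o unfolding is_functor_def DP_sel by blast
 thus ?thesis using serre unfolding serre_duality_def serre_iso_def DP_sel by blast
qed

end

theorem proposition4p13:
  fixes K :: "'k ring"
    and C :: "('k, 'o, 'm) kcat"
    and T :: "('k, 'o \<times> 'o, 'm \<times> 'm, 'u) mfnc"
    and \<mu> :: "'o \<times> 'o \<Rightarrow> ('m \<Rightarrow> 'k) \<Rightarrow> 'u"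
    and \<epsilon> :: "('k + 'o + 'm + nat) set \<Rightarrow> 'u"
  assumes "field K"
    and "klinear_category K C"
    and "yoneda_bifunctor K C T \<mu>"
    and "inj \<epsilon>"
  shows "(\<exists>\<eta>. natural_iso (prod_cat (Dperf K C T) (op_cat (Dperf K C T))) (Dkmod K)
                (RHom_dual K C T) (RHom_RD_dual K C T) \<eta>) \<and>
         (\<exists>\<phi>. serre_iso K (Dperf K C T) (Dtmod K C T) (RD_dual K C T) \<phi>) \<and>
         ((\<forall>X\<in>Ob (Dperf K C T). om (RD_dual K C T) X \<in> Ob (Dperf K C T)) \<longrightarrow>
           (\<exists>\<phi>. serre_duality K (Dperf K C T) (RD_dual K C T) \<phi>))"
proof -
 interpret yon K C T \<mu> \<epsilon>
  using assms by (simp add: yon_def gf_def yon_axioms_def)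
 show ?thesis using eta_natural_iso serre serre_perfect by blast
qed

end
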